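(* Let $N>2$, let $\Omega\subset\mathbb{R}^N$ be open, let $f\in C(\Omega)$, and let $u\in C^2(\Omega)$ be a classical solution to $\mathscr{L}u=f$ in $\Omega$, where $$\mathscr{L}u=\operatorname{div}(A\nabla u)+\langle b,\nabla u\rangle+cu$$ is uniformly elliptic with coefficients as in the context. Then for every $x_0\in\Omega$ there is $r_0>0$ such that for every $0<r<r_0$ both of the following formulas hold (with $\Gamma^*$, $\psi_r(x_0)$, $\Omega_r(x_0)$, $K$, $M$ as in the context): $$u(x_0)=\int_{\psi_r(x_0)}K(x_0,x)\,u(x)\,d\mathcal{H}^{N-1}_e(x)+\int_{\Omega_r(x_0)}f(x)\Big(\tfrac{1}{r^{N-2}}-\Gamma^*(x,x_0)\Big)dx+\frac{1}{r^{N-2}}\int_{\Omega_r(x_0)}\big(\operatorname{div}b(x)-c(x)\big)u(x)\,dx,$$ and $$u(x_0)=\frac{1}{r^N}\int_{\Omega_r(x_0)}M(x_0,x)\,u(x)\,dx+\frac{N}{r^N}\int_0^r\Big(\varrho^{N-1}\int_{\Omega_\varrho(x_0)}f(x)\Big(\tfrac{1}{\varrho^{N-2}}-\Gamma^*(x,x_0)\Big)dx\Big)d\varrho+\frac{N}{r^N}\int_0^r\Big(\varrho\int_{\Omega_\varrho(x_0)}\big(\operatorname{div}b(x)-c(x)\big)u(x)\,dx\Big)d\varrho.$$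
   Context: Coefficients. $A(x)=(a_{ij}(x))_{i,j=1,\dots,N}$ is a symmetric matrix, $b(x)=(b_1(x),\dots,b_N(x))$, and $c(x)$ is a scalar, all real and defined for $x\in\mathbb{R}^N$. There are constants $0<\lambda<\Lambda$ such that $\lambda|\xi|^2\le\langle A(x)\xi,\xi\rangle\le\Lambda|\xi|^2$ for all $\xi,x\in\mathbb{R}^N$. The functions $a_{ij}$, $b_i$, $c$ and the derivatives $\partial a_{ij}/\partial x_i$, $\partial b_i/\partial x_i$ ($i,j=1,\dots,N$) exist and are bounded Hölder continuous functions on $\mathbb{R}^N$ of exponent $\alpha\in\,]0,1]$. The formal adjoint of $\mathscr{L}$ is $$\mathscr{L}^*v=\operatorname{div}(A\nabla v)-\langle b,\nabla v\rangle+(c-\operatorname{div}b)v.$$ Fundamental solution. Given $x_0\in\Omega$, fix a bounded connected open set $\Omega_1$ with $x_0\in\Omega_1$ and $\overline{\Omega_1}\subset\Omega$. $\Gamma^*:(\Omega_1\times\Omega_1)\setminus\{(x,x):x\in\Omega_1\}\to\mathbb{R}$ denotes the fundamental solution of $\mathscr{L}^*v=0$ in $\Omega_1$ constructed by Levi's parametrix method. It exists by a theorem of Kalf and has the following properties. For every $y\in\Omega_1$: (i) $\Gamma^*(\cdot,y)\in C^2(\Omega_1\setminus\{y\})$ and $\mathscr{L}^*\Gamma^*(\cdot,y)=0$ in $\Omega_1\setminus\{y\}$; (ii) $\int_{\Omega_1}|\Gamma^*(x,y)|\,dx<\infty$; (iii) $\varphi(y)=-\int_{\Omega_1}\Gamma^*(x,y)\,\mathscr{L}\varphi(x)\,dx$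 for every $\varphi\in C_c^\infty(\Omega_1)$ (and, by density, for every $\varphi\in C^2_c(\Omega_1)$). Moreover there are positive constants $c^-,c^+,c_0$ such that for all $x\ne y$ in $\Omega_1$ $$\frac{c^-}{|x-y|^{N-2}}-\frac{c_0}{|x-y|^{N-2-\alpha}}\le\Gamma^*(x,y)\le\frac{c^+}{|x-y|^{N-2}}+\frac{c_0}{|x-y|^{N-2-\alpha}},$$ $$\frac{c^-}{|x-y|^{N-1}}-\frac{c_0}{|x-y|^{N-1-\alpha}}\le|\nabla_x\Gamma^*(x,y)|\le\frac{c^+}{|x-y|^{N-1}}+\frac{c_0}{|x-y|^{N-1-\alpha}}.$$ Sets and kernels. For $r>0$, $$\psi_r(x_0)=\{x\in\Omega_1\setminus\{x_0\}:\Gamma^*(x,x_0)=r^{-(N-2)}\},\qquad\Omega_r(x_0)=\{x\in\Omega_1:\Gamma^*(x,x_0)>r^{-(N-2)}\},$$ with the convention $\Gamma^*(x_0,x_0)=+\infty$ (so $x_0\in\Omega_r(x_0)$), and $$K(x_0,x)=\frac{\langle A(x)\nabla_x\Gamma^*(x,x_0),\nabla_x\Gamma^*(x,x_0)\rangle}{|\nabla_x\Gamma^*(x,x_0)|},\qquad M(x_0,x)=\frac{N}{N-2}\cdot\frac{\langle A(x)\nabla_x\Gamma^*(x,x_0),\nabla_x\Gamma^*(x,x_0)\rangle}{\Gamma^*(x,x_0)^{\frac{2(N-1)}{N-2}}}.$$ For $r$ sufficiently small, $\Omega_r(x_0)$ has compact closure in $\Omega_1$, $\nabla_x\Gamma^*(\cdot,x_0)\neq0$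 at the points of $\Omega_r(x_0)\setminus\{x_0\}$, and $\psi_r(x_0)$ is a $C^1$ manifold. $\mathcal{H}^{N-1}_e$ is the $(N-1)$-dimensional Euclidean Hausdorff measure. *)

theory Defs
  imports "HOL-Analysis.Analysis"
begin

definition partial_deriv :: "'n \<Rightarrow> (real ^ 'n \<Rightarrow> real) \<Rightarrow> real ^ 'n \<Rightarrow> real" where
  "partial_deriv i g x = deriv (\<lambda>t. g (x + t *\<^sub>R axis i 1)) 0"

definition has_partial :: "'n \<Rightarrow> (real ^ 'n \<Rightarrow> real) \<Rightarrow> real ^ 'n \<Rightarrow> bool" where
  "has_partial i g x \<longleftrightarrow> (\<lambda>t. g (x + t *\<^sub>R axis i 1)) field_differentiable (at 0)"

definition grad :: "(real ^ 'n \<Rightarrow> real) \<Rightarrow> real ^ 'n \<Rightarrow> real ^ 'n" where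
  "grad g x = (\<chi> i. partial_deriv i g x)"

definition divergence :: "(real ^ 'n \<Rightarrow> real ^ 'n) \<Rightarrow> real ^ 'n \<Rightarrow> real" where
  "divergence V x = (\<Sum>i\<in>UNIV. partial_deriv i (\<lambda>y. V y $ i) x)"

text \<open>To be used for open sets \<open>S\<close> only: existence and continuity on \<open>S\<close> of all iterated
  partial derivatives of order at most \<open>k\<close>.\<close>

fun Ck_on :: "nat \<Rightarrow> (real ^ 'n) set \<Rightarrow> (real ^ 'n \<Rightarrow> real) \<Rightarrow> bool" where
  "Ck_on 0 S g \<longleftrightarrow> continuous_on S g"
| "Ck_on (Suc k) S g \<longleftrightarrow> continuous_on S g \<and>
     (\<forall>i. (\<forall>x\<in>S. has_partial i g x) \<and> Ck_on k S (partial_deriv i g))"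

text \<open>Elements of $C^k_c(S)$, extended by zero to the whole space.\<close>

definition Ck_compact_support :: "nat \<Rightarrow> (real ^ 'n) set \<Rightarrow> (real ^ 'n \<Rightarrow> real) \<Rightarrow> bool" where
  "Ck_compact_support k S g \<longleftrightarrow>
     Ck_on k S g \<and> (\<exists>C. compact C \<and> C \<subseteq> S \<and> (\<forall>x. x \<notin> C \<longrightarrow> g x = 0))"

definition bounded_hoelder :: "real \<Rightarrow> (real ^ 'n \<Rightarrow> real) \<Rightarrow> bool" where
  "bounded_hoelder \<alpha> g \<longleftrightarrow>
     (\<exists>B. \<forall>x. \<bar>g x\<bar> \<le> B) \<and> (\<exists>C. \<forall>x y. \<bar>g x - g y\<bar> \<le> C * norm (x - y) powr \<alpha>)"

text \<open>Only the derivatives \<open>\<partial>a\<^sub>i\<^sub>j/\<partial>x\<^sub>i\<close> and \<open>\<partial>b\<^sub>i/\<partial>x\<^sub>i\<close> are required to exist; the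
  coefficients need not be continuously differentiable.\<close>

definition admissible_coefficients ::
    "real \<Rightarrow> (real ^ 'n \<Rightarrow> real ^ 'n ^ 'n) \<Rightarrow> (real ^ 'n \<Rightarrow> real ^ 'n) \<Rightarrow> (real ^ 'n \<Rightarrow> real) \<Rightarrow> bool" where
  "admissible_coefficients \<alpha> A b c \<longleftrightarrow>
     (\<forall>x. transpose (A x) = A x) \<and>
     (\<exists>l L. 0 < l \<and> l < L \<and>
        (\<forall>x \<xi>. l * (norm \<xi>)\<^sup>2 \<le> (A x *v \<xi>) \<bullet> \<xi> \<and> (A x *v \<xi>) \<bullet> \<xi> \<le> L * (norm \<xi>)\<^sup>2)) \<and>
     (\<forall>i j. bounded_hoelder \<alpha> (\<lambda>x. A x $ i $ j) \<and>
        (\<forall>x. has_partial i (\<lambda>y. A y $ i $ j) x) \<and>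
        bounded_hoelder \<alpha> (partial_deriv i (\<lambda>y. A y $ i $ j))) \<and>
     (\<forall>i. bounded_hoelder \<alpha> (\<lambda>x. b x $ i) \<and>
        (\<forall>x. has_partial i (\<lambda>y. b y $ i) x) \<and>
        bounded_hoelder \<alpha> (partial_deriv i (\<lambda>y. b y $ i))) \<and>
     bounded_hoelder \<alpha> c"

definition ell_op ::
    "(real ^ 'n \<Rightarrow> real ^ 'n ^ 'n) \<Rightarrow> (real ^ 'n \<Rightarrow> real ^ 'n) \<Rightarrow> (real ^ 'n \<Rightarrow> real) \<Rightarrow>
     (real ^ 'n \<Rightarrow> real) \<Rightarrow> real ^ 'n \<Rightarrow> real" where
  "ell_op A b c u x = divergence (\<lambda>y. A y *v grad u y) x + b x \<bullet> grad u x + c x * u x"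

definition ell_adjoint ::
    "(real ^ 'n \<Rightarrow> real ^ 'n ^ 'n) \<Rightarrow> (real ^ 'n \<Rightarrow> real ^ 'n) \<Rightarrow> (real ^ 'n \<Rightarrow> real) \<Rightarrow>
     (real ^ 'n \<Rightarrow> real) \<Rightarrow> real ^ 'n \<Rightarrow> real" where
  "ell_adjoint A b c v x =
     divergence (\<lambda>y. A y *v grad v y) x - b x \<bullet> grad v x + (c x - divergence b x) * v x"

text \<open>The first argument of \<open>\<Gamma>\<close> is the variable \<open>x\<close>, the second one the pole \<open>y\<close>.
  The value of \<open>\<Gamma>\<close> on the diagonal is irrelevant.  The fundamental solution obtained by Levi's
  parametrix method is represented by the properties that construction provides; the
  representation formula is required for all test functions in $C^2_c$, hence in
  particular for those in $C^\infty_c$.\<close>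

definition fundamental_solution ::
    "real \<Rightarrow> (real ^ 'n \<Rightarrow> real ^ 'n ^ 'n) \<Rightarrow> (real ^ 'n \<Rightarrow> real ^ 'n) \<Rightarrow> (real ^ 'n \<Rightarrow> real) \<Rightarrow>
     (real ^ 'n) set \<Rightarrow> (real ^ 'n \<Rightarrow> real ^ 'n \<Rightarrow> real) \<Rightarrow> bool" where
  "fundamental_solution \<alpha> A b c \<Omega>1 \<Gamma> \<longleftrightarrow>
     (\<forall>y\<in>\<Omega>1.
        Ck_on 2 (\<Omega>1 - {y}) (\<lambda>x. \<Gamma> x y) \<and>
        (\<forall>x\<in>\<Omega>1 - {y}. ell_adjoint A b c (\<lambda>z. \<Gamma> z y) x = 0) \<and>
        set_integrable lborel \<Omega>1 (\<lambda>x. \<Gamma> x y) \<and>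
        (\<forall>\<phi>. Ck_compact_support 2 \<Omega>1 \<phi> \<longrightarrow>
           \<phi> y = - (LINT x:\<Omega>1|lborel. \<Gamma> x y * ell_op A b c \<phi> x))) \<and>
     (\<exists>cm cp c0. 0 < cm \<and> 0 < cp \<and> 0 < c0 \<and>
        (\<forall>x\<in>\<Omega>1. \<forall>y\<in>\<Omega>1. x \<noteq> y \<longrightarrow>
           (let d = norm (x - y); N = real CARD('n) in
              cm / d powr (N - 2) - c0 / d powr (N - 2 - \<alpha>) \<le> \<Gamma> x y \<and>
              \<Gamma> x y \<le> cp / d powr (N - 2) + c0 / d powr (N - 2 - \<alpha>) \<and>
              cm / d powr (N - 1) - c0 / d powr (N - 1 - \<alpha>) \<le> norm (grad (\<lambda>z. \<Gamma> z y) x) \<and>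
              norm (grad (\<lambda>z. \<Gamma> z y) x) \<le> cp / d powr (N - 1) + c0 / d powr (N - 1 - \<alpha>))))"

definition level_set ::
    "(real ^ 'n \<Rightarrow> real ^ 'n \<Rightarrow> real) \<Rightarrow> (real ^ 'n) set \<Rightarrow> real ^ 'n \<Rightarrow> real \<Rightarrow> (real ^ 'n) set" where
  "level_set \<Gamma> \<Omega>1 x0 r = {x \<in> \<Omega>1 - {x0}. \<Gamma> x x0 = 1 / r ^ (CARD('n) - 2)}"

text \<open>The disjunct \<open>x = x0\<close> is the convention \<open>\<Gamma> x0 x0 = \<infinity>\<close>.\<close>

definition superlevel_set ::
    "(real ^ 'n \<Rightarrow> real ^ 'n \<Rightarrow> real) \<Rightarrow> (real ^ 'n) set \<Rightarrow> real ^ 'n \<Rightarrow> real \<Rightarrow> (real ^ 'n) set" where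
  "superlevel_set \<Gamma> \<Omega>1 x0 r = {x \<in> \<Omega>1. x = x0 \<or> \<Gamma> x x0 > 1 / r ^ (CARD('n) - 2)}"

definition kernel_K ::
    "(real ^ 'n \<Rightarrow> real ^ 'n ^ 'n) \<Rightarrow> (real ^ 'n \<Rightarrow> real ^ 'n \<Rightarrow> real) \<Rightarrow> real ^ 'n \<Rightarrow> real ^ 'n \<Rightarrow> real" where
  "kernel_K A \<Gamma> x0 x =
     (let g = grad (\<lambda>z. \<Gamma> z x0) x in ((A x *v g) \<bullet> g) / norm g)"

definition kernel_M ::
    "(real ^ 'n \<Rightarrow> real ^ 'n ^ 'n) \<Rightarrow> (real ^ 'n \<Rightarrow> real ^ 'n \<Rightarrow> real) \<Rightarrow> real ^ 'n \<Rightarrow> real ^ 'n \<Rightarrow> real" where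
  "kernel_M A \<Gamma> x0 x =
     (let g = grad (\<lambda>z. \<Gamma> z x0) x; N = real CARD('n) in
        N / (N - 2) * (((A x *v g) \<bullet> g) / \<Gamma> x x0 powr (2 * (N - 1) / (N - 2))))"

text \<open>Normalised so that on \<open>\<real>\<^sup>k\<close> the \<open>k\<close>-dimensional Hausdorff measure is Lebesgue measure.
  The case distinction only matters for \<open>k = 0\<close>.  Boundedness is required because
  \<^const>\<open>diameter\<close> has no meaningful value on unbounded sets.\<close>

definition hausdorff_content :: "nat \<Rightarrow> real \<Rightarrow> 'a::metric_space set \<Rightarrow> ennreal" where
  "hausdorff_content k \<delta> E =
     (INF C \<in> {C :: nat \<Rightarrow> 'a set. E \<subseteq> (\<Union>i. C i) \<and> (\<forall>i. bounded (C i) \<and> diameter (C i) \<le> \<delta>)}.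
        \<Sum>i. if C i = {} then 0 else ennreal (unit_ball_vol (real k) * (diameter (C i) / 2) ^ k))"

definition hausdorff_outer :: "nat \<Rightarrow> 'a::metric_space set \<Rightarrow> ennreal" where
  "hausdorff_outer k E = (SUP \<delta>\<in>{0<..}. hausdorff_content k \<delta> E)"

definition hausdorff_measure :: "nat \<Rightarrow> 'a::metric_space measure" where
  "hausdorff_measure k = measure_of UNIV (sets borel) (hausdorff_outer k)"

end

theory Submission
  imports Defs
begin

text \<open>Write \<open>G = \<Gamma>(\<cdot>, x0)\<close>. For a kernel \<open>\<kappa>\<close> with compact support in the range of large values of
  \<open>G\<close> and with primitive \<open>K\<close>, the function \<open>u K(G)\<close>, extended by a multiple of \<open>u\<close> across the pole, is
  an admissible test function in the representation formula. After one integration by parts and Fubini,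
  this shows that the integral of \<open>u \<kappa>(G) \<langle>A \<nabla>G, \<nabla>G\<rangle>\<close> equals the integral of \<open>\<kappa>(\<tau>) m(\<tau>)\<close> over \<open>\<tau>\<close>,
  where \<open>m(\<tau>)\<close> is \<open>u x0\<close> minus the two terms with \<open>f\<close> and \<open>div b - c\<close> over \<open>{G > \<tau>}\<close>. Letting \<open>\<kappa>\<close>
  concentrate at \<open>\<tau> = 1 / r\<^sup>N\<^sup>-\<^sup>2\<close> gives the surface formula: \<open>m\<close> is right continuous, and
  \<open>\<kappa>(G) |\<nabla>G|\<close> converges to the surface measure of the level set. The latter is checked in charts given by the
  orthogonal projection onto the tangent plane, which is almost an isometry, once the isodiametric inequality
  has identified Hausdorff measure with Lebesgue measure on the plane. Letting instead \<open>\<kappa>(\<tau>)\<close> increase to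
  \<open>\<tau>\<^sup>-\<^sup>p\<close> on \<open>\<tau> > 1 / r\<^sup>N\<^sup>-\<^sup>2\<close>, with \<open>p = 2(N-1)/(N-2)\<close>, and substituting \<open>\<tau> = 1 / \<rho>\<^sup>N\<^sup>-\<^sup>2\<close> gives the
  solid formula.\<close>

section \<open>Hausdorff measure\<close>

text \<open>The coefficients have few derivatives: entries in row i of \<open>A\<close> and
  component i of \<open>b\<close> can be differentiated in direction i only. Integration by parts is
  therefore done one coordinate at a time, on compactly supported functions with that single partial
  derivative, and never on a domain bounded by a level set. The level set enters only as the limit
  of thin bands, whose weighted volume has to converge to a Hausdorff integral. As Hausdorff measure
  is given by coverings, its additivity on Borel sets and its normalisation come first. Charts give
  comparisons up to factors arbitrarily close to 1, never equalities, so the limit of the bands is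
  squeezed out by letting the factor tend to 1. The bands lie on the side G > R because the terms
  over G > \<tau> are continuous from the right in \<tau>. The exponent p has two reasons: at
  distance d from the pole the energy is at most of order d^(-2(N-1)) and G at least of order
  d^(-(N-2)), so the energy divided by G^p stays bounded; and \<tau>^(-p) d\<tau> becomes (N-2)
  \<rho>^(N-1) d\<rho>.\<close>

definition hausdorff_weight :: "nat \<Rightarrow> 'a::metric_space set \<Rightarrow> ennreal" where
  "hausdorff_weight k C = (if C = {} then 0 else ennreal (unit_ball_vol (real k) * (diameter C / 2) ^ k))"

lemma hausdorff_weight_empty [simp]: "hausdorff_weight k {} = 0"
  by (simp add: hausdorff_weight_def)

lemma hausdorff_content_alt:
  "hausdorff_content k \<delta> E =
     (INF C \<in> {C :: nat \<Rightarrow> 'a::metric_space set. E \<subseteq> (\<Union>i. C i) \<and> (\<forall>i. bounded (C i) \<and> diameter (C i) \<le> \<delta>)}.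
        \<Sum>i. hausdorff_weight k (C i))"
  unfolding hausdorff_content_def hausdorff_weight_def ..

lemma hausdorff_content_le:
  fixes C :: "nat \<Rightarrow> 'a::metric_space set"
  assumes "E \<subseteq> (\<Union>i. C i)" "\<And>i. bounded (C i)" "\<And>i. diameter (C i) \<le> \<delta>"
  shows "hausdorff_content k \<delta> E \<le> (\<Sum>i. hausdorff_weight k (C i))"
  unfolding hausdorff_content_alt by (rule INF_lower) (use assms in auto)

lemma hausdorff_content_greatest:
  fixes E :: "'a::metric_space set"
  assumes "\<And>C. E \<subseteq> (\<Union>i. C i) \<Longrightarrow> (\<And>i. bounded (C i)) \<Longrightarrow> (\<And>i. diameter (C i) \<le> \<delta>) \<Longrightarrow>
    y \<le> (\<Sum>i. hausdorff_weight k (C i :: 'a set))"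
  shows "y \<le> hausdorff_content k \<delta> E"
  unfolding hausdorff_content_alt by (rule INF_greatest) (use assms in auto)

lemma hausdorff_content_cover:
  fixes E :: "'a::metric_space set"
  assumes "hausdorff_content k \<delta> E < y"
  obtains C where "E \<subseteq> (\<Union>i. C i)" "\<And>i. bounded (C i)" "\<And>i. diameter (C i :: 'a set) \<le> \<delta>"
    "(\<Sum>i. hausdorff_weight k (C i)) < y"
  using assms unfolding hausdorff_content_alt INF_less_iff by auto

lemma hausdorff_content_empty: "\<delta> > 0 \<Longrightarrow> hausdorff_content k \<delta> {} = 0"
  using hausdorff_content_le[of "{}" "\<lambda>_. {}" \<delta> k] by simp

lemma hausdorff_content_mono: "E \<subseteq> F \<Longrightarrow> hausdorff_content k \<delta> E \<le> hausdorff_content k \<delta> F"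
  by (rule hausdorff_content_greatest, rule hausdorff_content_le) auto

lemma hausdorff_content_antimono:
  fixes E :: "'a::metric_space set"
  assumes "\<delta> \<le> \<delta>'"
  shows "hausdorff_content k \<delta>' E \<le> hausdorff_content k \<delta> E"
proof (rule hausdorff_content_greatest, rule hausdorff_content_le)
  fix C :: "nat \<Rightarrow> 'a set" and i
  assume "\<And>i. diameter (C i) \<le> \<delta>"
  thus "diameter (C i) \<le> \<delta>'" using assms order_trans by blast
qed

lemma hausdorff_content_countable_subadditive:
  fixes E :: "nat \<Rightarrow> 'a::metric_space set"
  shows "hausdorff_content k \<delta> (\<Union>n. E n) \<le> (\<Sum>n. hausdorff_content k \<delta> (E n))"
proof (rule ennreal_le_epsilon)
  fix e :: real assume fin: "(\<Sum>n. hausdorff_content k \<delta> (E n)) < top" and e: "0 < e"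
  have pos: "0 < ennreal (e * (1/2) ^ Suc n)" for n
    using e by (simp add: ennreal_zero_less_mult_iff)
  have "hausdorff_content k \<delta> (E n) < hausdorff_content k \<delta> (E n) + ennreal (e * (1/2) ^ Suc n)" for n
  proof -
    have "hausdorff_content k \<delta> (E n) \<noteq> top"
      using fin ennreal_suminf_lessD less_top by blast
    thus ?thesis
      using pos[of n] ennreal_add_left_cancel_less[of "hausdorff_content k \<delta> (E n)" 0 "ennreal (e * (1/2) ^ Suc n)"]
      by (simp only: add_0_right) simp
  qed
  hence "\<forall>n. \<exists>C. E n \<subseteq> (\<Union>i. C i) \<and> (\<forall>i. bounded (C i)) \<and> (\<forall>i. diameter (C i :: 'a set) \<le> \<delta>) \<and>
    (\<Sum>i. hausdorff_weight k (C i)) < hausdorff_content k \<delta> (E n) + ennreal (e * (1/2) ^ Suc n)"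
    by (intro allI, rule hausdorff_content_cover) blast
  then obtain C where C: "\<And>n. E n \<subseteq> (\<Union>i. C n i)" "\<And>n i. bounded (C n i)" "\<And>n i. diameter (C n i) \<le> \<delta>"
    "\<And>n. (\<Sum>i. hausdorff_weight k (C n i)) < hausdorff_content k \<delta> (E n) + ennreal (e * (1/2) ^ Suc n)"
    unfolding choice_iff by blast
  \<comment> \<open>The covers of all the \<open>E n\<close> are merged into one sequence along the
    pairing of the naturals; their errors add up to \<open>e\<close>.\<close>
  define D where "D i = C (fst (prod_decode i)) (snd (prod_decode i))" for i
  have "hausdorff_content k \<delta> (\<Union>n. E n) \<le> (\<Sum>i. hausdorff_weight k (D i))"
  proof (rule hausdorff_content_le)
    show "(\<Union>n. E n) \<subseteq> (\<Union>i. D i)"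
    proof
      fix x assume "x \<in> (\<Union>n. E n)"
      then obtain n i where "x \<in> C n i" using C(1) by blast
      hence "x \<in> D (prod_encode (n, i))" by (simp add: D_def)
      thus "x \<in> (\<Union>i. D i)" by (rule UN_I[OF UNIV_I])
    qed
  qed (simp_all only: D_def C)
  also have "\<dots> = (\<Sum>i. (\<lambda>p. hausdorff_weight k (C (fst p) (snd p))) (prod_decode i))"
    by (simp only: D_def)
  also have "\<dots> = (\<Sum>m. \<Sum>n. hausdorff_weight k (C m n))"
    by (rule suminf_ennreal_2dimen) simp
  also have "\<dots> \<le> (\<Sum>m. hausdorff_content k \<delta> (E m) + ennreal (e * (1/2) ^ Suc m))"
    by (intro suminf_le less_imp_le C(4)) auto
  also have "\<dots> = (\<Sum>m. hausdorff_content k \<delta> (E m)) + (\<Sum>m. ennreal (e * (1/2) ^ Suc m))"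
    by (intro suminf_add[symmetric]) auto
  also have "(\<Sum>m. ennreal (e * (1/2) ^ Suc m)) = ennreal e * (\<Sum>m. ennreal ((1/2) ^ Suc m))"
    using e by (simp add: ennreal_mult del: power_Suc)
  also have "(\<Sum>m. ennreal ((1/2) ^ Suc m)) = 1"
    by (rule suminf_ennreal_eq[where x=1, simplified]) (use power_half_series in simp_all)
  finally show "hausdorff_content k \<delta> (\<Union>n. E n) \<le> (\<Sum>n. hausdorff_content k \<delta> (E n)) + ennreal e" by simp
qed

lemma hausdorff_content_le_outer: "\<delta> > 0 \<Longrightarrow> hausdorff_content k \<delta> E \<le> hausdorff_outer k E"
  unfolding hausdorff_outer_def by (rule SUP_upper) simp

lemma hausdorff_outer_least: "(\<And>\<delta>. \<delta> > 0 \<Longrightarrow> hausdorff_content k \<delta> E \<le> y) \<Longrightarrow> hausdorff_outer k E \<le> y"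
  unfolding hausdorff_outer_def by (rule SUP_least) simp

lemma hausdorff_outer_empty [simp]: "hausdorff_outer k {} = 0"
  using hausdorff_outer_least[of k "{}" 0] by (simp add: hausdorff_content_empty)

lemma hausdorff_outer_mono: "E \<subseteq> F \<Longrightarrow> hausdorff_outer k E \<le> hausdorff_outer k F"
  by (rule hausdorff_outer_least, rule order_trans[OF hausdorff_content_mono hausdorff_content_le_outer])

lemma hausdorff_outer_countable_subadditive:
  "hausdorff_outer k (\<Union>n. E n) \<le> (\<Sum>n. hausdorff_outer k (E n))" for E :: "nat \<Rightarrow> _"
proof (rule hausdorff_outer_least)
  fix \<delta> :: real assume "\<delta> > 0"
  have "hausdorff_content k \<delta> (\<Union>n. E n) \<le> (\<Sum>n. hausdorff_content k \<delta> (E n))"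
    by (rule hausdorff_content_countable_subadditive)
  also have "\<dots> \<le> (\<Sum>n. hausdorff_outer k (E n))"
    by (intro suminf_le hausdorff_content_le_outer \<open>\<delta> > 0\<close>) auto
  finally show "hausdorff_content k \<delta> (\<Union>n. E n) \<le> (\<Sum>n. hausdorff_outer k (E n))" .
qed

lemma hausdorff_outer_space: "outer_measure_space (Pow UNIV) (hausdorff_outer k)"
  unfolding outer_measure_space_def
proof (intro conjI)
  show "positive (Pow UNIV) (hausdorff_outer k)" by (simp add: positive_def)
  show "increasing (Pow UNIV) (hausdorff_outer k)"
    by (simp add: increasing_def hausdorff_outer_mono)
  show "countably_subadditive (Pow UNIV) (hausdorff_outer k)"
    by (simp add: countably_subadditive_def hausdorff_outer_countable_subadditive)
qed

lemma hausdorff_outer_Un: "hausdorff_outer k (A \<union> B) \<le> hausdorff_outer k A + hausdorff_outer k B"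
proof -
  let ?E = "\<lambda>n::nat. if n = 0 then A else if n = 1 then B else {}"
  have "A \<union> B = (\<Union>n. ?E n)" by (auto split: if_splits)
  also have "hausdorff_outer k \<dots> \<le> (\<Sum>n. hausdorff_outer k (?E n))"
    by (rule hausdorff_outer_countable_subadditive)
  also have "\<dots> = (\<Sum>n\<in>{0,1}. hausdorff_outer k (?E n))" by (rule suminf_finite) auto
  finally show ?thesis by simp
qed

text \<open>A set of diameter at most \<delta> cannot meet both \<open>A\<close> and
  \<open>B\<close>, so every cover of the union splits into a cover of each, and no set is counted
  twice.\<close>

lemma hausdorff_content_separated:
  fixes A B :: "'a::metric_space set"
  assumes "\<And>x y. x \<in> A \<Longrightarrow> y \<in> B \<Longrightarrow> \<delta> < dist x y" "0 < \<delta>"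
  shows "hausdorff_content k \<delta> A + hausdorff_content k \<delta> B \<le> hausdorff_content k \<delta> (A \<union> B)"
proof (rule hausdorff_content_greatest)
  fix C :: "nat \<Rightarrow> 'a set"
  assume C: "A \<union> B \<subseteq> (\<Union>i. C i)" "\<And>i. bounded (C i)" "\<And>i. diameter (C i) \<le> \<delta>"
  let ?CA = "\<lambda>i. if C i \<inter> A \<noteq> {} then C i else {}" and ?CB = "\<lambda>i. if C i \<inter> B \<noteq> {} then C i else {}"
  have disj: "C i \<inter> A = {} \<or> C i \<inter> B = {}" for i
  proof (rule ccontr)
    assume "\<not> ?thesis"
    then obtain x y where "x \<in> C i" "y \<in> C i" "x \<in> A" "y \<in> B" by blast
    thus False
      using assms(1)[of x y] diameter_bounded_bound[OF C(2), of x i y] C(3)[of i] by linarith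
  qed
  have "A \<subseteq> (\<Union>i. ?CA i)" "B \<subseteq> (\<Union>i. ?CB i)" using C(1) by force+
  hence "hausdorff_content k \<delta> A \<le> (\<Sum>i. hausdorff_weight k (?CA i))"
    and "hausdorff_content k \<delta> B \<le> (\<Sum>i. hausdorff_weight k (?CB i))"
    using C(2,3) assms(2) by (intro hausdorff_content_le; auto)+
  hence "hausdorff_content k \<delta> A + hausdorff_content k \<delta> B
      \<le> (\<Sum>i. hausdorff_weight k (?CA i)) + (\<Sum>i. hausdorff_weight k (?CB i))"
    by (rule add_mono)
  also have "\<dots> = (\<Sum>i. hausdorff_weight k (?CA i) + hausdorff_weight k (?CB i))"
    by (rule suminf_add) auto
  also have "\<dots> \<le> (\<Sum>i. hausdorff_weight k (C i))"
    by (intro suminf_le) (use disj in auto)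
  finally show "hausdorff_content k \<delta> A + hausdorff_content k \<delta> B \<le> (\<Sum>i. hausdorff_weight k (C i))" .
qed

lemma hausdorff_outer_separated:
  fixes A B :: "'a::metric_space set"
  assumes "\<And>x y. x \<in> A \<Longrightarrow> y \<in> B \<Longrightarrow> d \<le> dist x y" "0 < d"
  shows "hausdorff_outer k (A \<union> B) = hausdorff_outer k A + hausdorff_outer k B"
proof (rule antisym[OF hausdorff_outer_Un])
  have *: "hausdorff_content k \<delta> A + hausdorff_content k \<delta>' B \<le> hausdorff_outer k (A \<union> B)"
    if "\<delta> > 0" "\<delta>' > 0" for \<delta> \<delta>'
  proof -
    \<comment> \<open>One scale finer than both given ones and below the gap \<open>d\<close>.
      Contents grow as the scale shrinks, so the two suprema can be taken independently.\<close>
    define e where "e = min (min \<delta> \<delta>') (d / 2)"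
    have e: "0 < e" "e \<le> \<delta>" "e \<le> \<delta>'" "e < d" using that assms(2) by (auto simp: e_def min_def)
    have "hausdorff_content k \<delta> A + hausdorff_content k \<delta>' B \<le> hausdorff_content k e A + hausdorff_content k e B"
      by (intro add_mono hausdorff_content_antimono e)
    also have "\<dots> \<le> hausdorff_content k e (A \<union> B)"
      by (rule hausdorff_content_separated) (use assms e in force)+
    also have "\<dots> \<le> hausdorff_outer k (A \<union> B)" by (rule hausdorff_content_le_outer) fact
    finally show ?thesis .
  qed
  have "hausdorff_outer k A + hausdorff_outer k B =
      (SUP \<delta>\<in>{0<..}. hausdorff_content k \<delta> A + hausdorff_outer k B)"
    unfolding hausdorff_outer_def[of k A] by (rule ennreal_SUP_add_left[symmetric]) auto
  also have "\<dots> \<le> hausdorff_outer k (A \<union> B)"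
  proof (rule SUP_least)
    fix \<delta> :: real assume "\<delta> \<in> {0<..}"
    have "hausdorff_content k \<delta> A + hausdorff_outer k B =
      (SUP \<delta>'\<in>{0<..}. hausdorff_content k \<delta> A + hausdorff_content k \<delta>' B)"
      unfolding hausdorff_outer_def[of k B] by (subst ennreal_SUP_add_right) auto
    also have "\<dots> \<le> hausdorff_outer k (A \<union> B)"
      by (rule SUP_least) (use * \<open>\<delta> \<in> _\<close> in auto)
    finally show "hausdorff_content k \<delta> A + hausdorff_outer k B \<le> hausdorff_outer k (A \<union> B)" .
  qed
  finally show "hausdorff_outer k A + hausdorff_outer k B \<le> hausdorff_outer k (A \<union> B)" .
qed

text \<open>Caratheodory's criterion: the shells \<open>R n\<close> around \<open>F\<close> with indices of equal parity are
  separated from each other, so the sum of their outer measures is finite and its tails vanish.\<close>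

lemma hausdorff_outer_closed_split:
  fixes F A :: "'a::metric_space set"
  assumes "closed F" "F \<noteq> {}"
  shows "hausdorff_outer k (A \<inter> F) + hausdorff_outer k (A - F) \<le> hausdorff_outer k A"
proof (cases "hausdorff_outer k A = top")
  case False
  let ?h = "hausdorff_outer k"
  define P where "P n = {x \<in> A. 1 / real (Suc n) \<le> infdist x F}" for n
  define R where "R n = P (Suc n) - P n" for n
  have Pmono: "P m \<subseteq> P n" if "m \<le> n" for m n
  proof -
    have "1 / real (Suc n) \<le> 1 / real (Suc m)" using that by (simp add: field_simps)
    thus ?thesis by (auto simp: P_def)
  qed
  have infd: "infdist x F \<le> infdist y F + dist x y" for x y by (rule infdist_triangle)
  \<comment> \<open>Points of \<open>P (Suc n)\<close> have distance at least 1/(n+2) from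
    \<open>F\<close>, points of \<open>R (n + 2)\<close> less than 1/(n+3): skipping one index
    leaves a positive gap.\<close>
  have sep: "?h (X \<union> R (n + 2)) = ?h X + ?h (R (n + 2))" if "X \<subseteq> P (Suc n)" for X n
  proof (rule hausdorff_outer_separated)
    fix x y assume "x \<in> X" "y \<in> R (n + 2)"
    hence "1 / real (Suc (Suc n)) \<le> infdist x F" "infdist y F < 1 / real (Suc (n + 2))"
      using that by (auto simp: P_def R_def)
    thus "1 / real (Suc (Suc n)) - 1 / real (Suc (n + 2)) \<le> dist x y"
      using infd[of x y] by linarith
  qed (simp add: frac_less2)
  have parity_sum: "(\<Sum>i<n. ?h (R (2 * i + j))) = ?h (\<Union>i<n. R (2 * i + j))" for n j
  proof (induction n)
    case (Suc n)
    show ?case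
    proof (cases n)
      case (Suc m)
      have "R (2 * i + j) \<subseteq> P (Suc (2 * m + j))" if "i < n" for i
        using Pmono[of "Suc (2 * i + j)" "Suc (2 * m + j)"] that Suc by (auto simp: R_def)
      hence "?h ((\<Union>i<n. R (2 * i + j)) \<union> R (2 * m + j + 2)) =
          ?h (\<Union>i<n. R (2 * i + j)) + ?h (R (2 * m + j + 2))"
        by (intro sep) auto
      moreover have "2 * m + j + 2 = 2 * n + j" using Suc by simp
      ultimately have "?h ((\<Union>i<n. R (2 * i + j)) \<union> R (2 * n + j)) =
          ?h (\<Union>i<n. R (2 * i + j)) + ?h (R (2 * n + j))" by metis
      thus ?thesis using Suc.IH by (simp add: lessThan_Suc Un_commute add.commute)
    qed (simp add: lessThan_Suc)
  qed simp
  have parity_le: "(\<Sum>i. ?h (R (2 * i + j))) \<le> ?h A" for j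
    unfolding suminf_eq_SUP parity_sum
    by (rule SUP_least, rule hausdorff_outer_mono) (auto simp: R_def P_def)
  have "(\<Sum>i<n. ?h (R i)) \<le> ?h A + ?h A" for n
  proof -
    have "(\<Sum>i<n. ?h (R i)) \<le> (\<Sum>i<2*n. ?h (R i))" by (intro sum_mono2) auto
    also have "\<dots> = (\<Sum>i<n. ?h (R (2 * i + 0))) + (\<Sum>i<n. ?h (R (2 * i + 1)))"
      by (induction n) (auto simp: ac_simps)
    also have "\<dots> \<le> ?h A + ?h A"
      by (intro add_mono order_trans[OF sum_le_suminf parity_le]) auto
    finally show ?thesis .
  qed
  hence "(\<Sum>i. ?h (R i)) \<le> ?h A + ?h A" unfolding suminf_eq_SUP by (intro SUP_least)
  hence fin: "(\<Sum>i. ?h (R i)) \<noteq> top" using False by (metis ennreal_add_eq_top top.extremum_uniqueI)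
  \<comment> \<open>Adding the first \<open>n\<close> shells to both sides turns the tail into the
    full sum, whose finiteness permits cancellation at the end. Extended reals are never
    subtracted.\<close>
  have "?h (A \<inter> F) + ?h (A - F) + (\<Sum>i<n. ?h (R i)) \<le> ?h A + (\<Sum>i. ?h (R i))" for n
  proof -
    have "A - F \<subseteq> P n \<union> (\<Union>i. R (i + n))"
    proof
      fix x assume x: "x \<in> A - F"
      hence "0 < infdist x F"
        using assms in_closed_iff_infdist_zero infdist_pos_not_in_closed by blast
      then obtain m where "1 / real (Suc m) < infdist x F" using nat_approx_posE by blast
      hence ex: "\<exists>m. x \<in> P m" using x by (auto simp: P_def intro!: exI[of _ m])
      define l where "l = (LEAST m. x \<in> P m)"
      have l: "x \<in> P l" unfolding l_def using ex by (rule LeastI_ex)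
      show "x \<in> P n \<union> (\<Union>i. R (i + n))"
      proof (cases "l \<le> n")
        case True thus ?thesis using l Pmono by blast
      next
        case False
        have "x \<notin> P (l - 1)" unfolding l_def by (rule not_less_Least) (use False l_def in auto)
        hence "x \<in> R ((l - 1 - n) + n)" using l False by (auto simp: R_def)
        thus ?thesis by blast
      qed
    qed
    hence "?h (A - F) \<le> ?h (P n) + ?h (\<Union>i. R (i + n))"
      using hausdorff_outer_Un hausdorff_outer_mono order_trans by blast
    also have "\<dots> \<le> ?h (P n) + (\<Sum>i. ?h (R (i + n)))"
      by (intro add_mono order_refl hausdorff_outer_countable_subadditive)
    finally have "?h (A \<inter> F) + ?h (A - F) \<le> (?h (A \<inter> F) + ?h (P n)) + (\<Sum>i. ?h (R (i + n)))"
      by (simp add: add.assoc add_left_mono)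
    also have "?h (A \<inter> F) + ?h (P n) = ?h ((A \<inter> F) \<union> P n)"
    proof (rule hausdorff_outer_separated[symmetric])
      fix x y assume "x \<in> A \<inter> F" "y \<in> P n"
      thus "1 / real (Suc n) \<le> dist x y"
        using infdist_le[of x F y] by (auto simp: P_def dist_commute)
    qed simp
    also have "\<dots> \<le> ?h A" by (rule hausdorff_outer_mono) (auto simp: P_def)
    finally have "?h (A \<inter> F) + ?h (A - F) + (\<Sum>i<n. ?h (R i)) \<le> ?h A + (\<Sum>i. ?h (R (i + n))) + (\<Sum>i<n. ?h (R i))"
      by (simp add: add_mono)
    also have "\<dots> = ?h A + (\<Sum>i. ?h (R i))"
      by (simp add: add.assoc suminf_offset[of "\<lambda>i. ?h (R i)" n])
    finally show ?thesis .
  qed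
  hence "(SUP n. ?h (A \<inter> F) + ?h (A - F) + (\<Sum>i<n. ?h (R i))) \<le> ?h A + (\<Sum>i. ?h (R i))"
    by (intro SUP_least)
  hence "?h (A \<inter> F) + ?h (A - F) + (\<Sum>i. ?h (R i)) \<le> ?h A + (\<Sum>i. ?h (R i))"
    by (simp add: ennreal_SUP_add_right suminf_eq_SUP)
  thus ?thesis using fin by (simp add: add.commute[of _ "suminf _"] ennreal_add_left_cancel_le)
qed simp

text \<open>\<open>measure_of\<close> returns the values of the outer measure only if these are
  countably additive on the Borel sets. The Caratheodory sets form a sigma-algebra containing all
  closed sets, hence all Borel sets.\<close>

lemma hausdorff_measure_space: "measure_space UNIV (sets borel) (hausdorff_outer k :: 'a::metric_space set \<Rightarrow> ennreal)"
proof -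
  let ?L = "lambda_system UNIV (Pow UNIV) (hausdorff_outer k :: 'a set \<Rightarrow> ennreal)"
  interpret sigma_algebra UNIV "Pow UNIV :: 'a set set" by (rule sigma_algebra_Pow)
  have L: "measure_space UNIV ?L (hausdorff_outer k)"
    by (rule caratheodory_lemma) (rule hausdorff_outer_space)
  have "F \<in> ?L" if "closed F" for F :: "'a set"
  proof (cases "F = {}")
    case False
    have "hausdorff_outer k (A \<inter> F) + hausdorff_outer k (A - F) = hausdorff_outer k A" for A
      using hausdorff_outer_closed_split[OF that False, of k A] hausdorff_outer_Un[of k "A \<inter> F" "A - F"]
      by (simp add: Int_Diff_Un antisym)
    thus ?thesis unfolding lambda_system_def by (auto simp: Int_commute Diff_eq)
  qed (simp add: lambda_system_def)
  hence "sigma_sets UNIV (Collect closed) \<subseteq> ?L"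
    using L by (intro sigma_algebra.sigma_sets_subset) (auto simp: measure_space_def)
  moreover have "sets (borel :: 'a measure) = sigma_sets UNIV (Collect closed)"
    unfolding borel_eq_closed by (simp add: sets_measure_of)
  ultimately show ?thesis
    using measure_down[OF L, of "sets borel"] sets.sigma_algebra_axioms[of "borel :: 'a measure"] by simp
qed

lemma sets_hausdorff_measure [simp, measurable_cong]: "sets (hausdorff_measure k) = sets borel"
  unfolding hausdorff_measure_def
  by (metis sets.sigma_sets_eq sets.space_closed sets_measure_of space_borel)

lemma space_hausdorff_measure [simp]: "space (hausdorff_measure k) = UNIV"
  by (metis sets_eq_imp_space_eq sets_hausdorff_measure space_borel)

lemma emeasure_hausdorff_measure:
  fixes B :: "'a::metric_space set"
  assumes "B \<in> sets borel"
  shows "emeasure (hausdorff_measure k) B = hausdorff_outer k B"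
proof (rule emeasure_measure_of[OF hausdorff_measure_def])
  have "measure_space UNIV (sets (borel :: 'a measure)) (hausdorff_outer k)"
    by (rule hausdorff_measure_space)
  thus "positive (sets (hausdorff_measure k)) (hausdorff_outer k :: 'a set \<Rightarrow> ennreal)"
    "countably_additive (sets (hausdorff_measure k)) (hausdorff_outer k :: 'a set \<Rightarrow> ennreal)"
    by (auto simp: measure_space_def)
qed (use assms in auto)

lemma hausdorff_outer_lipschitz_image:
  fixes f :: "'a::metric_space \<Rightarrow> 'b::metric_space"
  assumes lip: "\<And>x y. x \<in> D \<Longrightarrow> y \<in> D \<Longrightarrow> dist (f x) (f y) \<le> L * dist x y" and L: "0 < L"
  shows "hausdorff_outer k (f ` D) \<le> ennreal (L ^ k) * hausdorff_outer k D"
proof (rule hausdorff_outer_least)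
  fix \<delta> :: real assume "\<delta> > 0"
  have "hausdorff_content k \<delta> (f ` D) \<le> ennreal (L ^ k) * (\<Sum>i. hausdorff_weight k (C i))"
    if C: "D \<subseteq> (\<Union>i. C i)" "\<And>i. bounded (C i)" "\<And>i. diameter (C i) \<le> \<delta> / L" for C :: "nat \<Rightarrow> 'a set"
  proof -
    define C' where "C' i = f ` (C i \<inter> D)" for i
    have dist: "dist y z \<le> L * diameter (C i)" if yz: "y \<in> C' i" "z \<in> C' i" for y z i
    proof -
      obtain a b where ab: "y = f a" "z = f b" "a \<in> C i" "a \<in> D" "b \<in> C i" "b \<in> D"
        using yz unfolding C'_def by blast
      have "dist y z \<le> L * dist a b" using ab lip by simp
      also have "\<dots> \<le> L * diameter (C i)"
        using L ab diameter_bounded_bound[OF C(2)] by simp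
      finally show ?thesis .
    qed
    have bd: "bounded (C' i)" for i
      using dist bounded_two_points by blast
    have diam: "diameter (C' i) \<le> L * diameter (C i)" for i
    proof (cases "C' i = {}")
      case False
      thus ?thesis unfolding diameter_def[of "C' i"] using dist by (auto intro!: cSUP_least)
    next
      case True
      thus ?thesis using L diameter_ge_0[OF C(2)[of i]] by simp
    qed
    have "hausdorff_content k \<delta> (f ` D) \<le> (\<Sum>i. hausdorff_weight k (C' i))"
    proof (rule hausdorff_content_le)
      show "f ` D \<subseteq> (\<Union>i. C' i)" using C(1) unfolding C'_def by blast
      show "diameter (C' i) \<le> \<delta>" for i
      proof -
        have "L * diameter (C i) \<le> L * (\<delta> / L)" using C(3)[of i] L by (intro mult_left_mono) auto
        thus ?thesis using diam[of i] L by simp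
      qed
    qed (rule bd)
    also have "\<dots> \<le> (\<Sum>i. ennreal (L ^ k) * hausdorff_weight k (C i))"
    proof (intro suminf_le allI)
      fix i
      show "hausdorff_weight k (C' i) \<le> ennreal (L ^ k) * hausdorff_weight k (C i)"
      proof (cases "C' i = {}")
        case False
        hence "C i \<noteq> {}" by (auto simp: C'_def)
        have "(diameter (C' i) / 2) ^ k \<le> (L * (diameter (C i) / 2)) ^ k"
          using diam[of i] diameter_ge_0[OF bd[of i]] by (intro power_mono) auto
        hence "unit_ball_vol (real k) * (diameter (C' i) / 2) ^ k \<le>
            L ^ k * (unit_ball_vol (real k) * (diameter (C i) / 2) ^ k)"
          using mult_left_mono[of "(diameter (C' i) / 2) ^ k" "(L * (diameter (C i) / 2)) ^ k" "unit_ball_vol (real k)"]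
          unfolding power_mult_distrib by (simp only: mult.left_commute[of "L ^ k"] unit_ball_vol_nonneg of_nat_0_le_iff simp_thms)
        hence "ennreal (unit_ball_vol (real k) * (diameter (C' i) / 2) ^ k) \<le>
            ennreal (L ^ k * (unit_ball_vol (real k) * (diameter (C i) / 2) ^ k))" by (rule ennreal_leI)
        also have "\<dots> = ennreal (L ^ k) * ennreal (unit_ball_vol (real k) * (diameter (C i) / 2) ^ k)"
          using L by (intro ennreal_mult') simp
        finally show ?thesis using False \<open>C i \<noteq> {}\<close>
          by (simp only: hausdorff_weight_def if_False)
      qed simp
    qed auto
    finally show ?thesis by simp
  qed
  note * = this
  \<comment> \<open>The content of \<open>D\<close> is an infimum over covers. Moving the factor
    \<open>L ^ k\<close> to the left first allows the estimate to be made for each single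
    cover.\<close>
  define I where "I = ennreal ((1 / L) ^ k)"
  have "(1 / L) ^ k * L ^ k = 1" using L by (simp add: power_one_over)
  hence one: "I * ennreal (L ^ k) = 1"
    unfolding I_def using L by (subst ennreal_mult'[symmetric]) simp_all
  have "I * hausdorff_content k \<delta> (f ` D) \<le> hausdorff_content k (\<delta> / L) D"
  proof (rule hausdorff_content_greatest)
    fix C :: "nat \<Rightarrow> 'a set"
    assume C: "D \<subseteq> (\<Union>i. C i)" "\<And>i. bounded (C i)" "\<And>i. diameter (C i) \<le> \<delta> / L"
    have "I * hausdorff_content k \<delta> (f ` D) \<le> I * (ennreal (L ^ k) * (\<Sum>i. hausdorff_weight k (C i)))"
      by (rule mult_left_mono[OF *[OF C]]) simp
    also have "\<dots> = (\<Sum>i. hausdorff_weight k (C i))"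
      unfolding mult.assoc[symmetric] one by (rule mult_1_left)
    finally show "I * hausdorff_content k \<delta> (f ` D) \<le> (\<Sum>i. hausdorff_weight k (C i))" .
  qed
  hence "ennreal (L ^ k) * (I * hausdorff_content k \<delta> (f ` D)) \<le>
      ennreal (L ^ k) * hausdorff_content k (\<delta> / L) D"
    by (rule mult_left_mono) simp
  moreover have "ennreal (L ^ k) * (I * hausdorff_content k \<delta> (f ` D)) = hausdorff_content k \<delta> (f ` D)"
    unfolding mult.assoc[symmetric] mult.commute[of "ennreal (L ^ k)" I] one by (rule mult_1_left)
  ultimately have "hausdorff_content k \<delta> (f ` D) \<le> ennreal (L ^ k) * hausdorff_content k (\<delta> / L) D"
    by (simp only:)
  also have "\<dots> \<le> ennreal (L ^ k) * hausdorff_outer k D"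
    using \<open>\<delta> > 0\<close> L by (intro mult_left_mono hausdorff_content_le_outer) auto
  finally show "hausdorff_content k \<delta> (f ` D) \<le> ennreal (L ^ k) * hausdorff_outer k D" .
qed

section \<open>The isodiametric inequality\<close>

text \<open>The parameter is the coordinate along \<open>b\<close> itself and not an offset from
  \<open>x\<close>, so all points of a line in direction \<open>b\<close> have the same
  slice.\<close>

definition slice :: "'a::euclidean_space \<Rightarrow> 'a set \<Rightarrow> 'a \<Rightarrow> real set" where
  "slice b C x = {t. x + (t - x \<bullet> b) *\<^sub>R b \<in> C}"

text \<open>Steiner symmetrization in the hyperplane orthogonal to \<open>b\<close>: each slice
  becomes the centred open interval of the same length. The strict inequality leaves lines with a
  null slice empty.\<close>

definition steiner :: "'a::euclidean_space \<Rightarrow> 'a set \<Rightarrow> 'a set" where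
  "steiner b C = {x. ennreal (2 * \<bar>x \<bullet> b\<bar>) < emeasure lborel (slice b C x)}"

definition reflection :: "'a::euclidean_space \<Rightarrow> 'a \<Rightarrow> 'a" where
  "reflection a x = x - (2 * (x \<bullet> a)) *\<^sub>R a"

lemma slice_translate: "b \<in> Basis \<Longrightarrow> slice b C (x + s *\<^sub>R b) = slice b C x"
  by (simp add: slice_def inner_add_left algebra_simps)

lemma nn_integral_lborel_translate:
  fixes f :: "'a::euclidean_space \<Rightarrow> ennreal"
  assumes [measurable]: "f \<in> borel_measurable borel"
  shows "(\<integral>\<^sup>+x. f (c + x) \<partial>lborel) = (\<integral>\<^sup>+x. f x \<partial>lborel)"
proof -
  have "(\<integral>\<^sup>+x. f x \<partial>lborel) = (\<integral>\<^sup>+x. f x \<partial>distr lborel borel ((+) c))"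
    by (simp add: lborel_distr_plus)
  also have "\<dots> = (\<integral>\<^sup>+x. f (c + x) \<partial>lborel)" by (rule nn_integral_distr) auto
  finally show ?thesis ..
qed

lemma slice_measurable [measurable]:
  assumes [measurable]: "C \<in> sets borel"
  shows "slice b C x \<in> sets borel"
  unfolding slice_def by measurable

lemma emeasure_slice_eq:
  assumes [measurable]: "C \<in> sets borel"
  shows "emeasure lborel (slice b C x) = (\<integral>\<^sup>+t. indicator C (x + (t - x \<bullet> b) *\<^sub>R b) \<partial>lborel)"
proof -
  have "emeasure lborel (slice b C x) = (\<integral>\<^sup>+t. indicator (slice b C x) t \<partial>lborel)" by simp
  also have "\<dots> = (\<integral>\<^sup>+t. indicator C (x + (t - x \<bullet> b) *\<^sub>R b) \<partial>lborel)"
    by (intro nn_integral_cong) (auto simp: slice_def indicator_def)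
  finally show ?thesis .
qed

lemma emeasure_slice_borel_measurable [measurable]:
  assumes [measurable]: "C \<in> sets borel"
  shows "(\<lambda>x. emeasure lborel (slice b C x)) \<in> borel_measurable borel"
  unfolding emeasure_slice_eq[OF assms] by measurable

text \<open>Fubini without coordinates: by translation invariance, averaging the slices over the
  positions \<open>x \<bullet> b \<in> {0..1}\<close> recovers the full volume.\<close>

lemma emeasure_eq_integral_slice:
  fixes C :: "'a::euclidean_space set"
  assumes b: "b \<in> Basis" and C[measurable]: "C \<in> sets borel"
  shows "emeasure lborel C = (\<integral>\<^sup>+x. emeasure lborel (slice b C x) * indicator {0..1} (x \<bullet> b) \<partial>lborel)"
proof -
  have "(\<integral>\<^sup>+x. emeasure lborel (slice b C x) * indicator {0..1} (x \<bullet> b) \<partial>lborel) =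
    (\<integral>\<^sup>+x. (\<integral>\<^sup>+t. indicator C (x + t *\<^sub>R b) * indicator {0..1} (x \<bullet> b) \<partial>lborel) \<partial>lborel)"
  proof (intro nn_integral_cong)
    fix x :: 'a
    have "emeasure lborel (slice b C x) = (\<integral>\<^sup>+t. indicator C (x + ((x \<bullet> b + t) - x \<bullet> b) *\<^sub>R b) \<partial>lborel)"
      unfolding emeasure_slice_eq[OF C] by (rule nn_integral_lborel_translate[symmetric]) measurable
    thus "emeasure lborel (slice b C x) * indicator {0..1} (x \<bullet> b) =
      (\<integral>\<^sup>+t. indicator C (x + t *\<^sub>R b) * indicator {0..1} (x \<bullet> b) \<partial>lborel)"
      by (simp add: nn_integral_multc)
  qed
  also have "\<dots> = (\<integral>\<^sup>+t. (\<integral>\<^sup>+x. indicator C (x + t *\<^sub>R b) * indicator {0..1} (x \<bullet> b) \<partial>lborel) \<partial>lborel)"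
    by (rule lborel_pair.Fubini') measurable
  also have "\<dots> = (\<integral>\<^sup>+t. (\<integral>\<^sup>+x. indicator C x * indicator {0..1} (x \<bullet> b - t) \<partial>lborel) \<partial>lborel)"
  proof (rule nn_integral_cong)
    fix t :: real
    have "(\<integral>\<^sup>+x. indicator C x * indicator {0..1} (x \<bullet> b - t) \<partial>lborel) =
      (\<integral>\<^sup>+x. indicator C (t *\<^sub>R b + x) * indicator {0..1} ((t *\<^sub>R b + x) \<bullet> b - t) \<partial>lborel)"
      by (rule nn_integral_lborel_translate[symmetric]) measurable
    thus "(\<integral>\<^sup>+x. indicator C (x + t *\<^sub>R b) * indicator {0..1} (x \<bullet> b) \<partial>lborel) =
      (\<integral>\<^sup>+x. indicator C x * indicator {0..1} (x \<bullet> b - t) \<partial>lborel)"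
      using b by (simp add: inner_add_left add.commute)
  qed
  also have "\<dots> = (\<integral>\<^sup>+x. (\<integral>\<^sup>+t. indicator C x * indicator {0..1} (x \<bullet> b - t) \<partial>lborel) \<partial>lborel)"
    by (rule lborel_pair.Fubini'[symmetric]) measurable
  also have "\<dots> = (\<integral>\<^sup>+x. indicator C x \<partial>lborel)"
  proof (intro nn_integral_cong)
    fix x :: 'a
    have "(\<integral>\<^sup>+t. indicator {0..1} (x \<bullet> b - t) \<partial>lborel) = (\<integral>\<^sup>+t. indicator {x \<bullet> b - 1..x \<bullet> b} t \<partial>lborel)"
      by (intro nn_integral_cong) (auto simp: indicator_def)
    also have "\<dots> = 1" by simp
    finally show "(\<integral>\<^sup>+t. indicator C x * indicator {0..1} (x \<bullet> b - t) \<partial>lborel) = indicator C x"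
      by (simp add: nn_integral_cmult)
  qed
  finally show ?thesis by simp
qed

lemma steiner_borel:
  assumes "C \<in> sets borel"
  shows "steiner b C \<in> sets borel"
proof -
  define m where "m x = emeasure lborel (slice b C x)" for x
  have [measurable]: "m \<in> borel_measurable borel"
    unfolding m_def by (rule emeasure_slice_borel_measurable[OF assms])
  have "{x \<in> space borel. ennreal (2 * \<bar>x \<bullet> b\<bar>) < m x} \<in> sets borel" by measurable
  thus ?thesis by (simp add: steiner_def m_def)
qed

lemma slice_bounds:
  assumes b: "b \<in> Basis" and d: "\<And>x y. x \<in> C \<Longrightarrow> y \<in> C \<Longrightarrow> dist x y \<le> d"
    and s: "s \<in> slice b C x" and t: "t \<in> slice b C x"
  shows "dist s t \<le> d"
proof -
  have "dist (x + (s - x \<bullet> b) *\<^sub>R b) (x + (t - x \<bullet> b) *\<^sub>R b) \<le> d"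
    using s t by (intro d) (auto simp: slice_def)
  moreover have "(x + (s - x \<bullet> b) *\<^sub>R b) - (x + (t - x \<bullet> b) *\<^sub>R b) = (s - t) *\<^sub>R b"
    by (simp add: algebra_simps)
  ultimately show ?thesis using b by (simp add: dist_norm)
qed

lemma slice_bounded:
  assumes "b \<in> Basis" and "\<And>x y. x \<in> C \<Longrightarrow> y \<in> C \<Longrightarrow> dist x y \<le> d"
  shows "bounded (slice b C x)"
  unfolding bounded_two_points using slice_bounds[OF assms] by blast

lemma emeasure_slice_finite:
  assumes "b \<in> Basis" and "\<And>x y. x \<in> C \<Longrightarrow> y \<in> C \<Longrightarrow> dist x y \<le> d"
  shows "emeasure lborel (slice b C x) < \<infinity>"
  by (rule emeasure_bounded_finite[OF slice_bounded[OF assms]])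

lemma emeasure_le_Sup_Inf:
  fixes X :: "real set"
  assumes "bounded X"
  shows "emeasure lborel X \<le> ennreal (Sup X - Inf X)"
proof (cases "X = {}")
  case False
  have "bdd_above X" "bdd_below X"
    using assms by (auto simp: bounded_imp_bdd_above bounded_imp_bdd_below)
  hence "X \<subseteq> {Inf X..Sup X}" by (auto intro: cInf_lower cSup_upper)
  hence "emeasure lborel X \<le> emeasure lborel {Inf X..Sup X}" by (intro emeasure_mono) auto
  also have "\<dots> = ennreal (Sup X - Inf X)"
    using \<open>X \<subseteq> _\<close> False by (subst emeasure_lborel_Icc) auto
  finally show ?thesis .
qed simp

text \<open>All slices keep their length, so Cavalieri's principle applies. The diameter bound makes
  the lengths finite, and each new slice is then a bounded interval.\<close>

lemma emeasure_steiner: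
  fixes C :: "'a::euclidean_space set"
  assumes b: "b \<in> Basis" and C[measurable]: "C \<in> sets borel"
    and d: "\<And>x y. x \<in> C \<Longrightarrow> y \<in> C \<Longrightarrow> dist x y \<le> d"
  shows "emeasure lborel (steiner b C) = emeasure lborel C"
proof -
  have "emeasure lborel (slice b (steiner b C) x) = emeasure lborel (slice b C x)" for x
  proof -
    define m where "m = measure lborel (slice b C x)"
    have m: "emeasure lborel (slice b C x) = ennreal m" "0 \<le> m"
      using emeasure_slice_finite[OF b d, of C x] by (auto simp: m_def emeasure_eq_ennreal_measure)
    have "slice b (steiner b C) x = {t. ennreal (2 * \<bar>t\<bar>) < ennreal m}"
      using b m unfolding steiner_def slice_def[of b "{x. _ x}"]
      by (simp add: slice_translate inner_add_left)
    also have "\<dots> = {- (m / 2) <..< m / 2}"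
      by (auto simp: ennreal_less_iff)
    also have "emeasure lborel \<dots> = ennreal m" using m by simp
    finally show ?thesis using m by simp
  qed
  thus ?thesis
    using emeasure_eq_integral_slice[OF b C] emeasure_eq_integral_slice[OF b steiner_borel[OF C]] by simp
qed

text \<open>Moving the coordinates along \<open>b\<close> further apart shortens no component of the
  difference.\<close>

lemma dist_line_le:
  fixes x y :: "'a::euclidean_space"
  assumes b: "b \<in> Basis" and st: "\<bar>x \<bullet> b - y \<bullet> b\<bar> \<le> \<bar>s - t\<bar>"
  shows "dist x y \<le> dist (x + (s - x \<bullet> b) *\<^sub>R b) (y + (t - y \<bullet> b) *\<^sub>R b)"
proof -
  let ?z = "(x + (s - x \<bullet> b) *\<^sub>R b) - (y + (t - y \<bullet> b) *\<^sub>R b)"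
  have "\<bar>(x - y) \<bullet> a\<bar> \<le> \<bar>?z \<bullet> a\<bar>" if "a \<in> Basis" for a
    using that b st by (cases "a = b") (auto simp: inner_add_left inner_diff_left inner_Basis)
  thus ?thesis unfolding dist_norm by (rule norm_le_componentwise)
qed

text \<open>A point of the symmetrized set has a coordinate along \<open>b\<close> smaller in
  modulus than half the spread \<open>Sup - Inf\<close> of its slice. Hence the difference of the
  two coordinates is less than the average of \<open>Sup X - Inf Y\<close> and
  \<open>Sup Y - Inf X\<close>, and so less than one of them. Points of \<open>C\<close> on the two
  lines near these extremes are at least as far apart as \<open>x\<close> and
  \<open>y\<close>.\<close>

lemma steiner_dist_le:
  fixes C :: "'a::euclidean_space set"
  assumes b: "b \<in> Basis" and d: "\<And>x y. x \<in> C \<Longrightarrow> y \<in> C \<Longrightarrow> dist x y \<le> d"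
    and xy: "x \<in> steiner b C" "y \<in> steiner b C"
  shows "dist x y \<le> d"
proof -
  define X where "X = slice b C x"
  define Y where "Y = slice b C y"
  have bd: "bounded X" "bounded Y" unfolding X_def Y_def using slice_bounded[OF b d] by blast+
  have "ennreal (2 * \<bar>x \<bullet> b\<bar>) < emeasure lborel X" "ennreal (2 * \<bar>y \<bullet> b\<bar>) < emeasure lborel Y"
    using xy by (auto simp: steiner_def X_def Y_def)
  hence ne: "X \<noteq> {}" "Y \<noteq> {}"
    and "ennreal (2 * \<bar>x \<bullet> b\<bar>) < ennreal (Sup X - Inf X)" "ennreal (2 * \<bar>y \<bullet> b\<bar>) < ennreal (Sup Y - Inf Y)"
    using emeasure_le_Sup_Inf[OF bd(1)] emeasure_le_Sup_Inf[OF bd(2)] by (auto intro: less_le_trans)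
  hence le: "2 * \<bar>x \<bullet> b\<bar> < Sup X - Inf X" "2 * \<bar>y \<bullet> b\<bar> < Sup Y - Inf Y"
    by (auto simp: ennreal_less_iff)
  have bdd: "bdd_above X" "bdd_below X" "bdd_above Y" "bdd_below Y"
    using bd by (auto simp: bounded_imp_bdd_above bounded_imp_bdd_below)
  have lines: "dist x y \<le> d" if "s \<in> X" "t \<in> Y" "\<bar>x \<bullet> b - y \<bullet> b\<bar> \<le> \<bar>s - t\<bar>" for s t
    using dist_line_le[OF b that(3)] d that(1,2) unfolding X_def Y_def slice_def
    by (metis (no_types, lifting) mem_Collect_eq order_trans)
  consider "\<bar>x \<bullet> b - y \<bullet> b\<bar> < Sup X - Inf Y" | "\<bar>x \<bullet> b - y \<bullet> b\<bar> < Sup Y - Inf X"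
    using le by argo
  thus ?thesis
  proof cases
    case 1
    hence "\<bar>x \<bullet> b - y \<bullet> b\<bar> + Inf Y < Sup X" by simp
    then obtain s where s: "s \<in> X" "\<bar>x \<bullet> b - y \<bullet> b\<bar> + Inf Y < s"
      using less_cSup_iff[OF ne(1) bdd(1)] by blast
    hence "Inf Y < s - \<bar>x \<bullet> b - y \<bullet> b\<bar>" by simp
    then obtain t where "t \<in> Y" "t < s - \<bar>x \<bullet> b - y \<bullet> b\<bar>"
      using cInf_less_iff[OF ne(2) bdd(4)] by blast
    thus ?thesis using s(1) by (intro lines) auto
  next
    case 2
    hence "\<bar>x \<bullet> b - y \<bullet> b\<bar> + Inf X < Sup Y" by simp
    then obtain t where t: "t \<in> Y" "\<bar>x \<bullet> b - y \<bullet> b\<bar> + Inf X < t"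
      using less_cSup_iff[OF ne(2) bdd(3)] by blast
    hence "Inf X < t - \<bar>x \<bullet> b - y \<bullet> b\<bar>" by simp
    then obtain s where "s \<in> X" "s < t - \<bar>x \<bullet> b - y \<bullet> b\<bar>"
      using cInf_less_iff[OF ne(1) bdd(2)] by blast
    thus ?thesis using t(1) by (intro lines) auto
  qed
qed

lemma reflection_twice: "a \<in> Basis \<Longrightarrow> reflection a (reflection a x) = x"
  by (simp add: reflection_def inner_diff_left algebra_simps flip: scaleR_add_left)

lemma steiner_symmetric:
  assumes b: "b \<in> Basis" and x: "x \<in> steiner b C"
  shows "reflection b x \<in> steiner b C"
proof -
  have "slice b C (reflection b x) = slice b C x"
    using slice_translate[OF b, of C x "- (2 * (x \<bullet> b))"] by (simp add: reflection_def)
  moreover have "\<bar>reflection b x \<bullet> b\<bar> = \<bar>x \<bullet> b\<bar>" using b by (simp add: reflection_def inner_diff_left)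
  ultimately show ?thesis using x by (simp add: steiner_def)
qed

text \<open>A reflection in another axis carries the line through \<open>x\<close> in direction
  \<open>b\<close> to the parallel line through the image, with the same coordinate
  \<open>t\<close>, so the two slices agree. Symmetries gained earlier thus survive later
  symmetrizations.\<close>

lemma steiner_keeps_symmetric:
  assumes ab: "a \<in> Basis" "b \<in> Basis" "a \<noteq> b" and sym: "\<And>x. x \<in> C \<Longrightarrow> reflection a x \<in> C"
    and x: "x \<in> steiner b C"
  shows "reflection a x \<in> steiner b C"
proof -
  have ab0: "a \<bullet> b = 0" "b \<bullet> a = 0" using ab by (simp_all add: inner_Basis)
  have inv: "reflection a z \<in> C \<longleftrightarrow> z \<in> C" for z using sym reflection_twice[OF ab(1)] by metis
  have xb: "reflection a x \<bullet> b = x \<bullet> b" using ab0 by (simp add: reflection_def inner_diff_left)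
  have "reflection a x + (t - x \<bullet> b) *\<^sub>R b = reflection a (x + (t - x \<bullet> b) *\<^sub>R b)" for t
    using ab0 by (simp add: reflection_def inner_add_left)
  hence "slice b C (reflection a x) = slice b C x" unfolding slice_def xb using inv by simp
  thus ?thesis using x xb by (simp add: steiner_def)
qed

lemma symmetrization:
  fixes C F :: "'a::euclidean_space set"
  assumes C: "C \<in> sets borel" and d: "\<And>x y. x \<in> C \<Longrightarrow> y \<in> C \<Longrightarrow> dist x y \<le> d"
    and "finite F" "F \<subseteq> Basis"
  shows "\<exists>C'. C' \<in> sets borel \<and> (\<forall>x\<in>C'. \<forall>y\<in>C'. dist x y \<le> d) \<and>
    emeasure lborel C' = emeasure lborel C \<and> (\<forall>a\<in>F. \<forall>x\<in>C'. reflection a x \<in> C')"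
  using assms(3,4)
proof (induction F)
  case empty
  show ?case by (intro exI[of _ C]) (simp add: C d)
next
  case (insert b F)
  from insert.prems have "F \<subseteq> Basis" by simp
  from insert.IH[OF this] obtain C' where C': "C' \<in> sets borel" "\<forall>x\<in>C'. \<forall>y\<in>C'. dist x y \<le> d"
    "emeasure lborel C' = emeasure lborel C" "\<forall>a\<in>F. \<forall>x\<in>C'. reflection a x \<in> C'"
    by (elim exE conjE)
  have b: "b \<in> Basis" using insert.prems by simp
  have "\<forall>x\<in>steiner b C'. \<forall>y\<in>steiner b C'. dist x y \<le> d"
  proof (intro ballI)
    fix x y assume xy: "x \<in> steiner b C'" "y \<in> steiner b C'"
    show "dist x y \<le> d"
      by (rule steiner_dist_le[OF b _ xy]) (simp add: C'(2))
  qed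
  moreover have "emeasure lborel (steiner b C') = emeasure lborel C"
    unfolding C'(3)[symmetric] by (rule emeasure_steiner[OF b C'(1), of d]) (simp add: C'(2))
  moreover have "reflection a x \<in> steiner b C'" if "a \<in> insert b F" "x \<in> steiner b C'" for a x
  proof (cases "a = b")
    case False
    thus ?thesis using that insert C'(4) by (intro steiner_keeps_symmetric[OF _ b]) auto
  qed (use that steiner_symmetric[OF b] in auto)
  ultimately show ?case
    using steiner_borel[OF C'(1), of b] by (intro exI[of _ "steiner b C'"]) simp
qed

text \<open>Symmetrizing in every coordinate direction preserves the volume and the bound
  \<open>d\<close> on distances and makes the set invariant under x -> -x. Then each point has
  distance 2 |x| from its antipode, which confines the set to a ball of radius d / 2.\<close>

theorem isodiametric:
  fixes C :: "'a::euclidean_space set"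
  assumes C: "C \<in> sets borel" and d: "\<And>x y. x \<in> C \<Longrightarrow> y \<in> C \<Longrightarrow> dist x y \<le> d" and "0 \<le> d"
  shows "emeasure lborel C \<le> ennreal (unit_ball_vol (real DIM('a)) * (d / 2) ^ DIM('a))"
proof -
  obtain C' :: "'a set" where C': "C' \<in> sets borel" "\<forall>x\<in>C'. \<forall>y\<in>C'. dist x y \<le> d"
    "emeasure lborel C' = emeasure lborel C" "\<forall>a\<in>Basis. \<forall>x\<in>C'. reflection a x \<in> C'"
    using symmetrization[OF C d finite_Basis order_refl] by blast
  have "C' \<subseteq> cball 0 (d / 2)"
  proof
    fix x assume x: "x \<in> C'"
    \<comment> \<open>Composing the reflections for the directions in \<open>F\<close> flips exactly
      these coordinates; for the whole basis this is the antipodal map.\<close>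
    have "x - (\<Sum>a\<in>F. (2 * (x \<bullet> a)) *\<^sub>R a) \<in> C'" if "finite F" "F \<subseteq> Basis" for F
      using that
    proof (induction F)
      case (insert b F)
      let ?y = "x - (\<Sum>a\<in>F. (2 * (x \<bullet> a)) *\<^sub>R a)"
      have "(\<Sum>a\<in>F. (2 * (x \<bullet> a)) *\<^sub>R a) \<bullet> b = 0"
        unfolding inner_sum_left
      proof (intro sum.neutral ballI)
        fix a assume "a \<in> F"
        hence "a \<bullet> b = 0" using insert by (intro inner_not_same_Basis) auto
        thus "((2 * (x \<bullet> a)) *\<^sub>R a) \<bullet> b = 0" by simp
      qed
      hence "reflection b ?y = x - (\<Sum>a\<in>insert b F. (2 * (x \<bullet> a)) *\<^sub>R a)"
        using insert by (simp add: reflection_def inner_diff_left)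
      thus ?case using insert C'(4) by (metis insert_subset)
    qed (use x in simp)
    from this[OF finite_Basis order_refl]
    have "x - 2 *\<^sub>R (\<Sum>a\<in>Basis. (x \<bullet> a) *\<^sub>R a) \<in> C'" by (simp add: scaleR_sum_right)
    hence "x - 2 *\<^sub>R x \<in> C'" by (simp add: euclidean_representation)
    hence "dist x (x - 2 *\<^sub>R x) \<le> d" using C'(2) x by blast
    thus "x \<in> cball 0 (d / 2)" by (simp add: dist_norm)
  qed
  hence "emeasure lborel C' \<le> emeasure lborel (cball (0::'a) (d / 2))" by (rule emeasure_mono) simp
  thus ?thesis using C'(3) \<open>0 \<le> d\<close> by (simp add: emeasure_cball)
qed

section \<open>Hausdorff measure of full dimension\<close>

lemma hausdorff_weight_ball:
  fixes a :: "'a::euclidean_space"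
  assumes "0 \<le> r"
  shows "hausdorff_weight DIM('a) (ball a r) = emeasure lborel (ball a r)"
  using assms by (cases "r = 0") (auto simp: hausdorff_weight_def emeasure_ball)

text \<open>Vitali's theorems return a countable set of balls, whereas contents are defined by
  covers indexed by the naturals. Spare indices receive radius 0, that is, an empty ball, which
  weighs nothing and keeps the family disjoint.\<close>

lemma countable_disjoint_balls_sequence:
  fixes K :: "('a::euclidean_space \<times> real) set"
  assumes C: "countable K" "\<And>p. p \<in> K \<Longrightarrow> 0 < snd p"
    "pairwise (\<lambda>p q. disjnt (ball (fst p) (snd p)) (ball (fst q) (snd q))) K"
  shows "\<exists>(a :: nat \<Rightarrow> 'a) r. (\<forall>n. r n = 0 \<or> (a n, r n) \<in> K) \<and> (\<forall>n. 0 \<le> r n) \<and>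
    (\<forall>p\<in>K. \<exists>n. p = (a n, r n)) \<and> disjoint_family (\<lambda>n. ball (a n) (r n))"
proof -
  define p where "p n = (if n \<in> to_nat_on K ` K then from_nat_into K n else (0, 0))" for n
  have inK: "p n \<in> K" if "n \<in> to_nat_on K ` K" for n using that C(1) by (auto simp: p_def)
  have zero: "p n = (0, 0)" if "n \<notin> to_nat_on K ` K" for n using that by (simp add: p_def)
  have 1: "snd (p n) = 0 \<or> (fst (p n), snd (p n)) \<in> K" for n
    using inK[of n] zero[of n] by (cases "n \<in> to_nat_on K ` K") auto
  have 2: "0 \<le> snd (p n)" for n
    using inK[of n] C(2)[of "p n"] zero[of n] by (cases "n \<in> to_nat_on K ` K") auto
  have 3: "\<exists>n. q = (fst (p n), snd (p n))" if "q \<in> K" for q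
    using that C(1) by (intro exI[of _ "to_nat_on K q"]) (simp add: p_def)
  have 4: "disjoint_family (\<lambda>n. ball (fst (p n)) (snd (p n)))"
    unfolding disjoint_family_on_def
  proof (intro ballI impI)
    fix m n :: nat assume "m \<noteq> n"
    show "ball (fst (p m)) (snd (p m)) \<inter> ball (fst (p n)) (snd (p n)) = {}"
    proof (cases "m \<in> to_nat_on K ` K \<and> n \<in> to_nat_on K ` K")
      case True
      hence "p m \<noteq> p n" using \<open>m \<noteq> n\<close> C(1) by (auto simp: p_def)
      from pairwiseD[OF C(3) inK[OF conjunct1[OF True]] inK[OF conjunct2[OF True]] this]
      show ?thesis by (simp only: disjnt_def)
    next
      case False
      thus ?thesis using zero[of m] zero[of n] by auto
    qed
  qed
  from 1 2 3 4 show ?thesis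
    by (intro exI[of _ "\<lambda>n. fst (p n)"] exI[of _ "\<lambda>n. snd (p n)"]) simp
qed

text \<open>Disposes of the null set that a Vitali covering by disjoint balls misses. A covering by
  fivefold balls is enough here, since the factor 5^k is harmless against arbitrarily small
  volume.\<close>

lemma hausdorff_content_negligible:
  fixes E :: "'a::euclidean_space set"
  assumes E: "negligible E" and \<delta>: "0 < \<delta>"
  shows "hausdorff_content DIM('a) \<delta> E = 0"
proof -
  have "hausdorff_content DIM('a) \<delta> E \<le> 0 + ennreal e" if "0 < e" for e
  proof -
    let ?k = "DIM('a)"
    have "E \<in> sets lebesgue" using E negligible_imp_sets by blast
    moreover have "0 < e / 5 ^ ?k" using that by simp
    ultimately obtain U where U: "open U" "E \<subseteq> U" "emeasure lebesgue (U - E) < ennreal (e / 5 ^ ?k)"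
      using sets_lebesgue_outer_open by metis
    have "emeasure lebesgue U \<le> emeasure lebesgue (U - E) + emeasure lebesgue E"
      using U E by (intro order_trans[OF emeasure_mono emeasure_subadditive]) (auto simp: negligible_imp_sets)
    also have "emeasure lebesgue E = 0" using E by (simp add: negligible_iff_null_sets null_setsD1)
    finally have mU: "emeasure lborel U \<le> ennreal (e / 5 ^ ?k)" using U by simp
    \<comment> \<open>Radii of at most \<delta> / 10 keep the diameters of the fivefold balls at
      most \<delta>.\<close>
    define K where "K = {p. fst p \<in> E \<and> 0 < snd p \<and> snd p \<le> \<delta> / 10 \<and> ball (fst p) (snd p) \<subseteq> U}"
    have "E \<subseteq> (\<Union>p\<in>K. ball (fst p) (snd p))"
    proof
      fix x assume "x \<in> E"
      then obtain s where "0 < s" "ball x s \<subseteq> U" using U open_contains_ball by blast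
      hence "(x, min s (\<delta> / 10)) \<in> K" using \<delta> \<open>x \<in> E\<close> by (auto simp: K_def)
      moreover have "x \<in> ball x (min s (\<delta> / 10))" using \<open>0 < s\<close> \<delta> by simp
      ultimately show "x \<in> (\<Union>p\<in>K. ball (fst p) (snd p))" by force
    qed
    then obtain C where C: "countable C" "C \<subseteq> K"
      "pairwise (\<lambda>p q. disjnt (ball (fst p) (snd p)) (ball (fst q) (snd q))) C"
      "E \<subseteq> (\<Union>p\<in>C. ball (fst p) (5 * snd p))"
      by (rule Vitali_covering_lemma_balls[where S = E and K = K and a = fst and r = snd and B = "\<delta> / 10"])
        (auto simp: K_def)
    have posC: "0 < snd p" if "p \<in> C" for p using that C(2) by (auto simp: K_def)
    obtain a :: "nat \<Rightarrow> 'a" and r where "\<forall>n. r n = 0 \<or> (a n, r n) \<in> C" "\<forall>n. 0 \<le> r n"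
      "\<forall>p\<in>C. \<exists>n. p = (a n, r n)" "disjoint_family (\<lambda>n. ball (a n) (r n))"
      using countable_disjoint_balls_sequence[OF C(1) posC C(3)] by blast
    hence ar: "\<And>n. r n = 0 \<or> (a n, r n) \<in> C" "\<And>n. 0 \<le> r n"
      "\<And>p. p \<in> C \<Longrightarrow> \<exists>n. p = (a n, r n)" "disjoint_family (\<lambda>n. ball (a n) (r n))"
      by simp_all
    have "r n \<le> \<delta> / 10 \<and> ball (a n) (r n) \<subseteq> U" for n
    proof (cases "r n = 0")
      case False
      hence "(a n, r n) \<in> K" using ar(1) C(2) by blast
      thus ?thesis by (simp add: K_def)
    qed (use \<open>\<delta> > 0\<close> in simp)
    hence r: "r n \<le> \<delta> / 10" "ball (a n) (r n) \<subseteq> U" for n by blast+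
    have "hausdorff_content ?k \<delta> E \<le> (\<Sum>n. hausdorff_weight ?k (ball (a n) (5 * r n)))"
    proof (rule hausdorff_content_le)
      show "E \<subseteq> (\<Union>n. ball (a n) (5 * r n))"
      proof
        fix x assume "x \<in> E"
        then obtain p where p: "p \<in> C" "x \<in> ball (fst p) (5 * snd p)" using C(4) by blast
        then obtain n where "p = (a n, r n)" using ar(3) by blast
        thus "x \<in> (\<Union>n. ball (a n) (5 * r n))" using p(2) by auto
      qed
      show "diameter (ball (a n) (5 * r n)) \<le> \<delta>" for n using r[of n] \<delta> by simp
    qed simp
    also have "\<dots> = (\<Sum>n. ennreal (5 ^ ?k) * emeasure lborel (ball (a n) (r n)))"
      using ar(2) by (intro suminf_cong)
        (simp add: hausdorff_weight_ball emeasure_ball power_mult_distrib ennreal_mult'[symmetric] mult.left_commute)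
    also have "\<dots> = ennreal (5 ^ ?k) * emeasure lborel (\<Union>n. ball (a n) (r n))"
      using ar(4) by (subst ennreal_suminf_cmult, subst suminf_emeasure) auto
    also have "\<dots> \<le> ennreal (5 ^ ?k) * emeasure lborel U"
      using U r(2) by (intro mult_left_mono emeasure_mono UN_least) simp_all
    also have "\<dots> \<le> ennreal (5 ^ ?k) * ennreal (e / 5 ^ ?k)"
      using mU by (intro mult_left_mono) auto
    also have "\<dots> = ennreal e" using that by (subst ennreal_mult'[symmetric]) auto
    finally show ?thesis by simp
  qed
  hence "hausdorff_content DIM('a) \<delta> E \<le> 0" by (rule ennreal_le_epsilon)
  thus ?thesis by simp
qed

text \<open>From above, an open set slightly larger than \<open>B\<close> is filled up to a null set
  by small disjoint balls, and the weight of a ball is its volume. From below, the isodiametric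
  inequality bounds the volume of each covering set by its weight; this works at every scale, so
  scale 1 is enough.\<close>

theorem hausdorff_outer_eq_lborel:
  fixes B :: "'a::euclidean_space set"
  assumes B: "B \<in> sets borel"
  shows "hausdorff_outer DIM('a) B = emeasure lborel B"
proof (rule antisym)
  let ?k = "DIM('a)"
  show "hausdorff_outer ?k B \<le> emeasure lborel B"
  proof (rule hausdorff_outer_least, rule ennreal_le_epsilon)
    fix \<delta> e :: real assume "\<delta> > 0" "0 < e"
    have "B \<in> sets lebesgue" using B by simp
    then obtain U where U: "open U" "B \<subseteq> U" "emeasure lebesgue (U - B) < ennreal e"
      using \<open>0 < e\<close> sets_lebesgue_outer_open by metis
    define K where "K = {p. 0 < snd p \<and> snd p \<le> \<delta> / 2 \<and> ball (fst p) (snd p) \<subseteq> U}"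
    have cov: "\<exists>p. p \<in> K \<and> x \<in> ball (fst p) (snd p) \<and> snd p < d" if x: "x \<in> U" "0 < d" for x d
    proof -
      obtain s where s: "0 < s" "ball x s \<subseteq> U" using U x open_contains_ball by blast
      define t where "t = min s (min (\<delta> / 2) (d / 2))"
      have "0 < t" "t \<le> s" "t \<le> \<delta> / 2" "t < d" using s x \<open>\<delta> > 0\<close> by (auto simp: t_def)
      moreover have "ball x t \<subseteq> U" using s \<open>t \<le> s\<close> subset_ball by blast
      ultimately show ?thesis by (intro exI[of _ "(x, t)"]) (auto simp: K_def)
    qed
    obtain C where C: "countable C" "C \<subseteq> K"
      "pairwise (\<lambda>p q. disjnt (ball (fst p) (snd p)) (ball (fst q) (snd q))) C"
      "negligible (U - (\<Union>p\<in>C. ball (fst p) (snd p)))"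
      by (rule Vitali_covering_theorem_balls[where S = U and K = K and a = fst and r = snd]) (use cov in auto)
    have posC: "0 < snd p" if "p \<in> C" for p using that C(2) by (auto simp: K_def)
    obtain a :: "nat \<Rightarrow> 'a" and r where "\<forall>n. r n = 0 \<or> (a n, r n) \<in> C" "\<forall>n. 0 \<le> r n"
      "\<forall>p\<in>C. \<exists>n. p = (a n, r n)" "disjoint_family (\<lambda>n. ball (a n) (r n))"
      using countable_disjoint_balls_sequence[OF C(1) posC C(3)] by blast
    hence ar: "\<And>n. r n = 0 \<or> (a n, r n) \<in> C" "\<And>n. 0 \<le> r n"
      "\<And>p. p \<in> C \<Longrightarrow> \<exists>n. p = (a n, r n)" "disjoint_family (\<lambda>n. ball (a n) (r n))"
      by simp_all
    have "r n \<le> \<delta> / 2 \<and> ball (a n) (r n) \<subseteq> U" for n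
    proof (cases "r n = 0")
      case False
      hence "(a n, r n) \<in> K" using ar(1) C(2) by blast
      thus ?thesis by (simp add: K_def)
    qed (use \<open>\<delta> > 0\<close> in simp)
    hence r: "r n \<le> \<delta> / 2" "ball (a n) (r n) \<subseteq> U" for n by blast+
    let ?V = "\<Union>n. ball (a n) (r n)"
    have CV: "(\<Union>p\<in>C. ball (fst p) (snd p)) \<subseteq> ?V"
    proof
      fix x assume "x \<in> (\<Union>p\<in>C. ball (fst p) (snd p))"
      then obtain p where p: "p \<in> C" "x \<in> ball (fst p) (snd p)" by blast
      then obtain n where "p = (a n, r n)" using ar(3) by blast
      thus "x \<in> ?V" using p(2) by auto
    qed
    let ?E = "\<lambda>n::nat. if n = 0 then ?V else if n = 1 then U - ?V else {}"
    have "negligible (U - ?V)" by (rule negligible_subset[OF C(4)]) (use CV in blast)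
    hence neg: "hausdorff_content ?k \<delta> (U - ?V) = 0"
      using \<open>\<delta> > 0\<close> by (rule hausdorff_content_negligible)
    have "hausdorff_content ?k \<delta> B \<le> hausdorff_content ?k \<delta> (\<Union>n. ?E n)"
      using U by (intro hausdorff_content_mono) (auto split: if_splits)
    also have "\<dots> \<le> (\<Sum>n. hausdorff_content ?k \<delta> (?E n))"
      by (rule hausdorff_content_countable_subadditive)
    also have "\<dots> = (\<Sum>n\<in>{0,1}. hausdorff_content ?k \<delta> (?E n))"
      by (rule suminf_finite) (auto simp: hausdorff_content_empty \<open>\<delta> > 0\<close>)
    also have "\<dots> = hausdorff_content ?k \<delta> ?V" using neg by simp
    also have "\<dots> \<le> (\<Sum>n. hausdorff_weight ?k (ball (a n) (r n)))"
    proof (rule hausdorff_content_le)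
      show "diameter (ball (a n) (r n)) \<le> \<delta>" for n using r(1)[of n] \<open>\<delta> > 0\<close> by simp
    qed simp_all
    also have "\<dots> = (\<Sum>n. emeasure lborel (ball (a n) (r n)))"
      using ar(2) by (simp add: hausdorff_weight_ball)
    also have "\<dots> = emeasure lborel ?V"
      using ar(4) by (intro suminf_emeasure) auto
    also have "\<dots> \<le> emeasure lborel U" using U r(2) by (intro emeasure_mono UN_least) simp_all
    also have "\<dots> \<le> emeasure lborel B + emeasure lborel (U - B)"
      using U B by (intro order_trans[OF emeasure_mono emeasure_subadditive]) auto
    also have "\<dots> \<le> emeasure lborel B + ennreal e"
      using U B by (intro add_left_mono) (simp add: less_imp_le)
    finally show "hausdorff_content ?k \<delta> B \<le> emeasure lborel B + ennreal e" .
  qed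
next
  let ?k = "DIM('a)"
  have "emeasure lborel B \<le> hausdorff_content ?k 1 B"
  proof (rule hausdorff_content_greatest)
    fix C :: "nat \<Rightarrow> 'a set"
    assume C: "B \<subseteq> (\<Union>i. C i)" "\<And>i. bounded (C i)"
    \<comment> \<open>The covering sets need not be measurable; their closures are, and have the
      same diameter.\<close>
    have "emeasure lborel B \<le> emeasure lborel (\<Union>i. closure (C i))"
    proof (rule emeasure_mono)
      show "B \<subseteq> (\<Union>i. closure (C i))" using C(1) closure_subset by blast
    qed simp
    also have "\<dots> \<le> (\<Sum>i. emeasure lborel (closure (C i)))"
      by (rule emeasure_subadditive_countably) (auto simp: image_subset_iff)
    also have "\<dots> \<le> (\<Sum>i. hausdorff_weight ?k (C i))"
    proof (intro suminf_le allI)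
      fix i
      show "emeasure lborel (closure (C i)) \<le> hausdorff_weight ?k (C i)"
      proof (cases "C i = {}")
        case False
        have "emeasure lborel (closure (C i)) \<le> ennreal (unit_ball_vol (real ?k) * (diameter (C i) / 2) ^ ?k)"
        proof (rule isodiametric)
          fix x y assume "x \<in> closure (C i)" "y \<in> closure (C i)"
          hence "dist x y \<le> diameter (closure (C i))"
            by (rule diameter_bounded_bound[OF bounded_closure[OF C(2)]])
          thus "dist x y \<le> diameter (C i)" by (simp only: diameter_closure[OF C(2)])
        qed (simp_all add: diameter_ge_0[OF C(2)])
        thus ?thesis using False by (simp add: hausdorff_weight_def)
      qed simp
    qed auto
    finally show "emeasure lborel B \<le> (\<Sum>i. hausdorff_weight ?k (C i))" .
  qed
  also have "\<dots> \<le> hausdorff_outer ?k B" by (rule hausdorff_content_le_outer) simp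
  finally show "emeasure lborel B \<le> hausdorff_outer ?k B" .
qed

lemma hausdorff_outer_isometry_image:
  assumes "\<And>x y. dist (f x) (f y) = dist x y"
  shows "hausdorff_outer k (f ` D) = hausdorff_outer k D"
proof (rule antisym)
  show "hausdorff_outer k (f ` D) \<le> hausdorff_outer k D"
    using hausdorff_outer_lipschitz_image[of D f 1 k] assms by simp
  have "inj f" using assms by (metis dist_eq_0_iff injI)
  hence "inv f ` f ` D = D" by (simp add: image_comp)
  moreover have "hausdorff_outer k (inv f ` f ` D) \<le> hausdorff_outer k (f ` D)"
  proof -
    have "dist (inv f x) (inv f y) \<le> 1 * dist x y" if "x \<in> f ` D" "y \<in> f ` D" for x y
      using that assms \<open>inj f\<close> by auto
    from hausdorff_outer_lipschitz_image[of "f ` D" "inv f" 1 k, OF this] show ?thesis by simp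
  qed
  ultimately show "hausdorff_outer k D \<le> hausdorff_outer k (f ` D)" by simp
qed

text \<open>Lebesgue measure is Hausdorff measure of full dimension, which isometries preserve. The
  two spaces may be different types of equal dimension, as needed for coordinates in a product of a
  hyperplane and a line.\<close>

lemma distr_lborel_isometry:
  fixes f :: "'a::euclidean_space \<Rightarrow> 'b::euclidean_space"
  assumes dist: "\<And>x y. dist (f x) (f y) = dist x y" and "bij f" and dim: "DIM('a) = DIM('b)"
  shows "distr lborel borel f = lborel"
proof (rule measure_eqI)
  have cont: "continuous_on UNIV f"
    by (rule continuous_onI) (use dist in auto)
  have m[measurable]: "f \<in> borel_measurable borel" using cont by (rule borel_measurable_continuous_onI)
  fix B assume "B \<in> sets (distr lborel borel f)"
  hence B: "B \<in> sets borel" by simp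
  hence fB: "f -` B \<in> sets borel" using measurable_sets[OF m B] by simp
  have "emeasure (distr lborel borel f) B = emeasure lborel (f -` B)"
    using B by (simp add: emeasure_distr)
  also have "\<dots> = hausdorff_outer DIM('a) (f -` B)" using fB by (simp add: hausdorff_outer_eq_lborel)
  also have "\<dots> = hausdorff_outer DIM('a) (f ` (f -` B))" by (simp only: hausdorff_outer_isometry_image[OF dist])
  also have "f ` (f -` B) = B" using \<open>bij f\<close> by (simp add: bij_is_surj surj_image_vimage_eq)
  also have "hausdorff_outer DIM('a) B = emeasure lborel B" using B dim by (simp add: hausdorff_outer_eq_lborel)
  finally show "emeasure (distr lborel borel f) B = emeasure lborel B" .
qed simp

section \<open>Partial derivatives\<close>

text \<open>Existence and value in one relation, so that derivative rules chain without separate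
  existence proofs; \<open>deriv\<close> alone has an unspecified value where no derivative
  exists.\<close>

definition has_pd :: "'n \<Rightarrow> (real ^ 'n \<Rightarrow> real) \<Rightarrow> real ^ 'n \<Rightarrow> real \<Rightarrow> bool" where
  "has_pd i g x d \<longleftrightarrow> ((\<lambda>t. g (x + t *\<^sub>R axis i 1)) has_real_derivative d) (at 0)"

lemma has_pd_partial_deriv: "has_pd i g x d \<Longrightarrow> partial_deriv i g x = d"
  unfolding has_pd_def partial_deriv_def by (rule DERIV_imp_deriv)

lemma has_pd_has_partial: "has_pd i g x d \<Longrightarrow> has_partial i g x"
  unfolding has_pd_def has_partial_def field_differentiable_def by blast

lemma has_partial_has_pd: "has_partial i g x \<Longrightarrow> has_pd i g x (partial_deriv i g x)"
  unfolding has_pd_def partial_deriv_def has_partial_def by (simp add: DERIV_deriv_iff_field_differentiable)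

lemma has_pd_shift:
  "has_pd i g (x + s *\<^sub>R axis i 1) d \<longleftrightarrow> ((\<lambda>t. g (x + t *\<^sub>R axis i 1)) has_real_derivative d) (at s)"
  unfolding has_pd_def
  using DERIV_shift[of "\<lambda>t. g (x + t *\<^sub>R axis i 1)" d 0 s]
  by (simp add: scaleR_add_left add_ac)

lemma has_pd_const: "has_pd i (\<lambda>_. c) x 0"
  unfolding has_pd_def by simp

lemma has_pd_add: "has_pd i f x a \<Longrightarrow> has_pd i g x b \<Longrightarrow> has_pd i (\<lambda>y. f y + g y) x (a + b)"
  unfolding has_pd_def by (rule DERIV_add)

lemma has_pd_minus: "has_pd i f x a \<Longrightarrow> has_pd i (\<lambda>y. - f y) x (- a)"
  unfolding has_pd_def by (rule DERIV_minus)

lemma has_pd_diff: "has_pd i f x a \<Longrightarrow> has_pd i g x b \<Longrightarrow> has_pd i (\<lambda>y. f y - g y) x (a - b)"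
  unfolding has_pd_def by (rule DERIV_diff)

lemma has_pd_mult:
  "has_pd i f x a \<Longrightarrow> has_pd i g x b \<Longrightarrow> has_pd i (\<lambda>y. f y * g y) x (a * g x + f x * b)"
  unfolding has_pd_def using DERIV_mult[of "\<lambda>t. f (x + t *\<^sub>R axis i 1)" a 0 UNIV "\<lambda>t. g (x + t *\<^sub>R axis i 1)" b]
  by (simp add: mult.commute)

lemma has_pd_sum:
  "(\<And>j. j \<in> J \<Longrightarrow> has_pd i (f j) x (a j)) \<Longrightarrow> has_pd i (\<lambda>y. \<Sum>j\<in>J. f j y) x (\<Sum>j\<in>J. a j)"
  unfolding has_pd_def by (rule DERIV_sum)

lemma has_pd_chain:
  assumes "has_pd i g x a" "(h has_real_derivative b) (at (g x))"
  shows "has_pd i (\<lambda>y. h (g y)) x (b * a)"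
  unfolding has_pd_def
  using DERIV_chain2[of h b "\<lambda>t. g (x + t *\<^sub>R axis i 1)" 0 a UNIV] assms
  by (simp add: has_pd_def)

lemma has_pd_cong_open:
  assumes "open S" "x \<in> S" "\<And>y. y \<in> S \<Longrightarrow> g y = g' y"
  shows "has_pd i g x d \<longleftrightarrow> has_pd i g' x d"
  unfolding has_pd_def
proof (rule DERIV_cong_ev)
  have "((\<lambda>t. x + t *\<^sub>R axis i 1) \<longlongrightarrow> x + 0 *\<^sub>R axis i (1::real)) (nhds 0)"
    by (intro tendsto_intros filterlim_ident)
  hence "\<forall>\<^sub>F t in nhds 0. x + t *\<^sub>R axis i 1 \<in> S"
    using assms by (intro topological_tendstoD) auto
  thus "\<forall>\<^sub>F t in nhds 0. g (x + t *\<^sub>R axis i 1) = g' (x + t *\<^sub>R axis i 1)"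
    by eventually_elim (rule assms(3))
qed simp_all

lemma partial_deriv_cong_open:
  assumes "open S" "x \<in> S" "\<And>y. y \<in> S \<Longrightarrow> g y = g' y"
  shows "partial_deriv i g x = partial_deriv i g' x" "has_partial i g x \<longleftrightarrow> has_partial i g' x"
proof -
  have *: "((\<lambda>t. g (x + t *\<^sub>R axis i 1)) has_real_derivative d) (at 0) \<longleftrightarrow>
      ((\<lambda>t. g' (x + t *\<^sub>R axis i 1)) has_real_derivative d) (at 0)" for d
    using has_pd_cong_open[OF assms] by (simp add: has_pd_def)
  show "partial_deriv i g x = partial_deriv i g' x" unfolding partial_deriv_def deriv_def using * by simp
  show "has_partial i g x \<longleftrightarrow> has_partial i g' x"
    unfolding has_partial_def field_differentiable_def using * by simp
qed

lemma Ck_on_cong: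
  assumes "open S" "\<And>y. y \<in> S \<Longrightarrow> g y = g' y"
  shows "Ck_on k S g \<longleftrightarrow> Ck_on k S g'"
  using assms(2)
proof (induction k arbitrary: g g')
  case 0
  thus ?case using continuous_on_cong[of S S g g'] by simp
next
  case (Suc k)
  have "Ck_on k S (partial_deriv i g) \<longleftrightarrow> Ck_on k S (partial_deriv i g')" for i
    by (rule Suc.IH) (rule partial_deriv_cong_open[OF assms(1) _ Suc.prems])
  moreover have "continuous_on S g \<longleftrightarrow> continuous_on S g'"
    by (rule continuous_on_cong) (auto intro: Suc.prems)
  moreover have "has_partial i g x \<longleftrightarrow> has_partial i g' x" if "x \<in> S" for i x
    by (rule partial_deriv_cong_open[OF assms(1) that Suc.prems])
  ultimately show ?case by simp
qed

lemma Ck_on_subset: "Ck_on k S g \<Longrightarrow> T \<subseteq> S \<Longrightarrow> Ck_on k T g"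
proof (induction k arbitrary: g)
  case (Suc k)
  thus ?case using continuous_on_subset by (simp add: subset_iff) blast
qed (simp add: continuous_on_subset)

lemma Ck_on_Un: "open S \<Longrightarrow> open T \<Longrightarrow> Ck_on k S g \<Longrightarrow> Ck_on k T g \<Longrightarrow> Ck_on k (S \<union> T) g"
proof (induction k arbitrary: g)
  case (Suc k)
  have "continuous_on (S \<union> T) g" using Suc.prems by (intro continuous_on_open_Un) auto
  moreover have "Ck_on k (S \<union> T) (partial_deriv i g)" for i using Suc by simp
  ultimately show ?case using Suc.prems by auto
qed (simp add: continuous_on_open_Un)

lemma Ck_on_Suc_D: "Ck_on (Suc k) S g \<Longrightarrow> Ck_on k S g"
proof (induction k arbitrary: g)
  case (Suc k)
  have "Ck_on (Suc k) S (partial_deriv i g)" for i using Suc.prems by simp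
  hence "Ck_on k S (partial_deriv i g)" for i by (rule Suc.IH)
  thus ?case using Suc.prems by simp
qed simp

lemma Ck_on_continuous: "Ck_on k S g \<Longrightarrow> continuous_on S g"
  by (cases k) auto

lemma Ck_on_SucI:
  assumes S: "open S" and "continuous_on S g"
    and d: "\<And>i x. x \<in> S \<Longrightarrow> has_pd i g x (D i x)" and D: "\<And>i. Ck_on k S (D i)"
  shows "Ck_on (Suc k) S g"
proof -
  have "Ck_on k S (partial_deriv i g)" for i
    using Ck_on_cong[OF S, of "partial_deriv i g" "D i" k] D has_pd_partial_deriv[OF d] by blast
  thus ?thesis using assms has_pd_has_partial[OF d] by simp
qed

lemma Ck_on_has_pd: "Ck_on (Suc k) S g \<Longrightarrow> x \<in> S \<Longrightarrow> has_pd i g x (partial_deriv i g x)"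
  by (simp add: has_partial_has_pd)

lemma Ck_on_add:
  assumes S: "open S"
  shows "Ck_on k S f \<Longrightarrow> Ck_on k S g \<Longrightarrow> Ck_on k S (\<lambda>x. f x + g x)"
proof (induction k arbitrary: f g)
  case (Suc k)
  show ?case
  proof (rule Ck_on_SucI[OF S])
    show "continuous_on S (\<lambda>x. f x + g x)" using Suc.prems by (intro continuous_on_add) auto
    show "has_pd i (\<lambda>x. f x + g x) x (partial_deriv i f x + partial_deriv i g x)" if "x \<in> S" for i x
      using Suc.prems that by (intro has_pd_add Ck_on_has_pd)
    show "Ck_on k S (\<lambda>x. partial_deriv i f x + partial_deriv i g x)" for i
      using Suc.prems by (intro Suc.IH) auto
  qed
qed (simp add: continuous_on_add)

lemma Ck_on_mult:
  assumes S: "open S"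
  shows "Ck_on k S f \<Longrightarrow> Ck_on k S g \<Longrightarrow> Ck_on k S (\<lambda>x. f x * g x)"
proof (induction k arbitrary: f g)
  case (Suc k)
  show ?case
  proof (rule Ck_on_SucI[OF S])
    show "continuous_on S (\<lambda>x. f x * g x)" using Suc.prems by (intro continuous_on_mult) auto
    show "has_pd i (\<lambda>x. f x * g x) x (partial_deriv i f x * g x + f x * partial_deriv i g x)" if "x \<in> S" for i x
      using Suc.prems that by (intro has_pd_mult Ck_on_has_pd)
    have "Ck_on k S f" "Ck_on k S g" using Suc.prems by (blast intro: Ck_on_Suc_D)+
    thus "Ck_on k S (\<lambda>x. partial_deriv i f x * g x + f x * partial_deriv i g x)" for i
      using Suc.prems by (intro Ck_on_add[OF S] Suc.IH) auto
  qed
qed (simp add: continuous_on_mult)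

lemma Ck_on_compose1:
  assumes S: "open S" and g: "Ck_on 1 S g"
    and h: "\<And>t. (h has_real_derivative h' t) (at t)" and h': "continuous_on UNIV h'"
  shows "Ck_on 1 S (\<lambda>x. h (g x))"
proof -
  have g': "Ck_on (Suc 0) S g" using g by simp
  have cg: "continuous_on S g" using g' by simp
  have ch: "continuous_on UNIV h"
    by (intro continuous_at_imp_continuous_on ballI) (rule DERIV_isCont[OF h])
  have "Ck_on (Suc 0) S (\<lambda>x. h (g x))"
  proof (rule Ck_on_SucI[OF S])
    show "continuous_on S (\<lambda>x. h (g x))"
      by (rule continuous_on_compose2[OF ch cg]) simp
    show "has_pd i (\<lambda>x. h (g x)) x (h' (g x) * partial_deriv i g x)" if "x \<in> S" for i x
      by (rule has_pd_chain[OF Ck_on_has_pd[OF g' that] h])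
    have "continuous_on S (partial_deriv i g)" for i using g' by simp
    thus "Ck_on 0 S (\<lambda>x. h' (g x) * partial_deriv i g x)" for i
      by (auto intro!: continuous_on_mult continuous_on_compose2[OF h' cg])
  qed
  thus ?thesis by simp
qed

lemma Ck_on_compose2:
  assumes S: "open S" and g: "Ck_on 2 S g"
    and h: "\<And>t. (h has_real_derivative h' t) (at t)"
    and h': "\<And>t. (h' has_real_derivative h'' t) (at t)" and h'': "continuous_on UNIV h''"
  shows "Ck_on 2 S (\<lambda>x. h (g x))"
proof -
  have g2: "Ck_on (Suc 1) S g" using g by (simp add: numeral_2_eq_2)
  hence g1: "Ck_on 1 S g" by (rule Ck_on_Suc_D)
  have ch: "continuous_on UNIV h"
    by (intro continuous_at_imp_continuous_on ballI) (rule DERIV_isCont[OF h])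
  have "Ck_on (Suc 1) S (\<lambda>x. h (g x))"
  proof (rule Ck_on_SucI[OF S])
    show "continuous_on S (\<lambda>x. h (g x))"
      by (rule continuous_on_compose2[OF ch Ck_on_continuous[OF g1]]) simp
    show "has_pd i (\<lambda>x. h (g x)) x (h' (g x) * partial_deriv i g x)" if "x \<in> S" for i x
      by (rule has_pd_chain[OF Ck_on_has_pd[OF g2 that] h])
    have "Ck_on 1 S (partial_deriv i g)" for i using g2 by simp
    thus "Ck_on 1 S (\<lambda>x. h' (g x) * partial_deriv i g x)" for i
      by (intro Ck_on_mult[OF S] Ck_on_compose1[OF S g1 h' h''])
  qed
  thus ?thesis by (simp add: numeral_2_eq_2)
qed

text \<open>The mean value theorem on a coordinate segment. The segment is parametrised over {0..1},
  so \<open>t\<close> may be negative or zero.\<close>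

lemma has_pd_increment:
  assumes "\<And>s. s \<in> {0<..<1} \<Longrightarrow> has_pd i g (x + (s * t) *\<^sub>R axis i 1) (D (x + (s * t) *\<^sub>R axis i 1))"
    and "\<And>s. s \<in> {0..1} \<Longrightarrow> \<exists>d. has_pd i g (x + (s * t) *\<^sub>R axis i 1) d"
  shows "\<exists>s\<in>{0<..<1}. g (x + t *\<^sub>R axis i 1) - g x = t * D (x + (s * t) *\<^sub>R axis i 1)"
proof -
  let ?f = "\<lambda>s. g (x + (s * t) *\<^sub>R axis i 1)"
  have der: "(?f has_real_derivative d * t) (at s)" if "has_pd i g (x + (s * t) *\<^sub>R axis i 1) d" for s d
    using DERIV_chain2[of "\<lambda>t. g (x + t *\<^sub>R axis i 1)" d "\<lambda>s. s * t" s t UNIV] that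
    unfolding has_pd_shift using DERIV_cmult_right[OF DERIV_ident[of "at s"], of t] by simp
  have cont: "continuous_on {0..1} ?f"
  proof (intro continuous_at_imp_continuous_on ballI)
    fix s :: real assume "s \<in> {0..1}"
    then obtain d where "has_pd i g (x + (s * t) *\<^sub>R axis i 1) d" using assms(2) by blast
    thus "isCont ?f s" by (rule DERIV_isCont[OF der])
  qed
  have "\<exists>l z. 0 < z \<and> z < 1 \<and> (?f has_real_derivative l) (at z) \<and> ?f 1 - ?f 0 = (1 - 0) * l"
  proof (rule MVT[OF _ cont])
    fix s :: real assume "0 < s" "s < 1"
    hence "(?f has_real_derivative D (x + (s * t) *\<^sub>R axis i 1) * t) (at s)"
      by (intro der assms(1)) simp
    thus "?f differentiable at s" using real_differentiable_def by blast
  qed simp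
  then obtain l z where z: "0 < z" "z < 1" "(?f has_real_derivative l) (at z)" "?f 1 - ?f 0 = l" by auto
  have "l = D (x + (z * t) *\<^sub>R axis i 1) * t"
    using z der[OF assms(1), of z] DERIV_unique by auto
  thus ?thesis using z by (intro bexI[of _ z]) (auto simp: mult.commute)
qed

text \<open>The coordinates of the increment \<open>h\<close> are switched on one at a time:
  \<open>hF F\<close> keeps those in \<open>F\<close>, and adding an index is one application of the
  mean value theorem. Each intermediate point is no further from \<open>x\<close> than
  \<open>y\<close> is, so the partial derivatives there differ little from those at
  \<open>x\<close>.\<close>

lemma C1_has_derivative:
  fixes g :: "real ^ 'n \<Rightarrow> real"
  assumes S: "open S" and g: "Ck_on 1 S g" and x: "x \<in> S"
  shows "(g has_derivative (\<lambda>h. grad g x \<bullet> h)) (at x)"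
  unfolding has_derivative_at_alt
proof (intro conjI allI impI)
  have g': "Ck_on (Suc 0) S g" using g by simp
  show "bounded_linear (\<lambda>h. grad g x \<bullet> h)" by (rule bounded_linear_inner_right)
  fix e :: real assume "0 < e"
  define N where "N = real CARD('n)"
  have N: "0 < N" by (simp add: N_def)
  have "\<exists>d>0. \<forall>y. dist y x < d \<longrightarrow> y \<in> S \<and> dist (partial_deriv i g y) (partial_deriv i g x) < e / N" for i
  proof -
    have "isCont (partial_deriv i g) x"
      using g' S x by (auto simp: continuous_on_eq_continuous_at)
    hence "\<exists>d>0. \<forall>y. dist y x < d \<longrightarrow> dist (partial_deriv i g y) (partial_deriv i g x) < e / N"
      using \<open>0 < e\<close> N unfolding continuous_at_eps_delta by (metis divide_pos_pos dist_real_def dist_norm)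
    then obtain d where d: "d > 0" "\<And>y. dist y x < d \<Longrightarrow> dist (partial_deriv i g y) (partial_deriv i g x) < e / N"
      by blast
    obtain d' where "d' > 0" "ball x d' \<subseteq> S" using S x open_contains_ball by blast
    thus ?thesis using d by (intro exI[of _ "min d d'"]) (auto simp: dist_commute subset_iff)
  qed
  then obtain d where d: "\<And>i. 0 < d i"
    "\<And>i y. dist y x < d i \<Longrightarrow> y \<in> S \<and> dist (partial_deriv i g y) (partial_deriv i g x) < e / N" by metis
  define r where "r = Min (range d)"
  have r: "0 < r" "\<And>i. r \<le> d i" using d(1) by (auto simp: r_def)
  have near: "y \<in> S" "\<bar>partial_deriv i g y - partial_deriv i g x\<bar> \<le> e / N" if "norm (y - x) < r" for y i
    using d(2)[of y i] r(2)[of i] that by (auto simp: dist_norm)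
  show "\<exists>r>0. \<forall>y. norm (y - x) < r \<longrightarrow> norm (g y - g x - grad g x \<bullet> (y - x)) \<le> e * norm (y - x)"
  proof (intro exI[of _ r] conjI allI impI r(1))
    fix y assume y: "norm (y - x) < r"
    define h where "h = y - x"
    define hF where "hF F = (\<Sum>i\<in>F. (h $ i) *\<^sub>R axis i 1 :: real ^ 'n)" for F
    have comp: "hF F $ j = (if j \<in> F then h $ j else 0)" if "finite F" for F j
      unfolding hF_def using that by (simp add: axis_def if_distrib[of "\<lambda>x. _ * x"] cong: if_cong)
    have "\<bar>g (x + hF F) - g x - (\<Sum>i\<in>F. partial_deriv i g x * h $ i)\<bar> \<le> (\<Sum>i\<in>F. e / N * \<bar>h $ i\<bar>)" if "finite F" for F
      using that
    proof (induction F)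
      case (insert i F)
      have nrm: "norm (x + hF F + (s * h $ i) *\<^sub>R axis i 1 - x) < r" if "s \<in> {0..1}" for s
      proof -
        have "\<bar>(hF F + (s * h $ i) *\<^sub>R axis i 1) $ j\<bar> \<le> \<bar>h $ j\<bar>" for j
          using insert that by (auto simp: comp axis_def abs_mult mult_left_le_one_le)
        hence "norm (hF F + (s * h $ i) *\<^sub>R axis i 1) \<le> norm h" by (intro norm_le_componentwise_cart) simp
        thus ?thesis using y by (simp add: h_def)
      qed
      have pd: "has_pd i g (x + hF F + (s * h $ i) *\<^sub>R axis i 1)
          (partial_deriv i g (x + hF F + (s * h $ i) *\<^sub>R axis i 1))" if "s \<in> {0..1}" for s
        by (rule Ck_on_has_pd[OF g' near(1)[OF nrm[OF that]]])
      have "\<exists>s\<in>{0<..<1}. g (x + hF F + (h $ i) *\<^sub>R axis i 1) - g (x + hF F) =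
          h $ i * partial_deriv i g (x + hF F + (s * h $ i) *\<^sub>R axis i 1)"
      proof (rule has_pd_increment)
        fix s :: real assume "s \<in> {0<..<1}"
        thus "has_pd i g (x + hF F + (s * h $ i) *\<^sub>R axis i 1)
          (partial_deriv i g (x + hF F + (s * h $ i) *\<^sub>R axis i 1))" by (intro pd) auto
      next
        fix s :: real assume "s \<in> {0..1}"
        from pd[OF this] show "\<exists>d. has_pd i g (x + hF F + (s * h $ i) *\<^sub>R axis i 1) d" by blast
      qed
      then obtain s where s: "s \<in> {0<..<1}" "g (x + hF F + (h $ i) *\<^sub>R axis i 1) - g (x + hF F) =
          h $ i * partial_deriv i g (x + hF F + (s * h $ i) *\<^sub>R axis i 1)" by blast
      let ?p = "partial_deriv i g (x + hF F + (s * h $ i) *\<^sub>R axis i 1)"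
      have "\<bar>?p - partial_deriv i g x\<bar> \<le> e / N" using s(1) by (intro near(2) nrm) auto
      hence "\<bar>h $ i * (?p - partial_deriv i g x)\<bar> \<le> e / N * \<bar>h $ i\<bar>"
        unfolding abs_mult by (subst mult.commute) (rule mult_right_mono, auto)
      moreover have "g (x + hF (insert i F)) - g x - (\<Sum>i\<in>insert i F. partial_deriv i g x * h $ i) =
          (g (x + hF F) - g x - (\<Sum>i\<in>F. partial_deriv i g x * h $ i)) + h $ i * (?p - partial_deriv i g x)"
      proof -
        have "x + hF (insert i F) = x + hF F + (h $ i) *\<^sub>R axis i 1" using insert by (simp add: hF_def add_ac)
        thus ?thesis using s(2) insert by (simp add: algebra_simps)
      qed
      ultimately show ?case using insert by simp
    qed (simp add: hF_def)
    from this[of UNIV] have "\<bar>g (x + hF UNIV) - g x - (\<Sum>i\<in>UNIV. partial_deriv i g x * h $ i)\<bar> \<le> (\<Sum>i\<in>UNIV. e / N * \<bar>h $ i\<bar>)"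
      by simp
    moreover have "hF UNIV = h" by (simp add: vec_eq_iff comp)
    moreover have "(\<Sum>i\<in>UNIV. partial_deriv i g x * h $ i) = grad g x \<bullet> h"
      by (simp add: inner_vec_def grad_def)
    moreover have "(\<Sum>i\<in>(UNIV::'n set). e / N * \<bar>h $ i\<bar>) \<le> (\<Sum>i\<in>(UNIV::'n set). e / N * norm h)"
      using \<open>0 < e\<close> N by (intro sum_mono mult_left_mono component_le_norm_cart) auto
    moreover have "(\<Sum>i\<in>(UNIV::'n set). e / N * norm h) = e * norm h" using N by (simp add: N_def)
    ultimately show "norm (g y - g x - grad g x \<bullet> (y - x)) \<le> e * norm (y - x)" by (simp add: h_def)
  qed
qed

section \<open>Partial derivatives of compactly supported functions\<close>

lemma continuous_on_extend_zero:
  fixes V :: "'a::topological_space \<Rightarrow> real"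
  assumes W: "open W" and C: "closed C" "C \<subseteq> W" and V: "continuous_on W V" and z: "\<And>x. x \<in> W - C \<Longrightarrow> V x = 0"
  shows "continuous_on UNIV (\<lambda>x. if x \<in> C then V x else 0)"
proof -
  have "continuous_on (W \<union> - C) (\<lambda>x. if x \<in> C then V x else 0)"
  proof (rule continuous_on_open_Un)
    have "continuous_on W V \<longleftrightarrow> continuous_on W (\<lambda>x. if x \<in> C then V x else 0)"
      by (rule continuous_on_cong) (auto simp: z)
    thus "continuous_on W (\<lambda>x. if x \<in> C then V x else 0)" using V by simp
    have "continuous_on (- C) (\<lambda>x. 0::real) \<longleftrightarrow> continuous_on (- C) (\<lambda>x. if x \<in> C then V x else 0)"
      by (rule continuous_on_cong) auto
    thus "continuous_on (- C) (\<lambda>x. if x \<in> C then V x else 0)" by simp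
  qed (use W C in auto)
  moreover have "W \<union> - C = UNIV" using C by blast
  ultimately show ?thesis by simp
qed

lemma integral_lborel_translate:
  fixes f :: "'a::euclidean_space \<Rightarrow> real"
  assumes [measurable]: "f \<in> borel_measurable borel"
  shows "(LINT x|lborel. f (c + x)) = (LINT x|lborel. f x)"
proof -
  have "(LINT x|lborel. f x) = (LINT x|distr lborel borel ((+) c). f x)"
    by (simp add: lborel_distr_plus)
  also have "\<dots> = (LINT x|lborel. f (c + x))" by (rule integral_distr) auto
  finally show ?thesis ..
qed

lemma integrable_compact_support:
  fixes f :: "'a::euclidean_space \<Rightarrow> real"
  assumes f: "continuous_on UNIV f" and C: "compact C" and z: "\<And>x. x \<notin> C \<Longrightarrow> f x = 0"
  shows "integrable lborel f"
proof -
  have "integrable lborel (\<lambda>x. indicator C x *\<^sub>R f x)"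
    by (rule borel_integrable_compact[OF C continuous_on_subset[OF f]]) simp
  moreover have "(\<lambda>x. indicator C x *\<^sub>R f x) = f" using z by (auto simp: fun_eq_iff indicator_def)
  ultimately show ?thesis by simp
qed

text \<open>Difference quotients have integral zero by translation invariance, and they converge
  dominatedly to \<open>D\<close>. The argument touches the single direction \<open>i\<close>, which
  is all that the regularity of the coefficients permits.\<close>

lemma integral_partial_deriv_zero_global:
  fixes V :: "real ^ 'n \<Rightarrow> real"
  assumes V: "continuous_on UNIV V" and D: "continuous_on UNIV D" and pd: "\<And>x. has_pd i V x (D x)"
    and C: "compact C" and Vz: "\<And>x. x \<notin> C \<Longrightarrow> V x = 0" and Dz: "\<And>x. x \<notin> C \<Longrightarrow> D x = 0"
  shows "(LINT x|lborel. D x) = 0"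
proof -
  have mV[measurable]: "V \<in> borel_measurable borel" and mD[measurable]: "D \<in> borel_measurable borel"
    using V D by (auto intro: borel_measurable_continuous_onI)
  have iV: "integrable lborel V" by (rule integrable_compact_support[OF V C Vz])
  have "bounded (D ` C)"
    by (intro compact_imp_bounded compact_continuous_image continuous_on_subset[OF D] C) simp
  then obtain M where M: "\<And>x. x \<in> C \<Longrightarrow> \<bar>D x\<bar> \<le> M" unfolding bounded_iff by auto
  define B where "B = \<bar>M\<bar>"
  have B: "\<bar>D x\<bar> \<le> B" for x
    using M[of x] Dz[of x] by (cases "x \<in> C") (auto simp: B_def)
  \<comment> \<open>The steps \<open>e n\<close> are at most 1, so all shifted supports lie in the
    closed 1-neighbourhood of \<open>C\<close>, which carries the dominating function.\<close>
  define C' where "C' = {x + y | x y. x \<in> C \<and> y \<in> cball (0 :: real ^ 'n) 1}"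
  have C': "compact C'" unfolding C'_def by (intro compact_sums C compact_cball)
  define e where "e n = 1 / real (Suc n)" for n
  have e: "0 < e n" "e n \<le> 1" for n by (auto simp: e_def)
  define q where "q n x = (V (e n *\<^sub>R axis i 1 + x) - V x) / e n" for n x
  have mq[measurable]: "q n \<in> borel_measurable borel" for n
  proof -
    have "continuous_on UNIV (\<lambda>x. V (e n *\<^sub>R axis i 1 + x))"
      by (intro continuous_on_compose2[OF V] continuous_intros) auto
    hence "continuous_on UNIV (q n)" unfolding q_def using V e[of n] by (intro continuous_intros) auto
    thus ?thesis by (rule borel_measurable_continuous_onI)
  qed
  have q0: "(LINT x|lborel. q n x) = 0" for n
  proof -
    have "integrable lborel (\<lambda>x. V (e n *\<^sub>R axis i 1 + x))"
    proof -
      have "integrable (distr lborel borel ((+) (e n *\<^sub>R axis i 1))) V" using iV by (simp add: lborel_distr_plus)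
      thus ?thesis by (subst (asm) integrable_distr_eq) auto
    qed
    hence "(LINT x|lborel. V (e n *\<^sub>R axis i 1 + x) - V x) = 0"
      using iV by (simp add: integral_lborel_translate)
    thus ?thesis by (simp add: q_def)
  qed
  have lim: "(\<lambda>n. q n x) \<longlonglongrightarrow> D x" for x
  proof -
    have "((\<lambda>h. (V (x + (0 + h) *\<^sub>R axis i 1) - V (x + 0 *\<^sub>R axis i 1)) / h) \<longlongrightarrow> D x) (at 0)"
      using pd[of x] unfolding has_pd_def DERIV_def .
    moreover have "e \<longlonglongrightarrow> 0" unfolding e_def using LIMSEQ_inverse_real_of_nat by (simp add: inverse_eq_divide)
    hence "filterlim e (at 0) sequentially"
      unfolding filterlim_at using e(1) by (simp add: less_imp_neq[symmetric])
    ultimately have "(\<lambda>n. (V (x + (0 + e n) *\<^sub>R axis i 1) - V (x + 0 *\<^sub>R axis i 1)) / e n) \<longlonglongrightarrow> D x"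
      by (rule filterlim_compose)
    thus ?thesis by (simp add: q_def add.commute)
  qed
  have bound: "norm (q n x) \<le> B * indicator C' x" for n x
  proof -
    have "\<exists>s\<in>{0<..<1}. V (x + e n *\<^sub>R axis i 1) - V x = e n * D (x + (s * e n) *\<^sub>R axis i 1)"
      using pd by (intro has_pd_increment) auto
    then obtain s where "V (x + e n *\<^sub>R axis i 1) - V x = e n * D (x + (s * e n) *\<^sub>R axis i 1)" by blast
    hence "q n x = D (x + (s * e n) *\<^sub>R axis i 1)" using e[of n] by (simp add: q_def add.commute)
    hence 1: "\<bar>q n x\<bar> \<le> B" using B by simp
    show ?thesis
    proof (cases "x \<in> C'")
      case False
      have "x \<notin> C"
      proof
        assume "x \<in> C"
        hence "x + 0 \<in> C'" unfolding C'_def by (intro CollectI exI conjI) auto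
        thus False using False by simp
      qed
      moreover have "e n *\<^sub>R axis i 1 + x \<notin> C"
      proof
        assume "e n *\<^sub>R axis i 1 + x \<in> C"
        hence "(e n *\<^sub>R axis i 1 + x) + (- (e n *\<^sub>R axis i 1)) \<in> C'"
          unfolding C'_def using e[of n]
          by (intro CollectI exI[of _ "e n *\<^sub>R axis i 1 + x"] exI[of _ "- (e n *\<^sub>R axis i 1)"] conjI) auto
        thus False using False by simp
      qed
      ultimately show ?thesis using Vz False by (simp add: q_def)
    qed (use 1 in simp)
  qed
  have "(\<lambda>n. LINT x|lborel. q n x) \<longlonglongrightarrow> (LINT x|lborel. D x)"
  proof (rule integral_dominated_convergence)
    have "emeasure lborel C' < \<infinity>" using C' by (intro emeasure_bounded_finite compact_imp_bounded)
    thus "integrable lborel (\<lambda>x. B * indicator C' x)"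
      using C' by (intro integrable_mult_right integrable_real_indicator) (auto simp: borel_compact)
  qed (use lim bound in auto)
  thus ?thesis by (simp add: q0 LIMSEQ_const_iff)
qed

text \<open>Both functions are extended by zero. Off \<open>C\<close> the derivative vanishes as
  well, because \<open>V\<close> is zero on the open set \<open>W - C\<close>.\<close>

lemma integral_partial_deriv_zero:
  fixes V :: "real ^ 'n \<Rightarrow> real"
  assumes W: "open W" and C: "compact C" "C \<subseteq> W" and V: "continuous_on W V" and D: "continuous_on W D"
    and pd: "\<And>x. x \<in> W \<Longrightarrow> has_pd i V x (D x)" and z: "\<And>x. x \<in> W - C \<Longrightarrow> V x = 0"
  shows "set_integrable lborel W D" "(LINT x:W|lborel. D x) = 0"
proof -
  have cC: "closed C" using C compact_imp_closed by blast
  have oWC: "open (W - C)" using W cC by blast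
  have Dz: "D x = 0" if "x \<in> W - C" for x
  proof -
    have "has_pd i V x 0 \<longleftrightarrow> has_pd i (\<lambda>_. 0) x 0" by (rule has_pd_cong_open[OF oWC that z])
    hence "has_pd i V x 0" using has_pd_const by blast
    moreover have "has_pd i V x (D x)" using that by (intro pd) simp
    ultimately show ?thesis using has_pd_partial_deriv by metis
  qed
  let ?V = "\<lambda>x. if x \<in> C then V x else 0" and ?D = "\<lambda>x. if x \<in> C then D x else 0"
  have cV: "continuous_on UNIV ?V" by (rule continuous_on_extend_zero[OF W cC C(2) V z])
  have cD: "continuous_on UNIV ?D" by (rule continuous_on_extend_zero[OF W cC C(2) D Dz])
  have "has_pd i ?V x (?D x)" for x
  proof (cases "x \<in> W")
    case True
    have "has_pd i ?V x (D x)" using has_pd_cong_open[OF W True, of ?V V] z pd[OF True] by auto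
    thus ?thesis using Dz[of x] True by (cases "x \<in> C") auto
  next
    case False
    hence "x \<in> - C" using C by auto
    have "has_pd i ?V x 0 \<longleftrightarrow> has_pd i (\<lambda>_. 0) x 0"
      by (rule has_pd_cong_open[of "- C"]) (use \<open>x \<in> - C\<close> cC in auto)
    hence "has_pd i ?V x 0" by (simp add: has_pd_const)
    thus ?thesis using \<open>x \<in> - C\<close> by simp
  qed
  hence "(LINT x|lborel. ?D x) = 0"
    by (rule integral_partial_deriv_zero_global[OF cV cD _ C(1)]) simp_all
  moreover have eq: "(\<lambda>x. indicator W x *\<^sub>R D x) = ?D" using Dz C by (auto simp: fun_eq_iff indicator_def)
  ultimately show "(LINT x:W|lborel. D x) = 0" by (simp add: set_lebesgue_integral_def)
  show "set_integrable lborel W D" unfolding set_integrable_def eq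
    by (rule integrable_compact_support[OF cD C(1)]) simp
qed

section \<open>Concentration on level sets\<close>

text \<open>An index type with one element less than \<open>'n\<close>, for coordinates in a hyperplane; the first
  disjunct only keeps it nonempty.\<close>

typedef (overloaded) ('n::finite) minus_one = "{i::'n. CARD('n) = 1 \<or> i \<noteq> undefined}"
proof (cases "CARD('n) = 1")
  case False
  hence "(UNIV :: 'n set) \<noteq> {undefined}" by (metis card.empty card.insert empty_iff finite.emptyI One_nat_def)
  thus ?thesis by auto
qed simp

instance minus_one :: (finite) finite
proof
  have "finite (Rep_minus_one ` (UNIV :: 'a minus_one set))" by simp
  thus "finite (UNIV :: 'a minus_one set)"
    by (rule finite_imageD) (simp add: inj_on_def Rep_minus_one_inject)
qed

lemma card_minus_one:
  assumes "1 < CARD('n::finite)"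
  shows "CARD('n minus_one) = CARD('n) - 1"
proof -
  have "CARD('n minus_one) = card {i::'n. CARD('n) = 1 \<or> i \<noteq> undefined}"
    by (rule type_definition.card[OF type_definition_minus_one])
  also have "{i::'n. CARD('n) = 1 \<or> i \<noteq> undefined} = UNIV - {undefined}" using assms by auto
  finally show ?thesis by simp
qed

text \<open>Turns a comparison of Hausdorff and Lebesgue measure on single sets into a comparison of
  integrals.\<close>

lemma nn_integral_mono_measure:
  assumes s: "sets M = sets N" and le: "\<And>B. B \<in> sets M \<Longrightarrow> emeasure M B \<le> emeasure N B"
    and f: "f \<in> borel_measurable M"
  shows "(\<integral>\<^sup>+x. f x \<partial>M) \<le> (\<integral>\<^sup>+x. f x \<partial>N)"
  using f
proof (induction rule: borel_measurable_induct)
  case (cong f g)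
  moreover have "space M = space N" using s by (rule sets_eq_imp_space_eq)
  ultimately show ?case using nn_integral_cong[of M f g] nn_integral_cong[of N f g] by simp
next
  case (set B)
  thus ?case using le s by simp
next
  case (mult g c)
  have [measurable]: "g \<in> borel_measurable N" using mult s measurable_cong_sets by blast
  show ?case using mult by (simp add: nn_integral_cmult mult_left_mono)
next
  case (add g h)
  have [measurable]: "g \<in> borel_measurable N" "h \<in> borel_measurable N" using add s measurable_cong_sets by blast+
  show ?case using add by (simp add: nn_integral_add add_mono)
next
  case (seq U)
  have [measurable]: "U i \<in> borel_measurable N" for i using seq s measurable_cong_sets by blast
  have eq: "Sup (range U) = (\<lambda>x. SUP i. U i x)" by (simp add: fun_eq_iff image_comp)
  have 1: "(\<integral>\<^sup>+x. (SUP i. U i x) \<partial>M) = (SUP i. \<integral>\<^sup>+x. U i x \<partial>M)"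
    by (rule nn_integral_monotone_convergence_SUP) (use seq in auto)
  have 2: "(\<integral>\<^sup>+x. (SUP i. U i x) \<partial>N) = (SUP i. \<integral>\<^sup>+x. U i x \<partial>N)"
    by (rule nn_integral_monotone_convergence_SUP) (use seq in auto)
  show ?case unfolding eq 1 2 using seq by (intro SUP_mono') auto
qed

text \<open>Equality of dimensions gives an isometry of the smaller coordinate space onto the
  hyperplane orthogonal to \<open>\<nu>\<close>; \<open>\<pi>\<close> is the orthogonal projection
  followed by its inverse. The identity for \<open>norm (y, t)\<close> says that (y, t) are
  isometric coordinates of the whole space.\<close>

lemma orthogonal_splitting:
  fixes \<nu> :: "real ^ 'n"
  assumes \<nu>: "norm \<nu> = 1" and N: "1 < CARD('n)"
  obtains \<iota> :: "real ^ ('n minus_one) \<Rightarrow> real ^ 'n" and \<pi> where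
    "linear \<iota>" "linear \<pi>" "\<And>y t. \<pi> (\<iota> y + t *\<^sub>R \<nu>) = y" "\<And>y t. (\<iota> y + t *\<^sub>R \<nu>) \<bullet> \<nu> = t"
    "\<And>x. \<iota> (\<pi> x) + (x \<bullet> \<nu>) *\<^sub>R \<nu> = x"
    "\<And>y t. norm (\<iota> y + t *\<^sub>R \<nu>) = norm (y, t)" "\<And>y. norm (\<iota> y) = norm y" "\<And>x. norm (\<pi> x) \<le> norm x"
proof -
  define T where "T = {x. \<nu> \<bullet> x = 0}"
  have "\<nu> \<noteq> 0" using \<nu> by auto
  have \<nu>\<nu>: "\<nu> \<bullet> \<nu> = 1" using \<nu> by (simp add: dot_square_norm)
  have "subspace T" unfolding T_def by (rule subspace_hyperplane)
  moreover have "dim (UNIV :: (real ^ ('n minus_one)) set) = dim T"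
    using card_minus_one[OF N] by (simp add: T_def dim_hyperplane[OF \<open>\<nu> \<noteq> 0\<close>])
  ultimately obtain \<iota> g where f: "linear \<iota>" "linear g" "\<iota> ` (UNIV :: (real ^ ('n minus_one)) set) = T"
    "\<And>x. x \<in> UNIV \<Longrightarrow> norm (\<iota> x) = norm x" "\<And>x. x \<in> T \<Longrightarrow> norm (g x) = norm x"
    "\<And>x. x \<in> UNIV \<Longrightarrow> g (\<iota> x) = x" "\<And>x. x \<in> T \<Longrightarrow> \<iota> (g x) = x"
    by (rule isometries_subspaces[OF subspace_UNIV]) blast
  have orth: "\<iota> y \<bullet> \<nu> = 0" for y using f(3) by (auto simp: T_def inner_commute)
  define \<pi> where "\<pi> x = g (x - (x \<bullet> \<nu>) *\<^sub>R \<nu>)" for x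
  have inT: "x - (x \<bullet> \<nu>) *\<^sub>R \<nu> \<in> T" for x
    using \<nu>\<nu> by (simp add: T_def inner_diff_right inner_commute)
  have pyth: "(norm (\<iota> y + t *\<^sub>R \<nu>))\<^sup>2 = (norm y)\<^sup>2 + t\<^sup>2" for y t
  proof -
    have "(norm (\<iota> y + t *\<^sub>R \<nu>))\<^sup>2 = (norm (\<iota> y))\<^sup>2 + (norm (t *\<^sub>R \<nu>))\<^sup>2"
      by (rule norm_add_Pythagorean) (simp add: orthogonal_def orth)
    thus ?thesis using f(4) \<nu> by simp
  qed
  show thesis
  proof (rule that[of \<iota> \<pi>])
    show "linear \<iota>" by fact
    show "linear \<pi>"
      using f(2) unfolding \<pi>_def
      by (intro linearI) (auto simp: linear_add linear_diff linear_scale inner_add_left algebra_simps)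
    show "(\<iota> y + t *\<^sub>R \<nu>) \<bullet> \<nu> = t" for y t by (simp add: inner_add_left orth \<nu>\<nu>)
    thus "\<pi> (\<iota> y + t *\<^sub>R \<nu>) = y" for y t using f(6) by (simp add: \<pi>_def)
    show inv: "\<iota> (\<pi> x) + (x \<bullet> \<nu>) *\<^sub>R \<nu> = x" for x using f(7)[OF inT] by (simp add: \<pi>_def)
    show "norm (\<iota> y) = norm y" for y using f(4) by simp
    show n: "norm (\<iota> y + t *\<^sub>R \<nu>) = norm (y, t)" for y t
      unfolding norm_Pair using pyth[of y t] by (simp add: real_sqrt_unique)
    have "norm (\<pi> x) \<le> norm (\<pi> x, x \<bullet> \<nu>)" for x by (simp add: norm_Pair)
    thus "norm (\<pi> x) \<le> norm x" for x using n[of "\<pi> x" "x \<bullet> \<nu>"] inv[of x] by simp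
  qed
qed

text \<open>Kernels concentrating at \<open>R\<close>, with distribution functions
  \<open>P n\<close>. Their support lies strictly to the right of \<open>R\<close>, the side from
  which the terms over superlevel sets are continuous.\<close>

locale level_kernel =
  fixes \<kappa> P :: "nat \<Rightarrow> real \<Rightarrow> real" and R :: real
  assumes kernel_continuous: "\<And>n. continuous_on UNIV (\<kappa> n)"
    and kernel_nonneg: "\<And>n t. 0 \<le> \<kappa> n t"
    and kernel_support: "\<And>n t. \<kappa> n t \<noteq> 0 \<Longrightarrow> R < t \<and> t < R + 1 / real (Suc n)"
    and primitive: "\<And>n t. (P n has_real_derivative \<kappa> n t) (at t)"
    and primitive_left: "\<And>n t. t \<le> R \<Longrightarrow> P n t = 0"
    and primitive_right: "\<And>n t. R + 1 / real (Suc n) \<le> t \<Longrightarrow> P n t = 1"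
begin

lemma primitive_mono: "s \<le> t \<Longrightarrow> P n s \<le> P n t"
  by (rule DERIV_nonneg_imp_nondecreasing, assumption, intro exI conjI, rule primitive, rule kernel_nonneg)

lemma primitive_bounds: "0 \<le> P n t" "P n t \<le> 1"
proof -
  have "P n (min t R) \<le> P n t" by (rule primitive_mono) simp
  thus "0 \<le> P n t" by (simp add: primitive_left)
  have "P n t \<le> P n (max t (R + 1 / real (Suc n)))" by (rule primitive_mono) simp
  also have "\<dots> = 1" by (rule primitive_right) simp
  finally show "P n t \<le> 1" .
qed

lemma line_integral:
  assumes "a \<le> b" and der: "\<And>t. t \<in> {a..b} \<Longrightarrow> (\<zeta> has_real_derivative \<zeta>' t) (at t)"
  shows "((\<lambda>t. \<kappa> n (\<zeta> t) * \<zeta>' t) has_integral (P n (\<zeta> b) - P n (\<zeta> a))) {a..b}"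
proof (rule fundamental_theorem_of_calculus[OF \<open>a \<le> b\<close>])
  fix t assume "t \<in> {a..b}"
  hence "((\<lambda>t. P n (\<zeta> t)) has_real_derivative \<kappa> n (\<zeta> t) * \<zeta>' t) (at t)"
    by (intro DERIV_chain2[OF primitive der])
  thus "((\<lambda>t. P n (\<zeta> t)) has_vector_derivative \<kappa> n (\<zeta> t) * \<zeta>' t) (at t within {a..b})"
    by (simp only: has_real_derivative_iff_has_vector_derivative has_vector_derivative_at_within)
qed

lemma line_integrable:
  assumes der: "\<And>t. t \<in> {a..b} \<Longrightarrow> (\<zeta> has_real_derivative \<zeta>' t) (at t)"
    and \<zeta>': "continuous_on {a..b} \<zeta>'" and \<omega>: "continuous_on {a..b} \<omega>"
  shows "continuous_on {a..b} (\<lambda>t. \<kappa> n (\<zeta> t) * \<omega> t * \<zeta>' t)"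
proof -
  have "continuous_on {a..b} \<zeta>"
    by (intro continuous_at_imp_continuous_on ballI) (rule DERIV_isCont[OF der])
  thus ?thesis using \<zeta>' \<omega> by (intro continuous_on_mult continuous_on_compose2[OF kernel_continuous]) auto
qed

text \<open>Uniform in \<open>n\<close>, since the mass of
  \<open>\<kappa> n (\<zeta> t) * \<zeta>' t\<close> is an increment of \<open>P n\<close> and hence
  at most 1. The weight is bounded only where the kernel is active, so the same lemma gives a
  dominating constant and, applied to \<open>\<omega> t - \<omega> t0\<close>, the error in the
  limit.\<close>

lemma line_bound:
  assumes ab: "a \<le> b" and der: "\<And>t. t \<in> {a..b} \<Longrightarrow> (\<zeta> has_real_derivative \<zeta>' t) (at t)"
    and \<zeta>': "continuous_on {a..b} \<zeta>'" "\<And>t. t \<in> {a..b} \<Longrightarrow> 0 < \<zeta>' t" and \<omega>: "continuous_on {a..b} \<omega>"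
    and M: "\<And>t. t \<in> {a..b} \<Longrightarrow> \<kappa> n (\<zeta> t) \<noteq> 0 \<Longrightarrow> \<bar>\<omega> t\<bar> \<le> M" "0 \<le> M"
  shows "\<bar>integral {a..b} (\<lambda>t. \<kappa> n (\<zeta> t) * \<omega> t * \<zeta>' t)\<bar> \<le> M"
proof -
  have "norm (integral {a..b} (\<lambda>t. \<kappa> n (\<zeta> t) * \<omega> t * \<zeta>' t)) \<le> integral {a..b} (\<lambda>t. M * (\<kappa> n (\<zeta> t) * \<zeta>' t))"
  proof (rule integral_norm_bound_integral)
    show "(\<lambda>t. \<kappa> n (\<zeta> t) * \<omega> t * \<zeta>' t) integrable_on {a..b}"
      by (intro integrable_continuous_interval line_integrable der \<zeta>' \<omega>)
    show "(\<lambda>t. M * (\<kappa> n (\<zeta> t) * \<zeta>' t)) integrable_on {a..b}"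
      using line_integral[OF ab der] by (intro integrable_on_mult_right) (auto simp: integrable_on_def)
    fix t assume t: "t \<in> {a..b}"
    have "\<kappa> n (\<zeta> t) * \<bar>\<omega> t\<bar> \<le> \<kappa> n (\<zeta> t) * M"
      using M(1)[OF t] kernel_nonneg[of n "\<zeta> t"] by (cases "\<kappa> n (\<zeta> t) = 0") (auto intro: mult_left_mono)
    hence "\<kappa> n (\<zeta> t) * \<bar>\<omega> t\<bar> * \<zeta>' t \<le> \<kappa> n (\<zeta> t) * M * \<zeta>' t"
      using \<zeta>'(2)[OF t] by (intro mult_right_mono) auto
    thus "norm (\<kappa> n (\<zeta> t) * \<omega> t * \<zeta>' t) \<le> M * (\<kappa> n (\<zeta> t) * \<zeta>' t)"
      using \<zeta>'(2)[OF t] kernel_nonneg[of n "\<zeta> t"] by (simp add: abs_mult mult_ac)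
  qed
  also have "\<dots> = M * (P n (\<zeta> b) - P n (\<zeta> a))"
    using line_integral[OF ab der] by (intro integral_unique has_integral_mult_right)
  also have "\<dots> \<le> M * 1"
    using primitive_bounds[of n] M(2) by (intro mult_left_mono) (auto simp: algebra_simps intro: add_increasing2)
  finally show ?thesis by simp
qed

text \<open>As \<open>\<zeta>\<close> is strictly increasing, it takes the value \<open>R\<close> at
  most once, and the mass of the kernel collects just to the right of that point. The ends are
  therefore not symmetric: a crossing at \<open>a\<close> is seen in full, one at \<open>b\<close>
  not at all, and \<open>\<omega> b = 0\<close> reconciles the latter with the claim.\<close>

lemma line_limit:
  assumes ab: "a \<le> b" and der: "\<And>t. t \<in> {a..b} \<Longrightarrow> (\<zeta> has_real_derivative \<zeta>' t) (at t)"
    and \<zeta>': "continuous_on {a..b} \<zeta>'" "\<And>t. t \<in> {a..b} \<Longrightarrow> 0 < \<zeta>' t"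
    and \<omega>: "continuous_on {a..b} \<omega>" "\<omega> b = 0"
    and L: "\<And>t. t \<in> {a..b} \<Longrightarrow> \<zeta> t = R \<Longrightarrow> L = \<omega> t" "(\<And>t. t \<in> {a..b} \<Longrightarrow> \<zeta> t \<noteq> R) \<Longrightarrow> L = 0"
  shows "(\<lambda>n. integral {a..b} (\<lambda>t. \<kappa> n (\<zeta> t) * \<omega> t * \<zeta>' t)) \<longlonglongrightarrow> L"
proof -
  have mono: "\<zeta> s < \<zeta> t" if "a \<le> s" "s < t" "t \<le> b" for s t
    using that der \<zeta>'(2) by (intro DERIV_pos_imp_increasing[OF that(2)]) (metis atLeastAtMost_iff order_trans)
  have cont: "continuous_on {a..b} \<zeta>"
    by (intro continuous_at_imp_continuous_on ballI) (rule DERIV_isCont[OF der])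
  have zero: "integral {a..b} (\<lambda>t. \<kappa> n (\<zeta> t) * \<omega> t * \<zeta>' t) = 0"
    if "\<And>t. t \<in> {a..b} \<Longrightarrow> \<kappa> n (\<zeta> t) = 0" for n
  proof -
    have "integral {a..b} (\<lambda>t. \<kappa> n (\<zeta> t) * \<omega> t * \<zeta>' t) = integral {a..b} (\<lambda>t. 0)"
      by (rule integral_cong) (simp add: that)
    thus ?thesis by simp
  qed
  have small: "\<forall>\<^sub>F n in sequentially. R + 1 / real (Suc n) \<le> c" if "R < c" for c
  proof -
    have "(\<lambda>n. R + 1 / real (Suc n)) \<longlonglongrightarrow> R + 0"
      using LIMSEQ_inverse_real_of_nat by (intro tendsto_add tendsto_const) (simp add: inverse_eq_divide)
    hence "\<forall>\<^sub>F n in sequentially. R + 1 / real (Suc n) < c" by (rule order_tendstoD) (use that in simp)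
    thus ?thesis by eventually_elim simp
  qed
  consider (below) "\<zeta> b \<le> R" | (above) "R < \<zeta> a" | (cross) "\<zeta> a \<le> R" "R < \<zeta> b" by linarith
  thus ?thesis
  proof cases
    case below
    have le: "\<zeta> t \<le> R" if "t \<in> {a..b}" for t using mono[of t b] that below by (cases "t = b") auto
    hence "\<kappa> n (\<zeta> t) = 0" if "t \<in> {a..b}" for n t using kernel_support[of n "\<zeta> t"] that by fastforce
    hence "integral {a..b} (\<lambda>t. \<kappa> n (\<zeta> t) * \<omega> t * \<zeta>' t) = 0" for n by (rule zero)
    moreover have "L = 0"
    proof (cases "\<exists>t\<in>{a..b}. \<zeta> t = R")
      case True
      then obtain t where t: "t \<in> {a..b}" "\<zeta> t = R" by blast
      have "t = b" using mono[of t b] t below by fastforce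
      thus ?thesis using L(1)[OF t] \<omega> by simp
    qed (use L(2) in blast)
    ultimately show ?thesis by simp
  next
    case above
    have ge: "\<zeta> a \<le> \<zeta> t" if "t \<in> {a..b}" for t using mono[of a t] that by (cases "t = a") auto
    have "L = 0" using ge above by (intro L(2)) fastforce
    moreover have "\<forall>\<^sub>F n in sequentially. integral {a..b} (\<lambda>t. \<kappa> n (\<zeta> t) * \<omega> t * \<zeta>' t) = 0"
      using small[OF above]
    proof eventually_elim
      case (elim n)
      show ?case by (rule zero) (use kernel_support[of n] ge elim in fastforce)
    qed
    ultimately show ?thesis by (simp add: tendsto_eventually)
  next
    case cross
    obtain t0 where t0: "a \<le> t0" "t0 \<le> b" "\<zeta> t0 = R"
      using IVT'[of \<zeta> a R b] cross ab cont by auto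
    have "t0 < b" using t0 cross by (cases "t0 = b") auto
    have L: "L = \<omega> t0" using L(1) t0 by simp
    show ?thesis unfolding L
    proof (rule LIMSEQ_I)
      fix e :: real assume "0 < e"
      have "\<exists>d>0. \<forall>t\<in>{a..b}. dist t t0 < d \<longrightarrow> dist (\<omega> t) (\<omega> t0) < e / 2"
        using \<omega>(1) t0 \<open>0 < e\<close> unfolding continuous_on_iff by (meson atLeastAtMost_iff half_gt_zero)
      then obtain d where d: "0 < d" "\<And>t. t \<in> {a..b} \<Longrightarrow> dist t t0 < d \<Longrightarrow> dist (\<omega> t) (\<omega> t0) < e / 2" by blast
      \<comment> \<open>A point within \<open>d\<close> to the right of the crossing; once the
        support of the kernel ends below \<open>\<zeta> t1\<close>, only parameters between
        \<open>t0\<close> and \<open>t1\<close> contribute.\<close>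
      define t1 where "t1 = min b (t0 + d / 2)"
      have t1: "t0 < t1" "t1 \<le> b" "t1 < t0 + d" using d \<open>t0 < b\<close> by (auto simp: t1_def)
      have "R < \<zeta> t1" using mono[of t0 t1] t0 t1 by simp
      from small[OF this] obtain n0 where n0: "\<And>n. n \<ge> n0 \<Longrightarrow> R + 1 / real (Suc n) \<le> \<zeta> t1"
        by (auto simp: eventually_sequentially)
      show "\<exists>n0. \<forall>n\<ge>n0. norm (integral {a..b} (\<lambda>t. \<kappa> n (\<zeta> t) * \<omega> t * \<zeta>' t) - \<omega> t0) < e"
      proof (intro exI[of _ n0] allI impI)
        fix n assume "n \<ge> n0"
        note n = n0[OF this]
        have close: "\<bar>\<omega> t - \<omega> t0\<bar> \<le> e / 2" if t: "t \<in> {a..b}" "\<kappa> n (\<zeta> t) \<noteq> 0" for t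
        proof -
          have "\<zeta> t0 < \<zeta> t" "\<zeta> t < \<zeta> t1" using kernel_support[OF t(2)] n t0 by auto
          moreover have "\<not> t < t0" using mono[of t t0] t t0 calculation by auto
          moreover have "\<not> t1 < t" using mono[of t1 t] t t0 t1 calculation by auto
          ultimately have "t0 < t" "t < t1" by (metis linorder_neqE_linordered_idom order_less_irrefl)+
          hence "dist t t0 < d" using t1 by (simp add: dist_real_def)
          from d(2)[OF t(1) this] show ?thesis by (simp add: dist_real_def)
        qed
        have "\<zeta> t1 \<le> \<zeta> b" using mono[of t1 b] t0 t1 by (cases "t1 = b") auto
        hence "P n (\<zeta> b) - P n (\<zeta> a) = 1"
          using n cross primitive_left[of "\<zeta> a" n] primitive_right[of n "\<zeta> b"] by simp
        hence one: "((\<lambda>t. \<kappa> n (\<zeta> t) * \<zeta>' t) has_integral 1) {a..b}"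
          using line_integral[OF ab der, of n] by simp
        have int: "(\<lambda>t. \<kappa> n (\<zeta> t) * \<omega> t * \<zeta>' t) integrable_on {a..b}"
          by (intro integrable_continuous_interval line_integrable der \<zeta>' \<omega>)
        have "((\<lambda>t. \<kappa> n (\<zeta> t) * \<omega> t * \<zeta>' t - \<omega> t0 * (\<kappa> n (\<zeta> t) * \<zeta>' t)) has_integral
            (integral {a..b} (\<lambda>t. \<kappa> n (\<zeta> t) * \<omega> t * \<zeta>' t) - \<omega> t0 * 1)) {a..b}"
          by (intro has_integral_diff has_integral_mult_right one integrable_integral int)
        hence "integral {a..b} (\<lambda>t. \<kappa> n (\<zeta> t) * (\<omega> t - \<omega> t0) * \<zeta>' t) =
            integral {a..b} (\<lambda>t. \<kappa> n (\<zeta> t) * \<omega> t * \<zeta>' t) - \<omega> t0"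
          by (intro integral_unique) (simp add: algebra_simps)
        moreover have "\<bar>integral {a..b} (\<lambda>t. \<kappa> n (\<zeta> t) * (\<omega> t - \<omega> t0) * \<zeta>' t)\<bar> \<le> e / 2"
          using close \<open>0 < e\<close> by (intro line_bound[OF ab der] \<zeta>' continuous_on_diff \<omega> continuous_on_const) auto
        ultimately show "norm (integral {a..b} (\<lambda>t. \<kappa> n (\<zeta> t) * \<omega> t * \<zeta>' t) - \<omega> t0) < e"
          using \<open>0 < e\<close> by simp
      qed
    qed
  qed
qed

end

section \<open>Charts over the tangent plane of a level set\<close>

lemma continuous_on_grad:
  assumes "Ck_on 1 W G" shows "continuous_on W (grad G)"
  using assms unfolding grad_def by (intro continuous_on_vec_lambda) simp

text \<open>The gradient differs from a constant vector by the relative error \<open>e\<close> at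
  most, so the level set is nearly a hyperplane and every comparison below costs a factor that tends
  to 1 with \<open>e\<close>. The ball has radius \<open>2 * r\<close> in order to contain a
  cylinder of radius \<open>r\<close> and half height \<open>r\<close>.\<close>

locale flat_chart = level_kernel +
  fixes G :: "real ^ 'n \<Rightarrow> real" and W :: "(real ^ 'n) set" and p \<nu> :: "real ^ 'n"
    and \<iota> :: "real ^ ('n minus_one) \<Rightarrow> real ^ 'n" and \<pi> and r e g0 :: real
  assumes dimension: "1 < CARD('n)"
    and lin: "linear \<iota>" "linear \<pi>"
    and split: "\<And>y t. \<pi> (\<iota> y + t *\<^sub>R \<nu>) = y" "\<And>y t. (\<iota> y + t *\<^sub>R \<nu>) \<bullet> \<nu> = t"
      "\<And>x. \<iota> (\<pi> x) + (x \<bullet> \<nu>) *\<^sub>R \<nu> = x"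
    and norms: "\<And>y t. norm (\<iota> y + t *\<^sub>R \<nu>) = norm (y, t)" "\<And>y. norm (\<iota> y) = norm y"
      "\<And>x. norm (\<pi> x) \<le> norm x" "norm \<nu> = 1"
    and e: "0 < e" "e < 1" and r: "0 < r" and g0: "0 < g0"
    and W: "open W" and G: "Ck_on 1 W G" and cball: "cball p (2 * r) \<subseteq> W"
    and grad_close: "\<And>x. x \<in> cball p (2 * r) \<Longrightarrow> norm (grad G x - g0 *\<^sub>R \<nu>) \<le> e * g0"
begin

definition chart :: "(real ^ ('n minus_one)) \<times> real \<Rightarrow> real ^ 'n" where
  "chart z = p + (\<iota> (fst z) + snd z *\<^sub>R \<nu>)"

definition proj :: "real ^ 'n \<Rightarrow> real ^ ('n minus_one)" where
  "proj x = \<pi> (x - p)"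

text \<open>A cylinder and not a ball, so that every vertical line over its base meets it in the
  same interval.\<close>

definition V :: "(real ^ 'n) set" where
  "V = {x. norm (proj x) < r \<and> \<bar>(x - p) \<bullet> \<nu>\<bar> < r}"

definition S :: "(real ^ 'n) set" where "S = {x \<in> V. G x = R}"

definition slope :: "real ^ 'n \<Rightarrow> real" where "slope x = grad G x \<bullet> \<nu>"

lemma dist_chart: "dist (chart z) (chart z') = dist z z'"
proof -
  have "chart z - chart z' = \<iota> (fst z - fst z') + (snd z - snd z') *\<^sub>R \<nu>"
    using lin(1) by (simp add: chart_def linear_diff algebra_simps)
  hence "norm (chart z - chart z') = norm (fst z - fst z', snd z - snd z')" by (simp only: norms(1))
  also have "(fst z - fst z', snd z - snd z') = z - z'" by (simp add: prod_eq_iff)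
  finally show ?thesis by (simp add: dist_norm)
qed

lemma proj_chart: "proj (chart (y, t)) = y" "(chart (y, t) - p) \<bullet> \<nu> = t"
  using split(1,2) by (simp_all add: chart_def proj_def)

lemma chart_proj: "chart (proj x, (x - p) \<bullet> \<nu>) = x"
  using split(3)[of "x - p"] by (simp add: chart_def proj_def)

lemma bij_chart: "bij chart"
proof (rule bijI)
  show "inj chart" by (rule injI) (metis dist_chart dist_eq_0_iff)
  show "surj chart" by (rule surjI[of chart "\<lambda>x. (proj x, (x - p) \<bullet> \<nu>)"]) (rule chart_proj)
qed

lemma distr_chart: "distr lborel borel chart = lborel"
proof (rule distr_lborel_isometry[OF dist_chart bij_chart])
  show "DIM((real, 'n minus_one) vec \<times> real) = DIM((real, 'n) vec)"
    using card_minus_one[OF dimension] dimension by simp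
qed

lemma chart_in_V: "chart (y, t) \<in> V \<longleftrightarrow> norm y < r \<and> \<bar>t\<bar> < r"
  by (simp add: V_def proj_chart)

lemma continuous_on_chart: "continuous_on A chart"
  by (rule continuous_onI) (auto simp: dist_chart)

lemma proj_nonexpansive: "dist (proj x) (proj x') \<le> dist x x'"
  using norms(3)[of "x - x'"] lin(2) by (simp add: proj_def dist_norm linear_diff algebra_simps)

lemma continuous_on_proj: "continuous_on A proj"
  by (rule continuous_onI) (meson proj_nonexpansive order_le_less_trans dist_commute order_less_le)

lemma norm_chart: "dist (chart (y, t)) p = norm (y, t)"
  using norms(1)[of y t] by (simp add: chart_def dist_norm)

lemma chart_in_cball:
  assumes "norm y \<le> r" "\<bar>t\<bar> \<le> r"
  shows "chart (y, t) \<in> cball p (2 * r)"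
proof -
  have "norm (y, t) \<le> norm y + norm t" by (rule norm_Pair_le)
  thus ?thesis using assms norm_chart[of y t] by (simp add: dist_commute)
qed

lemma V_subset: "V \<subseteq> cball p (2 * r)"
proof
  fix x assume "x \<in> V"
  thus "x \<in> cball p (2 * r)"
    using chart_in_cball[of "proj x" "(x - p) \<bullet> \<nu>"] chart_proj[of x] by (simp add: V_def)
qed

lemma open_V: "open V"
proof -
  have "open {x. norm (proj x) < r}" "open {x. \<bar>(x - p) \<bullet> \<nu>\<bar> < r}"
    by (intro open_Collect_less continuous_intros continuous_on_norm continuous_on_proj)+
  moreover have "V = {x. norm (proj x) < r} \<inter> {x. \<bar>(x - p) \<bullet> \<nu>\<bar> < r}" by (auto simp: V_def)
  ultimately show ?thesis by auto
qed

lemma p_in_V: "p \<in> V"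
  using r lin(2) by (simp add: V_def proj_def linear_0)

lemma V_W: "V \<subseteq> W" using V_subset cball by blast

lemma slope_bounds:
  assumes x: "x \<in> cball p (2 * r)"
  shows "(1 - e) * g0 \<le> slope x" "0 < slope x" "slope x \<le> norm (grad G x)"
    "norm (grad G x) \<le> (1 + e) / (1 - e) * slope x"
proof -
  let ?h = "grad G x - g0 *\<^sub>R \<nu>"
  have nn: "\<nu> \<bullet> \<nu> = 1" using norms(4) by (simp add: dot_square_norm)
  have "\<bar>?h \<bullet> \<nu>\<bar> \<le> norm ?h * norm \<nu>" by (rule Cauchy_Schwarz_ineq2)
  hence "\<bar>slope x - g0\<bar> \<le> e * g0"
    using grad_close[OF x] norms(4) nn by (simp add: slope_def inner_diff_left)
  thus 1: "(1 - e) * g0 \<le> slope x" by (simp add: algebra_simps abs_le_iff)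
  have "0 < (1 - e) * g0" using e g0 by simp
  thus "0 < slope x" using 1 by linarith
  show "slope x \<le> norm (grad G x)"
    using norm_cauchy_schwarz[of "grad G x" \<nu>] norms(4) by (simp add: slope_def)
  have "norm (grad G x) \<le> norm ?h + norm (g0 *\<^sub>R \<nu>)" using norm_triangle_ineq[of ?h "g0 *\<^sub>R \<nu>"] by simp
  also have "\<dots> \<le> (1 + e) * g0" using grad_close[OF x] norms(4) g0 by (simp add: algebra_simps)
  also have "\<dots> = (1 + e) / (1 - e) * ((1 - e) * g0)" using e by simp
  also have "\<dots> \<le> (1 + e) / (1 - e) * slope x" using 1 e by (intro mult_left_mono) auto
  finally show "norm (grad G x) \<le> (1 + e) / (1 - e) * slope x" .
qed

lemma slope_derivative:
  assumes "chart (y, t) \<in> W"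
  shows "((\<lambda>t. G (chart (y, t))) has_real_derivative slope (chart (y, t))) (at t)"
proof -
  have c: "((\<lambda>t. chart (y, t)) has_derivative (\<lambda>h. h *\<^sub>R \<nu>)) (at t)"
    unfolding chart_def by (auto intro!: derivative_eq_intros)
  have "((\<lambda>t. G (chart (y, t))) has_derivative (\<lambda>h. grad G (chart (y, t)) \<bullet> (h *\<^sub>R \<nu>))) (at t)"
    using has_derivative_compose[OF c C1_has_derivative[OF W G assms]] .
  moreover have "(\<lambda>h. grad G (chart (y, t)) \<bullet> (h *\<^sub>R \<nu>)) = (*) (slope (chart (y, t)))"
    by (auto simp: fun_eq_iff slope_def)
  ultimately show ?thesis unfolding has_field_derivative_def by (simp only:)
qed

lemma continuous_on_slope: "continuous_on W slope"
  unfolding slope_def by (intro continuous_intros continuous_on_grad G)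

text \<open>Level points lie in a narrow cone around the tangent plane, by the mean value theorem.\<close>

lemma level_cone:
  assumes x: "x \<in> cball p (2 * r)" and z: "z \<in> cball p (2 * r)" and eq: "G x = G z"
  shows "(1 - e) * dist x z \<le> dist (proj x) (proj z)"
proof -
  let ?h = "x - z"
  have seg: "z + t *\<^sub>R ?h \<in> cball p (2 * r)" if "0 \<le> t" "t \<le> 1" for t
  proof -
    have "(1 - t) *\<^sub>R z + t *\<^sub>R x \<in> cball p (2 * r)"
      using convexD[OF convex_cball z x, of "1 - t" t] that by simp
    thus ?thesis by (simp add: algebra_simps)
  qed
  have der: "((\<lambda>t. G (z + t *\<^sub>R ?h)) has_derivative (\<lambda>s. grad G (z + t *\<^sub>R ?h) \<bullet> (s *\<^sub>R ?h))) (at t within {0..1})"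
    if "0 \<le> t" "t \<le> 1" for t
  proof (rule has_derivative_at_withinI)
    have c: "((\<lambda>t. z + t *\<^sub>R ?h) has_derivative (\<lambda>s. s *\<^sub>R ?h)) (at t)"
      by (auto intro!: derivative_eq_intros)
    show "((\<lambda>t. G (z + t *\<^sub>R ?h)) has_derivative (\<lambda>s. grad G (z + t *\<^sub>R ?h) \<bullet> (s *\<^sub>R ?h))) (at t)"
      using has_derivative_compose[OF c C1_has_derivative[OF W G]] seg[OF that] cball by blast
  qed
  obtain t where t: "t \<in> {0..1}" "G (z + 1 *\<^sub>R ?h) - G (z + 0 *\<^sub>R ?h) = grad G (z + t *\<^sub>R ?h) \<bullet> ((1 - 0) *\<^sub>R ?h)"
    using mvt_very_simple[of 0 1, OF _ der] by auto
  let ?g = "grad G (z + t *\<^sub>R ?h)"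
  have "?g \<bullet> ?h = 0" using t(2) eq by simp
  moreover have "(?g - g0 *\<^sub>R \<nu>) \<bullet> ?h = ?g \<bullet> ?h - g0 * (\<nu> \<bullet> ?h)"
    by (simp only: inner_diff_left inner_scaleR_left)
  ultimately have "g0 * (?h \<bullet> \<nu>) = - ((?g - g0 *\<^sub>R \<nu>) \<bullet> ?h)" by (simp add: inner_commute[of ?h \<nu>])
  also have "\<bar>\<dots>\<bar> \<le> norm (?g - g0 *\<^sub>R \<nu>) * norm ?h" using Cauchy_Schwarz_ineq2 by simp
  also have "\<dots> \<le> e * g0 * norm ?h" using t(1) by (intro mult_right_mono grad_close seg) auto
  finally have "g0 * \<bar>?h \<bullet> \<nu>\<bar> \<le> g0 * (e * norm ?h)"
    using g0 by (simp only: abs_mult abs_of_pos mult.assoc mult.left_commute)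
  hence "\<bar>?h \<bullet> \<nu>\<bar> \<le> e * norm ?h" using g0 by (simp only: mult_le_cancel_left_pos)
  moreover have "norm ?h \<le> norm (\<iota> (\<pi> ?h)) + norm ((?h \<bullet> \<nu>) *\<^sub>R \<nu>)"
    using norm_triangle_ineq[of "\<iota> (\<pi> ?h)" "(?h \<bullet> \<nu>) *\<^sub>R \<nu>"] split(3)[of ?h] by simp
  moreover have "norm ((?h \<bullet> \<nu>) *\<^sub>R \<nu>) = \<bar>?h \<bullet> \<nu>\<bar>" using norms(4) by simp
  ultimately have "norm ?h \<le> norm (\<pi> ?h) + e * norm ?h" using norms(2)[of "\<pi> ?h"] by linarith
  hence "(1 - e) * norm ?h \<le> norm (\<pi> ?h)" by (simp only: left_diff_distrib mult_1_left diff_le_eq)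
  moreover have "\<pi> ?h = proj x - proj z" using lin(2) by (simp add: proj_def linear_diff[symmetric])
  ultimately show ?thesis by (simp add: dist_norm)
qed

lemma inj_on_proj: "inj_on proj S"
proof (rule inj_onI)
  fix x z assume xz: "x \<in> S" "z \<in> S" "proj x = proj z"
  hence "x \<in> cball p (2 * r)" "z \<in> cball p (2 * r)" "G x = G z"
    using V_subset by (auto simp: S_def simp del: mem_cball)
  from level_cone[OF this] have "(1 - e) * dist x z \<le> 0" using xz by simp
  thus "x = z" using e by (simp add: mult_le_0_iff)
qed

text \<open>\<open>G\<close> increases strictly along vertical lines, so a line meets the level
  exactly when \<open>G\<close> is below \<open>R\<close> at the bottom and above \<open>R\<close>
  at the top. Strictness excludes crossings at the ends, and it makes the projection of
  \<open>S\<close> open.\<close>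

lemma proj_S: "proj ` S = {y \<in> ball 0 r. G (chart (y, - r)) < R \<and> R < G (chart (y, r))}"
proof (intro equalityI subsetI)
  have mono: "G (chart (y, s)) < G (chart (y, t))" if "norm y < r" "- r \<le> s" "s < t" "t \<le> r" for y s t
  proof (rule DERIV_pos_imp_increasing[OF that(3)])
    fix u assume "s \<le> u" "u \<le> t"
    hence "chart (y, u) \<in> cball p (2 * r)" using that by (intro chart_in_cball) auto
    thus "\<exists>d. ((\<lambda>t. G (chart (y, t))) has_real_derivative d) (at u) \<and> 0 < d"
      using slope_derivative slope_bounds(2) cball by blast
  qed
  {
    fix y assume "y \<in> proj ` S"
    then obtain x where x: "x \<in> S" "y = proj x" by blast
    define t where "t = (x - p) \<bullet> \<nu>"
    have xc: "x = chart (y, t)" using chart_proj[of x] x by (simp add: t_def)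
    have *: "norm y < r" "\<bar>t\<bar> < r" "G x = R" using x by (auto simp: S_def V_def t_def)
    have "G (chart (y, - r)) < G (chart (y, t))" "G (chart (y, t)) < G (chart (y, r))"
      using * by (intro mono; simp)+
    thus "y \<in> {y \<in> ball 0 r. G (chart (y, - r)) < R \<and> R < G (chart (y, r))}" using * xc by simp
  }
  fix y assume "y \<in> {y \<in> ball 0 r. G (chart (y, - r)) < R \<and> R < G (chart (y, r))}"
  hence y: "norm y < r" "G (chart (y, - r)) < R" "R < G (chart (y, r))" by auto
  have cont: "continuous_on {- r..r} (\<lambda>t. G (chart (y, t)))"
  proof (intro continuous_at_imp_continuous_on ballI)
    fix t assume "t \<in> {- r..r}"
    hence "chart (y, t) \<in> W" using cball y by (intro subsetD[OF cball] chart_in_cball) auto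
    thus "isCont (\<lambda>t. G (chart (y, t))) t" by (rule DERIV_isCont[OF slope_derivative])
  qed
  have "\<exists>t\<ge>- r. t \<le> r \<and> G (chart (y, t)) = R" using y r by (intro IVT' cont) auto
  then obtain t where t: "- r \<le> t" "t \<le> r" "G (chart (y, t)) = R" by blast
  have "t \<noteq> - r" "t \<noteq> r" using y t by auto
  hence "chart (y, t) \<in> S" using t y by (simp add: S_def chart_in_V)
  thus "y \<in> proj ` S" using proj_chart(1)[of y t] by (metis image_eqI)
qed

lemma open_proj_S: "open (proj ` S)"
proof -
  have c: "continuous_on (ball 0 r) (\<lambda>y. G (chart (y, t)))" if "\<bar>t\<bar> \<le> r" for t
  proof (rule continuous_on_compose2[OF Ck_on_continuous[OF G]])
    show "continuous_on (ball 0 r) (\<lambda>y. chart (y, t))"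
      by (intro continuous_on_compose2[OF continuous_on_chart[of UNIV]] continuous_intros) auto
    show "(\<lambda>y. chart (y, t)) ` ball 0 r \<subseteq> W"
    proof (rule image_subsetI)
      fix y :: "real ^ 'n minus_one" assume "y \<in> ball 0 r"
      thus "chart (y, t) \<in> W" using that by (intro subsetD[OF cball] chart_in_cball) auto
    qed
  qed
  have "open (ball 0 r \<inter> (\<lambda>y. G (chart (y, - r))) -` {..<R})" "open (ball 0 r \<inter> (\<lambda>y. G (chart (y, r))) -` {R<..})"
    using r by (intro continuous_open_preimage c; simp)+
  moreover have "proj ` S = (ball 0 r \<inter> (\<lambda>y. G (chart (y, - r))) -` {..<R}) \<inter>
      (ball 0 r \<inter> (\<lambda>y. G (chart (y, r))) -` {R<..})"
    unfolding proj_S by auto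
  ultimately show ?thesis by auto
qed

lemma borel_S: "S \<in> sets borel"
proof -
  have "continuous_on V G" using Ck_on_continuous[OF G] V_W continuous_on_subset by blast
  hence "closedin (top_of_set V) (V \<inter> G -` {R})" by (intro continuous_closedin_preimage) auto
  then obtain T where "closed T" "V \<inter> G -` {R} = V \<inter> T" unfolding closedin_closed by auto
  moreover have "S = V \<inter> G -` {R}" by (auto simp: S_def)
  ultimately show ?thesis using open_V by simp
qed

text \<open>The projection does not increase distances, and by \<open>level_cone\<close> its inverse
  on \<open>S\<close> is Lipschitz with constant 1 / (1 - e). On the plane Hausdorff measure is
  Lebesgue measure.\<close>

lemma hausdorff_S:
  assumes B: "B \<in> sets borel"
  defines "H \<equiv> hausdorff_outer (CARD('n) - 1) (S \<inter> proj -` B)"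
  shows "emeasure lborel (proj ` S \<inter> B) \<le> H"
    "H \<le> ennreal ((1 / (1 - e)) ^ (CARD('n) - 1)) * emeasure lborel (proj ` S \<inter> B)"
proof -
  let ?k = "CARD('n) - 1" and ?SB = "S \<inter> proj -` B"
  have im: "proj ` ?SB = proj ` S \<inter> B" by auto
  have k: "DIM((real, 'n minus_one) vec) = ?k" using card_minus_one[OF dimension] by simp
  have leb: "hausdorff_outer ?k (proj ` ?SB) = emeasure lborel (proj ` S \<inter> B)"
    unfolding im k[symmetric] using B open_proj_S by (intro hausdorff_outer_eq_lborel) auto
  have "hausdorff_outer ?k (proj ` ?SB) \<le> ennreal (1 ^ ?k) * H"
    unfolding H_def using proj_nonexpansive by (intro hausdorff_outer_lipschitz_image) auto
  thus "emeasure lborel (proj ` S \<inter> B) \<le> H" using leb by simp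
  have inj: "inj_on proj ?SB" using inj_on_proj by (rule inj_on_subset) auto
  have "hausdorff_outer ?k (inv_into ?SB proj ` (proj ` ?SB)) \<le>
      ennreal ((1 / (1 - e)) ^ ?k) * hausdorff_outer ?k (proj ` ?SB)"
  proof (rule hausdorff_outer_lipschitz_image)
    fix y y' assume "y \<in> proj ` ?SB" "y' \<in> proj ` ?SB"
    then obtain x x' where x: "x \<in> ?SB" "x' \<in> ?SB" "y = proj x" "y' = proj x'" by blast
    have "(1 - e) * dist x x' \<le> dist (proj x) (proj x')"
      using x V_subset by (intro level_cone) (auto simp: S_def)
    thus "dist (inv_into ?SB proj y) (inv_into ?SB proj y') \<le> 1 / (1 - e) * dist y y'"
      using x inj e by (simp add: field_simps)
  qed (use e in simp)
  also have "inv_into ?SB proj ` (proj ` ?SB) = ?SB"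
    using inj by (simp add: inv_into_image_cancel)
  finally show "H \<le> ennreal ((1 / (1 - e)) ^ ?k) * emeasure lborel (proj ` S \<inter> B)"
    using leb by (simp add: H_def)
qed

context
  fixes w :: "real ^ 'n \<Rightarrow> real"
  assumes w: "continuous_on UNIV w" and w_nonneg: "\<And>x. 0 \<le> w x" and w_outside: "\<forall>x. x \<notin> V \<longrightarrow> w x = 0"
begin

lemma w_V: "x \<notin> V \<Longrightarrow> w x = 0"
  using w_outside by blast

lemma weighted_continuous:
  assumes h: "continuous_on W h"
  shows "continuous_on UNIV (\<lambda>x. \<kappa> n (G x) * w x * h x)"
    "integrable lborel (\<lambda>x. \<kappa> n (G x) * w x * h x)"
proof -
  let ?F = "\<lambda>x. \<kappa> n (G x) * w x * h x"
  have z: "?F x = 0" if "x \<notin> cball p (2 * r)" for x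
  proof -
    have "x \<notin> V" using that V_subset by blast
    thus ?thesis by (simp add: w_V)
  qed
  have "continuous_on W ?F"
    by (intro continuous_on_mult h continuous_on_subset[OF w] continuous_on_compose2[OF kernel_continuous]
        Ck_on_continuous[OF G]) auto
  hence "continuous_on UNIV (\<lambda>x. if x \<in> cball p (2 * r) then ?F x else 0)"
    by (rule continuous_on_extend_zero[OF W closed_cball cball]) (use z in blast)
  moreover have "(\<lambda>x. if x \<in> cball p (2 * r) then ?F x else 0) = ?F" using z by (auto simp: fun_eq_iff)
  ultimately show c: "continuous_on UNIV ?F" by (simp only:)
  show "integrable lborel ?F" by (rule integrable_compact_support[OF c compact_cball z])
qed

text \<open>The value of the weight at the only point where the vertical line over \<open>y\<close>
  can meet \<open>S\<close>; the limit to be expected of the integrals along that line.\<close>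

definition limit_density :: "real ^ ('n minus_one) \<Rightarrow> real" where
  "limit_density y = (if y \<in> proj ` S then w (inv_into S proj y) else 0)"

lemma limit_density_proj: "x \<in> S \<Longrightarrow> limit_density (proj x) = w x"
  using inj_on_proj by (simp add: limit_density_def)

lemma line_integral_chart:
  "(LINT t|lborel. \<kappa> n (G (chart (y, t))) * w (chart (y, t)) * slope (chart (y, t))) =
    (if norm y < r then integral {- r..r} (\<lambda>t. \<kappa> n (G (chart (y, t))) * w (chart (y, t)) * slope (chart (y, t))) else 0)"
proof -
  let ?F = "\<lambda>t. \<kappa> n (G (chart (y, t))) * w (chart (y, t)) * slope (chart (y, t))"
  show ?thesis
  proof (cases "norm y < r")
    case False
    hence "w (chart (y, t)) = 0" for t using w_V[of "chart (y, t)"] by (simp add: chart_in_V)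
    thus ?thesis using False by simp
  next
    case True
    have "?F t = 0" if "t \<notin> {- r..r}" for t
    proof -
      have "w (chart (y, t)) = 0" using that by (intro w_V) (auto simp: chart_in_V)
      thus ?thesis by simp
    qed
    hence "(\<lambda>t. indicator {- r..r} t *\<^sub>R ?F t) = ?F" by (auto simp: fun_eq_iff indicator_def)
    hence "(LINT t|lborel. ?F t) = (LINT t:{- r..r}|lborel. ?F t)" by (simp add: set_lebesgue_integral_def)
    also have "\<dots> = integral {- r..r} ?F"
    proof (intro set_borel_integral_eq_integral borel_integrable_atLeastAtMost')
      have "continuous_on UNIV (\<lambda>t. chart (y, t))"
        by (intro continuous_on_compose2[OF continuous_on_chart[of UNIV]] continuous_intros) auto
      hence "continuous_on UNIV ?F"
        by (rule continuous_on_compose2[OF weighted_continuous(1)[OF continuous_on_slope]]) simp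
      thus "continuous_on {- r..r} ?F" by (rule continuous_on_subset) simp
    qed
    finally show ?thesis using True by simp
  qed
qed

lemma
  assumes y: "norm y < r"
  shows chart_line_der: "\<And>t. t \<in> {- r..r} \<Longrightarrow> ((\<lambda>t. G (chart (y, t))) has_real_derivative slope (chart (y, t))) (at t)"
    and chart_line_cont: "continuous_on {- r..r} (\<lambda>t. slope (chart (y, t)))"
    and chart_line_pos: "\<And>t. t \<in> {- r..r} \<Longrightarrow> 0 < slope (chart (y, t))"
    and chart_line_weight: "continuous_on {- r..r} (\<lambda>t. w (chart (y, t)))"
proof -
  have cb: "chart (y, t) \<in> cball p (2 * r)" if "t \<in> {- r..r}" for t using y that by (intro chart_in_cball) auto
  have cc: "continuous_on {- r..r} (\<lambda>t. chart (y, t))"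
    by (intro continuous_on_compose2[OF continuous_on_chart[of UNIV]] continuous_intros) auto
  show "((\<lambda>t. G (chart (y, t))) has_real_derivative slope (chart (y, t))) (at t)" if "t \<in> {- r..r}" for t
    by (rule slope_derivative[OF subsetD[OF cball cb[OF that]]])
  show "0 < slope (chart (y, t))" if "t \<in> {- r..r}" for t by (rule slope_bounds(2)[OF cb[OF that]])
  show "continuous_on {- r..r} (\<lambda>t. slope (chart (y, t)))"
    by (rule continuous_on_compose2[OF continuous_on_slope cc]) (use cb cball in blast)
  show "continuous_on {- r..r} (\<lambda>t. w (chart (y, t)))"
    by (rule continuous_on_compose2[OF w cc]) simp
qed

lemma line_limit_chart:
  "(\<lambda>n. LINT t|lborel. \<kappa> n (G (chart (y, t))) * w (chart (y, t)) * slope (chart (y, t))) \<longlonglongrightarrow> limit_density y"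
proof (cases "norm y < r")
  case False
  hence "y \<notin> proj ` S" by (auto simp: S_def V_def)
  thus ?thesis using False unfolding line_integral_chart by (simp add: limit_density_def)
next
  case True
  have "(\<lambda>n. integral {- r..r} (\<lambda>t. \<kappa> n (G (chart (y, t))) * w (chart (y, t)) * slope (chart (y, t)))) \<longlonglongrightarrow> limit_density y"
  proof (rule line_limit)
    show "- r \<le> r" using r by simp
    show "w (chart (y, r)) = 0" using r by (intro w_V) (simp add: chart_in_V)
  next
    fix t assume t: "t \<in> {- r..r}" "G (chart (y, t)) = R"
    show "limit_density y = w (chart (y, t))"
    proof (cases "\<bar>t\<bar> < r")
      case inside: True
      hence "chart (y, t) \<in> S" using t True by (simp add: S_def chart_in_V)
      thus ?thesis using limit_density_proj proj_chart(1)[of y t] by metis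
    next
      case False
      \<comment> \<open>A crossing at an end of the segment lies outside the open cylinder: the line
        misses \<open>S\<close> by the strict inequalities in \<open>proj_S\<close>, and the weight
        vanishes at that point.\<close>
      hence "t = r \<or> t = - r" using t by auto
      hence "y \<notin> proj ` S" using t(2) unfolding proj_S by auto
      moreover have "w (chart (y, t)) = 0" using False by (intro w_V) (simp add: chart_in_V)
      ultimately show ?thesis by (simp add: limit_density_def)
    qed
  next
    assume none: "\<And>t. t \<in> {- r..r} \<Longrightarrow> G (chart (y, t)) \<noteq> R"
    have "y \<notin> proj ` S"
    proof
      assume "y \<in> proj ` S"
      then obtain x where x: "x \<in> S" "y = proj x" by blast
      hence "(x - p) \<bullet> \<nu> \<in> {- r..r}" "G (chart (y, (x - p) \<bullet> \<nu>)) = R"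
        using chart_proj[of x] by (auto simp: S_def V_def)
      thus False using none by blast
    qed
    thus "limit_density y = 0" by (simp add: limit_density_def)
  qed (use chart_line_der[OF True] chart_line_cont[OF True] chart_line_pos[OF True] chart_line_weight[OF True] in simp_all)
  thus ?thesis using True unfolding line_integral_chart by simp
qed

lemma weight_bounded: "\<exists>M\<ge>0. \<forall>x. w x \<le> M"
proof -
  have "bounded (w ` cball p (2 * r))"
    by (intro compact_imp_bounded compact_continuous_image continuous_on_subset[OF w] compact_cball) simp
  then obtain M where M: "\<forall>z\<in>w ` cball p (2 * r). norm z \<le> M" unfolding bounded_iff by blast
  have "w x \<le> \<bar>M\<bar>" for x
  proof (cases "x \<in> V")
    case True
    hence "norm (w x) \<le> M" using M V_subset by blast
    thus ?thesis by simp
  qed (simp add: w_V)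
  thus ?thesis by (intro exI[of _ "\<bar>M\<bar>"]) auto
qed

text \<open>Isometric coordinates and Fubini reduce the volume integral to vertical lines. The
  factor \<open>slope\<close> is the derivative of \<open>G\<close> along these lines, so each line
  integral has the form of \<open>line_limit\<close>, and \<open>line_bound\<close> supplies the
  domination.\<close>

lemma chart_limit:
  "(\<lambda>n. LINT x|lborel. \<kappa> n (G x) * w x * slope x) \<longlonglongrightarrow> (LINT y|lborel. limit_density y)"
  "integrable lborel limit_density"
proof -
  let ?F = "\<lambda>n x. \<kappa> n (G x) * w x * slope x"
  let ?I = "\<lambda>n y. LINT t|lborel. ?F n (chart (y, t))"
  have m[measurable]: "chart \<in> borel_measurable borel" "?F n \<in> borel_measurable borel" for n
    by (intro borel_measurable_continuous_onI continuous_on_chart weighted_continuous(1)[OF continuous_on_slope])+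
  have int: "integrable (lborel \<Otimes>\<^sub>M lborel) (\<lambda>z. ?F n (chart z))" for n
  proof -
    have "integrable (distr lborel borel chart) (?F n)"
      using weighted_continuous(2)[OF continuous_on_slope] by (simp add: distr_chart)
    hence "integrable lborel (\<lambda>z. ?F n (chart z))" by (subst (asm) integrable_distr_eq) simp_all
    thus ?thesis by (simp add: lborel_prod)
  qed
  have eq: "(LINT x|lborel. ?F n x) = (LINT y|lborel. ?I n y)" for n
  proof -
    have "(LINT x|lborel. ?F n x) = (LINT x|distr lborel borel chart. ?F n x)" by (simp add: distr_chart)
    also have "\<dots> = (LINT z|lborel. ?F n (chart z))" by (rule integral_distr) simp_all
    also have "\<dots> = (LINT z|(lborel \<Otimes>\<^sub>M lborel). ?F n (chart z))" by (simp add: lborel_prod)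
    also have "\<dots> = (LINT y|lborel. ?I n y)"
      using lborel_pair.integral_fst'[OF int[of n]] by simp
    finally show ?thesis .
  qed
  have mI: "?I n \<in> borel_measurable borel" for n
    using lborel_pair.integrable_fst'[OF int[of n]] borel_measurable_integrable by fastforce
  have mL: "limit_density \<in> borel_measurable borel"
    by (rule borel_measurable_LIMSEQ_real[OF line_limit_chart mI])
  obtain M where M: "0 \<le> M" "\<And>x. w x \<le> M" using weight_bounded by blast
  have bound: "norm (?I n y) \<le> M * indicator (ball 0 r) y" for n y
  proof (cases "norm y < r")
    case True
    have "\<bar>integral {- r..r} (\<lambda>t. \<kappa> n (G (chart (y, t))) * w (chart (y, t)) * slope (chart (y, t)))\<bar> \<le> M"
      using M w_nonneg r chart_line_der[OF True] chart_line_cont[OF True] chart_line_pos[OF True] chart_line_weight[OF True]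
      by (intro line_bound) auto
    thus ?thesis using True unfolding line_integral_chart by simp
  qed (simp add: line_integral_chart)
  have dom: "integrable lborel (\<lambda>y :: real ^ 'n minus_one. M * indicator (ball 0 r) y)"
    by (intro integrable_mult_right integrable_real_indicator emeasure_bounded_finite) auto
  have "(\<lambda>n. LINT y|lborel. ?I n y) \<longlonglongrightarrow> (LINT y|lborel. limit_density y)"
    by (rule integral_dominated_convergence[OF _ _ dom]) (use mL mI line_limit_chart bound in simp_all)
  thus "(\<lambda>n. LINT x|lborel. ?F n x) \<longlonglongrightarrow> (LINT y|lborel. limit_density y)" by (simp add: eq)
  show "integrable lborel limit_density"
    by (rule integrable_dominated_convergence[OF _ _ dom, where s = ?I]) (use mL mI line_limit_chart bound in simp_all)
qed

lemma limit_density_nonneg: "0 \<le> limit_density y"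
  by (simp add: limit_density_def w_nonneg)

text \<open>Both numbers are integrals of \<open>limit_density\<close>: one against the image under
  \<open>proj\<close> of Hausdorff measure on \<open>S\<close>, the other against Lebesgue measure
  on the projection of \<open>S\<close>. The two measures compare set by set.\<close>

lemma chart_hausdorff:
  defines "J \<equiv> LINT y|lborel. limit_density y"
    and "Z \<equiv> \<integral>\<^sup>+x. ennreal (w x) * indicator S x \<partial>hausdorff_measure (CARD('n) - 1)"
  shows "ennreal J \<le> Z" "Z \<le> ennreal ((1 / (1 - e)) ^ (CARD('n) - 1) * J)"
proof -
  let ?H = "hausdorff_measure (CARD('n) - 1) :: (real ^ 'n) measure"
  let ?c = "(1 / (1 - e)) ^ (CARD('n) - 1)"
  define \<mu> where "\<mu> = distr (density ?H (indicator S)) borel proj"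
  define \<nu>1 where "\<nu>1 = density lborel (indicator (proj ` S) :: _ \<Rightarrow> ennreal)"
  have mp: "proj \<in> borel_measurable borel" by (intro borel_measurable_continuous_onI continuous_on_proj)
  have mpH[measurable]: "proj \<in> measurable ?H borel"
    using mp measurable_cong_sets[OF sets_hausdorff_measure refl] by blast
  have mS[measurable]: "S \<in> sets ?H" using borel_S by simp
  have mD[measurable]: "proj ` S \<in> sets borel" using open_proj_S by simp
  have mL[measurable]: "limit_density \<in> borel_measurable borel"
    using chart_limit(2) borel_measurable_integrable by fastforce
  have ind: "indicator (proj ` S) y * ennreal (limit_density y) = ennreal (limit_density y)" for y
    by (auto simp: limit_density_def indicator_def)
  have 1: "(\<integral>\<^sup>+y. ennreal (limit_density y) \<partial>\<nu>1) = ennreal J"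
  proof -
    have "(\<integral>\<^sup>+y. ennreal (limit_density y) \<partial>\<nu>1) = (\<integral>\<^sup>+y. indicator (proj ` S) y * ennreal (limit_density y) \<partial>lborel)"
      unfolding \<nu>1_def by (rule nn_integral_density) auto
    also have "\<dots> = (\<integral>\<^sup>+y. ennreal (limit_density y) \<partial>lborel)" by (simp only: ind)
    also have "\<dots> = ennreal J" unfolding J_def
      by (rule nn_integral_eq_integral[OF chart_limit(2)]) (simp add: limit_density_nonneg)
    finally show ?thesis .
  qed
  have 2: "(\<integral>\<^sup>+y. ennreal (limit_density y) \<partial>\<mu>) = Z"
  proof -
    have "(\<integral>\<^sup>+y. ennreal (limit_density y) \<partial>\<mu>) = (\<integral>\<^sup>+x. ennreal (limit_density (proj x)) \<partial>density ?H (indicator S))"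
      unfolding \<mu>_def by (rule nn_integral_distr) auto
    also have "\<dots> = (\<integral>\<^sup>+x. indicator S x * ennreal (limit_density (proj x)) \<partial>?H)"
      by (rule nn_integral_density) auto
    also have "\<dots> = Z" unfolding Z_def
      by (rule nn_integral_cong) (auto simp: indicator_def limit_density_proj)
    finally show ?thesis .
  qed
  have em: "emeasure \<mu> B = hausdorff_outer (CARD('n) - 1) (S \<inter> proj -` B)"
    "emeasure \<nu>1 B = emeasure lborel (proj ` S \<inter> B)" if B: "B \<in> sets borel" for B
  proof -
    have pB: "proj -` B \<in> sets borel" using measurable_sets[OF mp B] by simp
    have "emeasure \<mu> B = emeasure (density ?H (indicator S)) (proj -` B)"
      unfolding \<mu>_def using B by (subst emeasure_distr) auto
    also have "\<dots> = emeasure ?H (S \<inter> proj -` B)"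
      using pB borel_S by (subst emeasure_restricted) auto
    also have "\<dots> = hausdorff_outer (CARD('n) - 1) (S \<inter> proj -` B)"
      using pB borel_S by (intro emeasure_hausdorff_measure) auto
    finally show "emeasure \<mu> B = hausdorff_outer (CARD('n) - 1) (S \<inter> proj -` B)" .
    show "emeasure \<nu>1 B = emeasure lborel (proj ` S \<inter> B)"
      unfolding \<nu>1_def using B by (subst emeasure_restricted) auto
  qed
  have s: "sets \<mu> = sets borel" "sets \<nu>1 = sets borel" by (simp_all add: \<mu>_def \<nu>1_def)
  have "(\<integral>\<^sup>+y. ennreal (limit_density y) \<partial>\<nu>1) \<le> (\<integral>\<^sup>+y. ennreal (limit_density y) \<partial>\<mu>)"
  proof (rule nn_integral_mono_measure)
    fix B assume "B \<in> sets \<nu>1"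
    hence B: "B \<in> sets borel" by (simp add: s)
    show "emeasure \<nu>1 B \<le> emeasure \<mu> B" unfolding em[OF B] by (rule hausdorff_S(1)[OF B])
  qed (simp_all add: s \<nu>1_def)
  thus "ennreal J \<le> Z" by (simp only: 1 2)
  have "(\<integral>\<^sup>+y. ennreal (limit_density y) \<partial>\<mu>) \<le> (\<integral>\<^sup>+y. ennreal (limit_density y) \<partial>scale_measure (ennreal ?c) \<nu>1)"
  proof (rule nn_integral_mono_measure)
    fix B assume "B \<in> sets \<mu>"
    hence B: "B \<in> sets borel" by (simp add: s)
    show "emeasure \<mu> B \<le> emeasure (scale_measure (ennreal ?c) \<nu>1) B"
      unfolding emeasure_scale_measure em[OF B] by (rule hausdorff_S(2)[OF B])
  qed (simp_all add: s \<mu>_def \<nu>1_def)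
  also have "\<dots> = ennreal ?c * (\<integral>\<^sup>+y. ennreal (limit_density y) \<partial>\<nu>1)"
    by (rule nn_integral_scale_measure) (simp add: \<nu>1_def)
  also have "\<dots> = ennreal (?c * J)"
    unfolding 1 using e by (intro ennreal_mult'[symmetric]) simp
  finally show "Z \<le> ennreal (?c * J)" by (simp only: 2)
qed

lemma chart_band_bounds:
  "(LINT x|lborel. \<kappa> n (G x) * w x * slope x) \<le> (LINT x|lborel. \<kappa> n (G x) * w x * norm (grad G x))"
  "(LINT x|lborel. \<kappa> n (G x) * w x * norm (grad G x)) \<le>
    (1 + e) / (1 - e) * (LINT x|lborel. \<kappa> n (G x) * w x * slope x)"
  "integrable lborel (\<lambda>x. \<kappa> n (G x) * w x * norm (grad G x))"
proof -
  have cg: "continuous_on W (\<lambda>x. norm (grad G x))" by (intro continuous_on_norm continuous_on_grad G)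
  show i: "integrable lborel (\<lambda>x. \<kappa> n (G x) * w x * norm (grad G x))" by (rule weighted_continuous(2)[OF cg])
  have le: "\<kappa> n (G x) * w x * slope x \<le> \<kappa> n (G x) * w x * norm (grad G x)"
    "\<kappa> n (G x) * w x * norm (grad G x) \<le> (1 + e) / (1 - e) * (\<kappa> n (G x) * w x * slope x)" for x
  proof -
    have "\<kappa> n (G x) * w x * slope x \<le> \<kappa> n (G x) * w x * norm (grad G x) \<and>
        \<kappa> n (G x) * w x * norm (grad G x) \<le> \<kappa> n (G x) * w x * ((1 + e) / (1 - e) * slope x)"
    proof (cases "x \<in> V")
      case True
      hence x: "x \<in> cball p (2 * r)" using V_subset by blast
      show ?thesis using slope_bounds(3,4)[OF x] w_nonneg[of x] kernel_nonneg[of n "G x"]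
        by (intro conjI mult_left_mono) auto
    qed (simp add: w_V)
    thus "\<kappa> n (G x) * w x * slope x \<le> \<kappa> n (G x) * w x * norm (grad G x)"
      "\<kappa> n (G x) * w x * norm (grad G x) \<le> (1 + e) / (1 - e) * (\<kappa> n (G x) * w x * slope x)"
      by (simp_all only: mult.left_commute[of "(1 + e) / (1 - e)"])
  qed
  note s = weighted_continuous(2)[OF continuous_on_slope, of n]
  show "(LINT x|lborel. \<kappa> n (G x) * w x * slope x) \<le> (LINT x|lborel. \<kappa> n (G x) * w x * norm (grad G x))"
    by (rule integral_mono[OF s i le(1)])
  have "(LINT x|lborel. \<kappa> n (G x) * w x * norm (grad G x)) \<le>
      (LINT x|lborel. (1 + e) / (1 - e) * (\<kappa> n (G x) * w x * slope x))"
    by (rule integral_mono[OF i integrable_mult_right[OF s] le(2)])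
  thus "(LINT x|lborel. \<kappa> n (G x) * w x * norm (grad G x)) \<le>
    (1 + e) / (1 - e) * (LINT x|lborel. \<kappa> n (G x) * w x * slope x)" by simp
qed

end

end

text \<open>What a partition of unity needs to know about a chart, with the coordinates hidden in
  \<open>I\<close> and \<open>J\<close>: the band integrals and the Hausdorff integral are both
  known up to the factor \<open>c\<close>, relative to a convergent sequence and its limit.\<close>

lemma (in level_kernel) band_local:
  fixes G :: "real ^ 'n \<Rightarrow> real"
  assumes N: "1 < CARD('n)" and W: "open W" and G: "Ck_on 1 W G"
    and p: "p \<in> W" and gp: "grad G p \<noteq> 0" and c: "1 < c"
  shows "\<exists>V. open V \<and> p \<in> V \<and> V \<subseteq> W \<and> bounded V \<and>
    (\<forall>w. continuous_on UNIV w \<and> (\<forall>x. 0 \<le> w x) \<and> (\<forall>x. x \<notin> V \<longrightarrow> w x = 0) \<longrightarrow>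
      (\<exists>I J. I \<longlonglongrightarrow> J \<and> 0 \<le> J \<and>
        (\<forall>n. integrable lborel (\<lambda>x. \<kappa> n (G x) * w x * norm (grad G x)) \<and>
          I n \<le> (LINT x|lborel. \<kappa> n (G x) * w x * norm (grad G x)) \<and>
          (LINT x|lborel. \<kappa> n (G x) * w x * norm (grad G x)) \<le> c * I n) \<and>
        ennreal J \<le> (\<integral>\<^sup>+x. ennreal (w x) * indicator {x \<in> W. G x = R} x \<partial>hausdorff_measure (CARD('n) - 1)) \<and>
        (\<integral>\<^sup>+x. ennreal (w x) * indicator {x \<in> W. G x = R} x \<partial>hausdorff_measure (CARD('n) - 1)) \<le> ennreal (c * J)))"
proof -
  let ?k = "CARD('n) - 1"
  define g0 where "g0 = norm (grad G p)"
  have g0: "0 < g0" using gp by (simp add: g0_def)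
  define \<nu> where "\<nu> = (1 / g0) *\<^sub>R grad G p"
  have \<nu>: "norm \<nu> = 1" "grad G p = g0 *\<^sub>R \<nu>" using g0 by (simp_all add: \<nu>_def g0_def)
  \<comment> \<open>One condition on \<open>e\<close> serves both losses: the ratio between gradient
    and slope, since the exponent is at least 1, and the power of the Lipschitz constant of the
    inverse projection.\<close>
  have "((\<lambda>e::real. ((1 + e) / (1 - e)) ^ ?k) \<longlongrightarrow> ((1 + 0) / (1 - 0)) ^ ?k) (at_right 0)"
    by (intro tendsto_intros) simp
  hence "\<forall>\<^sub>F e::real in at_right 0. ((1 + e) / (1 - e)) ^ ?k < c" by (rule order_tendstoD) (use c in simp)
  moreover have "\<forall>\<^sub>F e::real in at_right 0. e \<in> {0<..<1}" by (rule eventually_at_right_real) simp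
  ultimately have "\<forall>\<^sub>F e::real in at_right 0. ((1 + e) / (1 - e)) ^ ?k < c \<and> e \<in> {0<..<1}"
    by (rule eventually_conj)
  then obtain e :: real where e: "((1 + e) / (1 - e)) ^ ?k < c" "0 < e" "e < 1"
    using eventually_happens'[OF trivial_limit_at_right_real] by fastforce
  let ?q = "(1 + e) / (1 - e)"
  have q1: "1 \<le> ?q" using e by simp
  have "?q ^ 1 \<le> ?q ^ ?k" using q1 N by (intro power_increasing) auto
  hence qc: "?q \<le> c" using e by simp
  have "(1 / (1 - e)) ^ ?k \<le> ?q ^ ?k" using e by (intro power_mono divide_right_mono) auto
  hence ec: "(1 / (1 - e)) ^ ?k \<le> c" using e by linarith
  obtain d where d: "0 < d" "\<And>x. x \<in> W \<Longrightarrow> dist x p < d \<Longrightarrow> dist (grad G x) (grad G p) < e * g0"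
    using continuous_on_grad[OF G] p e g0 unfolding continuous_on_iff by (metis mult_pos_pos)
  obtain d' where d': "0 < d'" "ball p d' \<subseteq> W" using W p open_contains_ball by blast
  define r where "r = min d d' / 3"
  have r: "0 < r" "2 * r < d" "2 * r < d'" using d(1) d'(1) by (auto simp: r_def min_def)
  have cb: "cball p (2 * r) \<subseteq> W" using d'(2) r(3) by (intro order_trans[OF _ d'(2)]) auto
  have close: "norm (grad G x - g0 *\<^sub>R \<nu>) \<le> e * g0" if x: "x \<in> cball p (2 * r)" for x
  proof -
    have "dist x p < d" using x r(2) by (simp add: dist_commute)
    moreover have "x \<in> W" using x cb by blast
    ultimately have "dist (grad G x) (grad G p) < e * g0" by (intro d(2))
    thus ?thesis unfolding \<nu>(2)[symmetric] by (simp add: dist_norm)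
  qed
  obtain \<iota> :: "real ^ ('n minus_one) \<Rightarrow> real ^ 'n" and \<pi> where split:
    "linear \<iota>" "linear \<pi>" "\<And>y t. \<pi> (\<iota> y + t *\<^sub>R \<nu>) = y" "\<And>y t. (\<iota> y + t *\<^sub>R \<nu>) \<bullet> \<nu> = t"
    "\<And>x. \<iota> (\<pi> x) + (x \<bullet> \<nu>) *\<^sub>R \<nu> = x"
    "\<And>y t. norm (\<iota> y + t *\<^sub>R \<nu>) = norm (y, t)" "\<And>y. norm (\<iota> y) = norm y" "\<And>x. norm (\<pi> x) \<le> norm x"
    by (rule orthogonal_splitting[OF \<nu>(1) N], rule that) (assumption | simp only:)+
  interpret flat_chart \<kappa> P R G W p \<nu> \<iota> \<pi> r e g0
    by (rule flat_chart.intro[OF level_kernel_axioms flat_chart_axioms.intro]) (fact N W G split \<nu>(1) e(2,3) r(1) g0 cb close)+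
  show ?thesis
  proof (intro exI[of _ V] conjI allI impI open_V p_in_V V_W)
    show "bounded V" by (rule bounded_subset[OF bounded_cball V_subset])
    fix w :: "real ^ 'n \<Rightarrow> real"
    assume "continuous_on UNIV w \<and> (\<forall>x. 0 \<le> w x) \<and> (\<forall>x. x \<notin> V \<longrightarrow> w x = 0)"
    hence w: "continuous_on UNIV w" "\<And>x. 0 \<le> w x" "\<forall>x. x \<notin> V \<longrightarrow> w x = 0" by simp_all
    let ?I = "\<lambda>n. LINT x|lborel. \<kappa> n (G x) * w x * slope x"
    let ?J = "LINT y|lborel. limit_density w y"
    let ?Z = "\<integral>\<^sup>+x. ennreal (w x) * indicator {x \<in> W. G x = R} x \<partial>hausdorff_measure ?k"
    note bounds = chart_band_bounds[OF w] and lim = chart_limit[OF w] and Z = chart_hausdorff[OF w]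
    have J0: "0 \<le> ?J" by (intro integral_nonneg_AE AE_I2 limit_density_nonneg[OF w])
    have ind: "ennreal (w x) * indicator {x \<in> W. G x = R} x = ennreal (w x) * indicator S x" for x
      using w(3) V_W by (cases "x \<in> V") (auto simp: S_def indicator_def)
    \<comment> \<open>The two bounds on the band integral give I <= q I with q > 1, which is
      impossible for negative I.\<close>
    have I0: "0 \<le> ?I n" for n
    proof (rule ccontr)
      assume "\<not> 0 \<le> ?I n"
      hence "?q * ?I n \<le> 1 * ?I n" using q1 by (intro mult_right_mono_neg) auto
      have "?I n \<le> ?q * ?I n" using bounds(1,2)[of n] by linarith
      have "1 < ?q" using e by simp
      hence "?q * ?I n < 1 * ?I n" using \<open>\<not> 0 \<le> ?I n\<close> by (intro mult_strict_right_mono_neg) auto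
      thus False using \<open>?I n \<le> ?q * ?I n\<close> by linarith
    qed
    have up: "(LINT x|lborel. \<kappa> n (G x) * w x * norm (grad G x)) \<le> c * ?I n" for n
      using bounds(2)[of n] mult_right_mono[OF qc I0[of n]] by linarith
    have "ennreal ((1 / (1 - e)) ^ ?k * ?J) \<le> ennreal (c * ?J)"
      by (intro ennreal_leI mult_right_mono ec J0)
    hence "?Z \<le> ennreal (c * ?J)" unfolding ind using Z(2) by (rule order_trans[rotated])
    thus "\<exists>I J. I \<longlonglongrightarrow> J \<and> 0 \<le> J \<and>
        (\<forall>n. integrable lborel (\<lambda>x. \<kappa> n (G x) * w x * norm (grad G x)) \<and>
          I n \<le> (LINT x|lborel. \<kappa> n (G x) * w x * norm (grad G x)) \<and>
          (LINT x|lborel. \<kappa> n (G x) * w x * norm (grad G x)) \<le> c * I n) \<and>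
        ennreal J \<le> ?Z \<and> ?Z \<le> ennreal (c * J)"
      using lim(1) J0 bounds(1,3) up Z(1)
      by (intro exI[of _ ?I] exI[of _ ?J] conjI allI) (simp_all only: ind)
  qed
qed

text \<open>The comparison sequence changes with \<open>c\<close>, and convergence of
  \<open>B\<close> is not known beforehand; it results from letting \<open>c\<close> tend to
  1.\<close>

lemma squeeze_ratio:
  fixes B :: "nat \<Rightarrow> real"
  assumes Z: "0 \<le> Z"
    and approx: "\<And>c. 1 < c \<Longrightarrow> \<exists>I J. I \<longlonglongrightarrow> J \<and> (\<forall>\<^sub>F n in sequentially. I n \<le> B n \<and> B n \<le> c * I n) \<and> J \<le> Z \<and> Z \<le> c * J"
  shows "B \<longlonglongrightarrow> Z"
proof (rule LIMSEQ_I)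
  fix e0 :: real assume e0: "0 < e0"
  define e where "e = e0 / 3"
  have e: "0 < e" using e0 by (simp add: e_def)
  \<comment> \<open>Chosen such that (c - 1) (Z + e) <= e, which controls the multiplicative error
    on all values up to \<open>Z + e\<close>.\<close>
  define c where "c = 1 + e / (Z + e + 1)"
  have c: "1 < c" using e Z by (simp add: c_def)
  have "(c - 1) * (Z + e) = e * ((Z + e) / (Z + e + 1))" by (simp add: c_def)
  also have "\<dots> \<le> e * 1" using e Z by (intro mult_left_mono) auto
  finally have cZ: "(c - 1) * (Z + e) \<le> e" by simp
  obtain I J where IJ: "I \<longlonglongrightarrow> J" "\<forall>\<^sub>F n in sequentially. I n \<le> B n \<and> B n \<le> c * I n" "J \<le> Z" "Z \<le> c * J"
    using approx[OF c] by blast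
  have "\<forall>\<^sub>F n in sequentially. dist (I n) J < e" by (rule tendstoD[OF IJ(1) e])
  with IJ(2) have "\<forall>\<^sub>F n in sequentially. norm (B n - Z) < 3 * e"
  proof eventually_elim
    case (elim n)
    have In: "J - e < I n" "I n < J + e" using elim by (auto simp: dist_real_def abs_less_iff)
    have "c * I n \<le> c * (Z + e)" using In IJ(3) c by (intro mult_left_mono) auto
    also have "\<dots> = (Z + e) + (c - 1) * (Z + e)" by (simp add: algebra_simps)
    finally have up: "B n \<le> Z + 2 * e" using elim cZ by linarith
    have "Z \<le> J + (c - 1) * J" using IJ(4) by (simp add: algebra_simps)
    also have "(c - 1) * J \<le> (c - 1) * (Z + e)" using c IJ(3) e by (intro mult_left_mono) auto
    finally have "Z \<le> J + e" using cZ by linarith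
    hence "Z - 2 * e < B n" using In elim by linarith
    thus ?case using up e by (simp add: abs_less_iff)
  qed
  thus "\<exists>no. \<forall>n\<ge>no. norm (B n - Z) < e0" by (simp add: e_def eventually_sequentially)
qed

text \<open>Finitely many charts cover the compact level set. Their partition of unity needs to sum
  to 1 only near the level set, since by compactness the bands finally enter any neighbourhood of
  it.\<close>

theorem (in level_kernel) band_limit:
  fixes G w :: "real ^ 'n \<Rightarrow> real"
  assumes N: "1 < CARD('n)" and W: "open W" and G: "Ck_on 1 W G"
    and regular: "\<And>x. x \<in> W \<Longrightarrow> G x = R \<Longrightarrow> grad G x \<noteq> 0"
    and cT: "compact {x \<in> W. R \<le> G x \<and> G x \<le> R + 1}"
    and w: "continuous_on W w" and w0: "\<And>x. x \<in> W \<Longrightarrow> 0 \<le> w x"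
  defines "S \<equiv> {x \<in> W. G x = R}"
  shows "set_integrable (hausdorff_measure (CARD('n) - 1)) S w"
    "(\<lambda>n. LINT x:W|lborel. \<kappa> n (G x) * w x * norm (grad G x)) \<longlonglongrightarrow>
      (LINT x:S|hausdorff_measure (CARD('n) - 1). w x)"
proof -
  let ?H = "hausdorff_measure (CARD('n) - 1) :: (real ^ 'n) measure"
  let ?Z = "\<lambda>w. \<integral>\<^sup>+x. ennreal (w x) * indicator S x \<partial>?H"
  define T where "T = {x \<in> W. R \<le> G x \<and> G x \<le> R + 1}"
  have cT: "compact T" using cT by (simp add: T_def)
  have TW: "T \<subseteq> W" by (auto simp: T_def)
  have GT: "continuous_on T G" using Ck_on_continuous[OF G] TW by (rule continuous_on_subset)
  have "compact (T \<inter> G -` {..R})"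
  proof -
    have "closed (T \<inter> G -` {..R})"
      by (rule continuous_closed_preimage[OF GT compact_imp_closed[OF cT] closed_atMost])
    from compact_Int_closed[OF cT this] show ?thesis by (simp add: Int_assoc[symmetric])
  qed
  moreover have "T \<inter> G -` {..R} = S" by (auto simp: T_def S_def)
  ultimately have cS: "compact S" by simp
  have ST: "S \<subseteq> T" by (auto simp: S_def T_def)
  have bS: "S \<in> sets borel" using cS by (simp add: borel_compact)
  \<comment> \<open>The local statement takes nonnegative weights on the whole space, while
    \<open>w\<close> is known on \<open>W\<close> only. Tietze extends it from the compact band
    \<open>T\<close>, and the maximum with 0 restores the sign.\<close>
  obtain g where g: "continuous_on UNIV g" "\<And>x. x \<in> T \<Longrightarrow> g x = w x"
    using Tietze_unbounded[of T w UNIV] continuous_on_subset[OF w TW] compact_imp_closed[OF cT] by auto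
  define w' where "w' x = max 0 (g x)" for x
  have w': "continuous_on UNIV w'" "\<And>x. 0 \<le> w' x" "\<And>x. x \<in> T \<Longrightarrow> w' x = w x"
    using g w0 TW unfolding w'_def by (auto intro!: continuous_on_max)
  have approx: "\<exists>I J. I \<longlonglongrightarrow> J \<and> (\<forall>\<^sub>F n in sequentially. I n \<le> (LINT x:W|lborel. \<kappa> n (G x) * w x * norm (grad G x)) \<and>
        (LINT x:W|lborel. \<kappa> n (G x) * w x * norm (grad G x)) \<le> c * I n) \<and> 0 \<le> J \<and>
        ennreal J \<le> ?Z w \<and> ?Z w \<le> ennreal (c * J)" if c: "1 < c" for c
  proof -
    define local where "local p V \<longleftrightarrow> open V \<and> p \<in> V \<and> V \<subseteq> W \<and> bounded V \<and>
      (\<forall>w. continuous_on UNIV w \<and> (\<forall>x. 0 \<le> w x) \<and> (\<forall>x. x \<notin> V \<longrightarrow> w x = 0) \<longrightarrow>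
      (\<exists>I J. I \<longlonglongrightarrow> J \<and> 0 \<le> J \<and>
        (\<forall>n. integrable lborel (\<lambda>x. \<kappa> n (G x) * w x * norm (grad G x)) \<and>
          I n \<le> (LINT x|lborel. \<kappa> n (G x) * w x * norm (grad G x)) \<and>
          (LINT x|lborel. \<kappa> n (G x) * w x * norm (grad G x)) \<le> c * I n) \<and>
        ennreal J \<le> ?Z w \<and> ?Z w \<le> ennreal (c * J)))" for p V
    have "\<exists>V. local p V" if "p \<in> S" for p
      unfolding local_def S_def using that regular by (intro band_local N W G c) (auto simp: S_def)
    then obtain Vf where Vf: "\<And>p. p \<in> S \<Longrightarrow> local p (Vf p)" by metis
    have Vf_open: "open (Vf p)" "p \<in> Vf p" "Vf p \<subseteq> W" "bounded (Vf p)" if "p \<in> S" for p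
      using Vf[OF that] by (simp_all add: local_def)
    obtain F where F: "F \<subseteq> S" "finite F" "S \<subseteq> (\<Union>p\<in>F. Vf p)"
      by (rule compactE_image[OF cS, of S Vf]) (use Vf_open in auto)
    \<comment> \<open>A continuous function that is positive exactly on the chart domain.\<close>
    define d where "d p x = infdist x (- Vf p)" for p x
    have dc: "continuous_on A (d p)" for A p unfolding d_def by (intro continuous_intros)
    have d0: "0 \<le> d p x" for p x by (simp add: d_def infdist_nonneg)
    have d_out: "d p x = 0" if "x \<notin> Vf p" for p x using that by (simp add: d_def)
    have d_in: "0 < d p x" if "p \<in> F" "x \<in> Vf p" for p x
    proof -
      have p: "p \<in> S" using F that by blast
      have "Vf p \<noteq> UNIV" using Vf_open(4)[OF p] not_bounded_UNIV by metis
      hence "- Vf p \<noteq> {}" by blast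
      thus ?thesis unfolding d_def using that Vf_open(1)[OF p]
        by (intro infdist_pos_not_in_closed) auto
    qed
    define s where "s x = (\<Sum>p\<in>F. d p x)" for x
    have sc: "continuous_on A s" for A unfolding s_def by (intro continuous_on_sum dc)
    have s_pos: "0 < s x" if x: "x \<in> S" for x
    proof -
      obtain p where "p \<in> F" "x \<in> Vf p" using F x by blast
      thus ?thesis unfolding s_def using d_in d0 F(2) by (intro sum_pos2[of F p]) auto
    qed
    obtain m where m: "0 < m" "\<And>x. x \<in> S \<Longrightarrow> m \<le> s x"
    proof (cases "S = {}")
      case False
      then obtain x0 where "x0 \<in> S" "\<forall>x\<in>S. s x0 \<le> s x" using continuous_attains_inf[OF cS False sc] by blast
      thus ?thesis using s_pos by (intro that[of "s x0"]) auto
    qed (auto intro: that[of 1])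
    \<comment> \<open>The maximum keeps the denominator away from 0 everywhere and equals
      \<open>s x\<close> wherever \<open>s x\<close> is at least m / 2, in particular near the level
      set, where \<open>s\<close> is at least \<open>m\<close>.\<close>
    define pu where "pu p x = d p x / max (m / 2) (s x)" for p x
    have mx: "0 < max (m / 2) (s x)" for x using m(1) by simp
    define wp where "wp p x = pu p x * w' x" for p x
    have wp_cont: "continuous_on UNIV (wp p)" for p
      unfolding wp_def pu_def using mx
      by (intro continuous_on_mult continuous_on_divide dc continuous_on_max sc continuous_on_const w'(1)) (auto simp: less_imp_neq[symmetric])
    have wp_nonneg: "0 \<le> wp p x" for p x
      unfolding wp_def pu_def using d0 mx[of x] w'(2) by (intro mult_nonneg_nonneg divide_nonneg_nonneg) (auto intro: less_imp_le)
    have wp_out: "wp p x = 0" if "x \<notin> Vf p" for p x using that by (simp add: wp_def pu_def d_out)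
    have wp_sum: "(\<Sum>p\<in>F. wp p x) = w x" if "x \<in> T" "m / 2 \<le> s x" for x
    proof -
      have "(\<Sum>p\<in>F. wp p x) = s x / max (m / 2) (s x) * w' x"
        by (simp add: wp_def pu_def s_def sum_distrib_right sum_divide_distrib)
      thus ?thesis using that m(1) w'(3) by simp
    qed
    define Q where "Q p I J \<longleftrightarrow> I \<longlonglongrightarrow> J \<and> 0 \<le> J \<and>
        (\<forall>n. integrable lborel (\<lambda>x. \<kappa> n (G x) * wp p x * norm (grad G x)) \<and>
          I n \<le> (LINT x|lborel. \<kappa> n (G x) * wp p x * norm (grad G x)) \<and>
          (LINT x|lborel. \<kappa> n (G x) * wp p x * norm (grad G x)) \<le> c * I n) \<and>
        ennreal J \<le> ?Z (wp p) \<and> ?Z (wp p) \<le> ennreal (c * J)" for p I J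
    have "\<exists>I J. Q p I J" if "p \<in> F" for p
    proof -
      have "local p (Vf p)" using that F(1) by (intro Vf) blast
      hence all: "\<forall>w. continuous_on UNIV w \<and> (\<forall>x. 0 \<le> w x) \<and> (\<forall>x. x \<notin> Vf p \<longrightarrow> w x = 0) \<longrightarrow>
        (\<exists>I J. I \<longlonglongrightarrow> J \<and> 0 \<le> J \<and>
        (\<forall>n. integrable lborel (\<lambda>x. \<kappa> n (G x) * w x * norm (grad G x)) \<and>
          I n \<le> (LINT x|lborel. \<kappa> n (G x) * w x * norm (grad G x)) \<and>
          (LINT x|lborel. \<kappa> n (G x) * w x * norm (grad G x)) \<le> c * I n) \<and>
        ennreal J \<le> ?Z w \<and> ?Z w \<le> ennreal (c * J))"
        unfolding local_def by (elim conjE)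
      show ?thesis unfolding Q_def by (rule mp[OF spec[OF all, of "wp p"]]) (simp add: wp_cont wp_nonneg wp_out)
    qed
    then obtain I J where Q: "\<And>p. p \<in> F \<Longrightarrow> Q p (I p) (J p)" by metis
    have IJ: "\<And>p. p \<in> F \<Longrightarrow> I p \<longlonglongrightarrow> J p" "\<And>p. p \<in> F \<Longrightarrow> 0 \<le> J p"
      "\<And>p n. p \<in> F \<Longrightarrow> integrable lborel (\<lambda>x. \<kappa> n (G x) * wp p x * norm (grad G x))"
      "\<And>p n. p \<in> F \<Longrightarrow> I p n \<le> (LINT x|lborel. \<kappa> n (G x) * wp p x * norm (grad G x))"
      "\<And>p n. p \<in> F \<Longrightarrow> (LINT x|lborel. \<kappa> n (G x) * wp p x * norm (grad G x)) \<le> c * I p n"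
      "\<And>p. p \<in> F \<Longrightarrow> ennreal (J p) \<le> ?Z (wp p)" "\<And>p. p \<in> F \<Longrightarrow> ?Z (wp p) \<le> ennreal (c * J p)"
      using Q unfolding Q_def by blast+
    have Zsum: "?Z w = (\<Sum>p\<in>F. ?Z (wp p))"
    proof -
      have mS[measurable]: "S \<in> sets ?H" using bS by simp
      have [measurable]: "wp p \<in> borel_measurable ?H" for p
        using borel_measurable_continuous_onI[OF wp_cont[of p]] measurable_cong_sets[OF sets_hausdorff_measure refl] by blast
      have "?Z w = (\<integral>\<^sup>+x. (\<Sum>p\<in>F. ennreal (wp p x) * indicator S x) \<partial>?H)"
      proof (rule nn_integral_cong)
        fix x
        show "ennreal (w x) * indicator S x = (\<Sum>p\<in>F. ennreal (wp p x) * indicator S x)"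
        proof (cases "x \<in> S")
          case True
          hence "w x = (\<Sum>p\<in>F. wp p x)" using wp_sum[of x] m ST by fastforce
          thus ?thesis using True wp_nonneg by (simp add: sum_ennreal)
        qed simp
      qed
      also have "\<dots> = (\<Sum>p\<in>F. ?Z (wp p))" by (rule nn_integral_sum) measurable
      finally show ?thesis .
    qed
    \<comment> \<open>The part of \<open>T\<close> with \<open>s x\<close> at most m / 2 is compact
      and disjoint from \<open>S\<close>, so \<open>G\<close> exceeds \<open>R\<close> there by a
      positive gap.\<close>
    obtain \<delta> where \<delta>: "0 < \<delta>" "\<delta> \<le> 1" "\<And>x. x \<in> T \<Longrightarrow> G x < R + \<delta> \<Longrightarrow> m / 2 \<le> s x"
    proof -
      define T' where "T' = T \<inter> s -` {..m / 2}"
      have "closed T'" unfolding T'_def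
        by (rule continuous_closed_preimage[OF sc compact_imp_closed[OF cT] closed_atMost])
      from compact_Int_closed[OF cT this] have cT': "compact T'" by (simp add: T'_def Int_assoc[symmetric])
      show thesis
      proof (cases "T' = {}")
        case True
        have "m / 2 \<le> s x" if "x \<in> T" for x using that True by (fastforce simp: T'_def)
        thus thesis by (intro that[of 1]) auto
      next
        case False
        have "continuous_on T' G" by (rule continuous_on_subset[OF GT]) (auto simp: T'_def)
        then obtain x1 where x1: "x1 \<in> T'" "\<forall>x\<in>T'. G x1 \<le> G x"
          using continuous_attains_inf[OF cT' False] by blast
        have "G x1 \<noteq> R"
        proof
          assume "G x1 = R"
          hence "x1 \<in> S" using x1(1) by (auto simp: T'_def T_def S_def)
          hence "m \<le> s x1" by (rule m(2))
          thus False using x1(1) m(1) by (simp add: T'_def)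
        qed
        hence "R < G x1" using x1(1) by (auto simp: T'_def T_def)
        moreover have "m / 2 \<le> s x" if "x \<in> T" "G x < G x1" for x
        proof (rule ccontr)
          assume "\<not> m / 2 \<le> s x"
          hence "x \<in> T'" using that(1) by (simp add: T'_def)
          thus False using x1(2) that(2) by fastforce
        qed
        ultimately show thesis by (intro that[of "min 1 (G x1 - R)"]) auto
      qed
    qed
    have "(\<lambda>n. inverse (real (Suc n))) \<longlonglongrightarrow> 0" by (rule LIMSEQ_inverse_real_of_nat)
    hence "\<forall>\<^sub>F n in sequentially. inverse (real (Suc n)) < \<delta>" by (rule order_tendstoD) (rule \<delta>(1))
    hence ev: "\<forall>\<^sub>F n in sequentially. (LINT x:W|lborel. \<kappa> n (G x) * w x * norm (grad G x)) =
        (\<Sum>p\<in>F. LINT x|lborel. \<kappa> n (G x) * wp p x * norm (grad G x))"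
    proof eventually_elim
      case (elim n)
      have "indicator W x *\<^sub>R (\<kappa> n (G x) * w x * norm (grad G x)) =
          (\<Sum>p\<in>F. \<kappa> n (G x) * wp p x * norm (grad G x))" for x
      proof (cases "x \<in> W")
        case True
        show ?thesis
        proof (cases "\<kappa> n (G x) = 0")
          case False
          hence Gx: "R < G x" "G x < R + 1 / real (Suc n)" using kernel_support by blast+
          hence "G x < R + \<delta>" using elim by (simp add: inverse_eq_divide)
          moreover have "x \<in> T" using Gx \<open>G x < R + \<delta>\<close> \<delta>(2) True by (simp add: T_def)
          ultimately have "(\<Sum>p\<in>F. wp p x) = w x" using \<delta>(3) by (intro wp_sum)
          hence "\<kappa> n (G x) * w x * norm (grad G x) = \<kappa> n (G x) * (\<Sum>p\<in>F. wp p x) * norm (grad G x)" by simp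
          also have "\<dots> = (\<Sum>p\<in>F. \<kappa> n (G x) * wp p x * norm (grad G x))"
            by (simp only: sum_distrib_left sum_distrib_right)
          finally show ?thesis using True by simp
        qed simp
      next
        case False
        have "wp p x = 0" if "p \<in> F" for p
        proof (rule wp_out)
          have "p \<in> S" using that F(1) by blast
          thus "x \<notin> Vf p" using Vf_open(3) False by blast
        qed
        thus ?thesis using False by simp
      qed
      hence "(LINT x:W|lborel. \<kappa> n (G x) * w x * norm (grad G x)) =
          (LINT x|lborel. (\<Sum>p\<in>F. \<kappa> n (G x) * wp p x * norm (grad G x)))"
        unfolding set_lebesgue_integral_def by simp
      also have "\<dots> = (\<Sum>p\<in>F. LINT x|lborel. \<kappa> n (G x) * wp p x * norm (grad G x))"
        by (rule Bochner_Integration.integral_sum) (rule IJ(3))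
      finally show ?case .
    qed
    show ?thesis
    proof (intro exI[of _ "\<lambda>n. \<Sum>p\<in>F. I p n"] exI[of _ "\<Sum>p\<in>F. J p"] conjI)
      show "(\<lambda>n. \<Sum>p\<in>F. I p n) \<longlonglongrightarrow> (\<Sum>p\<in>F. J p)" by (intro tendsto_sum IJ(1))
      show "0 \<le> (\<Sum>p\<in>F. J p)" by (intro sum_nonneg IJ(2))
      have "ennreal (\<Sum>p\<in>F. J p) = (\<Sum>p\<in>F. ennreal (J p))" using IJ(2) by (intro sum_ennreal[symmetric])
      also have "\<dots> \<le> ?Z w" unfolding Zsum by (intro sum_mono IJ(6))
      finally show "ennreal (\<Sum>p\<in>F. J p) \<le> ?Z w" .
      have "?Z w \<le> (\<Sum>p\<in>F. ennreal (c * J p))" unfolding Zsum by (intro sum_mono IJ(7))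
      also have "\<dots> = ennreal (\<Sum>p\<in>F. c * J p)" using IJ(2) c by (intro sum_ennreal) simp
      finally show "?Z w \<le> ennreal (c * (\<Sum>p\<in>F. J p))" by (simp add: sum_distrib_left)
      show "\<forall>\<^sub>F n in sequentially. (\<Sum>p\<in>F. I p n) \<le> (LINT x:W|lborel. \<kappa> n (G x) * w x * norm (grad G x)) \<and>
        (LINT x:W|lborel. \<kappa> n (G x) * w x * norm (grad G x)) \<le> c * (\<Sum>p\<in>F. I p n)"
        using ev
      proof eventually_elim
        case (elim n)
        show ?case unfolding elim sum_distrib_left by (intro conjI sum_mono IJ(4,5))
      qed
    qed
  qed
  have "?Z w < top"
  proof -
    \<comment> \<open>Any fixed factor shows that the Hausdorff integral is finite.\<close>
    obtain J where "?Z w \<le> ennreal (2 * J)" using approx[of 2] by auto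
    thus ?thesis using ennreal_less_top order_le_less_trans by blast
  qed
  have wS: "(\<lambda>x. indicator S x *\<^sub>R w x) \<in> borel_measurable ?H"
  proof -
    have "(\<lambda>x. indicator S x *\<^sub>R w x) \<in> borel_measurable borel"
      using ST TW by (intro borel_measurable_continuous_on_indicator bS continuous_on_subset[OF w]) blast
    thus ?thesis using measurable_cong_sets[OF sets_hausdorff_measure refl] by blast
  qed
  have nonneg: "0 \<le> indicator S x *\<^sub>R w x" for x using w0[of x] by (auto simp: S_def indicator_def)
  have Z: "(\<integral>\<^sup>+x. ennreal (indicator S x *\<^sub>R w x) \<partial>?H) = ?Z w"
    by (rule nn_integral_cong) (simp add: indicator_def)
  show int: "set_integrable ?H S w"
    unfolding set_integrable_def using wS nonneg Z \<open>?Z w < top\<close> by (intro integrableI_nonneg) auto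
  define I where "I = (LINT x:S|?H. w x)"
  have I: "?Z w = ennreal I" "0 \<le> I"
  proof -
    show "0 \<le> I" unfolding I_def set_lebesgue_integral_def using nonneg by (intro integral_nonneg_AE AE_I2)
    have "(\<integral>\<^sup>+x. ennreal (indicator S x *\<^sub>R w x) \<partial>?H) = ennreal I"
      unfolding I_def set_lebesgue_integral_def
      using int nonneg by (intro nn_integral_eq_integral) (auto simp: set_integrable_def)
    thus "?Z w = ennreal I" using Z by simp
  qed
  show "(\<lambda>n. LINT x:W|lborel. \<kappa> n (G x) * w x * norm (grad G x)) \<longlonglongrightarrow> (LINT x:S|?H. w x)"
    unfolding I_def[symmetric]
  proof (rule squeeze_ratio[OF I(2)])
    fix c :: real assume c: "1 < c"
    obtain Ic J where J: "Ic \<longlonglongrightarrow> J" "\<forall>\<^sub>F n in sequentially. Ic n \<le> (LINT x:W|lborel. \<kappa> n (G x) * w x * norm (grad G x)) \<and>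
        (LINT x:W|lborel. \<kappa> n (G x) * w x * norm (grad G x)) \<le> c * Ic n" "0 \<le> J"
        "ennreal J \<le> ennreal I" "ennreal I \<le> ennreal (c * J)"
      using approx[OF c] unfolding I(1) by blast
    have "J \<le> I" "I \<le> c * J" using J(3-5) I(2) c by (simp_all add: ennreal_le_iff)
    thus "\<exists>Ic J. Ic \<longlonglongrightarrow> J \<and> (\<forall>\<^sub>F n in sequentially. Ic n \<le> (LINT x:W|lborel. \<kappa> n (G x) * w x * norm (grad G x)) \<and>
        (LINT x:W|lborel. \<kappa> n (G x) * w x * norm (grad G x)) \<le> c * Ic n) \<and> J \<le> I \<and> I \<le> c * J"
      using J(1,2) by blast
  qed
qed

section \<open>Testing the representation formula\<close>

text \<open>The primitive is written as an integral cut off at \<open>t\<close>, the form in which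
  Fubini produces it in \<open>inner_\<tau>\<close>.\<close>

lemma continuous_primitive:
  fixes k :: "real \<Rightarrow> real"
  assumes k: "continuous_on UNIV k" and supp: "\<And>t. t \<notin> {a..b} \<Longrightarrow> k t = 0"
  defines "K \<equiv> \<lambda>t. LINT \<tau>|lborel. k \<tau> * indicator {..<t} \<tau>"
  shows "(K has_real_derivative k t) (at t)" "t \<le> a \<Longrightarrow> K t = 0" "b \<le> t \<Longrightarrow> K t = (LINT \<tau>|lborel. k \<tau>)"
proof -
  have ic: "isCont k x" for x using k by (simp add: continuous_on_eq_continuous_at)
  obtain F where "\<forall>x. - \<infinity> < ereal x \<longrightarrow> ereal x < \<infinity> \<longrightarrow> (F has_vector_derivative k x) (at x)"
    using einterval_antiderivative[of "- \<infinity>" "\<infinity>" k] ic by auto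
  hence F: "(F has_real_derivative k x) (at x)" for x
    by (simp add: has_real_derivative_iff_has_vector_derivative)
  have eq: "K s = F s - F l" if ls: "l < a" "l < s" for s l
  proof -
    have "K s = (LINT \<tau>|lborel. k \<tau> * indicator {l..s} \<tau>)" unfolding K_def
    proof (rule integral_cong_AE)
      have km: "k \<in> borel_measurable borel" using k by (rule borel_measurable_continuous_onI)
      show "(\<lambda>\<tau>. k \<tau> * indicator {..<s} \<tau>) \<in> borel_measurable lborel"
        "(\<lambda>\<tau>. k \<tau> * indicator {l..s} \<tau>) \<in> borel_measurable lborel" using km by simp_all
      show "AE \<tau> in lborel. k \<tau> * indicator {..<s} \<tau> = k \<tau> * indicator {l..s} \<tau>"
        using AE_lborel_singleton[of s]
      proof eventually_elim
        case (elim \<tau>)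
        show ?case using elim supp[of \<tau>] ls by (cases "\<tau> < a") (auto simp: indicator_def)
      qed
    qed
    also have "\<dots> = F s - F l"
      using ls F ic by (intro integral_FTC_Icc_real) auto
    finally show ?thesis .
  qed
  define l where "l = min a t - 1"
  have l: "l < a" "l < t" by (auto simp: l_def)
  have "((\<lambda>s. F s - F l) has_real_derivative k t) (at t)" using DERIV_diff[OF F DERIV_const] by simp
  moreover have "\<forall>\<^sub>F s in nhds t. K s = F s - F l"
  proof -
    have "\<forall>\<^sub>F s in nhds t. s \<in> {l<..}" by (rule eventually_nhds_in_open) (use l in auto)
    thus ?thesis by eventually_elim (use l in \<open>auto intro: eq\<close>)
  qed
  ultimately show "(K has_real_derivative k t) (at t)"
    using DERIV_cong_ev[of t t K "\<lambda>s. F s - F l" "k t" "k t"] by simp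
  show "K t = 0" if "t \<le> a"
  proof -
    have "(\<lambda>\<tau>. k \<tau> * indicator {..<t} \<tau>) = (\<lambda>\<tau>. 0)"
      using supp that by (auto simp: fun_eq_iff indicator_def)
    thus ?thesis unfolding K_def by simp
  qed
  show "K t = (LINT \<tau>|lborel. k \<tau>)" if "b \<le> t" unfolding K_def
  proof (rule integral_cong_AE)
    have km: "k \<in> borel_measurable borel" using k by (rule borel_measurable_continuous_onI)
    show "(\<lambda>\<tau>. k \<tau> * indicator {..<t} \<tau>) \<in> borel_measurable lborel" "k \<in> borel_measurable lborel"
      using km by simp_all
    show "AE \<tau> in lborel. k \<tau> * indicator {..<t} \<tau> = k \<tau>"
      using AE_lborel_singleton[of t]
    proof eventually_elim
      case (elim \<tau>)
      show ?case using elim supp[of \<tau>] that by (cases "\<tau> \<le> b") (auto simp: indicator_def)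
    qed
  qed
qed

lemma has_pd_transform:
  assumes "has_pd i g' x d" "open S" "x \<in> S" "\<And>y. y \<in> S \<Longrightarrow> g y = g' y"
  shows "has_pd i g x d"
proof -
  have "has_pd i g x d \<longleftrightarrow> has_pd i g' x d" by (rule has_pd_cong_open[OF assms(2,3)]) (rule assms(4))
  thus ?thesis using assms(1) by simp
qed

lemma has_pd_self: "has_pd i g x d \<Longrightarrow> has_pd i g x (partial_deriv i g x)"
  by (simp add: has_pd_partial_deriv)

lemma Ck_on_transform:
  assumes "Ck_on k S g'" "open S" "\<And>y. y \<in> S \<Longrightarrow> g y = g' y"
  shows "Ck_on k S g"
proof -
  have "Ck_on k S g \<longleftrightarrow> Ck_on k S g'" by (rule Ck_on_cong[OF assms(2)]) (rule assms(3))
  thus ?thesis using assms(1) by simp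
qed

lemma continuous_on_transform:
  assumes "continuous_on S g'" "\<And>y. y \<in> S \<Longrightarrow> g y = g' y"
  shows "continuous_on S g"
  using assms(1) by (rule continuous_on_eq) (rule assms(2)[symmetric])

text \<open>Component \<open>i\<close> of the flux involves row \<open>i\<close> of the matrix only,
  and these entries are differentiable in direction \<open>i\<close>: the divergence form of the
  operator asks for exactly the derivatives that exist.\<close>

lemma flux_partial:
  fixes A :: "real ^ 'n \<Rightarrow> real ^ 'n ^ 'n"
  assumes S: "open S" and G: "Ck_on 2 S G"
    and A: "\<And>j. continuous_on UNIV (\<lambda>x. A x $ i $ j)"
      "\<And>j x. has_pd i (\<lambda>y. A y $ i $ j) x (partial_deriv i (\<lambda>y. A y $ i $ j) x)"
      "\<And>j. continuous_on UNIV (partial_deriv i (\<lambda>y. A y $ i $ j))"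
  defines "P \<equiv> \<lambda>y. (A y *v grad G y) $ i"
  shows "x \<in> S \<Longrightarrow> has_pd i P x (partial_deriv i P x)" "continuous_on S (partial_deriv i P)" "continuous_on S P"
proof -
  have G2: "Ck_on (Suc 1) S G" using G by (simp add: numeral_2_eq_2)
  have Gj: "Ck_on (Suc 0) S (partial_deriv j G)" for j using G2 by simp
  have P: "P = (\<lambda>y. \<Sum>j\<in>UNIV. A y $ i $ j * partial_deriv j G y)"
    by (simp add: P_def matrix_vector_mult_def grad_def fun_eq_iff)
  let ?D = "\<lambda>x. \<Sum>j\<in>UNIV. partial_deriv i (\<lambda>y. A y $ i $ j) x * partial_deriv j G x +
      A x $ i $ j * partial_deriv i (partial_deriv j G) x"
  have pd: "has_pd i P x (?D x)" if "x \<in> S" for x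
    unfolding P by (intro has_pd_sum has_pd_mult A(2) Ck_on_has_pd[OF Gj that])
  show "has_pd i P x (partial_deriv i P x)" if "x \<in> S" by (rule has_pd_self[OF pd[OF that]])
  have Ac: "continuous_on S (\<lambda>x. A x $ i $ j)" "continuous_on S (partial_deriv i (\<lambda>y. A y $ i $ j))" for j
    by (rule continuous_on_subset[OF A(1) subset_UNIV], rule continuous_on_subset[OF A(3) subset_UNIV])
  have cG: "continuous_on S (partial_deriv j G)" "continuous_on S (partial_deriv i (partial_deriv j G))" for j
    using Gj by simp_all
  show "continuous_on S P" unfolding P by (intro continuous_on_sum continuous_on_mult Ac cG)
  have "continuous_on S ?D" by (intro continuous_on_sum continuous_on_add continuous_on_mult Ac cG)
  thus "continuous_on S (partial_deriv i P)"
    by (rule continuous_on_transform) (rule has_pd_partial_deriv[OF pd])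
qed

text \<open>The domain is \<Omega>1, \<open>G\<close> is the fundamental solution with pole
  \<open>x0\<close>, and \<open>s0\<close> is a level above which the set {G >= s0}, completed by
  the pole, is compact. The pole is inserted by hand because \<open>G x0\<close> is an arbitrary
  number; \<open>blowup\<close> replaces the convention that it be infinite.\<close>

locale pole_setting =
  fixes A :: "real ^ 'n \<Rightarrow> real ^ 'n ^ 'n" and b :: "real ^ 'n \<Rightarrow> real ^ 'n"
    and c f u G :: "real ^ 'n \<Rightarrow> real" and D :: "(real ^ 'n) set" and x0 :: "real ^ 'n" and s0 :: real
  assumes D: "open D" "x0 \<in> D"
    and G2: "Ck_on 2 (D - {x0}) G"
    and A: "\<And>i j. continuous_on UNIV (\<lambda>x. A x $ i $ j)"
      "\<And>i j x. has_pd i (\<lambda>y. A y $ i $ j) x (partial_deriv i (\<lambda>y. A y $ i $ j) x)"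
      "\<And>i j. continuous_on UNIV (partial_deriv i (\<lambda>y. A y $ i $ j))"
    and b: "\<And>i. continuous_on UNIV (\<lambda>x. b x $ i)"
      "\<And>i x. has_pd i (\<lambda>y. b y $ i) x (partial_deriv i (\<lambda>y. b y $ i) x)"
      "\<And>i. continuous_on UNIV (partial_deriv i (\<lambda>y. b y $ i))"
    and c: "continuous_on UNIV c"
    and f: "continuous_on D f" and u: "Ck_on 2 D u" and equation: "\<And>x. x \<in> D \<Longrightarrow> ell_op A b c u x = f x"
    and G_integrable: "set_integrable lborel D G"
    and representation: "\<And>\<phi>. Ck_compact_support 2 D \<phi> \<Longrightarrow> \<phi> x0 = - (LINT x:D|lborel. G x * ell_op A b c \<phi> x)"
    and s0: "0 < s0"
    and compact_superlevel: "compact (insert x0 {x \<in> D - {x0}. s0 \<le> G x})"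
    and blowup: "\<And>t. \<exists>e>0. ball x0 e \<subseteq> D \<and> (\<forall>x\<in>ball x0 e - {x0}. t < G x)"
begin

abbreviation "W \<equiv> D - {x0}"

definition "C = insert x0 {x \<in> W. s0 \<le> G x}"

definition "energy x = (A x *v grad G x) \<bullet> grad G x"

definition "h x = (divergence b x - c x) * u x"

lemma open_W: "open W" using D by (simp add: open_delete)

lemma compact_C: "compact C" using compact_superlevel by (simp add: C_def)

lemma C_D: "C \<subseteq> D" using D by (auto simp: C_def)

lemma G_cont: "continuous_on W G" using G2 by (rule Ck_on_continuous)

lemma u_cont: "continuous_on D u" using u by (rule Ck_on_continuous)

lemma divergence_cont: "continuous_on UNIV (divergence b)"
  unfolding divergence_def by (intro continuous_on_sum b)

lemma h_cont: "continuous_on D h"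
  unfolding h_def using divergence_cont c u_cont
  by (intro continuous_on_mult continuous_on_diff) (auto intro: continuous_on_subset)

lemma energy_eq: "energy x = (\<Sum>i\<in>UNIV. (A x *v grad G x) $ i * grad G x $ i)"
  by (simp add: energy_def inner_vec_def)

lemma energy_cont: "continuous_on W energy"
  unfolding energy_eq[abs_def]
proof (intro continuous_on_sum continuous_on_mult)
  fix i
  show "continuous_on W (\<lambda>x. (A x *v grad G x) $ i)" by (rule flux_partial(3)[OF open_W G2 A])
  have "Ck_on (Suc 1) W G" using G2 by (simp add: numeral_2_eq_2)
  hence "continuous_on W (partial_deriv i G)" using Ck_on_continuous by simp
  thus "continuous_on W (\<lambda>x. grad G x $ i)" by (simp add: grad_def)
qed

lemma bounded_on_C:
  fixes g :: "real ^ 'n \<Rightarrow> real"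
  assumes "continuous_on D g"
  shows "\<exists>M\<ge>0. \<forall>x\<in>C. \<bar>g x\<bar> \<le> M"
proof -
  have "bounded (g ` C)"
    by (intro compact_imp_bounded compact_continuous_image continuous_on_subset[OF assms C_D] compact_C)
  then obtain M where "\<forall>y\<in>g ` C. norm y \<le> M" unfolding bounded_iff by blast
  hence "\<forall>x\<in>C. \<bar>g x\<bar> \<le> \<bar>M\<bar>" by fastforce
  thus ?thesis by (intro exI[of _ "\<bar>M\<bar>"]) simp
qed

end

text \<open>The kernel is C1, so its primitive composed with \<open>G\<close> is C2. Below
  \<open>lo\<close> the primitive vanishes, which yields compact support; above \<open>hi\<close> it
  is constant, which removes the pole.\<close>

locale pole_kernel = pole_setting +
  fixes \<kappa> \<kappa>' :: "real \<Rightarrow> real" and lo hi :: real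
  assumes \<kappa>: "\<And>t. (\<kappa> has_real_derivative \<kappa>' t) (at t)" and \<kappa>': "continuous_on UNIV \<kappa>'"
    and lo: "s0 \<le> lo" and supp: "\<And>t. t \<notin> {lo..hi} \<Longrightarrow> \<kappa> t = 0"
begin

definition "K1 t = (LINT \<tau>|lborel. \<kappa> \<tau> * indicator {..<t} \<tau>)"
definition "K2 t = (LINT \<tau>|lborel. \<tau> * \<kappa> \<tau> * indicator {..<t} \<tau>)"
definition "total1 = (LINT \<tau>|lborel. \<kappa> \<tau>)"
definition "total2 = (LINT \<tau>|lborel. \<tau> * \<kappa> \<tau>)"

lemma \<kappa>_cont: "continuous_on UNIV \<kappa>"
  by (intro continuous_at_imp_continuous_on ballI) (rule DERIV_isCont[OF \<kappa>])

lemma K1: "(K1 has_real_derivative \<kappa> t) (at t)" "t \<le> lo \<Longrightarrow> K1 t = 0" "hi \<le> t \<Longrightarrow> K1 t = total1"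
  unfolding K1_def[abs_def] total1_def using continuous_primitive[OF \<kappa>_cont supp] by auto

lemma K2: "(K2 has_real_derivative t * \<kappa> t) (at t)" "t \<le> lo \<Longrightarrow> K2 t = 0" "hi \<le> t \<Longrightarrow> K2 t = total2"
proof -
  have "continuous_on UNIV (\<lambda>t. t * \<kappa> t)" by (intro continuous_intros \<kappa>_cont)
  moreover have "t * \<kappa> t = 0" if "t \<notin> {lo..hi}" for t using supp that by simp
  ultimately show "(K2 has_real_derivative t * \<kappa> t) (at t)" "t \<le> lo \<Longrightarrow> K2 t = 0" "hi \<le> t \<Longrightarrow> K2 t = total2"
    unfolding K2_def[abs_def] total2_def using continuous_primitive[of "\<lambda>t. t * \<kappa> t" lo hi] by auto
qed

text \<open>Close to the pole \<open>K1 (G x)\<close> and \<open>K2 (G x)\<close> are constant, so \<open>\<phi>\<close> and \<open>field\<close> extend smoothly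
  across it. Up to the divergence of \<open>field\<close>, the integrand of the representation formula for \<open>\<phi>\<close>
  involves no derivative of \<open>u\<close>; the weight of \<open>f\<close> is
  \<open>G x * K1 (G x) - K2 (G x)\<close>, the integral of \<open>\<kappa> \<tau> * (G x - \<tau>)\<close> over \<open>\<tau> < G x\<close>.\<close>

definition "\<phi> x = (if x = x0 then total1 * u x0 else if x \<in> C then u x * K1 (G x) else 0)"

definition "field i x = (if x = x0 then - total2 * ((A x *v grad u x) $ i + u x * b x $ i)
   else if x \<in> C then - K2 (G x) * ((A x *v grad u x) $ i + u x * b x $ i) - u x * (G x * \<kappa> (G x)) * (A x *v grad G x) $ i
   else 0)"

lemma outside_C: "x \<in> W \<Longrightarrow> x \<notin> C \<Longrightarrow> G x < lo"
  using lo by (auto simp: C_def)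

lemma \<phi>_W: "x \<in> W \<Longrightarrow> \<phi> x = u x * K1 (G x)"
  using outside_C[of x] K1(2)[of "G x"] by (auto simp: \<phi>_def)

lemma field_W: "x \<in> W \<Longrightarrow> field i x =
    - K2 (G x) * ((A x *v grad u x) $ i + u x * b x $ i) - u x * (G x * \<kappa> (G x)) * (A x *v grad G x) $ i"
  using outside_C[of x] K2(2)[of "G x"] supp[of "G x"] by (auto simp: field_def)

lemma near_pole:
  obtains e where "0 < e" "ball x0 e \<subseteq> D" "\<And>x. x \<in> ball x0 e \<Longrightarrow> \<phi> x = total1 * u x"
    "\<And>i x. x \<in> ball x0 e \<Longrightarrow> field i x = - total2 * ((A x *v grad u x) $ i + u x * b x $ i)"
proof -
  obtain e where e: "0 < e" "ball x0 e \<subseteq> D" "\<forall>x\<in>ball x0 e - {x0}. max hi s0 < G x"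
    using blowup[of "max hi s0"] by blast
  have big: "x \<in> W" "hi < G x" if "x \<in> ball x0 e" "x \<noteq> x0" for x
    using e that by (auto simp del: mem_ball)
  show thesis
  proof (rule that[of e])
    show "\<phi> x = total1 * u x" if "x \<in> ball x0 e" for x
    proof (cases "x = x0")
      case False
      show ?thesis using \<phi>_W[OF big(1)[OF that False]] K1(3)[of "G x"] big(2)[OF that False] by simp
    qed (simp add: \<phi>_def)
    show "field i x = - total2 * ((A x *v grad u x) $ i + u x * b x $ i)" if "x \<in> ball x0 e" for i x
    proof (cases "x = x0")
      case False
      show ?thesis using field_W[OF big(1)[OF that False]] K2(3)[of "G x"] supp[of "G x"] big(2)[OF that False] by simp
    qed (simp add: field_def)
  qed (use e in auto)
qed

lemma D_cover: "0 < e \<Longrightarrow> ball x0 e \<subseteq> D \<Longrightarrow> ball x0 e \<union> W = D"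
  using D by auto

lemma Ck_\<phi>: "Ck_on 2 D \<phi>"
proof -
  obtain e where e: "0 < e" "ball x0 e \<subseteq> D" "\<And>x. x \<in> ball x0 e \<Longrightarrow> \<phi> x = total1 * u x"
    using near_pole by metis
  have const: "Ck_on 2 S (\<lambda>_. total1)" if "open S" for S :: "(real ^ 'n) set"
  proof -
    have 1: "Ck_on (Suc 0) S (\<lambda>_. 0)"
      by (rule Ck_on_SucI[OF that, where D = "\<lambda>_ _. 0"]) (simp_all add: has_pd_const)
    have "Ck_on (Suc (Suc 0)) S (\<lambda>_. total1)"
      by (rule Ck_on_SucI[OF that, where D = "\<lambda>_ _. 0"]) (rule continuous_on_const has_pd_const 1)+
    thus ?thesis by (simp add: numeral_2_eq_2)
  qed
  have "Ck_on 2 (ball x0 e) (\<lambda>x. total1 * u x)"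
    by (intro Ck_on_mult const open_ball Ck_on_subset[OF u e(2)])
  hence 1: "Ck_on 2 (ball x0 e) \<phi>" by (rule Ck_on_transform[OF _ open_ball]) (rule e(3))
  have "Ck_on 2 W (\<lambda>x. K1 (G x))"
    by (rule Ck_on_compose2[OF open_W G2 K1(1) \<kappa> \<kappa>'])
  hence "Ck_on 2 W (\<lambda>x. u x * K1 (G x))"
    by (intro Ck_on_mult open_W Ck_on_subset[OF u]) auto
  hence 2: "Ck_on 2 W \<phi>" by (rule Ck_on_transform[OF _ open_W]) (rule \<phi>_W)
  show ?thesis using Ck_on_Un[OF open_ball open_W 1 2] unfolding D_cover[OF e(1,2)] .
qed

lemma \<phi>_representation: "total1 * u x0 = - (LINT x:D|lborel. G x * ell_op A b c \<phi> x)"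
proof -
  have "Ck_compact_support 2 D \<phi>"
    unfolding Ck_compact_support_def using Ck_\<phi> compact_C C_D
    by (intro conjI exI[of _ C]) (auto simp: \<phi>_def C_def)
  from representation[OF this] show ?thesis by (simp add: \<phi>_def)
qed

text \<open>The derivative of \<open>field i\<close> in direction \<open>i\<close> off the pole,
  expanded by the product rule for term by term comparison in
  \<open>pointwise_identity\<close>.\<close>

definition "field' i x = - (G x * \<kappa> (G x) * partial_deriv i G x) * ((A x *v grad u x) $ i + u x * b x $ i)
    - K2 (G x) * (partial_deriv i (\<lambda>y. (A y *v grad u y) $ i) x +
        (partial_deriv i u x * b x $ i + u x * partial_deriv i (\<lambda>y. b y $ i) x))
    - (partial_deriv i u x * (G x * \<kappa> (G x)) * (A x *v grad G x) $ i
       + u x * (\<kappa> (G x) + G x * \<kappa>' (G x)) * partial_deriv i G x * (A x *v grad G x) $ i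
       + u x * (G x * \<kappa> (G x)) * partial_deriv i (\<lambda>y. (A y *v grad G y) $ i) x)"

lemma u_pd: "x \<in> D \<Longrightarrow> has_pd i u x (partial_deriv i u x)" "continuous_on D (partial_deriv i u)"
proof -
  have u2: "Ck_on (Suc 1) D u" using u by (simp add: numeral_2_eq_2)
  thus "x \<in> D \<Longrightarrow> has_pd i u x (partial_deriv i u x)" by (rule Ck_on_has_pd)
  show "continuous_on D (partial_deriv i u)" using u2 Ck_on_continuous by simp
qed

lemma G_pd: "x \<in> W \<Longrightarrow> has_pd i G x (partial_deriv i G x)" "continuous_on W (partial_deriv i G)"
proof -
  have G2': "Ck_on (Suc 1) W G" using G2 by (simp add: numeral_2_eq_2)
  thus "x \<in> W \<Longrightarrow> has_pd i G x (partial_deriv i G x)" by (rule Ck_on_has_pd)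
  show "continuous_on W (partial_deriv i G)" using G2' Ck_on_continuous by simp
qed

lemma field_pd: "x \<in> W \<Longrightarrow> has_pd i (field i) x (field' i x)"
proof -
  assume x: "x \<in> W"
  hence xD: "x \<in> D" by simp
  let ?P = "\<lambda>y. (A y *v grad u y) $ i" and ?Q = "\<lambda>y. (A y *v grad G y) $ i"
  have tk: "((\<lambda>t. t * \<kappa> t) has_real_derivative (\<kappa> t + t * \<kappa>' t)) (at t)" for t
    using DERIV_mult[OF DERIV_ident \<kappa>[of t]] by (simp add: mult.commute)
  have "has_pd i (\<lambda>x. - K2 (G x) * (?P x + u x * b x $ i) - u x * (G x * \<kappa> (G x)) * ?Q x) x
     ((- (G x * \<kappa> (G x) * partial_deriv i G x)) * (?P x + u x * b x $ i) +
       - K2 (G x) * (partial_deriv i ?P x + (partial_deriv i u x * b x $ i + u x * partial_deriv i (\<lambda>y. b y $ i) x))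
     - ((partial_deriv i u x * (G x * \<kappa> (G x)) + u x * ((\<kappa> (G x) + G x * \<kappa>' (G x)) * partial_deriv i G x)) * ?Q x
       + u x * (G x * \<kappa> (G x)) * partial_deriv i ?Q x))"
    by (intro has_pd_diff has_pd_mult has_pd_add has_pd_minus has_pd_chain[OF G_pd(1)[OF x] K2(1)]
        has_pd_chain[OF G_pd(1)[OF x] tk] flux_partial(1)[OF D(1) u A xD] flux_partial(1)[OF open_W G2 A x]
        u_pd(1)[OF xD] b(2))
  moreover have "(- (G x * \<kappa> (G x) * partial_deriv i G x)) * (?P x + u x * b x $ i) +
       - K2 (G x) * (partial_deriv i ?P x + (partial_deriv i u x * b x $ i + u x * partial_deriv i (\<lambda>y. b y $ i) x))
     - ((partial_deriv i u x * (G x * \<kappa> (G x)) + u x * ((\<kappa> (G x) + G x * \<kappa>' (G x)) * partial_deriv i G x)) * ?Q x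
       + u x * (G x * \<kappa> (G x)) * partial_deriv i ?Q x) = field' i x"
    by (simp add: field'_def algebra_simps)
  ultimately have "has_pd i (\<lambda>x. - K2 (G x) * (?P x + u x * b x $ i) - u x * (G x * \<kappa> (G x)) * ?Q x) x (field' i x)"
    by (simp only:)
  thus ?thesis by (rule has_pd_transform[OF _ open_W x]) (rule field_W)
qed

lemma continuous_compose_G: "continuous_on UNIV k \<Longrightarrow> continuous_on W (\<lambda>x. k (G x))"
  by (rule continuous_on_compose2[OF _ G_cont]) auto

lemma K2_cont: "continuous_on UNIV K2"
  by (intro continuous_at_imp_continuous_on ballI) (rule DERIV_isCont[OF K2(1)])

lemma on_W: "continuous_on D k \<Longrightarrow> continuous_on W k" "continuous_on UNIV k \<Longrightarrow> continuous_on W k"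
  by (auto intro: continuous_on_subset)

lemma field'_cont: "continuous_on W (field' i)"
  unfolding field'_def
  by (intro continuous_on_add continuous_on_diff continuous_on_mult continuous_on_minus G_cont
      continuous_compose_G \<kappa>_cont \<kappa>' K2_cont G_pd(2) on_W(1)[OF u_pd(2)] on_W(1)[OF u_cont] on_W(2)[OF b(1)] on_W(2)[OF b(3)]
      on_W(1)[OF flux_partial(2)[OF D(1) u A]] on_W(1)[OF flux_partial(3)[OF D(1) u A]]
      flux_partial(2)[OF open_W G2 A] flux_partial(3)[OF open_W G2 A])

text \<open>The components of the divergence integrate to zero separately. On a ball about the pole
  and on \<open>W\<close> different formulas show that the component and its derivative are
  continuous; the two open sets cover \<open>D\<close>.\<close>

lemma field_divergence:
  "set_integrable lborel D (partial_deriv i (field i))" "(LINT x:D|lborel. partial_deriv i (field i) x) = 0"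
proof -
  obtain e where e: "0 < e" "ball x0 e \<subseteq> D"
    "\<And>i x. x \<in> ball x0 e \<Longrightarrow> field i x = - total2 * ((A x *v grad u x) $ i + u x * b x $ i)"
    using near_pole by metis
  let ?P = "\<lambda>y. (A y *v grad u y) $ i"
  let ?N = "\<lambda>x. - total2 * (?P x + u x * b x $ i)"
  let ?N' = "\<lambda>x. - total2 * (partial_deriv i ?P x + (partial_deriv i u x * b x $ i + u x * partial_deriv i (\<lambda>y. b y $ i) x))"
  have pdN: "has_pd i (field i) x (?N' x)" if x: "x \<in> ball x0 e" for x
  proof -
    have xD: "x \<in> D" using x e by blast
    have "has_pd i ?N x (0 * (?P x + u x * b x $ i) + ?N' x)"
      by (intro has_pd_mult has_pd_const has_pd_add flux_partial(1)[OF D(1) u A xD] u_pd(1)[OF xD] b(2))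
    hence "has_pd i ?N x (?N' x)" by simp
    thus ?thesis by (rule has_pd_transform[OF _ open_ball x]) (rule e(3))
  qed
  have cN: "continuous_on D ?N" "continuous_on D ?N'"
    by (intro continuous_on_add continuous_on_mult continuous_on_const u_pd(2) u_cont
        flux_partial(2,3)[OF D(1) u A] continuous_on_subset[OF b(1)] continuous_on_subset[OF b(3)] subset_UNIV)+
  have "continuous_on (ball x0 e) (field i)"
    by (rule continuous_on_transform[OF continuous_on_subset[OF cN(1) e(2)]]) (rule e(3))
  moreover have "continuous_on W (field i)"
  proof -
    have "continuous_on W (\<lambda>x. - K2 (G x) * (?P x + u x * b x $ i) - u x * (G x * \<kappa> (G x)) * (A x *v grad G x) $ i)"
      by (intro continuous_on_add continuous_on_diff continuous_on_mult continuous_on_minus G_cont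
        continuous_compose_G \<kappa>_cont K2_cont on_W(1)[OF u_cont] on_W(2)[OF b(1)]
        on_W(1)[OF flux_partial(3)[OF D(1) u A]] flux_partial(3)[OF open_W G2 A])
    thus ?thesis by (rule continuous_on_transform) (rule field_W)
  qed
  ultimately have cf: "continuous_on D (field i)"
    using continuous_on_open_Un[OF open_ball open_W] D_cover[OF e(1,2)] by metis
  have "continuous_on (ball x0 e) (partial_deriv i (field i))"
    by (rule continuous_on_transform[OF continuous_on_subset[OF cN(2) e(2)]]) (rule has_pd_partial_deriv[OF pdN])
  moreover have "continuous_on W (partial_deriv i (field i))"
    by (rule continuous_on_transform[OF field'_cont]) (rule has_pd_partial_deriv[OF field_pd])
  ultimately have cd: "continuous_on D (partial_deriv i (field i))"
    using continuous_on_open_Un[OF open_ball open_W] D_cover[OF e(1,2)] by metis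
  have pd: "has_pd i (field i) x (partial_deriv i (field i) x)" if "x \<in> D" for x
  proof (cases "x = x0")
    case True
    hence "has_pd i (field i) x (?N' x)" using e(1) by (intro pdN) simp
    thus ?thesis by (rule has_pd_self)
  next
    case False
    hence "has_pd i (field i) x (field' i x)" using that by (intro field_pd) simp
    thus ?thesis by (rule has_pd_self)
  qed
  have z: "field i x = 0" if "x \<in> D - C" for x using that by (auto simp: field_def C_def)
  show "set_integrable lborel D (partial_deriv i (field i))" "(LINT x:D|lborel. partial_deriv i (field i) x) = 0"
    using integral_partial_deriv_zero[OF D(1) compact_C C_D cf cd pd z] by blast+
qed

text \<open>The field is designed so that all second derivatives of \<open>G\<close> and all first
  order terms in \<open>G\<close> linear in the gradient cancel. Second derivatives of
  \<open>u\<close> survive only in the factor \<open>K2 (G x) - G x * K1 (G x)\<close> times the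
  principal and first order part of the operator, where the equation replaces them by
  \<open>f\<close>. The energy survives because the derivative of t \<kappa>(t) exceeds t
  \<kappa>'(t) by \<kappa>(t).\<close>

lemma pointwise_identity:
  assumes x: "x \<in> W"
  shows "- (G x * ell_op A b c \<phi> x) = (\<Sum>i\<in>UNIV. partial_deriv i (field i) x) +
    (- f x * (G x * K1 (G x) - K2 (G x)) + u x * \<kappa> (G x) * energy x + h x * K2 (G x))"
proof -
  have xD: "x \<in> D" using x by simp
  let ?P = "\<lambda>i y. (A y *v grad u y) $ i" and ?Q = "\<lambda>i y. (A y *v grad G y) $ i"
  let ?p = "\<lambda>i. partial_deriv i (?P i) x" and ?q = "\<lambda>i. partial_deriv i (?Q i) x"
  let ?u = "\<lambda>i. partial_deriv i u x" and ?g = "\<lambda>i. partial_deriv i G x"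
  let ?k = "\<kappa> (G x)" and ?k' = "\<kappa>' (G x)"
  have pd\<phi>: "has_pd i \<phi> y (partial_deriv i u y * K1 (G y) + u y * (\<kappa> (G y) * partial_deriv i G y))" if y: "y \<in> W" for i y
  proof -
    have "has_pd i (\<lambda>y. u y * K1 (G y)) y (partial_deriv i u y * K1 (G y) + u y * (\<kappa> (G y) * partial_deriv i G y))"
      using y by (intro has_pd_mult u_pd(1) has_pd_chain[OF G_pd(1) K1(1)]) auto
    thus ?thesis by (rule has_pd_transform[OF _ open_W y]) (rule \<phi>_W)
  qed
  have grad\<phi>: "grad \<phi> y = K1 (G y) *\<^sub>R grad u y + (u y * \<kappa> (G y)) *\<^sub>R grad G y" if y: "y \<in> W" for y
    using has_pd_partial_deriv[OF pd\<phi>[OF y]] by (simp add: vec_eq_iff grad_def mult_ac)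
  have flux: "(A y *v grad \<phi> y) $ i = K1 (G y) * ?P i y + u y * \<kappa> (G y) * ?Q i y" if y: "y \<in> W" for i y
    unfolding grad\<phi>[OF y] by (simp add: matrix_vector_right_distrib matrix_vector_mult_scaleR)
  have div: "partial_deriv i (\<lambda>y. (A y *v grad \<phi> y) $ i) x =
      ?k * ?g i * ?P i x + K1 (G x) * ?p i + ((?u i * ?k + u x * (?k' * ?g i)) * ?Q i x + u x * ?k * ?q i)" for i
  proof (rule has_pd_partial_deriv)
    have "has_pd i (\<lambda>y. K1 (G y) * ?P i y + u y * \<kappa> (G y) * ?Q i y) x
       (?k * ?g i * ?P i x + K1 (G x) * ?p i + ((?u i * ?k + u x * (?k' * ?g i)) * ?Q i x + u x * ?k * ?q i))"
      by (intro has_pd_add has_pd_mult has_pd_chain[OF G_pd(1)[OF x] K1(1)] has_pd_chain[OF G_pd(1)[OF x] \<kappa>]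
        flux_partial(1)[OF D(1) u A xD] flux_partial(1)[OF open_W G2 A x] u_pd(1)[OF xD])
    thus "has_pd i (\<lambda>y. (A y *v grad \<phi> y) $ i) x
       (?k * ?g i * ?P i x + K1 (G x) * ?p i + ((?u i * ?k + u x * (?k' * ?g i)) * ?Q i x + u x * ?k * ?q i))"
      by (rule has_pd_transform[OF _ open_W x]) (rule flux)
  qed
  let ?b = "\<lambda>i. b x $ i" and ?b' = "\<lambda>i. partial_deriv i (\<lambda>y. b y $ i) x"
  have L: "ell_op A b c \<phi> x = (\<Sum>i\<in>UNIV. ?k * ?g i * ?P i x + K1 (G x) * ?p i +
      ((?u i * ?k + u x * (?k' * ?g i)) * ?Q i x + u x * ?k * ?q i) +
      ?b i * (?u i * K1 (G x) + u x * (?k * ?g i))) + c x * (u x * K1 (G x))"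
    unfolding ell_op_def divergence_def div \<phi>_W[OF x]
    by (simp add: inner_vec_def grad_def has_pd_partial_deriv[OF pd\<phi>[OF x]] sum.distrib)
  have F: "(\<Sum>i\<in>UNIV. ?p i + ?b i * ?u i) = f x - c x * u x"
    using equation[OF xD] by (simp add: ell_op_def divergence_def inner_vec_def grad_def sum.distrib)
  have E: "energy x = (\<Sum>i\<in>UNIV. ?g i * ?Q i x)"
    by (simp add: energy_def inner_vec_def grad_def mult.commute)
  have Dv: "divergence b x = (\<Sum>i\<in>UNIV. ?b' i)" by (simp add: divergence_def)
  have split: "- (g * ((\<Sum>i\<in>UNIV. X i) + k)) - (\<Sum>i\<in>UNIV. Y i) = (\<Sum>i\<in>UNIV. - g * X i - Y i) - g * k"
    for X Y :: "'n \<Rightarrow> real" and g k :: real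
    by (simp add: sum_subtractf sum_negf sum_distrib_left algebra_simps)
  have "- (G x * ell_op A b c \<phi> x) - (\<Sum>i\<in>UNIV. field' i x) =
     (\<Sum>i\<in>UNIV. - G x * (?k * ?g i * ?P i x + K1 (G x) * ?p i +
      ((?u i * ?k + u x * (?k' * ?g i)) * ?Q i x + u x * ?k * ?q i) +
      ?b i * (?u i * K1 (G x) + u x * (?k * ?g i))) - field' i x) - G x * (c x * (u x * K1 (G x)))"
    unfolding L by (rule split)
  \<comment> \<open>The cancellation happens for each index \<open>i\<close> by itself and is a
    polynomial identity.\<close>
  also have "(\<Sum>i\<in>UNIV. - G x * (?k * ?g i * ?P i x + K1 (G x) * ?p i +
      ((?u i * ?k + u x * (?k' * ?g i)) * ?Q i x + u x * ?k * ?q i) +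
      ?b i * (?u i * K1 (G x) + u x * (?k * ?g i))) - field' i x) =
     (\<Sum>i\<in>UNIV. (K2 (G x) - G x * K1 (G x)) * (?p i + ?b i * ?u i) + (K2 (G x) * u x) * ?b' i + (u x * ?k) * (?g i * ?Q i x))"
    by (intro sum.cong refl) (simp add: field'_def algebra_simps)
  also have "\<dots> = (K2 (G x) - G x * K1 (G x)) * (f x - c x * u x) + (K2 (G x) * u x) * divergence b x + (u x * ?k) * energy x"
  proof -
    have "(\<Sum>i\<in>UNIV. k1 * X i + k2 * Y i + k3 * Z i) = k1 * (\<Sum>i\<in>UNIV. X i) + k2 * (\<Sum>i\<in>UNIV. Y i) + k3 * (\<Sum>i\<in>UNIV. Z i)"
      for X Y Z :: "'n \<Rightarrow> real" and k1 k2 k3 :: real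
      by (simp only: sum.distrib sum_distrib_left)
    thus ?thesis unfolding F[symmetric] E Dv .
  qed
  finally show ?thesis
    unfolding has_pd_partial_deriv[OF field_pd[OF x]] by (simp add: h_def algebra_simps)
qed

end

section \<open>Terms over superlevel sets\<close>

lemma borel_measurable_on_open:
  fixes g :: "'a::topological_space \<Rightarrow> real"
  assumes "open S" "continuous_on S g"
  shows "(\<lambda>x. indicator S x * g x) \<in> borel_measurable borel"
  using borel_measurable_continuous_on_indicator[of S g] assms by (simp add: borel_open)

context pole_setting
begin

definition "region \<tau> = {x \<in> W. \<tau> < G x}"
definition "source_term \<tau> = (LINT x:region \<tau>|lborel. f x * (\<tau> - G x))"
definition "zero_order_term \<tau> = (LINT x:region \<tau>|lborel. h x)"
definition "mean \<tau> = u x0 - source_term \<tau> - \<tau> * zero_order_term \<tau>"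
definition "dominator x = indicator C x * \<bar>G x\<bar>"

lemma dominator_nonneg: "0 \<le> dominator x"
  by (simp add: dominator_def indicator_def)

lemma dominator_integrable: "integrable lborel dominator"
proof -
  have "set_integrable lborel C G"
    by (rule set_integrable_subset[OF G_integrable _ C_D]) (simp add: borel_compact compact_C)
  hence "integrable lborel (\<lambda>x. \<bar>indicator C x *\<^sub>R G x\<bar>)"
    unfolding set_integrable_def by (rule integrable_abs)
  moreover have "(\<lambda>x. \<bar>indicator C x *\<^sub>R G x\<bar>) = dominator" by (auto simp: fun_eq_iff dominator_def indicator_def)
  ultimately show ?thesis by simp
qed

lemma open_region: "open (region \<tau>)"
proof -
  have "open (W \<inter> G -` {\<tau><..})" by (intro continuous_open_preimage G_cont open_W open_greaterThan)
  moreover have "region \<tau> = W \<inter> G -` {\<tau><..}" by (auto simp: region_def)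
  ultimately show ?thesis by simp
qed

definition "integrand_f \<tau> x = indicator (region \<tau>) x * (f x * (\<tau> - G x))"
definition "integrand_h \<tau> x = indicator (region \<tau>) x * h x"

text \<open>Joint measurability for Fubini. All functions are continuous on \<open>W\<close> only,
  so they are first cut off to that open set.\<close>

lemma integrand_measurable:
  "(\<lambda>(\<tau>, x). integrand_f \<tau> x) \<in> borel_measurable (borel \<Otimes>\<^sub>M borel)"
  "(\<lambda>(\<tau>, x). integrand_h \<tau> x) \<in> borel_measurable (borel \<Otimes>\<^sub>M borel)"
proof -
  define G' where "G' x = indicator W x * G x" for x
  define f' where "f' x = indicator W x * f x" for x
  define h' where "h' x = indicator W x * h x" for x
  have [measurable]: "G' \<in> borel_measurable borel" "f' \<in> borel_measurable borel" "h' \<in> borel_measurable borel"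
    unfolding G'_def f'_def h'_def
    by (intro borel_measurable_on_open open_W G_cont continuous_on_subset[OF f] continuous_on_subset[OF h_cont] Diff_subset)+
  have [measurable]: "W \<in> sets borel" using open_W by simp
  have "(\<lambda>(\<tau>, x). integrand_f \<tau> x) = (\<lambda>(\<tau>, x). if x \<in> W \<and> \<tau> < G' x then f' x * (\<tau> - G' x) else 0)"
    "(\<lambda>(\<tau>, x). integrand_h \<tau> x) = (\<lambda>(\<tau>, x). if x \<in> W \<and> \<tau> < G' x then h' x else 0)"
    by (auto simp: fun_eq_iff integrand_f_def integrand_h_def region_def G'_def f'_def h'_def indicator_def)
  moreover have "(\<lambda>(\<tau>, x). if x \<in> W \<and> \<tau> < G' x then f' x * (\<tau> - G' x) else 0) \<in> borel_measurable (borel \<Otimes>\<^sub>M borel)"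
    "(\<lambda>(\<tau>, x). if x \<in> W \<and> \<tau> < G' x then h' x else 0) \<in> borel_measurable (borel \<Otimes>\<^sub>M borel)"
    by measurable
  ultimately show "(\<lambda>(\<tau>, x). integrand_f \<tau> x) \<in> borel_measurable (borel \<Otimes>\<^sub>M borel)"
    "(\<lambda>(\<tau>, x). integrand_h \<tau> x) \<in> borel_measurable (borel \<Otimes>\<^sub>M borel)" by simp_all
qed

text \<open>On \<open>region \<tau>\<close> with s0 <= \<tau> one has 0 < \<tau> < G, so both \<tau>
  and the distance from \<tau> to G are at most G, and 1 <= G / s0. Together with the bounds of
  \<open>f\<close> and \<open>h\<close> on the compact set \<open>C\<close>, a multiple of the
  integrable function \<open>dominator\<close> serves all levels at once.\<close>

lemma integrand_bound:
  "\<exists>M\<ge>0. \<forall>\<tau>\<ge>s0. \<forall>x. \<bar>integrand_f \<tau> x\<bar> \<le> M * dominator x \<and> \<bar>\<tau> * integrand_h \<tau> x\<bar> \<le> M * dominator x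
    \<and> \<bar>integrand_h \<tau> x\<bar> \<le> M / s0 * dominator x"
proof -
  obtain M1 where M1: "0 \<le> M1" "\<forall>x\<in>C. \<bar>f x\<bar> \<le> M1" using bounded_on_C[OF f] by blast
  obtain M2 where M2: "0 \<le> M2" "\<forall>x\<in>C. \<bar>h x\<bar> \<le> M2" using bounded_on_C[OF h_cont] by blast
  let ?M = "M1 + M2"
  have "\<bar>integrand_f \<tau> x\<bar> \<le> ?M * dominator x \<and> \<bar>\<tau> * integrand_h \<tau> x\<bar> \<le> ?M * dominator x
      \<and> \<bar>integrand_h \<tau> x\<bar> \<le> ?M / s0 * dominator x" if \<tau>: "s0 \<le> \<tau>" for \<tau> x
  proof (cases "x \<in> region \<tau>")
    case False
    thus ?thesis using dominator_nonneg[of x] M1(1) M2(1) s0 by (simp add: integrand_f_def integrand_h_def)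
  next
    case True
    hence G: "\<tau> < G x" "x \<in> C" using \<tau> by (auto simp: region_def C_def)
    hence dom: "dominator x = G x" using \<tau> s0 by (simp add: dominator_def)
    have "\<bar>f x\<bar> * \<bar>\<tau> - G x\<bar> \<le> M1 * G x" using G \<tau> s0 M1 by (intro mult_mono) auto
    also have "\<dots> \<le> ?M * G x" using G \<tau> s0 M2(1) by (intro mult_right_mono) auto
    finally have 1: "\<bar>integrand_f \<tau> x\<bar> \<le> ?M * dominator x" using True dom by (simp add: integrand_f_def abs_mult)
    have "\<bar>\<tau>\<bar> * \<bar>h x\<bar> \<le> G x * M2" using G \<tau> s0 M2 by (intro mult_mono) auto
    also have "\<dots> \<le> G x * ?M" using G \<tau> s0 M1(1) by (intro mult_left_mono) auto
    finally have 2: "\<bar>\<tau> * integrand_h \<tau> x\<bar> \<le> ?M * dominator x"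
      using True dom by (simp add: integrand_h_def abs_mult mult.commute)
    have "\<bar>h x\<bar> * s0 \<le> ?M * G x" using G \<tau> s0 M2 M1(1) by (intro mult_mono) (auto intro: add_increasing)
    hence "\<bar>integrand_h \<tau> x\<bar> \<le> ?M / s0 * dominator x"
      using True dom s0 by (simp add: integrand_h_def field_simps)
    thus ?thesis using 1 2 by blast
  qed
  thus ?thesis using M1(1) M2(1) by (intro exI[of _ ?M]) auto
qed

lemma section_measurable:
  "integrand_f \<tau> \<in> borel_measurable borel" "integrand_h \<tau> \<in> borel_measurable borel"
  using measurable_Pair2[OF integrand_measurable(1), of \<tau>] measurable_Pair2[OF integrand_measurable(2), of \<tau>] by simp_all

lemma integrand_integrable:
  assumes "s0 \<le> \<tau>"
  shows "integrable lborel (integrand_f \<tau>)" "integrable lborel (integrand_h \<tau>)"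
proof -
  obtain M where M: "0 \<le> M" "\<forall>\<tau>\<ge>s0. \<forall>x. \<bar>integrand_f \<tau> x\<bar> \<le> M * dominator x \<and> \<bar>\<tau> * integrand_h \<tau> x\<bar> \<le> M * dominator x
    \<and> \<bar>integrand_h \<tau> x\<bar> \<le> M / s0 * dominator x" using integrand_bound by blast
  show "integrable lborel (integrand_f \<tau>)"
  proof (rule Bochner_Integration.integrable_bound[OF integrable_mult_right[OF dominator_integrable, of M]])
    show "AE x in lborel. norm (integrand_f \<tau> x) \<le> norm (M * dominator x)"
      unfolding real_norm_def by (intro AE_I2 order_trans[OF _ abs_ge_self]) (use M assms in blast)
  qed (simp add: section_measurable)
  show "integrable lborel (integrand_h \<tau>)"
  proof (rule Bochner_Integration.integrable_bound[OF integrable_mult_right[OF dominator_integrable, of "M / s0"]])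
    show "AE x in lborel. norm (integrand_h \<tau> x) \<le> norm (M / s0 * dominator x)"
      unfolding real_norm_def by (intro AE_I2 order_trans[OF _ abs_ge_self]) (use M assms in blast)
  qed (simp add: section_measurable)
qed

lemma terms_alt:
  "source_term \<tau> = (LINT x|lborel. integrand_f \<tau> x)" "zero_order_term \<tau> = (LINT x|lborel. integrand_h \<tau> x)"
  by (simp_all add: source_term_def zero_order_term_def set_lebesgue_integral_def integrand_f_def integrand_h_def)

lemma terms_measurable:
  "source_term \<in> borel_measurable borel" "zero_order_term \<in> borel_measurable borel"
proof -
  have "(\<lambda>(\<tau>, x). integrand_f \<tau> x) \<in> borel_measurable (borel \<Otimes>\<^sub>M lborel)"
    "(\<lambda>(\<tau>, x). integrand_h \<tau> x) \<in> borel_measurable (borel \<Otimes>\<^sub>M lborel)"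
    using integrand_measurable measurable_cong_sets[OF sets_pair_measure_cong[OF refl sets_lborel] refl] by blast+
  from this[THEN lborel.borel_measurable_lebesgue_integral]
  show "source_term \<in> borel_measurable borel" "zero_order_term \<in> borel_measurable borel"
    unfolding terms_alt[abs_def] .
qed

lemma terms_bound:
  "\<exists>B\<ge>0. \<forall>\<tau>\<ge>s0. \<bar>source_term \<tau>\<bar> \<le> B \<and> \<bar>\<tau> * zero_order_term \<tau>\<bar> \<le> B"
proof -
  obtain M where M: "0 \<le> M" "\<forall>\<tau>\<ge>s0. \<forall>x. \<bar>integrand_f \<tau> x\<bar> \<le> M * dominator x \<and> \<bar>\<tau> * integrand_h \<tau> x\<bar> \<le> M * dominator x
    \<and> \<bar>integrand_h \<tau> x\<bar> \<le> M / s0 * dominator x" using integrand_bound by blast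
  define B where "B = (LINT x|lborel. M * dominator x)"
  have i: "integrable lborel (\<lambda>x. M * dominator x)" by (intro integrable_mult_right dominator_integrable)
  have B: "0 \<le> B" unfolding B_def using M(1) dominator_nonneg by (intro integral_nonneg_AE AE_I2) simp
  have "\<bar>source_term \<tau>\<bar> \<le> B \<and> \<bar>\<tau> * zero_order_term \<tau>\<bar> \<le> B" if \<tau>: "s0 \<le> \<tau>" for \<tau>
  proof
    have "norm (LINT x|lborel. integrand_f \<tau> x) \<le> B" unfolding B_def
      unfolding real_norm_def by (rule integral_abs_bound_integral[OF integrand_integrable(1)[OF \<tau>] i]) (use M \<tau> in simp)
    thus "\<bar>source_term \<tau>\<bar> \<le> B" by (simp add: terms_alt)
    have "norm (LINT x|lborel. \<tau> * integrand_h \<tau> x) \<le> B" unfolding B_def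
      unfolding real_norm_def
      by (rule integral_abs_bound_integral[OF integrable_mult_right[OF integrand_integrable(2)[OF \<tau>]] i]) (use M \<tau> in simp)
    thus "\<bar>\<tau> * zero_order_term \<tau>\<bar> \<le> B" by (simp add: terms_alt)
  qed
  thus ?thesis using B by blast
qed

text \<open>As \<tau> decreases to \<open>R\<close>, the sets {\<tau> < G} increase to {R < G}, so
  membership of a given point is eventually constant. From the left the limit set would be {R <=
  G}.\<close>

lemma mean_right_continuous:
  assumes R: "s0 \<le> R"
  shows "(mean \<longlongrightarrow> mean R) (at_right R)"
proof (rule tendsto_at_right_sequentially[of R "R + 1"])
  fix S :: "nat \<Rightarrow> real" assume S: "\<And>n. R < S n" "\<And>n. S n < R + 1" "decseq S" "S \<longlonglongrightarrow> R"
  obtain M where M: "0 \<le> M" "\<forall>\<tau>\<ge>s0. \<forall>x. \<bar>integrand_f \<tau> x\<bar> \<le> M * dominator x \<and> \<bar>\<tau> * integrand_h \<tau> x\<bar> \<le> M * dominator x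
    \<and> \<bar>integrand_h \<tau> x\<bar> \<le> M / s0 * dominator x" using integrand_bound by blast
  have Ss0: "s0 \<le> S n" for n using S(1)[of n] R by simp
  have ind: "\<forall>\<^sub>F n in sequentially. (x \<in> region (S n)) = (x \<in> region R)" for x
  proof (cases "x \<in> W \<and> R < G x")
    case True
    hence "\<forall>\<^sub>F n in sequentially. S n < G x" using order_tendstoD(2)[OF S(4)] by blast
    thus ?thesis by eventually_elim (use True in \<open>auto simp: region_def\<close>)
  next
    case False
    have "(x \<in> region (S n)) = (x \<in> region R)" for n
      using False S(1)[of n] by (auto simp: region_def)
    thus ?thesis by simp
  qed
  have limf: "(\<lambda>n. integrand_f (S n) x) \<longlonglongrightarrow> integrand_f R x" for x
  proof -
    have "(\<lambda>n. indicator (region R) x * (f x * (S n - G x))) \<longlonglongrightarrow> integrand_f R x"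
      unfolding integrand_f_def by (intro tendsto_intros S(4))
    moreover have "\<forall>\<^sub>F n in sequentially. indicator (region R) x * (f x * (S n - G x)) = integrand_f (S n) x"
      using ind[of x] by eventually_elim (simp add: integrand_f_def indicator_def)
    ultimately show ?thesis by (rule Lim_transform_eventually)
  qed
  have limh: "(\<lambda>n. integrand_h (S n) x) \<longlonglongrightarrow> integrand_h R x" for x
  proof (rule tendsto_eventually)
    show "\<forall>\<^sub>F n in sequentially. integrand_h (S n) x = integrand_h R x"
      using ind[of x] by eventually_elim (simp add: integrand_h_def indicator_def)
  qed
  have "(\<lambda>n. LINT x|lborel. integrand_f (S n) x) \<longlonglongrightarrow> (LINT x|lborel. integrand_f R x)"
    by (rule integral_dominated_convergence[where w = "\<lambda>x. M * dominator x"])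
      (use M(2) Ss0 limf section_measurable dominator_integrable in auto)
  moreover have "(\<lambda>n. LINT x|lborel. integrand_h (S n) x) \<longlonglongrightarrow> (LINT x|lborel. integrand_h R x)"
    by (rule integral_dominated_convergence[where w = "\<lambda>x. M / s0 * dominator x"])
      (use M(2) Ss0 limh section_measurable dominator_integrable in auto)
  ultimately show "(\<lambda>n. mean (S n)) \<longlonglongrightarrow> mean R"
    unfolding mean_def terms_alt by (intro tendsto_intros S(4))
qed simp

end

section \<open>Fubini between the kernel variable and space\<close>

context pole_kernel
begin

lemma \<kappa>_compact: "integrable lborel (\<lambda>t. q t * \<kappa> t)" if "continuous_on UNIV q"
  by (rule integrable_compact_support[of _ "{lo..hi}"]) (use supp in \<open>auto intro!: continuous_on_mult that \<kappa>_cont\<close>)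

lemma energy_compact: "set_integrable lborel W (\<lambda>x. u x * \<kappa> (G x) * energy x)"
proof -
  let ?C = "{x \<in> W. lo \<le> G x \<and> G x \<le> hi}"
  obtain e where e: "0 < e" "ball x0 e \<subseteq> D" "\<forall>x\<in>ball x0 e - {x0}. hi < G x" using blowup by blast
  have "open (W \<inter> G -` {..<lo})" "open (W \<inter> G -` {hi<..})"
    by (intro continuous_open_preimage G_cont open_W open_lessThan open_greaterThan)+
  hence o: "open ((W \<inter> G -` {..<lo}) \<union> (W \<inter> G -` {hi<..}) \<union> ball x0 e)" by (intro open_Un open_ball)
  have far: "x \<notin> ball x0 e" if "x \<noteq> x0" "G x \<le> hi" for x using e(3) that by force
  have near: "x0 \<in> ball x0 e" using e(1) by simp
  \<comment> \<open>Near the pole \<open>G\<close> exceeds \<open>hi\<close>, so a whole ball can be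
    removed from \<open>C\<close>; this keeps the band compact and away from
    \<open>x0\<close>.\<close>
  have "?C = C - ((W \<inter> G -` {..<lo}) \<union> (W \<inter> G -` {hi<..}) \<union> ball x0 e)"
    using lo far near by (auto simp: C_def simp del: mem_ball centre_in_ball)
  hence cC: "compact ?C" using compact_diff[OF compact_C o] by simp
  have cont: "continuous_on W (\<lambda>x. u x * \<kappa> (G x) * energy x)"
    by (intro continuous_on_mult continuous_compose_G \<kappa>_cont energy_cont on_W(1)[OF u_cont])
  have z: "u x * \<kappa> (G x) * energy x = 0" if "x \<in> W - ?C" for x using supp[of "G x"] that by auto
  have c: "continuous_on UNIV (\<lambda>x. if x \<in> ?C then u x * \<kappa> (G x) * energy x else 0)"
    by (rule continuous_on_extend_zero[OF open_W compact_imp_closed[OF cC] _ cont z]) auto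
  have "integrable lborel (\<lambda>x. if x \<in> ?C then u x * \<kappa> (G x) * energy x else 0)"
    by (rule integrable_compact_support[OF c cC]) (rule if_not_P)
  moreover have "(\<lambda>x. if x \<in> ?C then u x * \<kappa> (G x) * energy x else 0) = (\<lambda>x. indicator W x *\<^sub>R (u x * \<kappa> (G x) * energy x))"
    using z by (auto simp: fun_eq_iff indicator_def)
  ultimately show ?thesis unfolding set_integrable_def by simp
qed

text \<open>Integrated in \<tau> it yields the terms of \<open>pointwise_identity\<close> with
  \<open>f\<close> and \<open>h\<close>; integrated in x it yields the kernel times the difference
  of \<open>u x0\<close> and \<open>mean\<close>. The link is that x lies in
  \<open>region \<tau>\<close> iff \<tau> < G x, for x in \<open>W\<close>.\<close>

definition "product_integrand z = \<kappa> (fst z) * (integrand_f (fst z) (snd z) + fst z * integrand_h (fst z) (snd z))"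

lemma product_integrable: "integrable (lborel \<Otimes>\<^sub>M lborel) product_integrand"
proof -
  obtain M where M: "0 \<le> M" "\<forall>\<tau>\<ge>s0. \<forall>x. \<bar>integrand_f \<tau> x\<bar> \<le> M * dominator x \<and> \<bar>\<tau> * integrand_h \<tau> x\<bar> \<le> M * dominator x
    \<and> \<bar>integrand_h \<tau> x\<bar> \<le> M / s0 * dominator x" using integrand_bound by blast
  have bd: "norm (product_integrand (\<tau>, x)) \<le> \<bar>\<kappa> \<tau>\<bar> * (2 * M * dominator x)" for \<tau> x
  proof (cases "\<kappa> \<tau> = 0")
    case False
    hence \<tau>: "s0 \<le> \<tau>" using supp[of \<tau>] lo by force
    have "\<bar>integrand_f \<tau> x\<bar> \<le> M * dominator x" "\<bar>\<tau> * integrand_h \<tau> x\<bar> \<le> M * dominator x" using M(2) \<tau> by blast+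
    hence "\<bar>integrand_f \<tau> x + \<tau> * integrand_h \<tau> x\<bar> \<le> 2 * M * dominator x" by linarith
    thus ?thesis by (simp add: product_integrand_def abs_mult mult_left_mono)
  qed (simp add: product_integrand_def)
  have [measurable]: "\<kappa> \<in> borel_measurable borel" using \<kappa>_cont by (rule borel_measurable_continuous_onI)
  have [measurable]: "(\<lambda>z. integrand_f (fst z) (snd z)) \<in> borel_measurable (borel \<Otimes>\<^sub>M borel)"
    "(\<lambda>z. integrand_h (fst z) (snd z)) \<in> borel_measurable (borel \<Otimes>\<^sub>M borel)"
    using integrand_measurable by (simp_all add: case_prod_beta')
  have m0: "product_integrand \<in> borel_measurable (borel \<Otimes>\<^sub>M borel)" unfolding product_integrand_def[abs_def] by measurable
  have m: "product_integrand \<in> borel_measurable (lborel \<Otimes>\<^sub>M lborel)"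
    using m0 measurable_cong_sets[OF sets_pair_measure_cong[OF sets_lborel sets_lborel] refl] by blast
  have i\<kappa>: "integrable lborel (\<lambda>\<tau>. \<bar>\<kappa> \<tau>\<bar>)" using \<kappa>_compact[of "\<lambda>_. 1"] by simp
  have id: "integrable lborel (\<lambda>x. \<bar>\<kappa> \<tau>\<bar> * (2 * M * dominator x))" for \<tau>
    by (intro integrable_mult_right dominator_integrable)
  have sec: "integrable lborel (\<lambda>x. product_integrand (\<tau>, x))" for \<tau>
  proof (rule Bochner_Integration.integrable_bound[OF id[of \<tau>]])
    show "AE x in lborel. norm (product_integrand (\<tau>, x)) \<le> norm (\<bar>\<kappa> \<tau>\<bar> * (2 * M * dominator x))"
      unfolding real_norm_def
      by (intro AE_I2 order_trans[OF _ abs_ge_self]) (use bd in simp)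
  qed (use measurable_Pair2[OF m0, of \<tau>] in simp)
  show ?thesis
  proof (rule lborel_pair.Fubini_integrable[OF m])
    show "AE \<tau> in lborel. integrable lborel (\<lambda>x. product_integrand (\<tau>, x))" using sec by simp
    define I where "I = (LINT x|lborel. 2 * M * dominator x)"
    show "integrable lborel (\<lambda>\<tau>. LINT x|lborel. norm (product_integrand (\<tau>, x)))"
    proof (rule Bochner_Integration.integrable_bound[OF integrable_mult_left[OF i\<kappa>, of I]])
      show "(\<lambda>\<tau>. LINT x|lborel. norm (product_integrand (\<tau>, x))) \<in> borel_measurable lborel"
        using m by (intro lborel.borel_measurable_lebesgue_integral) (simp add: case_prod_beta')
      show "AE \<tau> in lborel. norm (LINT x|lborel. norm (product_integrand (\<tau>, x))) \<le> norm (\<bar>\<kappa> \<tau>\<bar> * I)"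
      proof (rule AE_I2)
        fix \<tau> :: real
        have "0 \<le> (LINT x|lborel. norm (product_integrand (\<tau>, x)))" by (intro integral_nonneg_AE AE_I2) simp
        moreover have "(LINT x|lborel. norm (product_integrand (\<tau>, x))) \<le> (LINT x|lborel. \<bar>\<kappa> \<tau>\<bar> * (2 * M * dominator x))"
          by (rule integral_mono[OF integrable_norm[OF sec] id bd])
        moreover have "\<dots> = \<bar>\<kappa> \<tau>\<bar> * I" unfolding I_def by simp
        ultimately have "\<bar>LINT x|lborel. norm (product_integrand (\<tau>, x))\<bar> \<le> \<bar>\<kappa> \<tau>\<bar> * I" by linarith
        thus "norm (LINT x|lborel. norm (product_integrand (\<tau>, x))) \<le> norm (\<bar>\<kappa> \<tau>\<bar> * I)"
          unfolding real_norm_def by (rule order_trans[OF _ abs_ge_self])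
      qed
    qed
  qed
qed

lemma inner_\<tau>:
  "(LINT \<tau>|lborel. product_integrand (\<tau>, x)) =
    indicator W x * (- f x * (G x * K1 (G x) - K2 (G x)) + h x * K2 (G x))"
proof (cases "x \<in> W")
  case False
  thus ?thesis by (simp add: product_integrand_def integrand_f_def integrand_h_def region_def)
next
  case True
  let ?i = "\<lambda>\<tau>. indicator {..<G x} \<tau> :: real"
  have eq: "product_integrand (\<tau>, x) = (- f x * G x) * (\<kappa> \<tau> * ?i \<tau>) + (f x + h x) * (\<tau> * \<kappa> \<tau> * ?i \<tau>)" for \<tau>
    using True by (simp add: product_integrand_def integrand_f_def integrand_h_def region_def indicator_def algebra_simps)
  have i: "integrable lborel (\<lambda>\<tau>. \<kappa> \<tau> * ?i \<tau>)" "integrable lborel (\<lambda>\<tau>. \<tau> * \<kappa> \<tau> * ?i \<tau>)"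
    using \<kappa>_compact[of "\<lambda>_. 1"] \<kappa>_compact[of "\<lambda>t. t"] by (auto intro!: integrable_real_mult_indicator)
  have "(LINT \<tau>|lborel. product_integrand (\<tau>, x)) =
      (- f x * G x) * (LINT \<tau>|lborel. \<kappa> \<tau> * ?i \<tau>) + (f x + h x) * (LINT \<tau>|lborel. \<tau> * \<kappa> \<tau> * ?i \<tau>)"
    unfolding eq by (subst Bochner_Integration.integral_add) (use i in auto)
  thus ?thesis using True by (simp add: K1_def K2_def algebra_simps)
qed

lemma inner_x:
  "(LINT x|lborel. product_integrand (\<tau>, x)) = \<kappa> \<tau> * (source_term \<tau> + \<tau> * zero_order_term \<tau>)"
proof (cases "\<kappa> \<tau> = 0")
  case False
  hence \<tau>: "s0 \<le> \<tau>" using supp[of \<tau>] lo by force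
  show ?thesis unfolding product_integrand_def terms_alt
    using integrand_integrable[OF \<tau>] by simp
qed (simp add: product_integrand_def)

theorem kernel_identity:
  "integrable lborel (\<lambda>\<tau>. \<kappa> \<tau> * mean \<tau>)"
  "(LINT x:W|lborel. u x * \<kappa> (G x) * energy x) = (LINT \<tau>|lborel. \<kappa> \<tau> * mean \<tau>)"
proof -
  let ?rest = "\<lambda>x. LINT \<tau>|lborel. product_integrand (\<tau>, x)"
  let ?I = "\<lambda>\<tau>. LINT x|lborel. product_integrand (\<tau>, x)"
  have sw: "integrable (lborel \<Otimes>\<^sub>M lborel) (\<lambda>(\<tau>, x). product_integrand (\<tau>, x))"
    using product_integrable by (simp add: case_prod_beta')
  have ir: "integrable lborel ?rest" using lborel_pair.integrable_snd[OF sw] .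
  have iI: "integrable lborel ?I" using lborel_pair.integrable_fst[OF sw] .
  have i1: "integrable lborel \<kappa>" using \<kappa>_compact[of "\<lambda>_. 1"] by simp
  have eqm: "\<kappa> \<tau> * mean \<tau> = \<kappa> \<tau> * u x0 - ?I \<tau>" for \<tau>
    unfolding inner_x by (simp add: mean_def algebra_simps)
  show "integrable lborel (\<lambda>\<tau>. \<kappa> \<tau> * mean \<tau>)" unfolding eqm using i1 iI by auto
  have "total1 * u x0 = (LINT x:D|lborel. - (G x * ell_op A b c \<phi> x))"
    unfolding \<phi>_representation set_lebesgue_integral_def by simp
  also have "\<dots> = (LINT x|lborel. (\<Sum>i\<in>UNIV. indicator D x *\<^sub>R partial_deriv i (field i) x) +
      (indicator W x *\<^sub>R (u x * \<kappa> (G x) * energy x) + ?rest x))"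
    unfolding set_lebesgue_integral_def
  proof (rule integral_cong_AE)
    have dx: "(\<lambda>x. indicator D x *\<^sub>R partial_deriv i (field i) x) \<in> borel_measurable lborel" for i
      using field_divergence(1)[of i] unfolding set_integrable_def by (rule borel_measurable_integrable)
    have ex: "(\<lambda>x. indicator W x *\<^sub>R (u x * \<kappa> (G x) * energy x)) \<in> borel_measurable lborel"
      using energy_compact unfolding set_integrable_def by (rule borel_measurable_integrable)
    show m: "(\<lambda>x. (\<Sum>i\<in>UNIV. indicator D x *\<^sub>R partial_deriv i (field i) x) +
      (indicator W x *\<^sub>R (u x * \<kappa> (G x) * energy x) + ?rest x)) \<in> borel_measurable lborel"
      by (intro borel_measurable_add borel_measurable_sum dx ex borel_measurable_integrable[OF ir])
    have eq: "indicator D x *\<^sub>R (- (G x * ell_op A b c \<phi> x)) = (\<Sum>i\<in>UNIV. indicator D x *\<^sub>R partial_deriv i (field i) x) +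
      (indicator W x *\<^sub>R (u x * \<kappa> (G x) * energy x) + ?rest x)" if "x \<noteq> x0" for x
    proof (cases "x \<in> D")
      case True
      thus ?thesis using pointwise_identity[of x] that unfolding inner_\<tau> by simp
    qed (simp add: inner_\<tau>)
    show "AE x in lborel. indicator D x *\<^sub>R (- (G x * ell_op A b c \<phi> x)) =
      (\<Sum>i\<in>UNIV. indicator D x *\<^sub>R partial_deriv i (field i) x) +
      (indicator W x *\<^sub>R (u x * \<kappa> (G x) * energy x) + ?rest x)"
    proof -
      from AE_lborel_singleton[of x0] show ?thesis by eventually_elim (rule eq)
    qed
    let ?R = "\<lambda>x. (\<Sum>i\<in>UNIV. indicator D x *\<^sub>R partial_deriv i (field i) x) +
      (indicator W x *\<^sub>R (u x * \<kappa> (G x) * energy x) + ?rest x)"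
    \<comment> \<open>The integrands agree except at the pole, where \<open>G\<close> is arbitrary.
      The left one is measurable as a modification of the right one at a single point.\<close>
    have "(\<lambda>x. if x = x0 then indicator D x0 *\<^sub>R (- (G x0 * ell_op A b c \<phi> x0)) else ?R x) \<in> borel_measurable lborel"
      using m by (intro measurable_If) auto
    moreover have "(\<lambda>x. if x = x0 then indicator D x0 *\<^sub>R (- (G x0 * ell_op A b c \<phi> x0)) else ?R x) =
        (\<lambda>x. indicator D x *\<^sub>R (- (G x * ell_op A b c \<phi> x)))"
      using eq by (auto simp: fun_eq_iff)
    ultimately show "(\<lambda>x. indicator D x *\<^sub>R (- (G x * ell_op A b c \<phi> x))) \<in> borel_measurable lborel" by simp
  qed
  also have "\<dots> = (LINT x|lborel. (\<Sum>i\<in>UNIV. indicator D x *\<^sub>R partial_deriv i (field i) x)) +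
      ((LINT x:W|lborel. u x * \<kappa> (G x) * energy x) + (LINT x|lborel. ?rest x))"
  proof -
    have 1: "integrable lborel (\<lambda>x. \<Sum>i\<in>UNIV. indicator D x *\<^sub>R partial_deriv i (field i) x)"
      using field_divergence(1) unfolding set_integrable_def by (intro Bochner_Integration.integrable_sum)
    have 2: "integrable lborel (\<lambda>x. indicator W x *\<^sub>R (u x * \<kappa> (G x) * energy x))"
      using energy_compact unfolding set_integrable_def .
    show ?thesis unfolding set_lebesgue_integral_def
      by (simp only: Bochner_Integration.integral_add[OF 1 Bochner_Integration.integrable_add[OF 2 ir]]
          Bochner_Integration.integral_add[OF 2 ir])
  qed
  also have "(LINT x|lborel. (\<Sum>i\<in>UNIV. indicator D x *\<^sub>R partial_deriv i (field i) x)) = 0"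
    using field_divergence unfolding set_integrable_def set_lebesgue_integral_def
    by (subst Bochner_Integration.integral_sum) simp_all
  also have "(LINT x|lborel. ?rest x) = (LINT \<tau>|lborel. ?I \<tau>)"
    using lborel_pair.Fubini_integral[OF sw] .
  finally have "(LINT x:W|lborel. u x * \<kappa> (G x) * energy x) = total1 * u x0 - (LINT \<tau>|lborel. ?I \<tau>)" by simp
  also have "\<dots> = (LINT \<tau>|lborel. \<kappa> \<tau> * mean \<tau>)"
    unfolding eqm total1_def using i1 iI by (subst Bochner_Integration.integral_diff) auto
  finally show "(LINT x:W|lborel. u x * \<kappa> (G x) * energy x) = (LINT \<tau>|lborel. \<kappa> \<tau> * mean \<tau>)" .
qed

end

section \<open>The surface mean formula\<close>

text \<open>A C1 function that is positive exactly on the positive half line; products of shifts and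
  reflections of it are C1 bumps.\<close>

definition sq_part :: "real \<Rightarrow> real" where
  "sq_part t = (max 0 t)\<^sup>2"

lemma sq_part_nonneg: "0 \<le> sq_part t" and sq_part_eq_0: "sq_part t = 0 \<longleftrightarrow> t \<le> 0"
  by (auto simp: sq_part_def max_def)

lemma sq_part_derivative: "(sq_part has_real_derivative 2 * max 0 t) (at t)"
proof -
  consider "t < 0" | "0 < t" | "t = 0" by linarith
  thus ?thesis
  proof cases
    case 1
    have "\<forall>\<^sub>F s in nhds t. s \<in> {..<0}" by (rule eventually_nhds_in_open) (use 1 in auto)
    hence "\<forall>\<^sub>F s in nhds t. sq_part s = 0" by eventually_elim (auto simp: sq_part_def)
    hence "(sq_part has_real_derivative 0) (at t) \<longleftrightarrow> ((\<lambda>_. 0) has_real_derivative 0) (at t)"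
      by (intro DERIV_cong_ev) auto
    thus ?thesis using 1 by simp
  next
    case 2
    have "\<forall>\<^sub>F s in nhds t. s \<in> {0<..}" by (rule eventually_nhds_in_open) (use 2 in auto)
    hence "\<forall>\<^sub>F s in nhds t. sq_part s = s\<^sup>2" by eventually_elim (auto simp: sq_part_def)
    hence "(sq_part has_real_derivative 2 * t) (at t) \<longleftrightarrow> ((\<lambda>s. s\<^sup>2) has_real_derivative 2 * t) (at t)"
      by (intro DERIV_cong_ev) auto
    moreover have "((\<lambda>s. s\<^sup>2) has_real_derivative 2 * t) (at t)" by (auto intro!: derivative_eq_intros)
    ultimately show ?thesis using 2 by simp
  next
    case 3
    have "((\<lambda>h. (sq_part (0 + h) - sq_part 0) / h) \<longlongrightarrow> 0) (at 0)"
    proof (rule Lim_null_comparison)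
      show "\<forall>\<^sub>F h in at 0. norm ((sq_part (0 + h) - sq_part 0) / h) \<le> \<bar>h\<bar>"
        by (rule always_eventually) (auto simp: sq_part_def max_def power2_eq_square)
      show "((\<lambda>h::real. \<bar>h\<bar>) \<longlongrightarrow> 0) (at 0)" by (intro tendsto_rabs_zero tendsto_ident_at)
    qed
    thus ?thesis unfolding DERIV_def 3 by simp
  qed
qed

lemma sq_part_continuous: "continuous_on UNIV sq_part"
  unfolding sq_part_def[abs_def] by (intro continuous_intros)

text \<open>A product of two such functions is positive exactly between \<open>R\<close> and R +
  1/(n+1); dividing by its integral gives mass 1. C1 regularity is what \<open>pole_kernel\<close>
  asks of a kernel.\<close>

lemma bump_kernel:
  fixes R :: real
  obtains \<kappa> \<kappa>' P where "\<And>n t. (\<kappa> n has_real_derivative \<kappa>' n t) (at t)"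
    "\<And>n. continuous_on UNIV (\<kappa>' n)" "level_kernel \<kappa> P R" "\<And>n. (LINT t|lborel. \<kappa> n t) = 1"
proof -
  define \<epsilon> where "\<epsilon> n = 1 / real (Suc n)" for n
  have \<epsilon>: "0 < \<epsilon> n" for n by (simp add: \<epsilon>_def)
  define k where "k n t = sq_part (t - R) * sq_part (R + \<epsilon> n - t)" for n t
  define k' where "k' n t = 2 * max 0 (t - R) * sq_part (R + \<epsilon> n - t) + sq_part (t - R) * - (2 * max 0 (R + \<epsilon> n - t))" for n t
  have kd: "(k n has_real_derivative k' n t) (at t)" for n t
  proof -
    have 1: "((\<lambda>t. sq_part (t - R)) has_real_derivative 2 * max 0 (t - R)) (at t)"
    proof -
      have "((\<lambda>t. t - R) has_real_derivative 1) (at t)" by (auto intro!: derivative_eq_intros)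
      from DERIV_chain2[OF sq_part_derivative this] show ?thesis by simp
    qed
    have 2: "((\<lambda>t. sq_part (R + \<epsilon> n - t)) has_real_derivative - (2 * max 0 (R + \<epsilon> n - t))) (at t)"
    proof -
      have "((\<lambda>t. R + \<epsilon> n - t) has_real_derivative - 1) (at t)" by (auto intro!: derivative_eq_intros)
      from DERIV_chain2[OF sq_part_derivative this] show ?thesis by simp
    qed
    show ?thesis unfolding k_def[abs_def] k'_def
      using DERIV_mult[OF 1 2] by (simp add: algebra_simps)
  qed
  have sc: "continuous_on UNIV (\<lambda>t. sq_part (q t))" if "continuous_on UNIV q" for q :: "real \<Rightarrow> real"
    by (rule continuous_on_compose2[OF sq_part_continuous that]) simp
  have kc: "continuous_on UNIV (k n)" "continuous_on UNIV (k' n)" for n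
    unfolding k_def[abs_def] k'_def[abs_def] by (intro continuous_intros sc)+
  have k0: "0 \<le> k n t" for n t by (simp add: k_def sq_part_nonneg)
  have ks: "k n t \<noteq> 0 \<longleftrightarrow> R < t \<and> t < R + \<epsilon> n" for n t by (auto simp: k_def sq_part_eq_0)
  define m where "m n = (LINT t|lborel. k n t)" for n
  have ki: "k n t = 0" if "t \<notin> {R..R + \<epsilon> n}" for n t using ks[of n t] that by auto
  have m: "0 < m n" for n
  proof -
    \<comment> \<open>The mass is positive because a primitive with positive derivative inside the
      interval increases strictly from 0 to the mass.\<close>
    define K where "K t = (LINT \<tau>|lborel. k n \<tau> * indicator {..<t} \<tau>)" for t
    have K: "(K has_real_derivative k n t) (at t)" "t \<le> R \<Longrightarrow> K t = 0"
      "R + \<epsilon> n \<le> t \<Longrightarrow> K t = (LINT \<tau>|lborel. k n \<tau>)" for t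
      unfolding K_def[abs_def] using continuous_primitive[where k = "k n" and a = R and b = "R + \<epsilon> n" and t = t, OF kc(1) ki] by simp_all
    have "K R < K (R + \<epsilon> n)"
    proof (rule DERIV_pos_imp_increasing_open[of R "R + \<epsilon> n" K])
      show "R < R + \<epsilon> n" using \<epsilon>[of n] by simp
      show "\<exists>y. (K has_real_derivative y) (at x) \<and> 0 < y" if "R < x" "x < R + \<epsilon> n" for x
        using K(1)[of x] k0[of n x] ks[of n x] that by (intro exI[of _ "k n x"]) (auto simp: less_le)
      show "continuous_on {R..R + \<epsilon> n} K"
        by (intro continuous_at_imp_continuous_on ballI) (rule DERIV_isCont[OF K(1)])
    qed
    thus ?thesis using K(2)[of R] K(3)[of "R + \<epsilon> n"] by (simp add: m_def)
  qed
  define \<kappa> where "\<kappa> n t = k n t / m n" for n t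
  define \<kappa>' where "\<kappa>' n t = k' n t / m n" for n t
  define P where "P n t = (LINT \<tau>|lborel. \<kappa> n \<tau> * indicator {..<t} \<tau>)" for n t
  have \<kappa>c: "continuous_on UNIV (\<kappa> n)" for n
    unfolding \<kappa>_def[abs_def] using m[of n] by (intro continuous_intros kc(1)) auto
  have \<kappa>i: "\<kappa> n t = 0" if "t \<notin> {R..R + \<epsilon> n}" for n t using ki[OF that] by (simp add: \<kappa>_def)
  have one: "(LINT t|lborel. \<kappa> n t) = 1" for n
    using m[of n] by (simp add: \<kappa>_def m_def)
  have P: "(P n has_real_derivative \<kappa> n t) (at t)" "t \<le> R \<Longrightarrow> P n t = 0"
    "R + \<epsilon> n \<le> t \<Longrightarrow> P n t = (LINT \<tau>|lborel. \<kappa> n \<tau>)" for n t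
    unfolding P_def[abs_def] using continuous_primitive[where k = "\<kappa> n" and a = R and b = "R + \<epsilon> n" and t = t, OF \<kappa>c \<kappa>i] by simp_all
  show thesis
  proof (rule that[of \<kappa> \<kappa>' P])
    show "(\<kappa> n has_real_derivative \<kappa>' n t) (at t)" for n t
      unfolding \<kappa>_def[abs_def] \<kappa>'_def using DERIV_cdivide[OF kd] .
    show "continuous_on UNIV (\<kappa>' n)" for n
      unfolding \<kappa>'_def[abs_def] using m[of n] by (intro continuous_intros kc(2)) auto
    show "level_kernel \<kappa> P R"
    proof
      show "continuous_on UNIV (\<kappa> n)" for n by (rule \<kappa>c)
      show "0 \<le> \<kappa> n t" for n t using k0[of n t] m[of n] by (simp add: \<kappa>_def)
      show "R < t \<and> t < R + 1 / real (Suc n)" if "\<kappa> n t \<noteq> 0" for n t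
        using ks[of n t] that by (auto simp: \<kappa>_def \<epsilon>_def)
      show "(P n has_real_derivative \<kappa> n t) (at t)" for n t by (rule P(1))
      show "P n t = 0" if "t \<le> R" for n t by (rule P(2)[OF that])
      show "P n t = 1" if "R + 1 / real (Suc n) \<le> t" for n t
        using P(3)[of n t] that one[of n] by (simp add: \<epsilon>_def)
    qed
    show "(LINT t|lborel. \<kappa> n t) = 1" for n by (rule one)
  qed
qed

context pole_setting
begin

text \<open>With the weight energy / |grad G| times \<open>u\<close>, the band integral of
  \<open>band_limit\<close> is the left side of \<open>kernel_identity\<close>. One limit is the
  surface integral, the other is \<open>mean R\<close>.\<close>

lemma surface_mean_formula:
  assumes N: "1 < CARD('n)" and R: "s0 < R"
    and regular: "\<And>x. x \<in> W \<Longrightarrow> s0 \<le> G x \<Longrightarrow> grad G x \<noteq> 0"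
  shows "set_integrable (hausdorff_measure (CARD('n) - 1)) {x \<in> W. G x = R} (\<lambda>x. energy x / norm (grad G x) * u x)"
    "(LINT x:{x \<in> W. G x = R}|hausdorff_measure (CARD('n) - 1). energy x / norm (grad G x) * u x) = mean R"
proof -
  let ?H = "hausdorff_measure (CARD('n) - 1) :: (real ^ 'n) measure"
  let ?w = "\<lambda>x. energy x / norm (grad G x) * u x"
  obtain \<kappa> \<kappa>' P where \<kappa>: "\<And>n t. (\<kappa> n has_real_derivative \<kappa>' n t) (at t)" "\<And>n. continuous_on UNIV (\<kappa>' n)"
    and lk: "level_kernel \<kappa> P R" and one: "\<And>n. (LINT t|lborel. \<kappa> n t) = 1"
    using bump_kernel by metis
  interpret level_kernel \<kappa> P R by (rule lk)
  have pk: "pole_kernel A b c f u G D x0 s0 (\<kappa> n) (\<kappa>' n) R (R + 1 / real (Suc n))" for n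
  proof (intro pole_kernel.intro pole_kernel_axioms.intro pole_setting_axioms \<kappa>)
    show "s0 \<le> R" using R by simp
    show "\<kappa> n t = 0" if "t \<notin> {R..R + 1 / real (Suc n)}" for t using kernel_support[of n t] that by fastforce
  qed
  \<comment> \<open>On this smaller open set the gradient does not vanish, so the quotient defining
    the weight is continuous; since s0 < R it still contains the level set and all bands.\<close>
  let ?U = "region s0"
  have Ueq: "{x \<in> ?U. G x = R} = {x \<in> W. G x = R}" using R by (auto simp: region_def)
  have UW: "?U \<subseteq> W" by (auto simp: region_def)
  have G1: "Ck_on 1 W G" using G2 Ck_on_Suc_D[of 1 W G] by (simp add: numeral_2_eq_2)
  have G1U: "Ck_on 1 ?U G" by (rule Ck_on_subset[OF G1 UW])
  have reg: "grad G x \<noteq> 0" if "x \<in> ?U" for x using that by (intro regular) (auto simp: region_def)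
  have wc: "continuous_on ?U ?w"
  proof (intro continuous_on_mult continuous_on_divide)
    show "continuous_on ?U energy" by (rule continuous_on_subset[OF energy_cont UW])
    show "continuous_on ?U u" by (rule continuous_on_subset[OF u_cont]) (use UW in auto)
    show "continuous_on ?U (\<lambda>x. norm (grad G x))" by (intro continuous_on_norm continuous_on_grad G1U)
    show "\<forall>x\<in>?U. norm (grad G x) \<noteq> 0" using reg by simp
  qed
  have cT: "compact {x \<in> ?U. R \<le> G x \<and> G x \<le> R + 1}"
  proof -
    let ?C = "{x \<in> ?U. R \<le> G x \<and> G x \<le> R + 1}"
    obtain e where e: "0 < e" "ball x0 e \<subseteq> D" "\<forall>x\<in>ball x0 e - {x0}. R + 1 < G x" using blowup by blast
    have "open (W \<inter> G -` {..<R})" "open (W \<inter> G -` {R + 1<..})"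
      by (intro continuous_open_preimage G_cont open_W open_lessThan open_greaterThan)+
    hence o: "open ((W \<inter> G -` {..<R}) \<union> (W \<inter> G -` {R + 1<..}) \<union> ball x0 e)" by (intro open_Un open_ball)
    have far: "x \<notin> ball x0 e" if "x \<noteq> x0" "G x \<le> R + 1" for x using e(3) that by force
    have near: "x0 \<in> ball x0 e" using e(1) by simp
    have "?C = C - ((W \<inter> G -` {..<R}) \<union> (W \<inter> G -` {R + 1<..}) \<union> ball x0 e)"
      using R far near by (auto simp: C_def region_def simp del: mem_ball centre_in_ball)
    thus ?thesis using compact_diff[OF compact_C o] by simp
  qed
  \<comment> \<open>\<open>band_limit\<close> requires a nonnegative weight, so the positive and the
    negative part are treated separately.\<close>
  define w1 where "w1 x = max 0 (?w x)" for x
  define w2 where "w2 x = max 0 (- ?w x)" for x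
  have wpm: "w1 x - w2 x = ?w x" for x by (simp add: w1_def w2_def max_def)
  have w12: "continuous_on ?U w1" "continuous_on ?U w2" "0 \<le> w1 x" "0 \<le> w2 x" for x
    unfolding w1_def[abs_def] w2_def[abs_def] using wc by (auto intro!: continuous_on_max continuous_on_minus)
  have b1: "set_integrable ?H {x \<in> W. G x = R} w1"
    "(\<lambda>n. LINT x:?U|lborel. \<kappa> n (G x) * w1 x * norm (grad G x)) \<longlonglongrightarrow> (LINT x:{x \<in> W. G x = R}|?H. w1 x)"
    using band_limit[OF N open_region G1U reg cT w12(1) w12(3)] unfolding Ueq by simp_all
  have b2: "set_integrable ?H {x \<in> W. G x = R} w2"
    "(\<lambda>n. LINT x:?U|lborel. \<kappa> n (G x) * w2 x * norm (grad G x)) \<longlonglongrightarrow> (LINT x:{x \<in> W. G x = R}|?H. w2 x)"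
    using band_limit[OF N open_region G1U reg cT w12(2) w12(4)] unfolding Ueq by simp_all
  show "set_integrable ?H {x \<in> W. G x = R} ?w"
    using set_integral_diff(1)[OF b1(1) b2(1)] unfolding wpm .
  have S: "(LINT x:{x \<in> W. G x = R}|?H. ?w x) = (LINT x:{x \<in> W. G x = R}|?H. w1 x) - (LINT x:{x \<in> W. G x = R}|?H. w2 x)"
    using set_integral_diff(2)[OF b1(1) b2(1)] unfolding wpm .
  have band: "(LINT x:?U|lborel. \<kappa> n (G x) * w1 x * norm (grad G x)) - (LINT x:?U|lborel. \<kappa> n (G x) * w2 x * norm (grad G x)) =
      (LINT \<tau>|lborel. \<kappa> n \<tau> * mean \<tau>)" for n
  proof -
    let ?g = "\<lambda>x. indicator W x *\<^sub>R (u x * \<kappa> n (G x) * energy x)"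
    have ig: "integrable lborel ?g"
      using pole_kernel.energy_compact[OF pk] unfolding set_integrable_def .
    have e1: "indicator ?U x *\<^sub>R (\<kappa> n (G x) * w1 x * norm (grad G x)) = max 0 (?g x)"
      "indicator ?U x *\<^sub>R (\<kappa> n (G x) * w2 x * norm (grad G x)) = max 0 (- ?g x)" for x
    proof -
      have k: "0 \<le> \<kappa> n (G x)" by (rule kernel_nonneg)
      have max_scale: "\<kappa> n (G x) * max 0 s * norm (grad G x) = max 0 (\<kappa> n (G x) * s * norm (grad G x))" for s
        using k by (auto simp: max_def mult_nonneg_nonneg mult_nonneg_nonpos mult_nonpos_nonneg
            zero_le_mult_iff mult_le_0_iff not_le)
      have "indicator ?U x *\<^sub>R (\<kappa> n (G x) * w1 x * norm (grad G x)) = max 0 (?g x) \<and>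
        indicator ?U x *\<^sub>R (\<kappa> n (G x) * w2 x * norm (grad G x)) = max 0 (- ?g x)"
      proof (cases "x \<in> ?U")
        case True
        hence "x \<in> W" "norm (grad G x) \<noteq> 0" using UW reg by auto
        thus ?thesis using True unfolding w1_def w2_def max_scale by (simp add: mult_ac)
      next
        case False
        hence "x \<notin> W \<or> \<kappa> n (G x) = 0" using kernel_support[of n "G x"] R by (force simp: region_def)
        thus ?thesis using False by auto
      qed
      thus "indicator ?U x *\<^sub>R (\<kappa> n (G x) * w1 x * norm (grad G x)) = max 0 (?g x)"
        "indicator ?U x *\<^sub>R (\<kappa> n (G x) * w2 x * norm (grad G x)) = max 0 (- ?g x)" by blast+
    qed
    have i: "integrable lborel (\<lambda>x. max 0 (?g x))" "integrable lborel (\<lambda>x. max 0 (- ?g x))"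
      using ig by (auto intro!: integrable_max)
    have "(LINT x:?U|lborel. \<kappa> n (G x) * w1 x * norm (grad G x)) - (LINT x:?U|lborel. \<kappa> n (G x) * w2 x * norm (grad G x)) =
        (LINT x|lborel. max 0 (?g x) - max 0 (- ?g x))"
      unfolding set_lebesgue_integral_def e1 using i by (subst Bochner_Integration.integral_diff) auto
    also have "\<dots> = (LINT x:W|lborel. u x * \<kappa> n (G x) * energy x)"
      unfolding set_lebesgue_integral_def by (intro Bochner_Integration.integral_cong) (auto simp: max_def)
    also have "\<dots> = (LINT \<tau>|lborel. \<kappa> n \<tau> * mean \<tau>)" by (rule pole_kernel.kernel_identity(2)[OF pk])
    finally show ?thesis .
  qed
  have "(\<lambda>n. LINT \<tau>|lborel. \<kappa> n \<tau> * mean \<tau>) \<longlonglongrightarrow>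
      (LINT x:{x \<in> W. G x = R}|?H. w1 x) - (LINT x:{x \<in> W. G x = R}|?H. w2 x)"
    unfolding band[symmetric] by (intro tendsto_diff b1(2) b2(2))
  \<comment> \<open>The kernels are probability densities concentrating at \<open>R\<close> from the
    right, so right continuity of \<open>mean\<close> is sufficient.\<close>
  moreover have "(\<lambda>n. LINT \<tau>|lborel. \<kappa> n \<tau> * mean \<tau>) \<longlonglongrightarrow> mean R"
  proof (rule LIMSEQ_I)
    fix e :: real assume e: "0 < e"
    have "\<forall>\<^sub>F \<tau> in at_right R. dist (mean \<tau>) (mean R) < e / 2"
      using e R by (intro tendstoD mean_right_continuous) auto
    then obtain d where d: "R < d" "\<And>\<tau>. R < \<tau> \<Longrightarrow> \<tau> < d \<Longrightarrow> dist (mean \<tau>) (mean R) < e / 2"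
      unfolding eventually_at_right_field by blast
    have "(\<lambda>n. R + inverse (real (Suc n))) \<longlonglongrightarrow> R + 0" by (intro tendsto_intros LIMSEQ_inverse_real_of_nat)
    hence "\<forall>\<^sub>F n in sequentially. R + inverse (real (Suc n)) < d" by (rule order_tendstoD) (use d in simp)
    then obtain n0 where n0: "\<And>n. n \<ge> n0 \<Longrightarrow> R + inverse (real (Suc n)) < d" by (auto simp: eventually_sequentially)
    show "\<exists>n0. \<forall>n\<ge>n0. norm ((LINT \<tau>|lborel. \<kappa> n \<tau> * mean \<tau>) - mean R) < e"
    proof (intro exI[of _ n0] allI impI)
      fix n assume n: "n \<ge> n0"
      have i1: "integrable lborel (\<kappa> n)" using pole_kernel.\<kappa>_compact[OF pk, of "\<lambda>_. 1"] by simp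
      note i2 = pole_kernel.kernel_identity(1)[OF pk, of n]
      have "(LINT \<tau>|lborel. \<kappa> n \<tau> * mean \<tau>) - mean R = (LINT \<tau>|lborel. \<kappa> n \<tau> * mean \<tau> - \<kappa> n \<tau> * mean R)"
        using i1 i2 one[of n] by (subst Bochner_Integration.integral_diff) auto
      also have "\<bar>\<dots>\<bar> \<le> (LINT \<tau>|lborel. \<kappa> n \<tau> * (e / 2))"
      proof (rule integral_abs_bound_integral)
        show "integrable lborel (\<lambda>\<tau>. \<kappa> n \<tau> * mean \<tau> - \<kappa> n \<tau> * mean R)" using i1 i2 by auto
        show "integrable lborel (\<lambda>\<tau>. \<kappa> n \<tau> * (e / 2))" using i1 by auto
        fix \<tau>
        show "\<bar>\<kappa> n \<tau> * mean \<tau> - \<kappa> n \<tau> * mean R\<bar> \<le> \<kappa> n \<tau> * (e / 2)"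
        proof (cases "\<kappa> n \<tau> = 0")
          case False
          hence "R < \<tau>" "\<tau> < d" using kernel_support[OF False] n0[OF n] by (auto simp: inverse_eq_divide)
          hence "\<bar>mean \<tau> - mean R\<bar> \<le> e / 2" using d(2)[of \<tau>] by (simp add: dist_real_def)
          hence "\<kappa> n \<tau> * \<bar>mean \<tau> - mean R\<bar> \<le> \<kappa> n \<tau> * (e / 2)" by (intro mult_left_mono kernel_nonneg)
          thus ?thesis using kernel_nonneg[of n \<tau>] by (simp add: right_diff_distrib[symmetric] abs_mult)
        qed simp
      qed
      also have "\<dots> = e / 2" using one[of n] by simp
      finally show "norm ((LINT \<tau>|lborel. \<kappa> n \<tau> * mean \<tau>) - mean R) < e" using e by simp
    qed
  qed
  ultimately show "(LINT x:{x \<in> W. G x = R}|?H. ?w x) = mean R"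
    unfolding S by (rule LIMSEQ_unique)
qed

end

section \<open>The solid mean formula\<close>

text \<open>The substitution \<tau> = 1 / \<rho>^m, a decreasing bijection from (0, r) onto the half
  line above 1 / r^m.\<close>

lemma set_integral_reciprocal_power:
  fixes g :: "real \<Rightarrow> real"
  assumes r: "0 < r" and m: "0 < m" and [measurable]: "g \<in> borel_measurable borel"
    and i: "set_integrable lborel {1 / r ^ m<..} g"
  shows "set_integrable lborel {0<..<r} (\<lambda>\<rho>. real m / \<rho> ^ Suc m * g (1 / \<rho> ^ m))"
    "(LINT \<rho>:{0<..<r}|lborel. real m / \<rho> ^ Suc m * g (1 / \<rho> ^ m)) = (LINT \<tau>:{1 / r ^ m<..}|lborel. g \<tau>)"
proof -
  let ?S = "{0<..<r}" and ?T = "{1 / r ^ m<..}"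
  define q where "q \<rho> = 1 / \<rho> ^ m" for \<rho> :: real
  define q' where "q' \<rho> = - (real m / \<rho> ^ Suc m)" for \<rho> :: real
  have qd: "(q has_real_derivative q' \<rho>) (at \<rho> within ?S)" if "\<rho> \<in> ?S" for \<rho>
  proof -
    have "((\<lambda>\<rho>. inverse (\<rho> ^ m)) has_real_derivative - (real m * \<rho> ^ (m - 1)) * inverse ((\<rho> ^ m) ^ Suc (Suc 0))) (at \<rho> within ?S)"
      using that by (auto intro!: derivative_eq_intros)
    moreover have "- (real m * \<rho> ^ (m - 1)) * inverse ((\<rho> ^ m) ^ Suc (Suc 0)) = q' \<rho>"
      using m that by (cases m) (auto simp: q'_def field_simps)
    moreover have "q = (\<lambda>\<rho>. inverse (\<rho> ^ m))" by (auto simp: q_def inverse_eq_divide)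
    ultimately show ?thesis by simp
  qed
  have less: "q t < q s" if "0 < s" "s < t" for s t
    unfolding q_def using that m by (intro divide_strict_left_mono power_strict_mono) auto
  have inj: "inj_on q ?S"
  proof (rule linorder_inj_onI)
    fix s t assume "s < t" "s \<in> ?S" "t \<in> ?S"
    thus "q s \<noteq> q t" using less[of s t] by simp
  qed auto
  have image: "q ` ?S = ?T"
  proof
    show "q ` ?S \<subseteq> ?T" using less[of _ r] by (auto simp: q_def)
    show "?T \<subseteq> q ` ?S"
    proof
      fix \<tau> assume \<tau>: "\<tau> \<in> ?T"
      hence \<tau>0: "0 < \<tau>" using r by (auto intro: less_trans[of _ "1 / r ^ m"])
      let ?\<rho> = "root m (1 / \<tau>)"
      have p: "?\<rho> ^ m = 1 / \<tau>" using m \<tau>0 by (intro real_root_pow_pos2) auto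
      have "1 / \<tau> < r ^ m" using \<tau> \<tau>0 r by (simp add: field_simps)
      hence "?\<rho> < r" using p r m by (intro power_less_imp_less_base[of ?\<rho> m r]) auto
      moreover have "0 < ?\<rho>" using m \<tau>0 by simp
      ultimately have "?\<rho> \<in> ?S" by simp
      moreover have "\<tau> = q ?\<rho>" by (simp only: q_def p) simp
      ultimately show "\<tau> \<in> q ` ?S" by (rule rev_image_eqI)
    qed
  qed
  \<comment> \<open>The change of variables theorem concerns the completed measure; Borel
    measurability of both integrands allows the passage there and back.\<close>
  have bm: "(\<lambda>\<tau>. indicator ?T \<tau> *\<^sub>R g \<tau>) \<in> borel_measurable lborel" by measurable
  have bs: "(\<lambda>\<rho>. indicator ?S \<rho> *\<^sub>R (real m / \<rho> ^ Suc m * g (1 / \<rho> ^ m))) \<in> borel_measurable lborel" by measurable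
  have iT: "g absolutely_integrable_on ?T"
    using i unfolding set_integrable_def integrable_completion[OF bm] .
  have vT: "(LINT \<tau>:?T|lborel. g \<tau>) = integral ?T g"
    using set_lebesgue_integral_eq_integral(2)[OF iT] unfolding set_lebesgue_integral_def integral_completion[OF bm] .
  have eq: "\<bar>q' \<rho>\<bar> * g (q \<rho>) = real m / \<rho> ^ Suc m * g (1 / \<rho> ^ m)" if "\<rho> \<in> ?S" for \<rho>
    using that by (simp add: q'_def q_def)
  have S: "(\<lambda>\<rho>. \<bar>q' \<rho>\<bar> * g (q \<rho>)) absolutely_integrable_on ?S \<and>
      integral ?S (\<lambda>\<rho>. \<bar>q' \<rho>\<bar> * g (q \<rho>)) = integral ?T g"
    using iT has_absolute_integral_change_of_variables_1'[OF _ qd inj, of g "integral ?T g"] unfolding image by simp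
  have "(\<lambda>\<rho>. \<bar>q' \<rho>\<bar> * g (q \<rho>)) absolutely_integrable_on ?S \<longleftrightarrow>
      (\<lambda>\<rho>. real m / \<rho> ^ Suc m * g (1 / \<rho> ^ m)) absolutely_integrable_on ?S"
    by (rule set_integrable_cong[OF refl refl eq])
  hence iS: "(\<lambda>\<rho>. real m / \<rho> ^ Suc m * g (1 / \<rho> ^ m)) absolutely_integrable_on ?S" using S by simp
  show "set_integrable lborel ?S (\<lambda>\<rho>. real m / \<rho> ^ Suc m * g (1 / \<rho> ^ m))"
    using iS unfolding set_integrable_def integrable_completion[OF bs] .
  have "(LINT \<rho>:?S|lborel. real m / \<rho> ^ Suc m * g (1 / \<rho> ^ m)) = integral ?S (\<lambda>\<rho>. real m / \<rho> ^ Suc m * g (1 / \<rho> ^ m))"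
    using set_lebesgue_integral_eq_integral(2)[OF iS] unfolding set_lebesgue_integral_def integral_completion[OF bs] .
  also have "\<dots> = integral ?S (\<lambda>\<rho>. \<bar>q' \<rho>\<bar> * g (q \<rho>))" by (intro integral_cong) (simp add: eq)
  finally show "(LINT \<rho>:?S|lborel. real m / \<rho> ^ Suc m * g (1 / \<rho> ^ m)) = (LINT \<tau>:?T|lborel. g \<tau>)"
    using S vT by simp
qed

lemma set_integral_power_Ioo:
  assumes "0 \<le> r"
  shows "set_integrable lborel {0<..<r} (\<lambda>\<rho>. \<rho> ^ k :: real)" "(LINT \<rho>:{0<..<r}|lborel. \<rho> ^ k) = r ^ Suc k / real (Suc k)"
proof -
  have "set_integrable lborel {0..r} (\<lambda>\<rho>. \<rho> ^ k)" by (intro borel_integrable_atLeastAtMost' continuous_intros)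
  thus "set_integrable lborel {0<..<r} (\<lambda>\<rho>. \<rho> ^ k)" by (rule set_integrable_subset) auto
  have "(LINT \<rho>:{0<..<r}|lborel. \<rho> ^ k) = (LINT \<rho>|lborel. \<rho> ^ k * indicator {0..r} \<rho>)"
    unfolding set_lebesgue_integral_def
  proof (rule integral_cong_AE)
    have "AE \<rho> in lborel. \<rho> \<noteq> 0" "AE \<rho> in lborel. \<rho> \<noteq> r" by (rule AE_lborel_singleton)+
    thus "AE \<rho> in lborel. indicator {0<..<r} \<rho> *\<^sub>R \<rho> ^ k = \<rho> ^ k * indicator {0..r} \<rho>"
      by eventually_elim (auto simp: indicator_def)
  qed measurable
  thus "(LINT \<rho>:{0<..<r}|lborel. \<rho> ^ k) = r ^ Suc k / real (Suc k)" using integral_power[OF assms, of k] by simp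
qed

lemma set_integrable_Ioo_bounded:
  fixes g :: "real \<Rightarrow> real"
  assumes [measurable]: "g \<in> borel_measurable borel" and "\<And>\<rho>. a < \<rho> \<Longrightarrow> \<rho> < b \<Longrightarrow> \<bar>g \<rho>\<bar> \<le> B"
  shows "set_integrable lborel {a<..<b} g"
  unfolding set_integrable_def
proof (rule Bochner_Integration.integrable_bound)
  have "emeasure lborel {a<..<b} < \<infinity>" by (rule emeasure_bounded_finite) simp
  thus "integrable lborel (\<lambda>\<rho>. B * indicator {a<..<b} \<rho>)"
    by (intro integrable_mult_right integrable_real_indicator) auto
  show "AE \<rho> in lborel. norm (indicator {a<..<b} \<rho> *\<^sub>R g \<rho>) \<le> norm (B * indicator {a<..<b} \<rho>)"
    using assms(2) by (intro AE_I2) (auto simp: indicator_def intro: order_trans[OF _ abs_ge_self])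
qed measurable

text \<open>The cutoff is S / (1 + S) with S equal to \<open>n\<close> times a bump on the interval
  from \<open>R\<close> to \<open>n\<close>. At each t > R the bump is bounded below for large
  \<open>n\<close>, so S tends to infinity and the cutoff to 1. It vanishes up to R > 0, which
  removes the singularity of the power at 0.\<close>

lemma cutoff_kernel:
  fixes R p :: real
  assumes R: "0 < R"
  obtains \<theta> \<kappa>' where
    "\<And>n t. ((\<lambda>t. \<theta> n t * t powr - p) has_real_derivative \<kappa>' n t) (at t)" "\<And>n. continuous_on UNIV (\<kappa>' n)"
    "\<And>n t. t \<notin> {R..real n} \<Longrightarrow> \<theta> n t = 0" "\<And>n t. t \<le> R \<Longrightarrow> \<theta> n t = 0"
    "\<And>n t. 0 \<le> \<theta> n t" "\<And>n t. \<theta> n t \<le> 1" "\<And>t. R < t \<Longrightarrow> (\<lambda>n. \<theta> n t) \<longlonglongrightarrow> 1"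
    "\<And>n. continuous_on UNIV (\<theta> n)"
proof -
  define S where "S n t = real n * (sq_part (t - R) * sq_part (real n - t))" for n t
  define S' where "S' n t = real n * (2 * max 0 (t - R) * sq_part (real n - t) - sq_part (t - R) * (2 * max 0 (real n - t)))" for n t
  define \<theta> where "\<theta> n t = S n t / (1 + S n t)" for n t
  define \<theta>' where "\<theta>' n t = S' n t / (1 + S n t)\<^sup>2" for n t
  define \<kappa>' where "\<kappa>' n t = \<theta>' n t * t powr - p + \<theta> n t * (- p * t powr (- p - 1))" for n t
  have Sd: "(S n has_real_derivative S' n t) (at t)" for n t
  proof -
    have 1: "((\<lambda>t. sq_part (t - R)) has_real_derivative 2 * max 0 (t - R)) (at t)"
    proof -
      have "((\<lambda>t. t - R) has_real_derivative 1) (at t)" by (auto intro!: derivative_eq_intros)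
      from DERIV_chain2[OF sq_part_derivative this] show ?thesis by simp
    qed
    have 2: "((\<lambda>t. sq_part (real n - t)) has_real_derivative - (2 * max 0 (real n - t))) (at t)"
    proof -
      have "((\<lambda>t. real n - t) has_real_derivative - 1) (at t)" by (auto intro!: derivative_eq_intros)
      from DERIV_chain2[OF sq_part_derivative this] show ?thesis by simp
    qed
    show ?thesis unfolding S_def[abs_def] S'_def
      using DERIV_cmult[OF DERIV_mult[OF 1 2], of "real n"] by (simp add: algebra_simps)
  qed
  have S0: "0 \<le> S n t" for n t by (simp add: S_def sq_part_nonneg)
  have Sz: "S n t = 0" "S' n t = 0" if "t \<le> R" for n t
    using that sq_part_eq_0[of "t - R"] by (auto simp: S_def S'_def)
  have Sz': "S n t = 0" if "real n < t" for n t using that sq_part_eq_0[of "real n - t"] by (auto simp: S_def)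
  have \<theta>d: "(\<theta> n has_real_derivative \<theta>' n t) (at t)" for n t
  proof -
    have nz: "1 + S n t \<noteq> 0" using S0[of n t] by linarith
    have "((\<lambda>t. S n t / (1 + S n t)) has_real_derivative
        (S' n t * (1 + S n t) - S n t * (0 + S' n t)) / ((1 + S n t) * (1 + S n t))) (at t)"
      by (intro DERIV_divide Sd DERIV_add DERIV_const nz)
    thus ?thesis unfolding \<theta>_def[abs_def] \<theta>'_def by (simp add: algebra_simps power2_eq_square)
  qed
  have \<theta>z: "\<theta> n t = 0" "\<theta>' n t = 0" if "t \<le> R" for n t using Sz[OF that] by (simp_all add: \<theta>_def \<theta>'_def)
  have sc: "continuous_on UNIV (\<lambda>t. sq_part (q t))" if "continuous_on UNIV q" for q :: "real \<Rightarrow> real"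
    by (rule continuous_on_compose2[OF sq_part_continuous that]) simp
  have Sc: "continuous_on UNIV (S n)" "continuous_on UNIV (S' n)" for n
    unfolding S_def[abs_def] S'_def[abs_def] by (intro continuous_intros sc)+
  have nz: "1 + S n t \<noteq> 0" for n t using S0[of n t] by linarith
  have \<theta>c: "continuous_on UNIV (\<theta> n)" "continuous_on UNIV (\<theta>' n)" for n
    unfolding \<theta>_def[abs_def] \<theta>'_def[abs_def] using nz by (intro continuous_intros Sc; simp)+
  show thesis
  proof (rule that[of \<theta> \<kappa>'])
    show "((\<lambda>t. \<theta> n t * t powr - p) has_real_derivative \<kappa>' n t) (at t)" for n t
    proof (cases "0 < t")
      case True
      show ?thesis unfolding \<kappa>'_def
        using DERIV_mult[OF \<theta>d has_real_derivative_powr[OF True, of "- p"], of n] by (simp add: algebra_simps)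
    next
      case False
      \<comment> \<open>For t <= 0 the product vanishes in a whole neighbourhood, because the cutoff
        is zero below \<open>R\<close>.\<close>
      have "\<forall>\<^sub>F s in nhds t. s \<in> {..<R}" by (rule eventually_nhds_in_open) (use False R in auto)
      hence "\<forall>\<^sub>F s in nhds t. \<theta> n s * s powr - p = 0" by eventually_elim (simp add: \<theta>z)
      hence "((\<lambda>s. \<theta> n s * s powr - p) has_real_derivative 0) (at t) \<longleftrightarrow> ((\<lambda>_. 0) has_real_derivative 0) (at t)"
        by (intro DERIV_cong_ev) auto
      moreover have "\<kappa>' n t = 0" using False R by (simp add: \<kappa>'_def \<theta>z)
      ultimately show ?thesis by simp
    qed
    show "continuous_on UNIV (\<kappa>' n)" for n
    proof -
      have "continuous_on {0<..} (\<kappa>' n)" unfolding \<kappa>'_def[abs_def]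
        by (intro continuous_intros continuous_on_subset[OF \<theta>c(1)] continuous_on_subset[OF \<theta>c(2)]) auto
      moreover have "continuous_on {..<R} (\<kappa>' n)"
        using continuous_on_cong[of "{..<R}" "{..<R}" "\<kappa>' n" "\<lambda>_. 0"] by (simp add: \<kappa>'_def \<theta>z)
      ultimately have "continuous_on ({0<..} \<union> {..<R}) (\<kappa>' n)" by (intro continuous_on_open_Un) auto
      moreover have "{0<..} \<union> {..<R} = (UNIV :: real set)" using R by auto
      ultimately show ?thesis by simp
    qed
    show "\<theta> n t = 0" if "t \<notin> {R..real n}" for n t
      using that \<theta>z(1)[of t n] Sz'[of n t] by (cases "t < R") (auto simp: \<theta>_def)
    show "\<theta> n t = 0" if "t \<le> R" for n t by (rule \<theta>z(1)[OF that])
    show "0 \<le> \<theta> n t" for n t using S0[of n t] by (simp add: \<theta>_def)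
    show "\<theta> n t \<le> 1" for n t using S0[of n t] by (simp add: \<theta>_def)
    show "continuous_on UNIV (\<theta> n)" for n by (rule \<theta>c)
    show "(\<lambda>n. \<theta> n t) \<longlonglongrightarrow> 1" if t: "R < t" for t
    proof -
      let ?a = "sq_part (t - R)"
      have a: "0 < ?a" using t sq_part_nonneg[of "t - R"] sq_part_eq_0[of "t - R"] by linarith
      have "(\<lambda>n. \<theta> n t - 1) \<longlonglongrightarrow> 0"
      proof (rule Lim_null_comparison)
        obtain k :: nat where k: "t + 1 \<le> real k" using real_arch_simple by blast
        have "norm (\<theta> n t - 1) \<le> 1 / ?a * inverse (real n)" if n: "max 1 k \<le> n" for n
        proof -
          have n1: "1 \<le> real n" "t + 1 \<le> real n" using n k by linarith+
          have "1\<^sup>2 \<le> (max 0 (real n - t))\<^sup>2" by (intro power_mono) (use n1 in auto)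
          hence "1 \<le> sq_part (real n - t)" by (simp add: sq_part_def)
          hence "real n * (?a * 1) \<le> S n t" unfolding S_def using a by (intro mult_left_mono) auto
          hence "1 / (1 + S n t) \<le> 1 / (real n * ?a)" using n1 a by (intro frac_le) auto
          moreover have "\<theta> n t - 1 = - (1 / (1 + S n t))" using nz[of n t] by (simp add: \<theta>_def field_simps)
          ultimately show ?thesis using S0[of n t] by (simp add: inverse_eq_divide mult.commute)
        qed
        thus "\<forall>\<^sub>F n in sequentially. norm (\<theta> n t - 1) \<le> 1 / ?a * inverse (real n)"
          unfolding eventually_sequentially by blast
        show "(\<lambda>n. 1 / ?a * inverse (real n)) \<longlonglongrightarrow> 0"
          using tendsto_mult_right_zero[OF lim_inverse_n, of "1 / ?a"] by simp
      qed
      thus ?thesis by (simp add: LIM_zero_iff)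
    qed
  qed
qed

context pole_setting
begin

lemma mean_measurable: "mean \<in> borel_measurable borel"
  unfolding mean_def[abs_def] using terms_measurable by measurable

text \<open>\<open>kernel_identity\<close> is applied to cutoffs of the power with exponent -p. The
  assumed bound makes the limiting integrand bounded on the compact set \<open>C\<close>, hence
  integrable up to the pole, and both sides pass to the limit by domination.\<close>

lemma volume_mean_formula:
  fixes p r B :: real
  defines "p \<equiv> 2 * (real CARD('n) - 1) / (real CARD('n) - 2)"
  assumes N: "2 < CARD('n)" and r: "0 < r" "s0 \<le> 1 / r ^ (CARD('n) - 2)"
    and B: "\<And>x. x \<in> W \<Longrightarrow> s0 \<le> G x \<Longrightarrow> \<bar>energy x\<bar> \<le> B * G x powr p"
  shows "set_integrable lborel (region (1 / r ^ (CARD('n) - 2))) (\<lambda>x. energy x / G x powr p * u x)"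
    "(LINT x:region (1 / r ^ (CARD('n) - 2))|lborel. energy x / G x powr p * u x) =
      real (CARD('n) - 2) * (LINT \<rho>:{0<..<r}|lborel. \<rho> ^ (CARD('n) - 1) * mean (1 / \<rho> ^ (CARD('n) - 2)))"
proof -
  define m where "m = CARD('n) - 2"
  define R where "R = 1 / r ^ m"
  have m: "0 < m" "CARD('n) - 1 = Suc m" "CARD('n) - 2 = m" "real CARD('n) = real m + 2" using N by (auto simp: m_def)
  have p: "p * real m = 2 * real (Suc m)" using m(1) unfolding p_def m(4) by simp
  have R: "0 < R" "s0 \<le> R" using r by (auto simp: R_def m_def)
  obtain \<theta> \<kappa>' where d: "\<And>n t. ((\<lambda>t. \<theta> n t * t powr - p) has_real_derivative \<kappa>' n t) (at t)"
      "\<And>n. continuous_on UNIV (\<kappa>' n)"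
    and supp: "\<And>n t. t \<notin> {R..real n} \<Longrightarrow> \<theta> n t = 0" "\<And>n t. t \<le> R \<Longrightarrow> \<theta> n t = 0"
    and \<theta>01: "\<And>n t. 0 \<le> \<theta> n t" "\<And>n t. \<theta> n t \<le> 1"
    and lim: "\<And>t. R < t \<Longrightarrow> (\<lambda>n. \<theta> n t) \<longlonglongrightarrow> 1" and \<theta>c: "\<And>n. continuous_on UNIV (\<theta> n)"
    by (rule cutoff_kernel[OF R(1), of p]) (rule that; assumption)
  define \<kappa> where "\<kappa> n t = \<theta> n t * t powr - p" for n t
  have pk: "pole_kernel A b c f u G D x0 s0 (\<kappa> n) (\<kappa>' n) R (real n)" for n
  proof (intro pole_kernel.intro pole_kernel_axioms.intro pole_setting_axioms)
    show "(\<kappa> n has_real_derivative \<kappa>' n t) (at t)" for t unfolding \<kappa>_def[abs_def] by (rule d)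
    show "continuous_on UNIV (\<kappa>' n)" by (rule d)
    show "s0 \<le> R" by (rule R)
    show "\<kappa> n t = 0" if "t \<notin> {R..real n}" for t using supp(1)[OF that] by (simp add: \<kappa>_def)
  qed
  note K = pole_kernel.kernel_identity[OF pk]
  have UW: "region R \<subseteq> W" by (auto simp: region_def)
  have pos: "0 < G x" if "x \<in> region R" for x using that R by (auto simp: region_def)
  let ?w = "\<lambda>x. energy x / G x powr p * u x"
  obtain M where M: "0 \<le> M" "\<forall>x\<in>C. \<bar>u x\<bar> \<le> M" using bounded_on_C[OF u_cont] by blast
  let ?s = "\<lambda>n x. indicator W x *\<^sub>R (u x * \<kappa> n (G x) * energy x)" and ?l = "\<lambda>x. indicator (region R) x *\<^sub>R ?w x"
  \<comment> \<open>The approximating integrand is the limit times a cutoff with values between 0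
    and 1, so the limit itself dominates.\<close>
  have sl: "?s n x = \<theta> n (G x) * ?l x" for n x
  proof (cases "x \<in> region R")
    case True
    moreover from True have "x \<in> W" using UW by blast
    ultimately show ?thesis using pos[OF True] by (simp add: \<kappa>_def powr_minus divide_simps)
  next
    case False
    hence "x \<notin> W \<or> \<kappa> n (G x) = 0" using supp(2)[of "G x" n] by (auto simp: region_def \<kappa>_def)
    thus ?thesis using False by auto
  qed
  have lb: "\<bar>?l x\<bar> \<le> \<bar>B\<bar> * M * indicator C x" for x
  proof (cases "x \<in> region R")
    case True
    hence x: "x \<in> W" "s0 \<le> G x" "x \<in> C" using R by (auto simp: region_def C_def)
    have gp: "0 < G x powr p" using pos[OF True] by simp
    have "\<bar>energy x\<bar> \<le> \<bar>B\<bar> * G x powr p"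
      using B[OF x(1,2)] gp by (meson abs_ge_self mult_right_mono order_trans less_imp_le)
    hence "\<bar>energy x / G x powr p\<bar> \<le> \<bar>B\<bar>" using gp by (simp add: abs_divide pos_divide_le_eq)
    hence "\<bar>energy x / G x powr p\<bar> * \<bar>u x\<bar> \<le> \<bar>B\<bar> * M" using M x by (intro mult_mono) auto
    thus ?thesis using True x by (simp add: abs_mult)
  qed (use M in \<open>auto simp: indicator_def\<close>)
  have lm: "?l \<in> borel_measurable lborel"
  proof -
    have "continuous_on (region R) ?w"
    proof (intro continuous_on_mult continuous_on_divide continuous_on_powr continuous_on_const)
      show "continuous_on (region R) energy" by (rule continuous_on_subset[OF energy_cont UW])
      show "continuous_on (region R) G" by (rule continuous_on_subset[OF G_cont UW])
      show "continuous_on (region R) u" by (rule continuous_on_subset[OF u_cont]) (use UW in auto)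
      show "\<forall>x\<in>region R. G x \<noteq> 0" "\<forall>x\<in>region R. G x powr p \<noteq> 0" using pos by force+
    qed
    from borel_measurable_on_open[OF open_region this] show ?thesis by simp
  qed
  have Ci: "integrable lborel (\<lambda>x. \<bar>B\<bar> * M * indicator C x)"
    using compact_C emeasure_compact_finite[OF compact_C]
    by (intro integrable_mult_right integrable_real_indicator) (auto simp: borel_compact)
  have li: "integrable lborel ?l"
    by (rule Bochner_Integration.integrable_bound[OF Ci lm]) (use lb M in \<open>auto simp: abs_mult intro: order_trans\<close>)
  thus wi: "set_integrable lborel (region (1 / r ^ (CARD('n) - 2))) ?w"
    unfolding set_integrable_def R_def m(3) .
  have L: "(\<lambda>n. LINT x:W|lborel. u x * \<kappa> n (G x) * energy x) \<longlonglongrightarrow> (LINT x:region R|lborel. ?w x)"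
    unfolding set_lebesgue_integral_def
  proof (rule integral_dominated_convergence)
    show "?l \<in> borel_measurable lborel" by (rule lm)
    show "?s n \<in> borel_measurable lborel" for n
      using pole_kernel.energy_compact[OF pk, of n] unfolding set_integrable_def by (rule borel_measurable_integrable)
    show "integrable lborel (\<lambda>x. \<bar>?l x\<bar>)" by (rule integrable_abs[OF li])
    show "AE x in lborel. norm (?s n x) \<le> \<bar>?l x\<bar>" for n
    proof (rule AE_I2)
      fix x
      have "\<bar>\<theta> n (G x)\<bar> * \<bar>?l x\<bar> \<le> 1 * \<bar>?l x\<bar>" using \<theta>01[of n "G x"] by (intro mult_right_mono) auto
      thus "norm (?s n x) \<le> \<bar>?l x\<bar>" unfolding sl real_norm_def by (simp add: abs_mult)
    qed
    show "AE x in lborel. (\<lambda>n. ?s n x) \<longlonglongrightarrow> ?l x"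
    proof (rule AE_I2)
      fix x
      show "(\<lambda>n. ?s n x) \<longlonglongrightarrow> ?l x"
      proof (cases "x \<in> region R")
        case True
        hence "(\<lambda>n. \<theta> n (G x) * ?l x) \<longlonglongrightarrow> 1 * ?l x"
          by (intro tendsto_mult lim tendsto_const) (simp add: region_def)
        thus ?thesis unfolding sl by simp
      next
        case False
        hence "?l x = 0" by simp
        thus ?thesis unfolding sl by (simp only: mult_zero_right tendsto_const)
      qed
    qed
  qed
  have [measurable]: "mean \<in> borel_measurable borel" by (rule mean_measurable)
  have \<kappa>m [measurable]: "\<kappa> n \<in> borel_measurable borel" for n
    by (rule borel_measurable_continuous_onI)
       (intro continuous_at_imp_continuous_on ballI DERIV_isCont[OF d(1)[folded \<kappa>_def]])
  have [measurable]: "\<theta> n \<in> borel_measurable borel" for n by (rule borel_measurable_continuous_onI[OF \<theta>c])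
  let ?k = "\<lambda>\<rho>. \<rho> ^ Suc m * mean (1 / \<rho> ^ m)"
  \<comment> \<open>Since p m = 2 (m + 1), the power contributes \<rho>^(2(m+1)), of which the
    Jacobian m / \<rho>^(m+1) leaves m \<rho>^(m+1).\<close>
  have sub: "real m / \<rho> ^ Suc m * (\<kappa> n (1 / \<rho> ^ m) * mean (1 / \<rho> ^ m)) = \<theta> n (1 / \<rho> ^ m) * (real m * ?k \<rho>)"
    if \<rho>: "\<rho> \<in> {0<..<r}" for n \<rho>
  proof -
    have "(1 / \<rho> ^ m) powr - p = (\<rho> powr real m) powr p"
      using \<rho> by (simp add: powr_realpow powr_minus_divide powr_divide)
    also have "\<dots> = \<rho> powr (2 * real (Suc m))" by (simp only: powr_powr p[symmetric] mult.commute[of p])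
    also have "\<dots> = \<rho> ^ (2 * Suc m)" using \<rho> powr_realpow[of \<rho> "2 * Suc m"] by simp
    also have "\<dots> = \<rho> ^ Suc m * \<rho> ^ Suc m" by (simp add: mult_2 power_add)
    finally have "(1 / \<rho> ^ m) powr - p = \<rho> ^ Suc m * \<rho> ^ Suc m" .
    moreover have "\<rho> ^ Suc m \<noteq> 0" using \<rho> by simp
    ultimately show ?thesis unfolding \<kappa>_def by (simp del: power_Suc)
  qed
  have rhs: "(LINT \<tau>|lborel. \<kappa> n \<tau> * mean \<tau>) = (LINT \<rho>:{0<..<r}|lborel. \<theta> n (1 / \<rho> ^ m) * (real m * ?k \<rho>))" for n
  proof -
    have z: "indicator {R<..} \<tau> *\<^sub>R (\<kappa> n \<tau> * mean \<tau>) = \<kappa> n \<tau> * mean \<tau>" for \<tau>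
      using supp(2)[of \<tau> n] by (cases "\<tau> \<le> R") (auto simp: \<kappa>_def)
    have i: "set_integrable lborel {R<..} (\<lambda>\<tau>. \<kappa> n \<tau> * mean \<tau>)"
      using K(1)[of n] unfolding set_integrable_def z .
    have "(LINT \<tau>|lborel. \<kappa> n \<tau> * mean \<tau>) = (LINT \<tau>:{R<..}|lborel. \<kappa> n \<tau> * mean \<tau>)"
      unfolding set_lebesgue_integral_def z ..
    also have "\<dots> = (LINT \<rho>:{0<..<r}|lborel. real m / \<rho> ^ Suc m * (\<kappa> n (1 / \<rho> ^ m) * mean (1 / \<rho> ^ m)))"
      using set_integral_reciprocal_power(2)[OF r(1) m(1) _ i[unfolded R_def]] unfolding R_def by simp
    also have "\<dots> = (LINT \<rho>:{0<..<r}|lborel. \<theta> n (1 / \<rho> ^ m) * (real m * ?k \<rho>))"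
      by (rule set_lebesgue_integral_cong) (use sub in auto)
    finally show ?thesis .
  qed
  obtain B' where B': "0 \<le> B'" "\<forall>\<tau>\<ge>s0. \<bar>source_term \<tau>\<bar> \<le> B' \<and> \<bar>\<tau> * zero_order_term \<tau>\<bar> \<le> B'"
    using terms_bound by blast
  have large: "R < 1 / \<rho> ^ m" if "\<rho> \<in> {0<..<r}" for \<rho>
    unfolding R_def using that m(1) by (intro divide_strict_left_mono power_strict_mono) auto
  \<comment> \<open>No singularity arises at \<rho> = 0: by \<open>terms_bound\<close> the function
    \<open>mean\<close> is bounded on all levels from \<open>s0\<close> on.\<close>
  have ki: "set_integrable lborel {0<..<r} (\<lambda>\<rho>. real m * ?k \<rho>)"
  proof (rule set_integrable_Ioo_bounded)
    fix \<rho> assume \<rho>: "0 < \<rho>" "\<rho> < r"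
    hence "s0 \<le> 1 / \<rho> ^ m" using large[of \<rho>] R by simp
    hence "\<bar>source_term (1 / \<rho> ^ m)\<bar> \<le> B'" "\<bar>1 / \<rho> ^ m * zero_order_term (1 / \<rho> ^ m)\<bar> \<le> B'" using B' by blast+
    hence "\<bar>mean (1 / \<rho> ^ m)\<bar> \<le> \<bar>u x0\<bar> + B' + B'" unfolding mean_def by linarith
    moreover have "\<bar>\<rho> ^ Suc m\<bar> \<le> r ^ Suc m" unfolding power_abs using \<rho> by (intro power_mono) auto
    ultimately have "\<bar>\<rho> ^ Suc m\<bar> * \<bar>mean (1 / \<rho> ^ m)\<bar> \<le> r ^ Suc m * (\<bar>u x0\<bar> + B' + B')"
      using r by (intro mult_mono) auto
    thus "\<bar>real m * ?k \<rho>\<bar> \<le> real m * (r ^ Suc m * (\<bar>u x0\<bar> + B' + B'))"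
      unfolding abs_mult by (simp add: mult_left_mono)
  qed measurable
  have L': "(\<lambda>n. LINT \<rho>:{0<..<r}|lborel. \<theta> n (1 / \<rho> ^ m) * (real m * ?k \<rho>)) \<longlonglongrightarrow> (LINT \<rho>:{0<..<r}|lborel. real m * ?k \<rho>)"
    unfolding set_lebesgue_integral_def
  proof (rule integral_dominated_convergence)
    show "integrable lborel (\<lambda>\<rho>. \<bar>indicator {0<..<r} \<rho> *\<^sub>R (real m * ?k \<rho>)\<bar>)"
      using ki unfolding set_integrable_def by (rule integrable_abs)
    show "AE \<rho> in lborel. norm (indicator {0<..<r} \<rho> *\<^sub>R (\<theta> n (1 / \<rho> ^ m) * (real m * ?k \<rho>))) \<le>
        \<bar>indicator {0<..<r} \<rho> *\<^sub>R (real m * ?k \<rho>)\<bar>" for n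
    proof (rule AE_I2)
      fix \<rho>
      have "\<bar>\<theta> n (1 / \<rho> ^ m)\<bar> * \<bar>real m * ?k \<rho>\<bar> \<le> 1 * \<bar>real m * ?k \<rho>\<bar>"
        using \<theta>01[of n "1 / \<rho> ^ m"] by (intro mult_right_mono) auto
      hence "\<bar>\<theta> n (1 / \<rho> ^ m) * (real m * ?k \<rho>)\<bar> \<le> \<bar>real m * ?k \<rho>\<bar>" by (simp only: abs_mult mult_1)
      thus "norm (indicator {0<..<r} \<rho> *\<^sub>R (\<theta> n (1 / \<rho> ^ m) * (real m * ?k \<rho>))) \<le>
        \<bar>indicator {0<..<r} \<rho> *\<^sub>R (real m * ?k \<rho>)\<bar>" by (cases "\<rho> \<in> {0<..<r}") simp_all
    qed
    show "AE \<rho> in lborel. (\<lambda>n. indicator {0<..<r} \<rho> *\<^sub>R (\<theta> n (1 / \<rho> ^ m) * (real m * ?k \<rho>))) \<longlonglongrightarrow>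
        indicator {0<..<r} \<rho> *\<^sub>R (real m * ?k \<rho>)"
    proof (rule AE_I2)
      fix \<rho>
      show "(\<lambda>n. indicator {0<..<r} \<rho> *\<^sub>R (\<theta> n (1 / \<rho> ^ m) * (real m * ?k \<rho>))) \<longlonglongrightarrow>
        indicator {0<..<r} \<rho> *\<^sub>R (real m * ?k \<rho>)"
      proof (cases "\<rho> \<in> {0<..<r}")
        case True
        have "(\<lambda>n. indicator {0<..<r} \<rho> *\<^sub>R (\<theta> n (1 / \<rho> ^ m) * (real m * ?k \<rho>))) \<longlonglongrightarrow>
          indicator {0<..<r} \<rho> *\<^sub>R (1 * (real m * ?k \<rho>))"
          by (intro tendsto_scaleR tendsto_mult tendsto_const lim large True)
        thus ?thesis by simp
      next
        case False
        hence "indicator {0<..<r} \<rho> = (0::real)" by simp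
        thus ?thesis by (simp only:) simp
      qed
    qed
  qed measurable
  have "(LINT x:region R|lborel. ?w x) = (LINT \<rho>:{0<..<r}|lborel. real m * ?k \<rho>)"
    by (rule LIMSEQ_unique[OF L]) (use L' in \<open>simp only: K(2) rhs\<close>)
  thus "(LINT x:region (1 / r ^ (CARD('n) - 2))|lborel. ?w x) =
      real (CARD('n) - 2) * (LINT \<rho>:{0<..<r}|lborel. \<rho> ^ (CARD('n) - 1) * mean (1 / \<rho> ^ (CARD('n) - 2)))"
    unfolding m(2,3) R_def by simp
qed

text \<open>The three parts of \<open>mean\<close> are integrated separately against \<rho>^(N-1).
  The constant part gives r^N / N times \<open>u x0\<close>, the origin of the normalisation N /
  r^N; in the zero order part the factor 1 / \<rho>^(N-2) leaves the weight \<rho>.\<close>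

lemma ball_mean_formula:
  fixes p r B :: real
  defines "p \<equiv> 2 * (real CARD('n) - 1) / (real CARD('n) - 2)"
  assumes N: "2 < CARD('n)" and r: "0 < r" "s0 \<le> 1 / r ^ (CARD('n) - 2)"
    and B: "\<And>x. x \<in> W \<Longrightarrow> s0 \<le> G x \<Longrightarrow> \<bar>energy x\<bar> \<le> B * G x powr p"
  shows "set_integrable lborel {0<..<r} (\<lambda>\<rho>. \<rho> ^ (CARD('n) - 1) * source_term (1 / \<rho> ^ (CARD('n) - 2)))"
    "set_integrable lborel {0<..<r} (\<lambda>\<rho>. \<rho> * zero_order_term (1 / \<rho> ^ (CARD('n) - 2)))"
    "u x0 = 1 / r ^ CARD('n) * (LINT x:region (1 / r ^ (CARD('n) - 2))|lborel.
          real CARD('n) / (real CARD('n) - 2) * (energy x / G x powr p) * u x)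
      + real CARD('n) / r ^ CARD('n) *
          (LINT \<rho>:{0<..<r}|lborel. \<rho> ^ (CARD('n) - 1) * source_term (1 / \<rho> ^ (CARD('n) - 2)))
      + real CARD('n) / r ^ CARD('n) * (LINT \<rho>:{0<..<r}|lborel. \<rho> * zero_order_term (1 / \<rho> ^ (CARD('n) - 2)))"
proof -
  define m where "m = CARD('n) - 2"
  have m: "0 < m" "CARD('n) - 1 = Suc m" "CARD('n) - 2 = m" "CARD('n) = Suc (Suc m)" using N by (auto simp: m_def)
  obtain B' where B': "0 \<le> B'" "\<forall>\<tau>\<ge>s0. \<bar>source_term \<tau>\<bar> \<le> B' \<and> \<bar>\<tau> * zero_order_term \<tau>\<bar> \<le> B'"
    using terms_bound by blast
  have large: "s0 \<le> 1 / \<rho> ^ m" if "0 < \<rho>" "\<rho> < r" for \<rho>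
  proof -
    have "1 / r ^ m \<le> 1 / \<rho> ^ m" using that by (intro divide_left_mono power_mono) auto
    thus ?thesis using r(2) by (simp add: m)
  qed
  have pw: "\<bar>\<rho> ^ Suc m\<bar> \<le> r ^ Suc m" if "0 < \<rho>" "\<rho> < r" for \<rho>
    unfolding power_abs using that by (intro power_mono) auto
  note [measurable] = terms_measurable
  have i1: "set_integrable lborel {0<..<r} (\<lambda>\<rho>. \<rho> ^ Suc m * source_term (1 / \<rho> ^ m))"
  proof (rule set_integrable_Ioo_bounded)
    fix \<rho> assume \<rho>: "0 < \<rho>" "\<rho> < r"
    show "\<bar>\<rho> ^ Suc m * source_term (1 / \<rho> ^ m)\<bar> \<le> r ^ Suc m * B'"
      unfolding abs_mult using pw[OF \<rho>] large[OF \<rho>] B' r by (intro mult_mono) auto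
  qed measurable
  have i2: "set_integrable lborel {0<..<r} (\<lambda>\<rho>. \<rho> * zero_order_term (1 / \<rho> ^ m))"
  proof (rule set_integrable_Ioo_bounded)
    fix \<rho> assume \<rho>: "0 < \<rho>" "\<rho> < r"
    have "\<rho> * zero_order_term (1 / \<rho> ^ m) = \<rho> ^ Suc m * (1 / \<rho> ^ m * zero_order_term (1 / \<rho> ^ m))" using \<rho> by simp
    also have "\<bar>\<dots>\<bar> \<le> r ^ Suc m * B'"
      unfolding abs_mult[of "\<rho> ^ Suc m"] using pw[OF \<rho>] large[OF \<rho>] B' r by (intro mult_mono) auto
    finally show "\<bar>\<rho> * zero_order_term (1 / \<rho> ^ m)\<bar> \<le> r ^ Suc m * B'" .
  qed measurable
  show "set_integrable lborel {0<..<r} (\<lambda>\<rho>. \<rho> ^ (CARD('n) - 1) * source_term (1 / \<rho> ^ (CARD('n) - 2)))"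
    "set_integrable lborel {0<..<r} (\<lambda>\<rho>. \<rho> * zero_order_term (1 / \<rho> ^ (CARD('n) - 2)))"
    unfolding m(2,3) by (fact i1 i2)+
  note i0 = set_integral_power_Ioo[OF less_imp_le[OF r(1)], of "Suc m"]
  let ?S = "LINT \<rho>:{0<..<r}|lborel. \<rho> ^ Suc m * source_term (1 / \<rho> ^ m)"
    and ?Z = "LINT \<rho>:{0<..<r}|lborel. \<rho> * zero_order_term (1 / \<rho> ^ m)"
    and ?V = "LINT x:region (1 / r ^ m)|lborel. energy x / G x powr p * u x"
  have "(LINT \<rho>:{0<..<r}|lborel. \<rho> ^ Suc m * mean (1 / \<rho> ^ m)) =
      (LINT \<rho>:{0<..<r}|lborel. \<rho> ^ Suc m * u x0 - \<rho> ^ Suc m * source_term (1 / \<rho> ^ m) - \<rho> * zero_order_term (1 / \<rho> ^ m))"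
    by (rule set_lebesgue_integral_cong) (auto simp: mean_def field_simps)
  also have "\<dots> = r ^ Suc (Suc m) / real (Suc (Suc m)) * u x0 - ?S - ?Z"
    using i0 i1 i2 by (simp add: set_integral_diff set_integrable_mult_left del: power_Suc)
  finally have "?V = real m * (r ^ Suc (Suc m) / real (Suc (Suc m)) * u x0 - ?S - ?Z)"
    using volume_mean_formula(2)[OF N r B[unfolded p_def]] unfolding m(2,3) p_def by simp
  moreover have "r ^ Suc (Suc m) \<noteq> 0" using r by simp
  moreover have "U = 1 / E * (K / M * V) + K / E * S + K / E * Z"
    if "V = M * (E / K * U - S - Z)" "E \<noteq> 0" "M \<noteq> 0" "K \<noteq> 0" for U E K M V S Z :: real
    using that by (simp add: field_simps)
  ultimately have "u x0 = 1 / r ^ Suc (Suc m) * (real (Suc (Suc m)) / real m * ?V)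
      + real (Suc (Suc m)) / r ^ Suc (Suc m) * ?S + real (Suc (Suc m)) / r ^ Suc (Suc m) * ?Z"
    using m(1) by simp
  moreover have "(LINT x:region (1 / r ^ m)|lborel. real (Suc (Suc m)) / real m * (energy x / G x powr p) * u x) =
      real (Suc (Suc m)) / real m * ?V"
    by (simp only: mult.assoc set_integral_mult_right)
  ultimately show "u x0 = 1 / r ^ CARD('n) * (LINT x:region (1 / r ^ (CARD('n) - 2))|lborel.
          real CARD('n) / (real CARD('n) - 2) * (energy x / G x powr p) * u x)
      + real CARD('n) / r ^ CARD('n) *
          (LINT \<rho>:{0<..<r}|lborel. \<rho> ^ (CARD('n) - 1) * source_term (1 / \<rho> ^ (CARD('n) - 2)))
      + real CARD('n) / r ^ CARD('n) * (LINT \<rho>:{0<..<r}|lborel. \<rho> * zero_order_term (1 / \<rho> ^ (CARD('n) - 2)))"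
    unfolding m(2,3) unfolding m(4) by simp
qed

end

section \<open>Behaviour at the pole\<close>

lemma bounded_hoelder_continuous:
  assumes "0 < \<alpha>" "bounded_hoelder \<alpha> g"
  shows "continuous_on UNIV g"
proof -
  obtain K where K: "\<And>x y. \<bar>g x - g y\<bar> \<le> K * norm (x - y) powr \<alpha>"
    using assms(2) unfolding bounded_hoelder_def by blast
  have "isCont g x" for x
  proof -
    have "((\<lambda>y. g y - g x) \<longlongrightarrow> 0) (at x)"
    proof (rule Lim_null_comparison)
      show "\<forall>\<^sub>F y in at x. norm (g y - g x) \<le> K * norm (y - x) powr \<alpha>"
        using K by (intro always_eventually) simp
      have "((\<lambda>y. norm (y - x)) \<longlongrightarrow> 0) (at x)" by (intro tendsto_norm_zero LIM_zero tendsto_ident_at)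
      hence "((\<lambda>y. norm (y - x) powr \<alpha>) \<longlongrightarrow> 0) (at x)"
        by (rule tendsto_zero_powrI[OF _ tendsto_const]) (use assms in auto)
      thus "((\<lambda>y. K * norm (y - x) powr \<alpha>) \<longlongrightarrow> 0) (at x)" by (rule tendsto_mult_right_zero)
    qed
    thus ?thesis unfolding isCont_def by (rule LIM_zero_cancel)
  qed
  thus ?thesis by (intro continuous_at_imp_continuous_on ballI)
qed

lemma set_integral_insert:
  fixes g :: "'a::euclidean_space \<Rightarrow> real"
  shows "set_integrable lborel (insert a S) g \<longleftrightarrow> set_integrable lborel S g"
    "(LINT x:insert a S|lborel. g x) = (LINT x:S|lborel. g x)"
  unfolding set_integrable_def set_lebesgue_integral_def
  by (rule integrable_discrete_difference[of "{a}"] integral_discrete_difference[of "{a}"]; auto simp: indicator_def)+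

text \<open>At distance d from the pole the correction terms are c0 d^\<alpha> relative to the
  leading power, so for small d they cost at most half of the lower constant. Larger distances are
  excluded by choosing the level \<open>s0\<close> above all values of \<open>G\<close>
  there.\<close>

lemma pole_bounds:
  fixes G :: "real ^ 'n \<Rightarrow> real"
  assumes N: "2 < CARD('n)" and \<alpha>: "0 < \<alpha>" "\<alpha> \<le> 1" and D: "open D" "x0 \<in> D"
    and c: "0 < cm" "0 < cp" "0 < c0"
    and est: "\<And>x. x \<in> D \<Longrightarrow> x \<noteq> x0 \<Longrightarrow>
      cm / norm (x - x0) powr (real CARD('n) - 2) - c0 / norm (x - x0) powr (real CARD('n) - 2 - \<alpha>) \<le> G x \<and>
      G x \<le> cp / norm (x - x0) powr (real CARD('n) - 2) + c0 / norm (x - x0) powr (real CARD('n) - 2 - \<alpha>) \<and>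
      cm / norm (x - x0) powr (real CARD('n) - 1) - c0 / norm (x - x0) powr (real CARD('n) - 1 - \<alpha>) \<le> norm (grad G x) \<and>
      norm (grad G x) \<le> cp / norm (x - x0) powr (real CARD('n) - 1) + c0 / norm (x - x0) powr (real CARD('n) - 1 - \<alpha>)"
  obtains \<delta> s0 k K where "0 < \<delta>" "\<delta> \<le> 1" "0 < s0" "0 < k" "0 < K" "cball x0 \<delta> \<subseteq> D"
    "\<And>x. x \<in> D \<Longrightarrow> x \<noteq> x0 \<Longrightarrow> s0 \<le> G x \<Longrightarrow> norm (x - x0) < \<delta>"
    "\<And>x. x \<noteq> x0 \<Longrightarrow> norm (x - x0) \<le> \<delta> \<Longrightarrow> k / norm (x - x0) ^ (CARD('n) - 2) \<le> G x"
    "\<And>x. x \<noteq> x0 \<Longrightarrow> norm (x - x0) \<le> \<delta> \<Longrightarrow> k / norm (x - x0) ^ (CARD('n) - 1) \<le> norm (grad G x)"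
    "\<And>x. x \<noteq> x0 \<Longrightarrow> norm (x - x0) \<le> \<delta> \<Longrightarrow> norm (grad G x) \<le> K / norm (x - x0) ^ (CARD('n) - 1)"
proof -
  obtain \<delta>1 where \<delta>1: "0 < \<delta>1" "cball x0 \<delta>1 \<subseteq> D" using D open_contains_cball by blast
  \<comment> \<open>The solution of c0 \<delta>2^\<alpha> = cm / 2.\<close>
  define \<delta>2 where "\<delta>2 = (cm / (2 * c0)) powr (1 / \<alpha>)"
  define \<delta> where "\<delta> = min 1 (min \<delta>1 \<delta>2)"
  have \<delta>2: "0 < \<delta>2" using c by (simp add: \<delta>2_def)
  have \<delta>: "0 < \<delta>" "\<delta> \<le> 1" "\<delta> \<le> \<delta>1" "\<delta> \<le> \<delta>2" using \<delta>1 \<delta>2 by (auto simp: \<delta>_def)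
  \<comment> \<open>The upper estimate of \<open>G\<close> at distance \<delta>, plus 1 for
    strictness. Both exponents are nonnegative, as N >= 3 and \<alpha> <= 1, so the estimate
    decreases with the distance.\<close>
  define s0 where "s0 = cp / \<delta> powr (real CARD('n) - 2) + c0 / \<delta> powr (real CARD('n) - 2 - \<alpha>) + 1"
  have s0: "0 < s0" unfolding s0_def using c \<delta>(1) by (intro add_nonneg_pos add_nonneg_nonneg) auto
  have small: "c0 * d powr \<alpha> \<le> cm / 2" "c0 * d powr \<alpha> \<le> c0" if "0 < d" "d \<le> \<delta>" for d
  proof -
    have "d powr \<alpha> \<le> \<delta>2 powr \<alpha>" using that \<alpha> \<delta> by (intro powr_mono2) auto
    also have "\<dots> = cm / (2 * c0)" using \<alpha> c by (simp add: \<delta>2_def powr_powr)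
    finally show "c0 * d powr \<alpha> \<le> cm / 2" using c by (simp add: field_simps)
    have "d powr \<alpha> \<le> 1 powr \<alpha>" using that \<alpha> \<delta> by (intro powr_mono2) auto
    thus "c0 * d powr \<alpha> \<le> c0" using c by simp
  qed
  have lower: "cm / 2 / d ^ j \<le> cm / d powr q - c0 / d powr (q - \<alpha>)"
    and upper: "cp / d powr q + c0 / d powr (q - \<alpha>) \<le> (cp + c0) / d ^ j"
    if d: "0 < d" "d \<le> \<delta>" and q: "q = real j" for d q j
  proof -
    have e: "d powr q = d ^ j" "c0 / d powr (q - \<alpha>) = c0 * d powr \<alpha> / d ^ j"
      using d by (simp_all add: q powr_diff powr_realpow)
    have dj: "0 < d ^ j" using d by simp
    have "cm / 2 / d ^ j \<le> (cm - c0 * d powr \<alpha>) / d ^ j" using small[OF d] dj by (intro divide_right_mono) auto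
    thus "cm / 2 / d ^ j \<le> cm / d powr q - c0 / d powr (q - \<alpha>)" unfolding e by (simp add: diff_divide_distrib)
    have "(cp + c0 * d powr \<alpha>) / d ^ j \<le> (cp + c0) / d ^ j" using small[OF d] dj by (intro divide_right_mono) auto
    thus "cp / d powr q + c0 / d powr (q - \<alpha>) \<le> (cp + c0) / d ^ j" unfolding e by (simp add: add_divide_distrib)
  qed
  have n: "real CARD('n) - 2 = real (CARD('n) - 2)" "real CARD('n) - 1 = real (CARD('n) - 1)" using N by auto
  have inD: "x \<in> D" "0 < norm (x - x0)" if "x \<noteq> x0" "norm (x - x0) \<le> \<delta>" for x
  proof -
    have "x \<in> cball x0 \<delta>1" using that \<delta>(3) by (simp add: dist_norm norm_minus_commute)
    thus "x \<in> D" using \<delta>1(2) by blast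
  qed (use that in simp)
  show thesis
  proof (rule that[of \<delta> s0 "cm / 2" "cp + c0"])
    show "0 < \<delta>" "\<delta> \<le> 1" "0 < s0" "0 < cm / 2" "0 < cp + c0" using \<delta> s0 c by auto
    show "cball x0 \<delta> \<subseteq> D" using \<delta>1(2) \<delta>(3) subset_cball[of \<delta> \<delta>1 x0] by blast
    show "norm (x - x0) < \<delta>" if x: "x \<in> D" "x \<noteq> x0" "s0 \<le> G x" for x
    proof (rule ccontr)
      assume "\<not> norm (x - x0) < \<delta>"
      hence d: "\<delta> \<le> norm (x - x0)" by simp
      have "cp / norm (x - x0) powr (real CARD('n) - 2) \<le> cp / \<delta> powr (real CARD('n) - 2)"
        using d \<delta> N c by (intro divide_left_mono powr_mono2 mult_pos_pos) auto
      moreover have "c0 / norm (x - x0) powr (real CARD('n) - 2 - \<alpha>) \<le> c0 / \<delta> powr (real CARD('n) - 2 - \<alpha>)"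
        using d \<delta> N c \<alpha> by (intro divide_left_mono powr_mono2 mult_pos_pos) auto
      ultimately show False using est[OF x(1,2)] x(3) unfolding s0_def by linarith
    qed
    fix x assume x: "x \<noteq> x0" "norm (x - x0) \<le> \<delta>"
    note e = est[OF inD(1)[OF x] x(1)] and l = lower[OF inD(2)[OF x] x(2)] and u = upper[OF inD(2)[OF x] x(2)]
    show "cm / 2 / norm (x - x0) ^ (CARD('n) - 2) \<le> G x" using e l[OF n(1)] by linarith
    show "cm / 2 / norm (x - x0) ^ (CARD('n) - 1) \<le> norm (grad G x)" using e l[OF n(2)] by linarith
    show "norm (grad G x) \<le> (cp + c0) / norm (x - x0) ^ (CARD('n) - 1)" using e u[OF n(2)] by linarith
  qed
qed

text \<open>As (N - 2) p = 2 (N - 1), the lower bound of \<open>G\<close> raised to the power p and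
  the squared upper bound of the gradient carry the same power of the distance.\<close>

lemma energy_bound:
  fixes k K L d g G e :: real
  assumes "2 < N" "0 < d" "0 < k" "0 \<le> L" "k / d ^ (N - 2) \<le> G" "0 \<le> g" "g \<le> K / d ^ (N - 1)" "0 \<le> e" "e \<le> L * g\<^sup>2"
  defines "p \<equiv> 2 * (real N - 1) / (real N - 2)"
  shows "\<bar>e\<bar> \<le> L * K\<^sup>2 / k powr p * G powr p"
proof -
  have p: "0 \<le> p" "real (N - 2) * p = real (2 * (N - 1))" using assms(1) by (simp_all add: p_def of_nat_diff)
  have "(d ^ (N - 2)) powr p = d powr (real (N - 2) * p)" using assms(2) by (simp add: powr_powr powr_realpow[symmetric])
  also have "\<dots> = d ^ (2 * (N - 1))" unfolding p(2) using assms(2) by (rule powr_realpow)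
  also have "\<dots> = (d ^ (N - 1))\<^sup>2" by (simp add: power_mult[symmetric] mult.commute)
  finally have dp: "(d ^ (N - 2)) powr p = (d ^ (N - 1))\<^sup>2" .
  have "k powr p / (d ^ (N - 1))\<^sup>2 = (k / d ^ (N - 2)) powr p" using assms(2,3) dp by (simp add: powr_divide)
  also have "\<dots> \<le> G powr p" using assms(2,3,5) p(1) by (intro powr_mono2) auto
  finally have low: "k powr p / (d ^ (N - 1))\<^sup>2 \<le> G powr p" .
  have "e \<le> L * g\<^sup>2" by fact
  also have "\<dots> \<le> L * (K / d ^ (N - 1))\<^sup>2" using assms(4,6,7) by (intro mult_left_mono power_mono) auto
  also have "\<dots> = L * K\<^sup>2 / k powr p * (k powr p / (d ^ (N - 1))\<^sup>2)" using assms(2,3) by (simp add: power_divide)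
  also have "\<dots> \<le> L * K\<^sup>2 / k powr p * G powr p" using assms(3,4) low by (intro mult_left_mono) auto
  finally show ?thesis using assms(8) by simp
qed

section \<open>Both formulas at a given pole\<close>

theorem theorem2p1:
  fixes A :: "real ^ 'n \<Rightarrow> real ^ 'n ^ 'n"
    and b :: "real ^ 'n \<Rightarrow> real ^ 'n"
    and c f u :: "real ^ 'n \<Rightarrow> real"
    and \<Omega> :: "(real ^ 'n) set"
    and \<alpha> :: real
  assumes "CARD('n) > 2"
    and "0 < \<alpha>" and "\<alpha> \<le> 1"
    and "admissible_coefficients \<alpha> A b c"
    and "open \<Omega>"
    and "continuous_on \<Omega> f"
    and "Ck_on 2 \<Omega> u"
    and "\<forall>x\<in>\<Omega>. ell_op A b c u x = f x"
  shows "\<forall>x0\<in>\<Omega>. \<forall>\<Omega>1 \<Gamma>.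
    open \<Omega>1 \<and> bounded \<Omega>1 \<and> connected \<Omega>1 \<and> x0 \<in> \<Omega>1 \<and> closure \<Omega>1 \<subseteq> \<Omega> \<and>
    fundamental_solution \<alpha> A b c \<Omega>1 \<Gamma> \<longrightarrow>
    (\<exists>r0>0. \<forall>r. 0 < r \<and> r < r0 \<longrightarrow>
      set_integrable (hausdorff_measure (CARD('n) - 1)) (level_set \<Gamma> \<Omega>1 x0 r)
        (\<lambda>x. kernel_K A \<Gamma> x0 x * u x) \<and>
      set_integrable lborel (superlevel_set \<Gamma> \<Omega>1 x0 r)
        (\<lambda>x. f x * (1 / r ^ (CARD('n) - 2) - \<Gamma> x x0)) \<and>
      set_integrable lborel (superlevel_set \<Gamma> \<Omega>1 x0 r)
        (\<lambda>x. (divergence b x - c x) * u x) \<and>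
      u x0 =
        (LINT x:level_set \<Gamma> \<Omega>1 x0 r|hausdorff_measure (CARD('n) - 1). kernel_K A \<Gamma> x0 x * u x)
        + (LINT x:superlevel_set \<Gamma> \<Omega>1 x0 r|lborel. f x * (1 / r ^ (CARD('n) - 2) - \<Gamma> x x0))
        + 1 / r ^ (CARD('n) - 2) *
          (LINT x:superlevel_set \<Gamma> \<Omega>1 x0 r|lborel. (divergence b x - c x) * u x) \<and>
      set_integrable lborel (superlevel_set \<Gamma> \<Omega>1 x0 r) (\<lambda>x. kernel_M A \<Gamma> x0 x * u x) \<and>
      set_integrable lborel {0<..<r}
        (\<lambda>\<rho>. \<rho> ^ (CARD('n) - 1) *
          (LINT x:superlevel_set \<Gamma> \<Omega>1 x0 \<rho>|lborel. f x * (1 / \<rho> ^ (CARD('n) - 2) - \<Gamma> x x0))) \<and>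
      set_integrable lborel {0<..<r}
        (\<lambda>\<rho>. \<rho> * (LINT x:superlevel_set \<Gamma> \<Omega>1 x0 \<rho>|lborel. (divergence b x - c x) * u x)) \<and>
      u x0 =
        1 / r ^ CARD('n) *
          (LINT x:superlevel_set \<Gamma> \<Omega>1 x0 r|lborel. kernel_M A \<Gamma> x0 x * u x)
        + real CARD('n) / r ^ CARD('n) *
          (LINT \<rho>:{0<..<r}|lborel. \<rho> ^ (CARD('n) - 1) *
            (LINT x:superlevel_set \<Gamma> \<Omega>1 x0 \<rho>|lborel.
               f x * (1 / \<rho> ^ (CARD('n) - 2) - \<Gamma> x x0)))
        + real CARD('n) / r ^ CARD('n) *
          (LINT \<rho>:{0<..<r}|lborel. \<rho> *
            (LINT x:superlevel_set \<Gamma> \<Omega>1 x0 \<rho>|lborel. (divergence b x - c x) * u x)))"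
proof (intro ballI allI impI, elim conjE)
  fix x0 \<Omega>1 \<Gamma>
  assume D: "open \<Omega>1" "x0 \<in> \<Omega>1" "closure \<Omega>1 \<subseteq> \<Omega>" and fs: "fundamental_solution \<alpha> A b c \<Omega>1 \<Gamma>"
  have sub: "\<Omega>1 \<subseteq> \<Omega>" using D(3) closure_subset by blast
  let ?G = "\<lambda>x. \<Gamma> x x0" and ?N = "CARD('n)"
  note adm = assms(4)[unfolded admissible_coefficients_def]
  obtain l L where l: "0 < l" "l < L" and ell: "\<And>x \<xi>. l * (norm \<xi>)\<^sup>2 \<le> (A x *v \<xi>) \<bullet> \<xi> \<and> (A x *v \<xi>) \<bullet> \<xi> \<le> L * (norm \<xi>)\<^sup>2"
    using adm by blast
  have pole: "Ck_on 2 (\<Omega>1 - {x0}) ?G" "set_integrable lborel \<Omega>1 ?G"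
    "\<And>\<phi>. Ck_compact_support 2 \<Omega>1 \<phi> \<Longrightarrow> \<phi> x0 = - (LINT x:\<Omega>1|lborel. \<Gamma> x x0 * ell_op A b c \<phi> x)"
    using fs D(2) unfolding fundamental_solution_def by blast+
  obtain cm cp c0 where cc: "0 < cm" "0 < cp" "0 < c0" and est: "\<And>x y. x \<in> \<Omega>1 \<Longrightarrow> y \<in> \<Omega>1 \<Longrightarrow> x \<noteq> y \<Longrightarrow>
      (let d = norm (x - y); N = real CARD('n) in
              cm / d powr (N - 2) - c0 / d powr (N - 2 - \<alpha>) \<le> \<Gamma> x y \<and>
              \<Gamma> x y \<le> cp / d powr (N - 2) + c0 / d powr (N - 2 - \<alpha>) \<and>
              cm / d powr (N - 1) - c0 / d powr (N - 1 - \<alpha>) \<le> norm (grad (\<lambda>z. \<Gamma> z y) x) \<and>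
              norm (grad (\<lambda>z. \<Gamma> z y) x) \<le> cp / d powr (N - 1) + c0 / d powr (N - 1 - \<alpha>))"
    using fs unfolding fundamental_solution_def by blast
  obtain \<delta> s0 k K where \<delta>: "0 < \<delta>" "\<delta> \<le> 1" and pos: "0 < s0" "0 < k" "0 < K" and cb: "cball x0 \<delta> \<subseteq> \<Omega>1"
    and near: "\<And>x. x \<in> \<Omega>1 \<Longrightarrow> x \<noteq> x0 \<Longrightarrow> s0 \<le> ?G x \<Longrightarrow> norm (x - x0) < \<delta>"
    and low: "\<And>x. x \<noteq> x0 \<Longrightarrow> norm (x - x0) \<le> \<delta> \<Longrightarrow> k / norm (x - x0) ^ (?N - 2) \<le> ?G x"
    and glow: "\<And>x. x \<noteq> x0 \<Longrightarrow> norm (x - x0) \<le> \<delta> \<Longrightarrow> k / norm (x - x0) ^ (?N - 1) \<le> norm (grad ?G x)"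
    and gup: "\<And>x. x \<noteq> x0 \<Longrightarrow> norm (x - x0) \<le> \<delta> \<Longrightarrow> norm (grad ?G x) \<le> K / norm (x - x0) ^ (?N - 1)"
  proof (rule pole_bounds[OF assms(1-3) D(1,2) cc])
    show "cm / norm (x - x0) powr (real ?N - 2) - c0 / norm (x - x0) powr (real ?N - 2 - \<alpha>) \<le> ?G x \<and>
      ?G x \<le> cp / norm (x - x0) powr (real ?N - 2) + c0 / norm (x - x0) powr (real ?N - 2 - \<alpha>) \<and>
      cm / norm (x - x0) powr (real ?N - 1) - c0 / norm (x - x0) powr (real ?N - 1 - \<alpha>) \<le> norm (grad ?G x) \<and>
      norm (grad ?G x) \<le> cp / norm (x - x0) powr (real ?N - 1) + c0 / norm (x - x0) powr (real ?N - 1 - \<alpha>)"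
      if "x \<in> \<Omega>1" "x \<noteq> x0" for x using est[OF that(1) D(2) that(2)] by (simp only: Let_def)
  qed (rule that; assumption)
  interpret pole_setting A b c f u ?G \<Omega>1 x0 s0
  proof
    show "open \<Omega>1" "x0 \<in> \<Omega>1" "0 < s0" by fact+
    show "Ck_on 2 (\<Omega>1 - {x0}) ?G" "set_integrable lborel \<Omega>1 ?G" by fact+
    show "\<phi> x0 = - (LINT x:\<Omega>1|lborel. \<Gamma> x x0 * ell_op A b c \<phi> x)" if "Ck_compact_support 2 \<Omega>1 \<phi>" for \<phi>
      by (rule pole(3)[OF that])
    show "continuous_on UNIV (\<lambda>x. A x $ i $ j)" "continuous_on UNIV (partial_deriv i (\<lambda>y. A y $ i $ j))" for i j
      using adm by (intro bounded_hoelder_continuous[OF assms(2)]; blast)+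
    show "has_pd i (\<lambda>y. A y $ i $ j) x (partial_deriv i (\<lambda>y. A y $ i $ j) x)" for i j x
      using adm by (intro has_partial_has_pd) blast
    show "continuous_on UNIV (\<lambda>x. b x $ i)" "continuous_on UNIV (partial_deriv i (\<lambda>y. b y $ i))" for i
      using adm by (intro bounded_hoelder_continuous[OF assms(2)]; blast)+
    show "has_pd i (\<lambda>y. b y $ i) x (partial_deriv i (\<lambda>y. b y $ i) x)" for i x
      using adm by (intro has_partial_has_pd) blast
    show "continuous_on UNIV c" using adm by (intro bounded_hoelder_continuous[OF assms(2)]) blast
    show "continuous_on \<Omega>1 f" by (rule continuous_on_subset[OF assms(6) sub])
    show "Ck_on 2 \<Omega>1 u" by (rule Ck_on_subset[OF assms(7) sub])
    show "ell_op A b c u x = f x" if "x \<in> \<Omega>1" for x using assms(8) sub that by blast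
    show "compact (insert x0 {x \<in> \<Omega>1 - {x0}. s0 \<le> ?G x})"
    proof -
      have "open ((\<Omega>1 - {x0}) \<inter> ?G -` {..<s0})"
        by (intro continuous_open_preimage Ck_on_continuous[OF pole(1)] open_delete D(1) open_lessThan)
      hence "compact (cball x0 \<delta> - ((\<Omega>1 - {x0}) \<inter> ?G -` {..<s0}))" by (intro compact_diff compact_cball)
      \<comment> \<open>Compactness cannot fail at the boundary of \<Omega>1, because {G >= s0}
        stays in a closed ball contained in \<Omega>1.\<close>
      moreover have "insert x0 {x \<in> \<Omega>1 - {x0}. s0 \<le> ?G x} = cball x0 \<delta> - ((\<Omega>1 - {x0}) \<inter> ?G -` {..<s0})"
        using near cb \<delta>(1) by (auto simp: dist_norm norm_minus_commute less_imp_le subset_iff)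
      ultimately show ?thesis by simp
    qed
    show "\<exists>e>0. ball x0 e \<subseteq> \<Omega>1 \<and> (\<forall>x\<in>ball x0 e - {x0}. t < ?G x)" for t
    \<comment> \<open>For a distance d <= 1 the lower bound k / d^(N-2) is at least k / d, which
      exceeds |t| + 1 in this ball.\<close>
    proof (intro exI[of _ "min \<delta> (k / (\<bar>t\<bar> + 1))"] conjI ballI)
      let ?e = "min \<delta> (k / (\<bar>t\<bar> + 1))"
      show "0 < ?e" using \<delta> pos by simp
      show "ball x0 ?e \<subseteq> \<Omega>1" using cb by (auto simp: subset_iff)
      fix x assume "x \<in> ball x0 ?e - {x0}"
      hence x: "x \<noteq> x0" "norm (x - x0) \<le> \<delta>" "norm (x - x0) < k / (\<bar>t\<bar> + 1)" by (auto simp: dist_norm norm_minus_commute)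
      let ?d = "norm (x - x0)"
      have d: "0 < ?d" "?d \<le> 1" using x \<delta> by auto
      have "?d ^ (?N - 2) \<le> ?d ^ 1" using d assms(1) by (intro power_decreasing) auto
      hence "k / ?d \<le> k / ?d ^ (?N - 2)" using d pos by (intro divide_left_mono) auto
      moreover have "\<bar>t\<bar> + 1 < k / ?d" using x(3) d by (simp add: field_simps)
      ultimately show "t < ?G x" using low[OF x(1,2)] by linarith
    qed
  qed
  let ?p = "2 * (real ?N - 1) / (real ?N - 2)"
  have regular: "grad ?G x \<noteq> 0" if "x \<in> W" "s0 \<le> ?G x" for x
  proof -
    have x: "x \<noteq> x0" "norm (x - x0) \<le> \<delta>" using that near[of x] by auto
    have "0 < k / norm (x - x0) ^ (?N - 1)" using x pos by simp
    also have "\<dots> \<le> norm (grad ?G x)" by (rule glow[OF x])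
    finally show ?thesis by simp
  qed
  have B: "\<bar>energy x\<bar> \<le> L * K\<^sup>2 / k powr ?p * ?G x powr ?p" if "x \<in> W" "s0 \<le> ?G x" for x
  proof (rule energy_bound[OF assms(1) _ pos(2)])
    have x: "x \<noteq> x0" "norm (x - x0) \<le> \<delta>" using that near[of x] by auto
    show "0 < norm (x - x0)" "0 \<le> L" using x l by auto
    show "k / norm (x - x0) ^ (?N - 2) \<le> ?G x" by (rule low[OF x])
    show "norm (grad ?G x) \<le> K / norm (x - x0) ^ (?N - 1)" by (rule gup[OF x])
    have "0 \<le> l * (norm (grad ?G x))\<^sup>2" using l by simp
    thus "0 \<le> energy x" "energy x \<le> L * (norm (grad ?G x))\<^sup>2"
      using ell[of "grad ?G x" x] unfolding energy_def by linarith+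
  qed simp
  have level: "level_set \<Gamma> \<Omega>1 x0 r = {x \<in> W. ?G x = 1 / r ^ (?N - 2)}" for r
    by (simp add: level_set_def)
  \<comment> \<open>The convention at the pole adds a single point, which is Lebesgue null and
    changes no integral.\<close>
  have superlevel: "superlevel_set \<Gamma> \<Omega>1 x0 r = insert x0 (region (1 / r ^ (?N - 2)))" for r
    using D(2) by (auto simp: superlevel_set_def region_def)
  have K: "kernel_K A \<Gamma> x0 x = energy x / norm (grad ?G x)" for x
    by (simp add: kernel_K_def energy_def Let_def)
  have M: "kernel_M A \<Gamma> x0 x = real ?N / (real ?N - 2) * (energy x / ?G x powr ?p)" for x
    by (simp add: kernel_M_def energy_def Let_def)
  have S: "(LINT x:superlevel_set \<Gamma> \<Omega>1 x0 r|lborel. f x * (1 / r ^ (?N - 2) - \<Gamma> x x0)) = source_term (1 / r ^ (?N - 2))" for r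
    by (simp only: superlevel set_integral_insert source_term_def)
  have Z: "(LINT x:superlevel_set \<Gamma> \<Omega>1 x0 r|lborel. (divergence b x - c x) * u x) = zero_order_term (1 / r ^ (?N - 2))" for r
    by (simp only: superlevel set_integral_insert zero_order_term_def h_def)
  show "\<exists>r0>0. \<forall>r. 0 < r \<and> r < r0 \<longrightarrow>
      set_integrable (hausdorff_measure (CARD('n) - 1)) (level_set \<Gamma> \<Omega>1 x0 r)
        (\<lambda>x. kernel_K A \<Gamma> x0 x * u x) \<and>
      set_integrable lborel (superlevel_set \<Gamma> \<Omega>1 x0 r)
        (\<lambda>x. f x * (1 / r ^ (CARD('n) - 2) - \<Gamma> x x0)) \<and>
      set_integrable lborel (superlevel_set \<Gamma> \<Omega>1 x0 r)
        (\<lambda>x. (divergence b x - c x) * u x) \<and>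
      u x0 =
        (LINT x:level_set \<Gamma> \<Omega>1 x0 r|hausdorff_measure (CARD('n) - 1). kernel_K A \<Gamma> x0 x * u x)
        + (LINT x:superlevel_set \<Gamma> \<Omega>1 x0 r|lborel. f x * (1 / r ^ (CARD('n) - 2) - \<Gamma> x x0))
        + 1 / r ^ (CARD('n) - 2) *
          (LINT x:superlevel_set \<Gamma> \<Omega>1 x0 r|lborel. (divergence b x - c x) * u x) \<and>
      set_integrable lborel (superlevel_set \<Gamma> \<Omega>1 x0 r) (\<lambda>x. kernel_M A \<Gamma> x0 x * u x) \<and>
      set_integrable lborel {0<..<r}
        (\<lambda>\<rho>. \<rho> ^ (CARD('n) - 1) *
          (LINT x:superlevel_set \<Gamma> \<Omega>1 x0 \<rho>|lborel. f x * (1 / \<rho> ^ (CARD('n) - 2) - \<Gamma> x x0))) \<and>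
      set_integrable lborel {0<..<r}
        (\<lambda>\<rho>. \<rho> * (LINT x:superlevel_set \<Gamma> \<Omega>1 x0 \<rho>|lborel. (divergence b x - c x) * u x)) \<and>
      u x0 =
        1 / r ^ CARD('n) *
          (LINT x:superlevel_set \<Gamma> \<Omega>1 x0 r|lborel. kernel_M A \<Gamma> x0 x * u x)
        + real CARD('n) / r ^ CARD('n) *
          (LINT \<rho>:{0<..<r}|lborel. \<rho> ^ (CARD('n) - 1) *
            (LINT x:superlevel_set \<Gamma> \<Omega>1 x0 \<rho>|lborel.
               f x * (1 / \<rho> ^ (CARD('n) - 2) - \<Gamma> x x0)))
        + real CARD('n) / r ^ CARD('n) *
          (LINT \<rho>:{0<..<r}|lborel. \<rho> *
            (LINT x:superlevel_set \<Gamma> \<Omega>1 x0 \<rho>|lborel. (divergence b x - c x) * u x))"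
    unfolding S Z
  \<comment> \<open>For r < 1 the level 1 / r^(N-2) is at least 1 / r, and r < 1 / s0 puts it above
    \<open>s0\<close>, where all the estimates are valid.\<close>
  proof (intro exI[of _ "min 1 (1 / s0)"] conjI allI impI)
    show "0 < min 1 (1 / s0)" using pos by simp
    fix r assume "0 < r \<and> r < min 1 (1 / s0)"
    hence r: "0 < r" "r < 1" "r < 1 / s0" by auto
    let ?R = "1 / r ^ (?N - 2)"
    have "r ^ (?N - 2) \<le> r ^ 1" using r assms(1) by (intro power_decreasing) auto
    hence "1 / r \<le> ?R" using r by (intro divide_left_mono) auto
    moreover have "s0 < 1 / r" using r pos by (simp add: field_simps)
    ultimately have R: "s0 < ?R" by linarith
    have N1: "1 < ?N" using assms(1) by simp
    note surface = surface_mean_formula[OF N1 R regular]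
    have surface_mean: "(LINT x:{x \<in> W. ?G x = ?R}|hausdorff_measure (?N - 1). energy x / norm (grad ?G x) * u x) = mean ?R"
      by (rule surface)
    note vol = volume_mean_formula[OF assms(1) r(1) less_imp_le[OF R] B]
    note ball = ball_mean_formula[OF assms(1) r(1) less_imp_le[OF R] B]
    show "set_integrable (hausdorff_measure (?N - 1)) (level_set \<Gamma> \<Omega>1 x0 r) (\<lambda>x. kernel_K A \<Gamma> x0 x * u x)"
      unfolding level K by (rule surface)
    show "set_integrable lborel (superlevel_set \<Gamma> \<Omega>1 x0 r) (\<lambda>x. f x * (1 / r ^ (?N - 2) - \<Gamma> x x0))"
      "set_integrable lborel (superlevel_set \<Gamma> \<Omega>1 x0 r) (\<lambda>x. (divergence b x - c x) * u x)"
      unfolding superlevel set_integral_insert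
      using integrand_integrable[OF less_imp_le[OF R]]
      unfolding set_integrable_def integrand_f_def[abs_def] integrand_h_def[abs_def] h_def by simp_all
    show "u x0 = (LINT x:level_set \<Gamma> \<Omega>1 x0 r|hausdorff_measure (?N - 1). kernel_K A \<Gamma> x0 x * u x)
        + source_term ?R + ?R * zero_order_term ?R"
      unfolding level K surface_mean mean_def by simp
    show "set_integrable lborel (superlevel_set \<Gamma> \<Omega>1 x0 r) (\<lambda>x. kernel_M A \<Gamma> x0 x * u x)"
      unfolding superlevel set_integral_insert M mult.assoc by (intro set_integrable_mult_right vol(1))
    show "set_integrable lborel {0<..<r} (\<lambda>\<rho>. \<rho> ^ (?N - 1) * source_term (1 / \<rho> ^ (?N - 2)))"
      by (rule ball(1))
    show "set_integrable lborel {0<..<r} (\<lambda>\<rho>. \<rho> * zero_order_term (1 / \<rho> ^ (?N - 2)))"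
      by (rule ball(2))
    show "u x0 = 1 / r ^ ?N * (LINT x:superlevel_set \<Gamma> \<Omega>1 x0 r|lborel. kernel_M A \<Gamma> x0 x * u x)
        + real ?N / r ^ ?N * (LINT \<rho>:{0<..<r}|lborel. \<rho> ^ (?N - 1) * source_term (1 / \<rho> ^ (?N - 2)))
        + real ?N / r ^ ?N * (LINT \<rho>:{0<..<r}|lborel. \<rho> * zero_order_term (1 / \<rho> ^ (?N - 2)))"
      unfolding superlevel set_integral_insert M by (rule ball(3))
  qed
qed

end
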